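(* Let $k$ be an infinite field, $S=k[x_1,\ldots,x_{d+1}]$, $f\in S$ a homogeneous polynomial of degree $m\ge 1$, and $R=S/(f)$; let $\overline{\,\cdot\,}$ denote images modulo $(f)$. Let $I$ be a perfect Gorenstein $R$-ideal of grade $3$ with alternating presentation matrix $\varphi$ consisting of linear entries in $R$, and assume that $I$ satisfies $G_d$, $\mu(I)=d+1$, and $I_1(\varphi)=\overline{(x_1,\ldots,x_{d+1})}$. Let $\psi$ be a $(d+1)\times(d+1)$ alternating matrix of linear forms in $S$ with $I_1(\psi)=(x_1,\ldots,x_{d+1})$ and $\overline{\psi}=\varphi$, write $[\ell_1\cdots\ell_{d+1}]=[T_1\cdots T_{d+1}]\cdot\psi$, and set $\mathscr{L}=(\ell_1,\ldots,\ell_{d+1},f)$ and $\mathcal{A}=\mathscr{L}:(x_1,\ldots,x_{d+1})^m$ in $S[T_1,\ldots,T_{d+1}]$. Let $(\mathcal{B}_i,\mathcal{L}_i)$, $1\le i\le m$, be the gcd-iterations of $(B,\mathscr{L})$, where $B$ is a modified Jacobian dual of $\psi$, and let $g_i=\gcd I_{d+1}(\mathcal{B}_i)$. Then the generating set $$\{\ell_1,\ldots,\ell_{d+1},f,g_1,\ldots,g_m\}$$ of $\mathcal{A}=\mathcal{L}_m+(\gcd I_{d+1}(\mathcal{B}_m))$ obtained from the gcd-iterations is minimal. In particular, $\mu(\mathcal{A})=d+m+2$ and $\mu(\mathcal{J})=d+m+1$, where $\mathcal{J}\subset R[T_1,\ldots,T_{d+1}]$ is the defining ideal of $\mathcal{R}(I)$.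 Moreover, the relation type of $I$ is $\operatorname{rt}(I)=m(d-1)$.
   Context: **Ideals.** An ideal $I$ of grade $g$ in $R$ is perfect if $\operatorname{pd}_R(R/I)=g$; a perfect ideal is Gorenstein if $\operatorname{Ext}^g_R(R/I,R)\cong R/I$. $\mu$ denotes minimal number of (bi)homogeneous generators, $I_j(M)$ the ideal generated by the $j\times j$ minors of a matrix $M$. $I$ satisfies $G_s$ if $\mu(I_{\mathfrak p})\le\dim R_{\mathfrak p}$ for all primes $\mathfrak p\supseteq I$ with $\dim R_{\mathfrak p}\le s-1$. Alternating means skew-symmetric with zero diagonal; $\varphi$ is $(d+1)\times(d+1)$ with $R^{d+1}\xrightarrow{\varphi}R^{d+1}\to I\to 0$ exact. **Rees algebra.** For $I=(f_1,\ldots,f_{d+1})$ (generators corresponding to the presentation $\varphi$), $\mathcal{R}(I)=R[f_1t,\ldots,f_{d+1}t]\subset R[t]$ and $\mathcal{J}=\ker\big(R[T_1,\ldots,T_{d+1}]\to\mathcal{R}(I),\ T_i\mapsto f_it\big)$. The relation type $\operatorname{rt}(I)$ is the maximum degree, with respect to $T_1,\ldots,T_{d+1}$, of a minimal generator of $\mathcal{J}$. **Modified Jacobian dual.** $B(\psi)$ is the unique $(d+1)\times(d+1)$ matrix of linear forms in $k[T_1,\ldots,T_{d+1}]$ with $[T_1\cdots T_{d+1}]\cdot\psi=[x_1\cdots x_{d+1}]\cdot B(\psi)$. Bigrade $S[T_1,\ldots,T_{d+1}]$ by $\deg x_i=(1,0)$, $\deg T_i=(0,1)$. For a nonzero bihomogeneous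 $F\in(x_1,\ldots,x_{d+1})S[T_1,\ldots,T_{d+1}]$, $\partial F$ denotes a (chosen, not unique) column with bihomogeneous entries of bidegree $\deg F-(1,0)$ such that $[x_1\cdots x_{d+1}]\cdot\partial F=F$; if $F=0$ then $\partial F$ is the zero column. A modified Jacobian dual of $\psi$ is a matrix $B=[B(\psi)\,|\,\partial f]$. **gcd-iterations.** $\gcd I_{d+1}(M)$ denotes the greatest common divisor of the $(d+1)\times(d+1)$ minors of $M$ (up to a unit; $0$ if all minors are $0$). Set $\mathcal{B}_1=B$, $\mathcal{L}_1=\mathscr{L}$. For $2\le i\le m$, with $g_{i-1}=\gcd I_{d+1}(\mathcal{B}_{i-1})$, set $\mathcal{L}_i=\mathcal{L}_{i-1}+(g_{i-1})$, $\mathcal{B}_i=[B(\psi)\,|\,\partial g_{i-1}]$. The pair $(\mathcal{B}_i,\mathcal{L}_i)$ is the $i$-th gcd-iteration of $(B,\mathscr{L})$. *)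

theory Defs
  imports
    "HOL-Analysis.Determinants"
    "HOL-Library.Extended_Nat"
    "HOL-Library.Poly_Mapping"
    "HOL-Algebra.Ideal_Product"
    "HOL-Algebra.Module"
    "HOL-Algebra.Algebraic_Closure_Type"
begin

section \<open>Modules over a commutative ring, projective dimension and Ext\<close>

definition mod_hom ::
    "('a, 'r) ring_scheme \<Rightarrow> ('a, 'b) module \<Rightarrow> ('a, 'c) module \<Rightarrow> ('b \<Rightarrow> 'c) set" where
  "mod_hom R M N = {h \<in> carrier M \<rightarrow>\<^sub>E carrier N.
     (\<forall>x\<in>carrier M. \<forall>y\<in>carrier M. h (x \<oplus>\<^bsub>M\<^esub> y) = h x \<oplus>\<^bsub>N\<^esub> h y) \<and>
     (\<forall>a\<in>carrier R. \<forall>x\<in>carrier M. h (a \<odot>\<^bsub>M\<^esub> x) = a \<odot>\<^bsub>N\<^esub> h x)}"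

definition mod_isomorphic ::
    "('a, 'r) ring_scheme \<Rightarrow> ('a, 'b) module \<Rightarrow> ('a, 'c) module \<Rightarrow> bool" where
  "mod_isomorphic R M N \<longleftrightarrow> (\<exists>h\<in>mod_hom R M N. bij_betw h (carrier M) (carrier N))"

text \<open>
  The record type of modules extends that of rings, so the modules below carry irrelevant
  multiplicative fields. They are left undefined wherever there is no natural choice.
\<close>

definition ring_module :: "('a, 'r) ring_scheme \<Rightarrow> ('a, 'a) module" where
  "ring_module R =
     \<lparr>carrier = carrier R, monoid.mult = monoid.mult R, one = \<one>\<^bsub>R\<^esub>,
      zero = \<zero>\<^bsub>R\<^esub>, add = add R, module.smult = monoid.mult R\<rparr>"

definition quot_module :: "('a, 'b) module \<Rightarrow> 'b set \<Rightarrow> ('a, 'b set) module" where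
  "quot_module M N =
     \<lparr>carrier = a_rcosets\<^bsub>M\<^esub> N, monoid.mult = undefined, one = undefined,
      zero = N, add = set_add M,
      module.smult = (\<lambda>a U. \<Union>x\<in>U. N +>\<^bsub>M\<^esub> (a \<odot>\<^bsub>M\<^esub> x))\<rparr>"

definition hom_module ::
    "('a, 'r) ring_scheme \<Rightarrow> ('a, 'b) module \<Rightarrow> ('a, 'c) module \<Rightarrow> ('a, 'b \<Rightarrow> 'c) module" where
  "hom_module R M N =
     \<lparr>carrier = mod_hom R M N, monoid.mult = undefined, one = undefined,
      zero = (\<lambda>x\<in>carrier M. \<zero>\<^bsub>N\<^esub>), add = (\<lambda>g h. \<lambda>x\<in>carrier M. g x \<oplus>\<^bsub>N\<^esub> h x),
      module.smult = (\<lambda>a h. \<lambda>x\<in>carrier M. a \<odot>\<^bsub>N\<^esub> h x)\<rparr>"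

definition free_module :: "('a, 'r) ring_scheme \<Rightarrow> 'x set \<Rightarrow> ('a, 'x \<Rightarrow> 'a) module" where
  "free_module R U =
     \<lparr>carrier = {u. (\<forall>x. u x \<in> carrier R) \<and> (\<forall>x. x \<notin> U \<longrightarrow> u x = \<zero>\<^bsub>R\<^esub>) \<and>
                    finite {x. u x \<noteq> \<zero>\<^bsub>R\<^esub>}},
      monoid.mult = undefined, one = undefined,
      zero = (\<lambda>x. \<zero>\<^bsub>R\<^esub>), add = (\<lambda>u v x. u x \<oplus>\<^bsub>R\<^esub> v x),
      module.smult = (\<lambda>a u x. a \<otimes>\<^bsub>R\<^esub> u x)\<rparr>"

text \<open>
  Projective means: direct summand of a free module. It is no restriction that the basis \<open>U\<close>
  consists of elements of the type of \<open>P\<close>, as \<open>P\<close> is a quotient of the free module on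
  \<open>carrier P\<close>.
\<close>

definition projective_module :: "('a, 'r) ring_scheme \<Rightarrow> ('a, 'b) module \<Rightarrow> bool" where
  "projective_module R P \<longleftrightarrow> Module.module R P \<and>
     (\<exists>(U :: 'b set) s p. s \<in> mod_hom R P (free_module R U) \<and> p \<in> mod_hom R (free_module R U) P \<and>
        (\<forall>x\<in>carrier P. p (s x) = x))"

definition mod_kernel :: "('a, 'b) module \<Rightarrow> ('a, 'c) module \<Rightarrow> ('b \<Rightarrow> 'c) \<Rightarrow> 'b set" where
  "mod_kernel M N h = {x \<in> carrier M. h x = \<zero>\<^bsub>N\<^esub>}"

text \<open>\<open>\<dots> \<rightarrow> P 2 \<rightarrow> P 1 \<rightarrow> P 0 \<rightarrow> M \<rightarrow> 0\<close> with differentials \<open>\<delta> i : P (i + 1) \<rightarrow> P i\<close>.\<close>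

definition projective_resolution ::
    "('a, 'r) ring_scheme \<Rightarrow> ('a, 'm) module \<Rightarrow>
     (nat \<Rightarrow> ('a, 'p) module) \<Rightarrow> (nat \<Rightarrow> 'p \<Rightarrow> 'p) \<Rightarrow> ('p \<Rightarrow> 'm) \<Rightarrow> bool" where
  "projective_resolution R M P \<delta> \<epsilon> \<longleftrightarrow>
     (\<forall>i. projective_module R (P i)) \<and>
     (\<forall>i. \<delta> i \<in> mod_hom R (P (Suc i)) (P i)) \<and>
     \<epsilon> \<in> mod_hom R (P 0) M \<and>
     \<epsilon> ` carrier (P 0) = carrier M \<and>
     mod_kernel (P 0) M \<epsilon> = \<delta> 0 ` carrier (P 1) \<and>
     (\<forall>i. mod_kernel (P (Suc i)) (P i) (\<delta> i) = \<delta> (Suc i) ` carrier (P (Suc (Suc i))))"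

text \<open>
  HOL cannot quantify over the types carrying the modules of a resolution. Below they live in
  the type \<open>nat \<Rightarrow> 'a\<close>. Every cyclic (more generally, countably generated) module \<open>M\<close> over a
  nonzero ring \<open>R\<close> has a projective resolution all of whose modules have at most
  \<open>max |R| \<aleph>\<^sub>0\<close> elements, of the least possible length if \<open>M\<close> has finite projective dimension, and
  such modules can be transported to \<open>nat \<Rightarrow> 'a\<close>. The definitions are only meant for such \<open>M\<close>.
\<close>

definition proj_dim :: "('a, 'r) ring_scheme \<Rightarrow> ('a, 'm) module \<Rightarrow> enat" where
  "proj_dim R M = Inf {enat n | n. \<exists>(P :: nat \<Rightarrow> ('a, nat \<Rightarrow> 'a) module) \<delta> \<epsilon>.
     projective_resolution R M P \<delta> \<epsilon> \<and> (\<forall>i>n. carrier (P i) = {\<zero>\<^bsub>P i\<^esub>})}"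

text \<open>\<open>H\<^sup>n(Hom(P, N))\<close> for a complex \<open>P\<close> with differentials \<open>\<delta>\<close>.\<close>

definition hom_cohomology ::
    "('a, 'r) ring_scheme \<Rightarrow> (nat \<Rightarrow> ('a, 'p) module) \<Rightarrow> (nat \<Rightarrow> 'p \<Rightarrow> 'p) \<Rightarrow>
     ('a, 'c) module \<Rightarrow> nat \<Rightarrow> ('a, ('p \<Rightarrow> 'c) set) module" where
  "hom_cohomology R P \<delta> N n =
     (let H = (\<lambda>i. hom_module R (P i) N);
          d = (\<lambda>i h. \<lambda>x\<in>carrier (P (Suc i)). h (\<delta> i x));
          Z = mod_kernel (H n) (H (Suc n)) (d n);
          C = (case n of 0 \<Rightarrow> {\<zero>\<^bsub>H 0\<^esub>} | Suc j \<Rightarrow> d j ` carrier (H j))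
      in quot_module ((H n)\<lparr>carrier := Z\<rparr>) C)"

text \<open>Ext is independent of the chosen resolution up to isomorphism.\<close>

definition Ext ::
    "('a, 'r) ring_scheme \<Rightarrow> nat \<Rightarrow> ('a, 'm) module \<Rightarrow> ('a, 'c) module \<Rightarrow>
     ('a, ((nat \<Rightarrow> 'a) \<Rightarrow> 'c) set) module" where
  "Ext R n M N =
     (let (P, \<delta>) = (SOME (P :: nat \<Rightarrow> ('a, nat \<Rightarrow> 'a) module, \<delta>).
                      \<exists>\<epsilon>. projective_resolution R M P \<delta> \<epsilon>)
      in hom_cohomology R P \<delta> N n)"


section \<open>Perfect and Gorenstein ideals, the condition \<open>G\<^sub>s\<close>\<close>

definition regular_sequence :: "('a, 'r) ring_scheme \<Rightarrow> 'a list \<Rightarrow> bool" where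
  "regular_sequence R as \<longleftrightarrow> set as \<subseteq> carrier R \<and> Idl\<^bsub>R\<^esub> (set as) \<noteq> carrier R \<and>
     (\<forall>i<length as. \<forall>r\<in>carrier R.
        as ! i \<otimes>\<^bsub>R\<^esub> r \<in> Idl\<^bsub>R\<^esub> (set (take i as)) \<longrightarrow> r \<in> Idl\<^bsub>R\<^esub> (set (take i as)))"

definition grade :: "('a, 'r) ring_scheme \<Rightarrow> 'a set \<Rightarrow> enat" where
  "grade R I = Sup {enat (length as) | as. set as \<subseteq> I \<and> regular_sequence R as}"

definition perfect_ideal :: "('a, 'r) ring_scheme \<Rightarrow> 'a set \<Rightarrow> bool" where
  "perfect_ideal R I \<longleftrightarrow> ideal I R \<and> proj_dim R (quot_module (ring_module R) I) = grade R I"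

definition gorenstein_ideal :: "('a, 'r) ring_scheme \<Rightarrow> 'a set \<Rightarrow> bool" where
  "gorenstein_ideal R I \<longleftrightarrow> perfect_ideal R I \<and>
     (\<exists>g. grade R I = enat g \<and>
        mod_isomorphic R (Ext R g (quot_module (ring_module R) I) (ring_module R))
                         (quot_module (ring_module R) I))"

text \<open>The fraction \<open>a/s\<close> in the localization of \<open>R\<close> at the prime \<open>p\<close>, as an equivalence class.\<close>

definition fraction :: "('a, 'r) ring_scheme \<Rightarrow> 'a set \<Rightarrow> 'a \<Rightarrow> 'a \<Rightarrow> ('a \<times> 'a) set" where
  "fraction R p a s = {(b, t). b \<in> carrier R \<and> t \<in> carrier R - p \<and>
     (\<exists>u\<in>carrier R - p. u \<otimes>\<^bsub>R\<^esub> (a \<otimes>\<^bsub>R\<^esub> t) = u \<otimes>\<^bsub>R\<^esub> (b \<otimes>\<^bsub>R\<^esub> s))}"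

definition localization :: "('a, 'r) ring_scheme \<Rightarrow> 'a set \<Rightarrow> ('a \<times> 'a) set ring" where
  "localization R p =
     \<lparr>carrier = {fraction R p a s | a s. a \<in> carrier R \<and> s \<in> carrier R - p},
      monoid.mult = (\<lambda>U V. \<Union>(a, s)\<in>U. \<Union>(b, t)\<in>V. fraction R p (a \<otimes>\<^bsub>R\<^esub> b) (s \<otimes>\<^bsub>R\<^esub> t)),
      one = fraction R p \<one>\<^bsub>R\<^esub> \<one>\<^bsub>R\<^esub>,
      zero = fraction R p \<zero>\<^bsub>R\<^esub> \<one>\<^bsub>R\<^esub>,
      add = (\<lambda>U V. \<Union>(a, s)\<in>U. \<Union>(b, t)\<in>V.
               fraction R p ((a \<otimes>\<^bsub>R\<^esub> t) \<oplus>\<^bsub>R\<^esub> (b \<otimes>\<^bsub>R\<^esub> s)) (s \<otimes>\<^bsub>R\<^esub> t))\<rparr>"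

definition local_ideal :: "('a, 'r) ring_scheme \<Rightarrow> 'a set \<Rightarrow> 'a set \<Rightarrow> ('a \<times> 'a) set set" where
  "local_ideal R p I = Idl\<^bsub>localization R p\<^esub> {fraction R p a \<one>\<^bsub>R\<^esub> | a. a \<in> I}"

definition krull_dim :: "('a, 'r) ring_scheme \<Rightarrow> enat" where
  "krull_dim R = Sup {enat n | n.
     \<exists>P. (\<forall>i\<le>n. primeideal (P i) R) \<and> (\<forall>i<n. P i \<subset> P (Suc i))}"

text \<open>
  The least number of generators of \<open>I\<close> taken from \<open>H\<close>. In a bigraded (graded) ring, \<open>H\<close> is the
  set of bihomogeneous (homogeneous) elements; in a local ring it is everything.
\<close>

definition num_gens :: "('a, 'r) ring_scheme \<Rightarrow> 'a set \<Rightarrow> 'a set \<Rightarrow> enat" where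
  "num_gens R H I = Inf {enat (card G) | G. finite G \<and> G \<subseteq> carrier R \<inter> H \<and> Idl\<^bsub>R\<^esub> G = I}"

definition minimal_generating_set :: "('a, 'r) ring_scheme \<Rightarrow> 'a set \<Rightarrow> 'a set \<Rightarrow> bool" where
  "minimal_generating_set R I G \<longleftrightarrow>
     G \<subseteq> carrier R \<and> Idl\<^bsub>R\<^esub> G = I \<and> (\<forall>G'. G' \<subset> G \<longrightarrow> Idl\<^bsub>R\<^esub> G' \<noteq> I)"

definition satisfies_G :: "('a, 'r) ring_scheme \<Rightarrow> nat \<Rightarrow> 'a set \<Rightarrow> bool" where
  "satisfies_G R s I \<longleftrightarrow>
     (\<forall>p. primeideal p R \<and> I \<subseteq> p \<and> krull_dim (localization R p) + 1 \<le> enat s \<longrightarrow>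
        num_gens (localization R p) (carrier (localization R p)) (local_ideal R p I)
          \<le> krull_dim (localization R p))"

definition ideal_colon :: "('a, 'r) ring_scheme \<Rightarrow> 'a set \<Rightarrow> 'a set \<Rightarrow> 'a set" where
  "ideal_colon R I J = {a \<in> carrier R. \<forall>b\<in>J. a \<otimes>\<^bsub>R\<^esub> b \<in> I}"


section \<open>Polynomial rings\<close>

text \<open>
  Polynomials with coefficients in \<open>'a\<close> in the variables indexed by the finite type \<open>'n\<close>.
  \<open>S[T]\<close> with \<open>S = k[x]\<close> is the type \<open>('n, ('n, 'k) mpoly) mpoly\<close>.
\<close>

type_synonym ('n, 'a) mpoly = "('n \<Rightarrow>\<^sub>0 nat) \<Rightarrow>\<^sub>0 'a"

abbreviation rng :: "'a::comm_ring_1 ring" where "rng \<equiv> ring_of_type_algebra"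

definition Var :: "'n \<Rightarrow> ('n, 'a::comm_ring_1) mpoly" where
  "Var i = Poly_Mapping.single (Poly_Mapping.single i 1) 1"

definition Const :: "'a::comm_ring_1 \<Rightarrow> ('n, 'a) mpoly" where
  "Const c = Poly_Mapping.single 0 c"

definition mon_degree :: "('n::finite \<Rightarrow>\<^sub>0 nat) \<Rightarrow> nat" where
  "mon_degree m = (\<Sum>i\<in>UNIV. Poly_Mapping.lookup m i)"

text \<open>The forms of degree \<open>b\<close> with coefficients in \<open>C\<close>, including \<open>0\<close>.\<close>

definition forms_over :: "'a::comm_ring_1 set \<Rightarrow> nat \<Rightarrow> ('n::finite, 'a) mpoly set" where
  "forms_over C b =
     {F. \<forall>m\<in>Poly_Mapping.keys F. mon_degree m = b \<and> Poly_Mapping.lookup F m \<in> C}"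

abbreviation forms :: "nat \<Rightarrow> ('n::finite, 'a::comm_ring_1) mpoly set" where
  "forms \<equiv> forms_over UNIV"

text \<open>Elements of \<open>S[T]\<close> of bidegree \<open>(a, b)\<close>, where \<open>x\<close> has bidegree \<open>(1, 0)\<close> and \<open>T\<close> has \<open>(0, 1)\<close>.\<close>

abbreviation biforms :: "nat \<Rightarrow> nat \<Rightarrow> ('n::finite, ('n, 'a::comm_ring_1) mpoly) mpoly set" where
  "biforms a b \<equiv> forms_over (forms a) b"

definition eval_mpoly ::
    "('a::comm_ring_1 \<Rightarrow> 'b::comm_ring_1) \<Rightarrow> ('n::finite \<Rightarrow> 'b) \<Rightarrow> ('n, 'a) mpoly \<Rightarrow> 'b" where
  "eval_mpoly h v F = (\<Sum>m\<in>Poly_Mapping.keys F.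
     h (Poly_Mapping.lookup F m) * (\<Prod>i\<in>UNIV. v i ^ Poly_Mapping.lookup m i))"

definition X_vec :: "('n::finite, ('n, 'a::comm_ring_1) mpoly) mpoly ^ 'n" where
  "X_vec = (\<chi> i. Const (Var i))"

definition T_vec :: "('n::finite, 'a::comm_ring_1) mpoly ^ 'n" where
  "T_vec = (\<chi> i. Var i)"


section \<open>Matrices, modified Jacobian duals and gcd-iterations\<close>

definition entries :: "'a ^ 'c ^ 'r \<Rightarrow> 'a set" where
  "entries M = {M $ i $ j | i j. True}"

definition alternating :: "'a::comm_ring_1 ^ 'n ^ 'n \<Rightarrow> bool" where
  "alternating M \<longleftrightarrow> (\<forall>i j. M $ i $ j = - (M $ j $ i)) \<and> (\<forall>i. M $ i $ i = 0)"

definition const_mat :: "'a::comm_ring_1 ^ 'n ^ 'n \<Rightarrow> ('n, 'a) mpoly ^ 'n ^ 'n" where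
  "const_mat M = (\<chi> i j. Const (M $ i $ j))"

definition is_jacobian_dual ::
    "('n::finite, 'k::field) mpoly ^ 'n ^ 'n \<Rightarrow>
     ('n, ('n, 'k) mpoly) mpoly ^ 'n ^ 'n \<Rightarrow> bool" where
  "is_jacobian_dual \<psi> B \<longleftrightarrow>
     entries B \<subseteq> biforms 0 1 \<and> T_vec v* const_mat \<psi> = X_vec v* B"

definition is_partial ::
    "('n::finite, ('n, 'k::field) mpoly) mpoly \<Rightarrow> ('n, ('n, 'k) mpoly) mpoly ^ 'n \<Rightarrow> bool" where
  "is_partial F D \<longleftrightarrow>
     (if F = 0 then D = 0
      else (\<exists>a b. F \<in> biforms (Suc a) b \<and> (\<forall>i. D $ i \<in> biforms a b) \<and>
                  (\<Sum>i\<in>UNIV. X_vec $ i * D $ i) = F))"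

text \<open>The matrix \<open>[M | D]\<close>; its last column has index \<open>None\<close>.\<close>

definition augment :: "'a ^ 'n ^ 'n \<Rightarrow> 'a ^ 'n \<Rightarrow> 'a ^ ('n option) ^ 'n" where
  "augment M D = (\<chi> i j. case j of None \<Rightarrow> D $ i | Some j' \<Rightarrow> M $ i $ j')"

text \<open>The maximal minors of a matrix with rows \<open>'n\<close>; each occurs with every ordering of its columns,
  that is, up to sign.\<close>

definition max_minors :: "'a::comm_ring_1 ^ 'c ^ 'n::finite \<Rightarrow> 'a set" where
  "max_minors M = {det (\<chi> i j. M $ i $ c j) | c :: 'n \<Rightarrow> 'c. inj c}"

definition is_gcd :: "'a::comm_ring_1 set \<Rightarrow> 'a \<Rightarrow> bool" where
  "is_gcd A g \<longleftrightarrow> (\<forall>a\<in>A. g dvd a) \<and> (\<forall>h. (\<forall>a\<in>A. h dvd a) \<longrightarrow> h dvd g)"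

text \<open>
  \<open>(B i, L i)\<close> for \<open>1 \<le> i \<le> m\<close> are gcd-iterations of \<open>(B 1, L 1)\<close>, with \<open>g i\<close> a gcd of the maximal
  minors of \<open>B i\<close>. All choices (of the gcds up to a unit, of the columns \<open>\<partial>g\<close>) are left open.
\<close>

definition gcd_iterations ::
    "nat \<Rightarrow> ('n::finite, ('n, 'k::field) mpoly) mpoly ^ 'n ^ 'n \<Rightarrow>
     (nat \<Rightarrow> ('n, ('n, 'k) mpoly) mpoly ^ ('n option) ^ 'n) \<Rightarrow>
     (nat \<Rightarrow> ('n, ('n, 'k) mpoly) mpoly set) \<Rightarrow>
     (nat \<Rightarrow> ('n, ('n, 'k) mpoly) mpoly) \<Rightarrow> bool" where
  "gcd_iterations m B\<psi> B L g \<longleftrightarrow>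
     (\<forall>i\<in>{1..m}. is_gcd (max_minors (B i)) (g i)) \<and>
     (\<forall>i\<in>{2..m}. L i = L (i - 1) <+>\<^bsub>rng\<^esub> PIdl\<^bsub>rng\<^esub> (g (i - 1)) \<and>
                  (\<exists>D. is_partial (g (i - 1)) D \<and> B i = augment B\<psi> D))"


section \<open>Presentations and Rees algebras\<close>

text \<open>\<open>R\<^sup>n \<rightarrow> R\<^sup>n \<rightarrow> I \<rightarrow> 0\<close> is exact, with maps \<open>\<phi>\<close> and \<open>(a\<^sub>1, \<dots>, a\<^sub>n)\<close>.\<close>

definition presents :: "'r::comm_ring_1 ^ 'n::finite ^ 'n \<Rightarrow> 'r ^ 'n \<Rightarrow> 'r set \<Rightarrow> bool" where
  "presents \<phi> a I \<longleftrightarrow>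
     Idl\<^bsub>rng\<^esub> (range (\<lambda>i. a $ i)) = I \<and>
     (\<forall>v. (\<Sum>i\<in>UNIV. a $ i * v $ i) = 0 \<longleftrightarrow> (\<exists>w. v = \<phi> *v w))"

text \<open>The kernel of \<open>R[T] \<rightarrow> R[t]\<close>, \<open>T\<^sub>i \<mapsto> a\<^sub>i t\<close>.\<close>

definition rees_ideal :: "'r::comm_ring_1 ^ 'n::finite \<Rightarrow> ('n, 'r) mpoly set" where
  "rees_ideal a = {F. eval_mpoly (\<lambda>c. [:c:]) (\<lambda>i. Polynomial.monom (a $ i) 1) F = 0}"

text \<open>
  For \<open>R = S/(f)\<close> with projection \<open>\<pi>\<close>: the homogeneous elements of \<open>R\<close> and the bihomogeneous
  elements of \<open>R[T]\<close>.
\<close>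

definition homogs_quot :: "(('n::finite, 'k::field) mpoly \<Rightarrow> 'r::comm_ring_1) \<Rightarrow> 'r set" where
  "homogs_quot \<pi> = (\<Union>a. \<pi> ` forms a)"

definition bihomogs_quot ::
    "(('n::finite, 'k::field) mpoly \<Rightarrow> 'r::comm_ring_1) \<Rightarrow> ('n, 'r) mpoly set" where
  "bihomogs_quot \<pi> = (\<Union>a b. forms_over (\<pi> ` forms a) b)"

definition bihomogs :: "('n::finite, ('n, 'k::field) mpoly) mpoly set" where
  "bihomogs = (\<Union>a b. biforms a b)"

text \<open>
  The largest \<open>T\<close>-degree of a member of a minimal bihomogeneous generating set of the defining
  ideal of the Rees algebra.
\<close>

definition relation_type ::
    "(('n::finite, 'k::field) mpoly \<Rightarrow> 'r::comm_ring_1) \<Rightarrow> 'r ^ 'n \<Rightarrow> enat" where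
  "relation_type \<pi> a = Sup {enat b | b. \<exists>G F.
     minimal_generating_set rng (rees_ideal a) G \<and> G \<subseteq> bihomogs_quot \<pi> \<and>
     F \<in> G \<and> F \<in> forms b}"

end

(* Let W be the matrix with l_j = sum_s W_js x_s. Since T W = 0 with one-dimensional kernel on each
   side, adj W = h T for a column h of forms of degree d - 1, and g_i is, up to a unit, the sum of
   h_r times the r-th entry of the column of g_{i-1}. By G_d the ideals (l) and (l, f) have the
   expected dimension. As T psi T^t = 0, a double complex comparing the Koszul complex of l with the
   Cech complex in T then shows that neither ideal has T-torsion in positive T-degree. Where some
   T_k is inverted, F(h, T) = 0 exactly when F lies in (l), and every g_i takes the value f(h) up to
   a unit. This turns the saturation of (l, f) into (l, f, g_1, ..., g_m), which also gives the Rees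
   ideal. For minimality no syzygy of the generators has a nonzero constant coefficient. *)
theory Submission
 imports Defs "HOL-Library.Function_Algebras"
begin

text \<open>Dimension is measured throughout by algebraic independence modulo an ideal
  (\<open>dimle\<close>). It can be bounded by counting monomials, it can be checked on primes, and
  Noether normalization by linear forms, which uses that k is infinite, turns it into parameters.
  Depth enters only as vanishing of Koszul homology: parameters are adjoined until the ideal is
  primary to the origin, and are then removed one at a time. The obstacle is that l_1, ..., l_{d+1}
  is not a regular sequence, because T_1 l_1 + ... + T_{d+1} l_{d+1} = 0 is a cycle in degree 1 of
  the Koszul complex. Regularity of further elements therefore holds only after some T_k is
  inverted, where the subcomplex killed by exterior multiplication by T is exact from degree 2 on.
  The condition G_d acts through matrices: at a prime over f it yields a matrix invertible there
  that has few columns not taken from \<psi>. Each column of \<psi> is a linear equation for T, so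
  this bounds the dimension of the fibre over the prime. Most of the work is done in k[x, T]; the
  ring S[T] appears only at the end.\<close>

abbreviation sgl :: "'i => 'a => 'i \<Rightarrow>\<^sub>0 'a::zero" where "sgl == Poly_Mapping.single"
abbreviation xv :: "'i => ('i + 'j, 'a::comm_ring_1) mpoly" where "xv j == Var (Inl j)"
abbreviation tv :: "'j => ('i + 'j, 'a::comm_ring_1) mpoly" where "tv k == Var (Inr k)"
lemmas pm_eqI = poly_mapping_eqI

section \<open>Polynomials\<close>

abbreviation lk where "lk == Poly_Mapping.lookup"
abbreviation kys where "kys == Poly_Mapping.keys"

definition rhom :: "('a::comm_ring_1 => 'b::comm_ring_1) => bool" where
 "rhom h \<longleftrightarrow> h 1 = 1 & (ALL x y. h (x + y) = h x + h y) & (ALL x y. h (x*y) = h x * h y)"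

lemma rhom_1: "rhom h ==> h 1 = 1" and rhom_add: "rhom h ==> h (x + y) = h x + h y" and rhom_mult: "rhom h ==> h (x*y) = h x * h y"
 by (auto simp: rhom_def)

lemma rhom_0: "rhom h ==> h 0 = 0" by (metis add_cancel_right_right rhom_add)

lemma rhom_minus: "rhom h ==> h (- x) = - h x" by (metis add.right_inverse add_eq_0_iff rhom_0 rhom_add)

lemma rhom_diff: "rhom h ==> h (x - y) = h x - h y" using rhom_add[of h x "- y"] rhom_minus[of h y] by simp

lemma rhom_sum: "rhom h ==> h (sum f A) = (SUM a:A. h (f a))" by (induction A rule: infinite_finite_induct) (auto simp: rhom_0 rhom_add)

lemma rhom_prod: "rhom h ==> h (prod f A) = (PROD a:A. h (f a))" by (induction A rule: infinite_finite_induct) (auto simp: rhom_1 rhom_mult)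

lemma rhom_power: "rhom h ==> h (x^n) = h x^n" by (induction n) (auto simp: rhom_1 rhom_mult)

lemmas rhom_simps = rhom_1 rhom_0 rhom_add rhom_mult rhom_minus rhom_diff rhom_sum rhom_prod rhom_power

lemma rhom_comp: "rhom f ==> rhom g ==> rhom (%x. f (g x))" by (auto simp: rhom_def)

lemma rhom_id: "rhom (%x. x)" by (auto simp: rhom_def)

definition mev :: "('i => 'b::comm_ring_1) => ('i \<Rightarrow>\<^sub>0 nat) => 'b" where
 "mev v m = (PROD i:kys m. v i^lk m i)"

text \<open>The product in \<open>mev\<close> runs over the support of a monomial, so the variables
  may be indexed by an infinite type; algebraic independence uses polynomials in variables indexed
  by \<open>nat\<close>.\<close>

definition ev :: "('a::comm_ring_1 => 'b::comm_ring_1) => ('i => 'b) => ('i, 'a) mpoly => 'b" where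
 "ev h v F = (SUM m:kys F. h (lk F m)*mev v m)"

lemma mev_superset: "finite K ==> kys m <= K ==> mev v m = (PROD i:K. v i^lk m i)"
 unfolding mev_def by (rule prod.mono_neutral_left) (auto simp: in_keys_iff)

lemma mev_0 [simp]: "mev v 0 = 1" by (simp add: mev_def)

lemma mev_add: "mev v (m + n) = mev v m * mev v n" proof -
 have "kys (m + n) <= kys m Un kys n" by (rule Poly_Mapping.keys_add)
 thus ?thesis by (simp add: mev_superset[of "kys m Un kys n"] lookup_add power_add prod.distrib)
qed

lemma mev_single [simp]: "mev v (sgl i k) = v i^k" by (cases "k = 0") (auto simp: mev_def)

lemma ev_superset: "h 0 = 0 ==> finite K ==> kys F <= K ==> ev h v F = (SUM m:K. h (lk F m)*mev v m)"
 unfolding ev_def by (rule sum.mono_neutral_left) (auto simp: in_keys_iff)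

lemma ev_single: "h 0 = 0 ==> ev h v (sgl m c) = h c * mev v m" by (cases "c = 0") (auto simp: ev_def)

lemma ev_add: "rhom h ==> ev h v (F + G) = ev h v F + ev h v G" proof -
 assume h: "rhom h"
 have "kys (F + G) <= kys F Un kys G" by (rule Poly_Mapping.keys_add)
 with h show ?thesis by (simp add: ev_superset[of h "kys F Un kys G"] lookup_add rhom_0 rhom_add distrib_right sum.distrib)
qed

lemma ev_0: "ev h v 0 = 0" by (simp add: ev_def)

lemma ev_sum: "rhom h ==> ev h v (sum f A) = (SUM a:A. ev h v (f a))" by (induction A rule: infinite_finite_induct) (auto simp: ev_0 ev_add)

lemma mpoly_expand: "F = (SUM m:kys F. sgl m (lk F m))" by (rule pm_eqI) (auto simp: lookup_sum lookup_single when_def in_keys_iff)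

lemma ev_mult: "rhom h ==> ev h v (F*G) = ev h v F * ev h v G" proof -
 assume h: "rhom h"
 have "F * G = (SUM m:kys F. SUM n:kys G. sgl (m + n) (lk F m * lk G n))"
  by (subst mpoly_expand[of F], subst mpoly_expand[of G]) (simp add: sum_product mult_single)
 thus ?thesis using h by (simp add: ev_sum ev_single rhom_0 rhom_mult mev_add)
   (simp add: ev_def sum_product algebra_simps)
qed

lemma rhom_ev: "rhom h ==> rhom (ev h v)" proof -
 assume h: "rhom h"
 have "ev h v (sgl 0 1) = 1" using h by (simp only: ev_single rhom_0 rhom_1 mev_0 mult_1)
 thus ?thesis using h by (simp add: rhom_def[of "ev h v"] ev_add ev_mult single_one[symmetric] del: single_one)
qed

lemma rhom_Const: "rhom Const" by (auto simp: rhom_def Const_def single_add mult_single)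

lemmas Const_simps = rhom_simps[OF rhom_Const]

lemma Const_eq_iff [simp]: "Const a = Const b \<longleftrightarrow> a = b" unfolding Const_def by (metis lookup_single_eq)

lemma Const_eq_0 [simp]: "Const a = 0 \<longleftrightarrow> a = 0" by (metis Const_eq_iff rhom_0 rhom_Const)

lemma ev_Const: "rhom h ==> ev h v (Const c) = h c" by (simp add: Const_def ev_single rhom_0)

lemma ev_Var: "rhom h ==> ev h v (Var i) = v i" by (simp add: Var_def ev_single rhom_0 rhom_1)

lemma power_Var: "Var i^k = sgl (sgl i k) 1" by (induction k) (auto simp: Var_def mult_single single_add[symmetric])

lemma single_eq_prod: "sgl m (c::'a::comm_ring_1) = Const c * mev Var m" proof -
 have *: "finite K ==> (PROD i:K. sgl (sgl i (lk m i)) (1::'a))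
   = sgl (SUM i:K. sgl i (lk m i)) 1" for K by (induction K rule: finite_induct) (auto simp: mult_single)
 have "(SUM i:kys m. sgl i (lk m i)) = m" using mpoly_expand[of m] by simp
 hence "mev Var m = sgl m (1::'a)" by (simp add: mev_def power_Var *)
 thus ?thesis by (simp add: Const_def mult_single)
qed

lemma lookup_Const_mult: "lk (Const c * F) m = c*lk F m" proof -
 have "lk (Const c * F) m = (SUM n:kys F. (c*lk F n when n = m))" unfolding Const_def
  by (subst mpoly_expand[of F]) (simp add: sum_distrib_left mult_single lookup_sum lookup_single)
 also have "... = c*lk F m" by (auto simp: when_def in_keys_iff)
 finally show ?thesis .
qed

lemma mpoly_induct [case_names Const Var add mult]: assumes c: "!!c. P (Const c)" and v: "!!i. P (Var i)"
  and a: "!!F G. P F ==> P G ==> P (F + G)" and m: "!!F G. P F ==> P G ==> P (F*G)" shows "P F" proof -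
 have pw: "P (Var i^k)" for i k by (induction k) (use c[of 1] v m in "auto simp: Const_simps")
 have pr: "finite K ==> P (PROD i:K. Var i^f i)" for K f by (induction K rule: finite_induct) (use c[of 1] pw m in "auto simp: Const_simps")
 have s: "P (sgl n d)" for n d using m[OF c pr] by (simp add: single_eq_prod mev_def)
 have "finite K ==> P (SUM m:K. sgl m (lk F m))" for K by (induction K rule: finite_induct) (use c[of 0] s a in "auto simp: Const_simps")
 thus ?thesis by (subst mpoly_expand) simp
qed

text \<open>Identities between compositions of substitutions are later reduced to constants and
  variables in this way.\<close>

lemma rhom_ext: assumes "rhom f" "rhom g" "!!c. f (Const c) = g (Const c)" "!!i. f (Var i) = g (Var i)" shows "f F = g F"
 by (induction F rule: mpoly_induct) (use assms in "auto simp: rhom_add rhom_mult")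

lemma ev_Const_Var [simp]: "ev Const Var F = F" by (rule rhom_ext[OF rhom_ev[OF rhom_Const] rhom_id]) (auto simp: ev_Const ev_Var rhom_Const)

lemma ev_comp: assumes "rhom g" "rhom h" shows "g (ev h v F) = ev (%c. g (h c)) (%i. g (v i)) F" proof (rule rhom_ext[of "%F. g (ev h v F)"])
 show "rhom (%F. g (ev h v F))" by (rule rhom_comp[OF assms(1) rhom_ev[OF assms(2)]])
 show "rhom (ev (%c. g (h c)) (%i. g (v i)))" by (rule rhom_ev[OF rhom_comp[OF assms]])
qed (simp_all add: ev_Const ev_Var assms rhom_comp[OF assms])

lemma ev_cong: assumes "!!i m. m : kys F ==> i : kys m ==> v i = w i" shows "ev h v F = ev h w F"
 unfolding ev_def mev_def by (intro sum.cong prod.cong arg_cong2[of _ _ _ _ "(*)"] refl) (use assms in auto)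

lemma eval_mpoly_ev: "eval_mpoly h v F = ev h v F" unfolding eval_mpoly_def ev_def
 by (intro sum.cong refl arg_cong2[of _ _ _ _ "(*)"] mev_superset[symmetric]) auto

subsection \<open>Kronecker substitution\<close>

lemma digits_unique: fixes a b :: "nat => nat" assumes "!!i. i < r ==> a i < D" "!!i. i < r ==> b i < D" and "(SUM i<r. a i * D^i) = (SUM i<r. b i * D^i)" "i < r"
 shows "a i = b i" using assms proof (induction r arbitrary: a b i)
 case (Suc r)
 have e: "(SUM i<Suc r. c i * D^i) = c 0 + D*(SUM i<r. c (Suc i)*D^i)" for c :: "nat => nat"
  by (subst sum.lessThan_Suc_shift) (simp add: sum_distrib_left algebra_simps)
 have eq: "a 0 + D*(SUM i<r. a (Suc i)*D^i) = b 0 + D*(SUM i<r. b (Suc i)*D^i)" using Suc.prems(3) by (simp only: e)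
 have l: "a 0 < D" "b 0 < D" using Suc.prems by auto
 have 0: "a 0 = b 0" using arg_cong[OF eq, of "%x. x mod D"] l by simp
 with eq l have "(SUM i<r. a (Suc i)*D^i) = (SUM i<r. b (Suc i)*D^i)" by simp
 hence *: "a (Suc j) = b (Suc j)" if "j < r" for j using Suc.IH[of "%i. a (Suc i)" "%i. b (Suc i)" j] Suc.prems(1,2) that by simp
 show ?case using 0 * Suc.prems(4) by (cases i) simp_all
qed simp

text \<open>Put X^(D^i) for the i-th variable, with D above every exponent that occurs: the
  resulting exponent of X is a numeral in base D, so distinct monomials stay distinct. Absence of
  zero divisors, existence of nonzero values and the shape of units are transferred from one
  variable along this map.\<close>

lemma kronecker: assumes fin: "finite (Z :: ('i, 'a::comm_ring_1) mpoly set)"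
 shows "EX w. ALL F:Z. F ~= 0 --> ev (%c. [:c:]) (%i. Polynomial.monom 1 (w i)) F ~= (0 :: 'a poly)" proof -
 define V where "V = (UN F:Z. UN m:kys F. kys m)"
 define D where "D = Suc (SUM F:Z. SUM m:kys F. SUM i:kys m. lk m i)"
 have finV: "finite V" using fin by (auto simp: V_def)
 then obtain e r where e: "bij_betw e V {..<r::nat}" using finite_same_card_bij[of V "{..<card V}"] by auto
 define g where "g = inv_into V e"
 have g: "g i : V" "e (g i) = i" if "i < r" for i using that e by (auto simp: g_def bij_betw_def inv_into_into f_inv_into_f)
 have ge: "g (e x) = x" if "x : V" for x using that e by (simp add: g_def bij_betw_def)
 define w where "w = (%x. D^e x)"
 have ltD: "lk m i < D" if "F : Z" "m : kys F" for F m i proof (cases "i : kys m")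
  case True
  have "lk m i <= (SUM i:kys m. lk m i)" using True by (intro member_le_sum) auto
  also have "... <= (SUM m:kys F. SUM i:kys m. lk m i)" using that by (intro member_le_sum[of _ _ "%m. SUM i:kys m. lk m i"]) auto
  also have "... <= (SUM F:Z. SUM m:kys F. SUM i:kys m. lk m i)"
   using that fin by (intro member_le_sum[of _ _ "%F. SUM m:kys F. SUM i:kys m. lk m i"]) auto
  finally show ?thesis by (simp add: D_def)
 qed (simp add: D_def in_keys_iff)
 define W where "W = (%m. SUM x:V. lk m x * w x)"
 have W: "W m = (SUM i<r. lk m (g i)*D^i)" for m
  unfolding W_def w_def using sum.reindex_bij_betw[OF bij_betw_inv_into[OF e], of "%x. lk m x * D^e x"] g by (simp add: g_def)
 have mv: "mev (%i. Polynomial.monom (1::'a) (w i)) m = Polynomial.monom 1 (W m)" if "F : Z" "m : kys F" for F m proof -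
  have "finite K ==> (PROD i:K. Polynomial.monom (1::'a) (w i)^lk m i) = Polynomial.monom 1 (SUM i:K. lk m i * w i)" for K
   by (induction K rule: finite_induct) (auto simp: monom_power mult_monom monom_0 mult.commute)
  moreover have "kys m <= V" using that by (auto simp: V_def)
  ultimately show ?thesis using finV by (simp add: mev_superset W_def)
 qed
 have inj: "m = n" if "F : Z" "m : kys F" "n : kys F" "W m = W n" for F m n proof (rule pm_eqI)
  fix x
  show "lk m x = lk n x" proof (cases "x : V")
   case True
   hence "e x < r" using e by (auto simp: bij_betw_def)
   from digits_unique[of r "%i. lk m (g i)" D "%i. lk n (g i)", OF _ _ _ this] show ?thesis using that True by (auto simp: W[symmetric] ltD ge)
  next
   case False
   hence "x ~: kys m" "x ~: kys n" using that by (auto simp: V_def)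
   thus ?thesis by (simp add: in_keys_iff)
  qed
 qed
 have "ev (%c. [:c:]) (%i. Polynomial.monom 1 (w i)) F ~= 0" if F: "F : Z" "F ~= 0" for F proof -
  from F obtain n where n: "n : kys F" by (metis pm_eqI in_keys_iff lookup_zero)
  have "coeff (ev (%c. [:c:]) (%i. Polynomial.monom 1 (w i)) F) (W n) = (SUM m:kys F. lk F m*(if m = n then 1 else 0))" unfolding ev_def coeff_sum
   by (intro sum.cong refl) (use F n inj[OF F(1)] in "auto simp: mv[OF F(1)]")
  also have "... = lk F n" using n by (simp add: if_distrib cong: if_cong)
  also have "... ~= 0" using n by (simp add: in_keys_iff)
  finally show ?thesis by auto
 qed
 thus ?thesis by blast
qed

lemma rhom_pCons: "rhom (%c. [:c:])" by (auto simp: rhom_def one_pCons)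

lemma mpoly_mult_eq_0: fixes F G :: "('i, 'a::idom) mpoly" assumes "F * G = 0" shows "F = 0 \<or> G = 0" proof -
 obtain w where w: "!!H. H : {F, G} ==> H ~= 0 ==> ev (%c. [:c:]) (%i. Polynomial.monom 1 (w i)) H ~= (0 :: 'a poly)"
  using kronecker[of "{F, G}"] by auto
 have "ev (%c. [:c:]) (%i. Polynomial.monom 1 (w i)) F * ev (%c. [:c:]) (%i. Polynomial.monom 1 (w i)) G = (0 :: 'a poly)"
  using arg_cong[OF assms, of "ev (%c. [:c:]) (%i. Polynomial.monom 1 (w i))"] by (simp add: ev_mult rhom_pCons ev_0)
 thus ?thesis using w[of F] w[of G] by auto
qed

lemma mpoly_power_eq_0: "(F :: ('i, 'a::idom) mpoly)^n = 0 ==> F = 0" proof (induction n)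
 case 0
 hence "Const (1::'a) = (0 :: ('i, 'a) mpoly)" by (simp add: Const_simps)
 thus ?case by simp
qed (auto dest: mpoly_mult_eq_0)

lemma mpoly_mult_cancel: fixes F :: "('i, 'a::idom) mpoly" assumes "F * G = F*H" "F ~= 0" shows "G = H" using mpoly_mult_eq_0[of F "G - H"] assms by (simp add: algebra_simps)

lemma mpoly_nonvanishing: fixes F :: "('i, 'a::field) mpoly" assumes "infinite (UNIV :: 'a set)" "F ~= 0" shows "EX c. ev (%x. x) c F ~= (0 :: 'a)" proof -
 obtain w where w: "ev (%c. [:c:]) (%i. Polynomial.monom 1 (w i)) F ~= (0 :: 'a poly)" using kronecker[of "{F}"] assms by auto
 obtain a where a: "poly (ev (%c. [:c:]) (%i. Polynomial.monom 1 (w i)) F) a ~= 0"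
  using poly_roots_finite[OF w] assms(1) by (metis (mono_tags, lifting) UNIV_eq_I mem_Collect_eq)
 have "poly (ev (%c. [:c:]) (%i. Polynomial.monom 1 (w i)) F) a = ev (%x. x) (%i. a^w i) F"
  by (subst ev_comp[of "%p. poly p a"]) (auto simp: rhom_pCons rhom_def poly_monom)
 with a show ?thesis by auto
qed

subsection \<open>Gradings\<close>

definition wdeg :: "('i => nat) => ('i \<Rightarrow>\<^sub>0 nat) => nat" where
 "wdeg wt m = (SUM i:kys m. wt i * lk m i)"

lemma wdeg_superset: "finite K ==> kys m <= K ==> wdeg wt m = (SUM i:K. wt i * lk m i)"
 unfolding wdeg_def by (rule sum.mono_neutral_left) (auto simp: in_keys_iff)

lemma wdeg_add: "wdeg wt (m + n) = wdeg wt m + wdeg wt n" proof -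
 have "kys (m + n) <= kys m Un kys n" by (rule Poly_Mapping.keys_add)
 thus ?thesis by (simp add: wdeg_superset[of "kys m Un kys n"] lookup_add algebra_simps sum.distrib)
qed

lemma wdeg_0 [simp]: "wdeg wt 0 = 0" by (simp add: wdeg_def)

lemma wdeg_single [simp]: "wdeg wt (sgl i k) = wt i * k" by (cases "k = 0") (auto simp: wdeg_def)

definition homg :: "('i => nat) => nat => ('i, 'a::comm_ring_1) mpoly set" where
 "homg wt d = {F. ALL m:kys F. wdeg wt m = d}"

definition hcomp :: "('i => nat) => nat => ('i, 'a::comm_ring_1) mpoly => ('i, 'a) mpoly" where
 "hcomp wt d F = Poly_Mapping.mapp (%m c. if wdeg wt m = d then c else 0) F"

lemma lookup_hcomp: "lk (hcomp wt d F) m = (if wdeg wt m = d then lk F m else 0)" by (auto simp: hcomp_def lookup_mapp when_def in_keys_iff)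

lemma homg_iff: "F : homg wt d \<longleftrightarrow> (ALL m. wdeg wt m ~= d --> lk F m = 0)" by (auto simp: homg_def in_keys_iff)

lemma homg_0 [simp]: "0 : homg wt d" by (simp add: homg_iff)

lemma homg_add: "F : homg wt d ==> G : homg wt d ==> F + G : homg wt d" by (force simp: homg_iff lookup_add)

lemma homg_minus: "F : homg wt d ==> - F : homg wt d" by (force simp: homg_iff)

lemma homg_diff: "F : homg wt d ==> G : homg wt d ==> F - G : homg wt d" by (force simp: homg_iff lookup_minus)

lemma homg_sum: "(!!a. a : A ==> f a : homg wt d) ==> sum f A : homg wt d" by (induction A rule: infinite_finite_induct) (auto intro: homg_add)

lemma homg_mult: "F : homg wt d ==> G : homg wt e ==> F * G : homg wt (d + e)"
 unfolding homg_def using keys_mult[of F G] by (fastforce simp: wdeg_add)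

lemma homg_Const [simp]: "Const c : homg wt 0" by (auto simp: homg_iff Const_def lookup_single when_def split: if_splits)

lemma homg_1 [simp]: "1 : homg wt 0" using homg_Const[of 1] by (simp add: Const_simps)

lemma homg_Var: "Var i : homg wt (wt i)" by (auto simp: homg_iff Var_def lookup_single when_def split: if_splits)

lemma homg_power: "F : homg wt d ==> F^n : homg wt (n*d)" by (induction n) (auto dest: homg_mult)

lemma homg_prod: "finite A ==> (!!a. a : A ==> f a : homg wt (d a)) ==> prod f A : homg wt (sum d A)"
 by (induction A rule: finite_induct) (auto intro: homg_mult)

lemma homg_Const_mult: "F : homg wt d ==> Const c * F : homg wt d" using homg_mult[of "Const c" wt 0 F d] by simp

lemma homg_single: "sgl m c : homg wt (wdeg wt m)" by (auto simp: homg_iff lookup_single when_def split: if_splits)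

lemma homg_inter_0: "F : homg wt d ==> F : homg wt e ==> d ~= e ==> F = 0" by (rule pm_eqI) (force simp: homg_iff)

lemma hcomp_homg [simp]: "hcomp wt d F : homg wt d" by (auto simp: homg_iff lookup_hcomp)

lemma hcomp_add: "hcomp wt d (F + G) = hcomp wt d F + hcomp wt d G" by (rule pm_eqI) (auto simp: lookup_hcomp lookup_add)

lemma hcomp_0 [simp]: "hcomp wt d 0 = 0" by (rule pm_eqI) (auto simp: lookup_hcomp)

lemma hcomp_minus: "hcomp wt d (- F) = - hcomp wt d F" by (rule pm_eqI) (auto simp: lookup_hcomp)

lemma hcomp_diff: "hcomp wt d (F - G) = hcomp wt d F - hcomp wt d G" by (rule pm_eqI) (auto simp: lookup_hcomp lookup_minus)

lemma hcomp_sum: "hcomp wt d (sum f A) = (SUM a:A. hcomp wt d (f a))" by (induction A rule: infinite_finite_induct) (auto simp: hcomp_add)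

lemma hcomp_of_homg: "F : homg wt d ==> hcomp wt e F = (if e = d then F else 0)" by (rule pm_eqI) (auto simp: lookup_hcomp homg_iff)

text \<open>Every bound beyond D works, so one bound can serve several polynomials or exceed a given
  degree.\<close>

lemma hcomp_decomp: "EX D. ALL E>=D. F = (SUM d<=E. hcomp wt d F)" proof -
 have "F = (SUM d<=E. hcomp wt d F)" if "E >= (SUM m:kys F. wdeg wt m)" for E proof (rule pm_eqI)
  fix m
  have "lk F m ~= 0 ==> wdeg wt m <= E" using that member_le_sum[of m "kys F" "wdeg wt"] by (force simp: in_keys_iff)
  thus "lk F m = lk (SUM d<=E. hcomp wt d F) m" by (auto simp: lookup_sum lookup_hcomp)
 qed
 thus ?thesis by blast
qed

lemma hcomp_mult_homg: assumes G: "G : homg wt e" shows "hcomp wt d (G*F) = (if e <= d then G * hcomp wt (d - e) F else 0)" proof -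
 obtain D where D: "F = (SUM c<=D + d. hcomp wt c F)" using hcomp_decomp[of F wt] by (meson le_add1)
 have "hcomp wt d (G*F) = (SUM c<=D + d. hcomp wt d (G*hcomp wt c F))" by (subst D) (simp add: sum_distrib_left hcomp_sum)
 also have "... = (SUM c<=D + d. if d = e + c then G * hcomp wt c F else 0)" by (intro sum.cong refl hcomp_of_homg homg_mult G) auto
 also have "... = (SUM c<=D + d. if c = d - e then (if e <= d then G * hcomp wt c F else 0) else 0)" by (intro sum.cong refl) auto
 also have "... = (if e <= d then G * hcomp wt (d - e) F else 0)" by (subst sum.delta) auto
 finally show ?thesis .
qed

lemma hcomp_eqI: "(!!d. hcomp wt d F = hcomp wt d G) ==> F = G" by (metis (no_types, lifting) lookup_hcomp pm_eqI)

lemma hcomp_homg': "F : homg wt e ==> hcomp wt' d F : homg wt e" by (auto simp: homg_iff lookup_hcomp)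

lemma hcomp_of_Var_power_mult:
 "hcomp wt (wt i * k + d) (Var i^k*F) = Var i^k*hcomp wt d F"
 using hcomp_mult_homg[OF homg_power[OF homg_Var], of wt "wt i * k + d" i k F] by (simp add: mult.commute)

section \<open>Ideals and algebraic independence\<close>

interpretation idl: Modules.module "(*) :: 'a::comm_ring_1 => 'a => 'a" by unfold_locales (auto simp: algebra_simps)

interpretation ksp: Vector_Spaces.vector_space "%(c::'k::field) (F::('v, 'k) mpoly). Const c * F"
 by unfold_locales (simp_all only: distrib_left distrib_right Const_simps mult.assoc mult_1)

declare idl.scale_scale [simp del] ksp.scale_scale [simp del]

abbreviation isideal :: "'a::comm_ring_1 set => bool" where "isideal == idl.subspace"
abbreviation igen :: "'a::comm_ring_1 set => 'a set" where "igen == idl.span"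
lemmas isideal_igen = idl.subspace_span and igen_base = idl.span_base and ideal_0 = idl.subspace_0 and ideal_add = idl.subspace_add and ideal_sum = idl.subspace_sum and ideal_neg = idl.subspace_neg

lemma ideal_mult_l: "isideal a ==> x : a ==> r * x : a" and ideal_mult_r: "isideal a ==> x : a ==> x * r : a"
 using idl.subspace_scale[of a x r] by (simp_all add: mult.commute)

lemma ideal_mem_cong: "isideal a ==> x - y : a ==> x : a \<longleftrightarrow> y : a"
 using ideal_add[of a "x - y" y] idl.subspace_diff[of a x "x - y"] by auto

lemma igen_image: assumes "finite J" shows "x : igen (f ` J) \<longleftrightarrow> (EX c. x = (SUM j:J. c j * f j))" proof
 have "isideal {x. EX c. x = (SUM j:J. c j * f j)}" proof (rule idl.subspaceI)
  show "0 : {x. EX c. x = (SUM j:J. c j * f j)}" by (auto intro!: exI[of _ "%_. 0"])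
 next
  fix x y assume "x : {x. EX c. x = (SUM j:J. c j * f j)}" "y : {x. EX c. x = (SUM j:J. c j * f j)}"
  then obtain c d where "x = (SUM j:J. c j * f j)" "y = (SUM j:J. d j * f j)" by auto
  thus "x + y : {x. EX c. x = (SUM j:J. c j * f j)}" by (auto intro!: exI[of _ "%j. c j + d j"] simp: distrib_right sum.distrib)
 next
  fix r x assume "x : {x. EX c. x = (SUM j:J. c j * f j)}"
  then obtain c where c: "x = (SUM j:J. c j * f j)" by blast
  have "r * x = (SUM j:J. (r*c j)*f j)" by (simp add: c sum_distrib_left mult.assoc)
  thus "r * x : {x. EX c. x = (SUM j:J. c j * f j)}" by (intro CollectI exI)
 qed
 moreover have "f ` J <= {x. EX c. x = (SUM j:J. c j * f j)}" proof
  fix x assume "x : f ` J"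
  then obtain i where "i : J" "x = f i" by auto
  thus "x : {x. EX c. x = (SUM j:J. c j * f j)}"
   using assms by (auto intro!: exI[of _ "%j. if j = i then 1 else 0"] simp: if_distrib[of "%x. x * _"] cong: if_cong)
 qed
 ultimately show "x : igen (f ` J) ==> EX c. x = (SUM j:J. c j * f j)" using idl.span_minimal by blast
next
 assume "EX c. x = (SUM j:J. c j * f j)"
 then obtain c where c: "x = (SUM j:J. c j * f j)" by blast
 show "x : igen (f ` J)" unfolding c by (rule idl.span_sum, rule idl.span_scale, rule igen_base) auto
qed

lemma igen_insert: "x : igen (insert a S) \<longleftrightarrow> (EX r. x - r*a : igen S)" by (rule idl.span_breakdown_eq)

lemma igen_ideal: "isideal a ==> igen a = a" by (simp add: idl.span_eq_iff)

lemma igen_subset: "Z <= a ==> isideal a ==> igen Z <= a" by (rule idl.span_minimal)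

lemma igen_mono: "A <= B ==> igen A <= igen B" by (rule idl.span_mono)

lemma ideal_vimage: assumes "rhom h" "isideal a" shows "isideal {x. h x : a}" by (rule idl.subspaceI)
   (use assms in "auto simp: rhom_simps ideal_0 ideal_add ideal_mult_l")

section \<open>Prime ideals and radicals\<close>

definition isprime :: "'a::comm_ring_1 set => bool" where
 "isprime p \<longleftrightarrow> isideal p & 1 ~: p & (ALL x y. x * y : p --> x : p \<or> y : p)"

lemma isprime_ideal: "isprime p ==> isideal p" by (simp add: isprime_def)

lemma prime_multD: "isprime p ==> x * y : p ==> x : p \<or> y : p" by (auto simp: isprime_def)

lemma prime_powerD: "isprime p ==> x^n : p ==> x : p" by (induction n) (auto simp: isprime_def)

lemma prime_prodD: "isprime p ==> prod f A : p ==> EX a:A. f a : p" by (induction A rule: infinite_finite_induct) (auto simp: isprime_def)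

lemma prime_vimage: "rhom h ==> isprime p ==> isprime {x. h x : p}" by (auto simp: isprime_def rhom_simps intro: ideal_vimage)

lemma prime_zero: "isprime {0 :: ('i, 'a::idom) mpoly}" using mpoly_mult_eq_0 Const_eq_0[of "1::'a"] by (auto simp: isprime_def Const_simps)

lemma const_notin_prime: assumes "isprime (p :: ('i, 'a::field) mpoly set)" "c ~= 0" shows "Const c ~: p"
 using assms ideal_mult_l[of p "Const c" "Const (inverse c)"] by (auto simp: isprime_def Const_simps simp flip: rhom_mult[OF rhom_Const])

definition rad :: "'a::comm_ring_1 set => 'a set" where
 "rad a = {x. EX N. x^N : a}"

lemma rad_ideal: assumes a: "isideal a" shows "isideal (rad a)" proof (rule idl.subspaceI)
 show "0 : rad a" using ideal_0[OF a] by (auto simp: rad_def intro!: exI[of _ 1])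
next
 fix x y assume "x : rad a" "y : rad a"
 then obtain m n where mn: "x^m : a" "y^n : a" by (auto simp: rad_def)
 have "(x + y)^(m + n) = (SUM k<=m + n. of_nat ((m + n) choose k)*x^k*y^(m + n - k))" by (rule binomial_ring)
 also have "... : a" proof (rule ideal_sum[OF a])
  fix k assume "k : {..m + n}"
  consider "k = m + (k - m)" | "m + n - k = n + (m - k)" by linarith
  thus "of_nat ((m + n) choose k)*x^k*y^(m + n - k) : a" proof cases
   case 1
   hence "x^k = x^m*x^(k - m)" by (metis power_add)
   thus ?thesis using mn by (simp add: a ideal_mult_l ideal_mult_r)
  next
   case 2
   hence "y^(m + n - k) = y^n*y^(m - k)" by (metis power_add)
   thus ?thesis using mn by (simp add: a ideal_mult_l ideal_mult_r)
  qed
 qed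
 finally show "x + y : rad a" by (auto simp: rad_def)
next
 fix r x assume "x : rad a"
 thus "r * x : rad a" using a by (force simp: rad_def power_mult_distrib intro: ideal_mult_l)
qed

lemma rad_superset: "a <= rad a" by (auto simp: rad_def intro!: exI[of _ 1])

lemma igen_subset_rad: "Z <= rad (igen Y) ==> igen Z <= rad (igen Y)" by (intro igen_subset rad_ideal isideal_igen)

lemma rad_rad: "x : rad (rad a) ==> x : rad a" by (auto simp: rad_def simp flip: power_mult)

text \<open>An ideal maximal among those that contain a and are disjoint from W is prime, because W
  is closed under products.\<close>

lemma exists_prime_avoiding: assumes a: "isideal a" and W: "1 : W" "!!x y. x : W ==> y : W ==> x * y : W" and d: "a Int W = {}"
 shows "EX p. isprime p & a <= p & p Int W = {}" proof -
 define \<A> where "\<A> = {b. isideal b & a <= b & b Int W = {}}"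
 have "EX M:\<A>. ALL Z:\<A>. M <= Z --> Z = M" proof (rule subset_Zorn_nonempty)
  show "\<A> ~= {}" using a d by (auto simp: \<A>_def)
  fix C assume C: "C ~= {}" "subset.chain \<A> C"
  have "isideal (\<Union>C)" proof (rule idl.subspaceI)
   show "0 : \<Union>C" using C by (force simp: \<A>_def subset.chain_def ideal_0)
   fix x y assume "x : \<Union>C" "y : \<Union>C"
   then obtain b where "b : C" "x : b" "y : b" using C(2) by (auto simp: subset.chain_def) blast
   thus "x + y : \<Union>C" using C(2) by (auto simp: \<A>_def subset.chain_def intro!: bexI[of _ b] ideal_add)
  next
   fix r x assume "x : \<Union>C"
   thus "r * x : \<Union>C" using C(2) by (fastforce simp: \<A>_def subset.chain_def intro: ideal_mult_l)
  qed
  thus "\<Union>C : \<A>" using C by (auto simp: \<A>_def subset.chain_def)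
 qed
 then obtain p where p: "p : \<A>" "!!Z. Z : \<A> ==> p <= Z ==> Z = p" by blast
 have pi: "isideal p" and pa: "a <= p" and pW: "p Int W = {}" using p(1) by (auto simp: \<A>_def)
 \<comment> \<open>By maximality, adjoining x to p creates an element of W.\<close>
 have big: "EX w:W. EX r. w - r*x : p" if "x ~: p" for x proof (rule ccontr)
  assume n: "~ ?thesis"
  have "isideal (igen (insert x p))" "p <= igen (insert x p)" "x : igen (insert x p)" by (auto intro: igen_base)
  moreover have "igen (insert x p) Int W = {}" using n pi by (auto simp: igen_insert igen_ideal)
  ultimately have "igen (insert x p) = p" using pa by (intro p(2)) (auto simp: \<A>_def)
  with that `x : igen (insert x p)` show False by simp
 qed
 have "isprime p" unfolding isprime_def proof (intro conjI allI impI pi)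
  show "1 ~: p" using W pW by auto
  fix x y assume xy: "x * y : p"
  show "x : p \<or> y : p" proof (rule ccontr)
   assume "~ ?thesis"
   then obtain w r v s where wv: "w : W" "w - r*x : p" "v : W" "v - s*y : p" using big[of x] big[of y] by auto
   have "w * v = (w - r*x) * v + (r*x)*(v - s*y) + r * s*(x*y)" by (simp add: algebra_simps)
   also have "... : p" using wv xy pi by (intro ideal_add) (auto intro: ideal_mult_l ideal_mult_r)
   finally show False using W wv pW by blast
  qed
 qed
 with pa pW show ?thesis by blast
qed

section \<open>Graded ideals\<close>

definition hideal :: "('i => nat) => ('i, 'a::comm_ring_1) mpoly set => bool" where
 "hideal wt a \<longleftrightarrow> isideal a & (ALL F:a. ALL d. hcomp wt d F : a)"

lemma hideal_igen: assumes "!!x. x : Z ==> EX d. x : homg wt d" shows "hideal wt (igen Z)" proof -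
 have "hcomp wt d F : igen Z" if "F : igen Z" for F d using that proof (induction rule: idl.span_induct_alt)
  case base thus ?case by (simp add: idl.span_zero)
 next
  case (step c x y)
  obtain e where e: "x : homg wt e" using assms step by blast
  have "x * r : igen Z" for r using idl.span_scale[OF igen_base[OF step(1)], of r] by (simp add: mult.commute)
  thus ?case using step e by (auto simp: hcomp_add mult.commute[of c] hcomp_mult_homg intro: idl.span_add)
 qed
 thus ?thesis by (simp add: hideal_def)
qed

lemma hideal_insert: assumes "hideal wt a" "x : homg wt e" shows "hideal wt (igen (insert x a))" proof -
 have "hcomp wt d F : igen (insert x a)" if F: "F : igen (insert x a)" for F d proof -
  obtain r where r: "F - r*x : a" using F assms(1) by (auto simp: igen_insert hideal_def igen_ideal)
  hence "hcomp wt d (F - x*r) : a" using assms(1) by (auto simp: hideal_def mult.commute)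
  hence "hcomp wt d F - hcomp wt d (x*r) : igen (insert x a)" by (simp add: hcomp_diff igen_base)
  moreover have "hcomp wt d (x*r) : igen (insert x a)" using assms(2) ideal_mult_r[OF isideal_igen igen_base[of x "insert x a"]]
   by (simp add: hcomp_mult_homg idl.span_zero)
  ultimately show ?thesis using idl.span_add by fastforce
 qed
 thus ?thesis by (simp add: hideal_def)
qed

section \<open>Algebraic independence modulo an ideal\<close>

definition vin :: "'i set => ('i, 'a::comm_ring_1) mpoly => bool" where
 "vin V F \<longleftrightarrow> (ALL m:kys F. kys m <= V)"

lemma vin_mult: "vin V F ==> vin V G ==> vin V (F*G)" unfolding vin_def proof
 fix m assume a: "ALL m:kys F. kys m <= V" "ALL m:kys G. kys m <= V" "m : kys (F*G)"
 then obtain k l where "k : kys F" "l : kys G" "m = k + l" using keys_mult[of F G] by blast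
 with a(1,2) show "kys m <= V" using Poly_Mapping.keys_add[of k l] by blast
qed

lemma vin_hcomp: "vin V F ==> vin V (hcomp wt d F)" by (auto simp: vin_def lookup_hcomp in_keys_iff split: if_splits)

definition indep :: "('v, 'k::field) mpoly set => nat => (nat => ('v, 'k) mpoly) => bool" where
 "indep a r t \<longleftrightarrow> (ALL F. vin {..<r} F & ev Const t F : a --> F = 0)"

text \<open>For a quotient of a polynomial ring over a field, the largest number of algebraically
  independent elements is the Krull dimension.\<close>

definition dimle :: "('v, 'k::field) mpoly set => nat => bool" where
 "dimle a e \<longleftrightarrow> (ALL r t. indep a r t --> r <= e)"

lemma indep_mono: "indep b r t ==> a <= b ==> indep a r t" by (auto simp: indep_def)

lemma dimle_mono: "dimle a e ==> a <= b ==> e <= e' ==> dimle b e'" unfolding dimle_def by (meson indep_mono le_trans)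

lemma indep_less: "indep a r t ==> r' <= r ==> indep a r' t" unfolding indep_def vin_def by (meson dual_order.trans lessThan_subset_iff)

lemma indep_vimage: assumes "rhom h" "!!c. h (Const c) = Const c" shows "indep {F. h F : a} r t \<longleftrightarrow> indep a r (%j. h (t j))"
 by (simp add: indep_def ev_comp assms rhom_Const)

text \<open>Powers of s times nonzero polynomials in t form a multiplicative set; a prime disjoint
  from it misses s and keeps t independent.\<close>

lemma indep_prime_over: assumes a: "isideal a" and i: "!!N F. vin {..<r} F ==> F ~= 0 ==> s^N*ev Const t F ~: a"
 shows "EX Q. isprime Q & a <= Q & s ~: Q & indep Q r t" proof -
 define W where "W = {s^N*ev Const t F | N F. vin {..<r} F & F ~= 0}"
 have c1: "vin {..<r} (Const 1)" by (auto simp: vin_def Const_def split: if_splits)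
 have "EX p. isprime p & a <= p & p Int W = {}" proof (rule exists_prime_avoiding[OF a])
  show "1 : W" unfolding W_def by (rule CollectI, rule exI[of _ 0], rule exI[of _ "Const 1"])
    (use c1 in "simp add: ev_Const rhom_Const rhom_1[OF rhom_ev] Const_simps")
  show "a Int W = {}" using i by (auto simp: W_def)
  fix x y assume "x : W" "y : W"
  then obtain N F M G where *: "x = s^N*ev Const t F" "y = s^M*ev Const t G"
   "vin {..<r} F" "vin {..<r} G" "F ~= 0" "G ~= 0" by (auto simp: W_def)
  hence "x * y = s^(N + M)*ev Const t (F*G)" "F * G ~= 0" "vin {..<r} (F*G)"
   using mpoly_mult_eq_0[of F G] by (auto simp: ev_mult rhom_Const power_add vin_mult)
  thus "x * y : W" unfolding W_def by (intro CollectI exI[of _ "N + M"] exI[of _ "F * G"] conjI)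
 qed
 then obtain p where p: "isprime p" "a <= p" "p Int W = {}" by blast
 have "s : W" unfolding W_def by (rule CollectI, rule exI[of _ 1], rule exI[of _ "Const 1"])
   (use c1 in "simp add: ev_Const rhom_Const rhom_1[OF rhom_ev] Const_simps")
 moreover have "indep p r t" unfolding indep_def proof (intro allI impI, rule ccontr)
  fix F assume "vin {..<r} F & ev Const t F : p" "F ~= 0"
  hence "s^0*ev Const t F : W" "s^0*ev Const t F : p" by (auto simp: W_def simp del: power_0) simp
  with p show False by blast
 qed
 ultimately show ?thesis using p by blast
qed

lemma indep_prime: assumes "isideal a" "indep a r t" shows "EX Q. isprime Q & a <= Q & indep Q r t"
 using indep_prime_over[OF assms(1), of r 1 t] assms(2) by (auto simp: indep_def)

lemma dimle_primes: assumes "isideal a" "!!Q. isprime Q ==> a <= Q ==> dimle Q e" shows "dimle a e"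
 using assms indep_prime unfolding dimle_def by blast

subsection \<open>Division by powers of a variable\<close>

text \<open>\<open>vdiv\<close> and \<open>vrem\<close> are quotient and remainder on division by a
  power of one variable. Division commutes with multiplication by the other variables, which makes
  it a contracting homotopy for Koszul complexes on powers of variables.\<close>

definition vdiv :: "'i => nat => ('i, 'a::comm_ring_1) mpoly => ('i, 'a) mpoly" where
 "vdiv i M F = Poly_Mapping.map_key (%m. m + sgl i M) F"

definition vrem :: "'i => nat => ('i, 'a::comm_ring_1) mpoly => ('i, 'a) mpoly" where
 "vrem i M F = Poly_Mapping.mapp (%m c. if lk m i < M then c else 0) F"

lemma lookup_vdiv: "lk (vdiv i M F) m = lk F (m + sgl i M)" by (simp add: vdiv_def map_key.rep_eq inj_on_def)

lemma lookup_vrem: "lk (vrem i M F) m = (if lk m i < M then lk F m else 0)" by (auto simp: vrem_def lookup_mapp when_def in_keys_iff)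

lemma lookup_single_mult: "lk (sgl n 1 * F) (m + n) = lk (F :: ('i, 'a::comm_ring_1) mpoly) m" proof -
 have "lk (sgl n 1 * F) (m + n) = (SUM l:kys F. (lk F l when n + l = m + n))"
  by (subst mpoly_expand[of F]) (simp add: sum_distrib_left mult_single lookup_sum lookup_single)
 also have "... = lk F m" by (auto simp: when_def in_keys_iff add.commute)
 finally show ?thesis .
qed

lemma lookup_single_mult_0: assumes "!!l. m ~= l + n" shows "lk (sgl n 1*(F :: ('i, 'a::comm_ring_1) mpoly)) m = 0" proof -
 have "lk (sgl n 1 * F) m = (SUM l:kys F. (lk F l when n + l = m))"
  by (subst mpoly_expand[of F]) (simp add: sum_distrib_left mult_single lookup_sum lookup_single)
 also have "... = 0" using assms by (intro sum.neutral) (metis add.commute when_def)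
 finally show ?thesis .
qed

lemma exponent_split: "(M::nat) <= lk m i ==> EX l. m = l + sgl i M" by (rule exI[of _ "m - sgl i M"], rule pm_eqI)
   (auto simp: lookup_add lookup_minus lookup_single when_def)

lemma vdiv_vrem: "F = Var i^M * vdiv i M F + vrem i M F" proof (rule pm_eqI)
 fix m
 show "lk F m = lk (Var i^M * vdiv i M F + vrem i M F) m" proof (cases "M <= lk m i")
  case True
  then obtain l where "m = l + sgl i M" using exponent_split[OF True] by blast
  thus ?thesis by (simp add: power_Var lookup_add lookup_single_mult lookup_vdiv lookup_vrem)
 next
  case False
  hence "!!l. m ~= l + sgl i M" by (auto simp: lookup_add)
  with False show ?thesis by (simp add: power_Var lookup_add lookup_single_mult_0 lookup_vrem)
 qed
qed

lemma vdiv_mult: "vdiv i M (Var i^M*F) = F" by (rule pm_eqI) (simp add: lookup_vdiv power_Var lookup_single_mult)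

lemma vdiv_add: "vdiv i M (F + G) = vdiv i M F + vdiv i M G" by (rule pm_eqI) (simp add: lookup_vdiv lookup_add)

lemma vdiv_minus: "vdiv i M (- F) = - vdiv i M F" by (rule pm_eqI) (simp add: lookup_vdiv)

lemma vdiv_0 [simp]: "vdiv i M 0 = 0" by (rule pm_eqI) (simp add: lookup_vdiv)

lemma vdiv_Var_mult: assumes "i ~= j" shows "vdiv i M (Var j^N*F) = Var j^N * vdiv i M F" proof (rule pm_eqI)
 fix m
 show "lk (vdiv i M (Var j^N*F)) m = lk (Var j^N * vdiv i M F) m" proof (cases "N <= lk m j")
  case True
  then obtain l where l: "m = l + sgl j N" using exponent_split[OF True] by blast
  have "m + sgl i M = (l + sgl i M) + sgl j N" by (simp add: l algebra_simps)
  thus ?thesis by (simp only: lookup_vdiv power_Var lookup_single_mult) (simp add: l lookup_single_mult lookup_vdiv)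
 next
  case False
  hence "!!l. m ~= l + sgl j N"
   "!!l. m + sgl i M ~= l + sgl j N" using assms by (auto simp: lookup_add poly_mapping_eq_iff fun_eq_iff lookup_single when_def intro!: exI[of _ j])
  thus ?thesis by (simp add: lookup_vdiv power_Var lookup_single_mult_0)
 qed
qed

lemma vin_split_var: assumes "vin {..<Suc r} (F :: (nat, 'k::comm_ring_1) mpoly)" shows "vin {..<r} (vrem r 1 F)" "vin {..<Suc r} (vdiv r 1 F)"
proof -
 show "vin {..<r} (vrem r 1 F)" unfolding vin_def proof (intro ballI subsetI)
  fix m i assume m: "m : kys (vrem r 1 F)" "i : kys m"
  hence "lk m r = 0" "m : kys F" by (auto simp: in_keys_iff lookup_vrem split: if_splits)
  moreover from this assms m(2) have "i : {..<Suc r}" by (auto simp: vin_def)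
  moreover have "i ~= r" using m(2) `lk m r = 0` by (auto simp: in_keys_iff)
  ultimately show "i : {..<r}" by auto
 qed
 show "vin {..<Suc r} (vdiv r 1 F)" unfolding vin_def proof (intro ballI subsetI)
  fix m i assume m: "m : kys (vdiv r 1 F)" "i : kys m"
  hence "m + sgl r 1 : kys F" "i : kys (m + sgl r 1)" by (auto simp: in_keys_iff lookup_vdiv lookup_add)
  thus "i : {..<Suc r}" using assms by (auto simp: vin_def)
 qed
qed

text \<open>In a relation modulo p0, the part free of the new variable is a relation among t modulo
  p1, hence zero. The rest is divisible by g, which cancels because p0 is prime. So each strict
  inclusion of primes is worth one independent element.\<close>

lemma indep_strict: assumes p0: "isprime p0" and p1: "isideal p1" "p0 <= p1" and g: "g : p1" "g ~: p0" and i: "indep p1 r t"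
 shows "indep p0 (Suc r) (t(r := g))" proof -
 \<comment> \<open>n bounds the exponents of the new variable, which drop by one at each
   cancellation.\<close>
 have "F = 0" if "vin {..<Suc r} F" "ev Const (t(r := g)) F : p0" "ALL m:kys F. lk m r < n" for F n using that proof (induction n arbitrary: F)
  case 0
  hence "kys F = {}" by auto
  thus ?case by (metis in_keys_iff empty_iff lookup_zero pm_eqI)
 next
  case (Suc n)
  note vs = vin_split_var[OF Suc.prems(1)]
  have F: "F = Var r * vdiv r 1 F + vrem r 1 F" using vdiv_vrem[of F r 1] by simp
  have e: "ev Const (t(r := g)) (vrem r 1 F) = ev Const t (vrem r 1 F)" proof (rule ev_cong)
   fix i m assume "m : kys (vrem r 1 F)" "i : kys m"
   hence "i : {..<r}" using vs(1) unfolding vin_def by blast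
   thus "(t(r := g)) i = t i" by simp
  qed
  have eq: "ev Const (t(r := g)) F = g*ev Const (t(r := g)) (vdiv r 1 F) + ev Const t (vrem r 1 F)"
   by (subst F) (simp add: ev_add ev_mult rhom_Const ev_Var e del: One_nat_def)
  have "ev Const t (vrem r 1 F) = ev Const (t(r := g)) F - g*ev Const (t(r := g)) (vdiv r 1 F)" by (simp add: eq)
  moreover have "ev Const (t(r := g)) F : p1" using p1(2) Suc.prems(2) by blast
  ultimately have "ev Const t (vrem r 1 F) : p1" by (simp only: idl.subspace_diff[OF p1(1)] ideal_mult_r[OF p1(1) g(1)])
  hence r0: "vrem r 1 F = 0" using i vs by (auto simp: indep_def)
  hence "g * ev Const (t(r := g)) (vdiv r 1 F) : p0" using Suc.prems(2) by (simp only: eq r0 ev_0 add_0_right)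
  hence "ev Const (t(r := g)) (vdiv r 1 F) : p0" using prime_multD[OF p0] g by blast
  moreover have "ALL m:kys (vdiv r 1 F). lk m r < n" proof
   fix m assume "m : kys (vdiv r 1 F)"
   hence "m + sgl r 1 : kys F" by (auto simp: in_keys_iff lookup_vdiv)
   thus "lk m r < n" using Suc.prems(3) by (force simp: lookup_add)
  qed
  ultimately have "vdiv r 1 F = 0" using Suc.IH vs by blast
  with r0 F show ?case by simp
 qed
 moreover have "EX n. ALL m:kys F. lk m r < n" for F :: "(nat, 'b) mpoly"
  by (rule exI[of _ "Suc (SUM m:kys F. lk m r)"]) (auto simp: less_Suc_eq_le intro!: member_le_sum)
 ultimately show ?thesis unfolding indep_def by blast
qed

section \<open>Dimension bounds and Noether normalization\<close>

abbreviation tot :: "'i => nat" where "tot == %_. 1"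

text \<open>Representatives in the span of T inherit linear independence from the classes modulo
  a.\<close>

lemma independent_mod_bound: fixes f :: "'b => ('v, 'k::field) mpoly" assumes J: "finite J" and T: "finite T" and a: "isideal a"
  and f: "!!j. j : J ==> EX g:ksp.span T. f j - g : a" and i: "!!c. (SUM j:J. Const (c j)*f j) : a ==> ALL j:J. c j = 0" shows "card J <= card T"
proof -
 obtain g where g: "!!j. j : J ==> g j : ksp.span T & f j - g j : a" using f by metis
 have z: "ALL j:J. c j = 0" if "(SUM j:J. Const (c j)*g j) = 0" for c proof (rule i)
  have "(SUM j:J. Const (c j)*f j) = (SUM j:J. Const (c j)*(f j - g j))" using that by (simp add: right_diff_distrib sum_subtractf)
  also have "... : a" by (intro ideal_sum[OF a] ideal_mult_l[OF a]) (use g in auto)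
  finally show "(SUM j:J. Const (c j)*f j) : a" .
 qed
 have inj: "inj_on g J" proof (rule inj_onI, rule ccontr)
  fix x y assume xy: "x : J" "y : J" "g x = g y" "x ~= y"
  \<comment> \<open>Two equal representatives would give the relation with coefficients 1 and
    -1.\<close>
  have "(SUM j:J. Const (if j = x then 1 else if j = y then - 1 else 0)*g j)
    = (SUM j:{x, y}. Const (if j = x then 1 else if j = y then - 1 else 0)*g j)" by (rule sum.mono_neutral_right) (use J xy in auto)
  also have "... = 0" using xy by (simp add: Const_simps)
  finally have "ALL j:J. (if j = x then 1 else if j = y then - 1 else 0) = (0::'k)" by (rule z)
  with xy show False by auto
 qed
 have "ksp.independent (g ` J)" proof (rule ccontr)
  assume "~ ?thesis"
  then obtain u where u: "EX v:g ` J. u v ~= 0" "(SUM v:g ` J. Const (u v) * v) = 0" using ksp.dependent_finite[of "g ` J"] J by auto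
  from u(2) have "(SUM j:J. Const (u (g j))*g j) = 0" by (simp add: sum.reindex[OF inj])
  from z[OF this] u(1) show False by auto
 qed
 with ksp.independent_span_bound[OF T] g have "card (g ` J) <= card T" by blast
 thus ?thesis by (simp add: card_image[OF inj])
qed

lemma gen_in_rad: "x : Z ==> x : rad (igen Z)" using igen_base[of x Z] by (force simp: rad_def intro: exI[of _ 1])

lemma Const_inverse: "(c::'k::field) ~= 0 ==> Const (inverse c)*(Const c * F) = (F :: ('b, 'k) mpoly)" proof -
 assume "c ~= 0"
 hence "Const (inverse c)*Const c = (1 :: ('b, 'k) mpoly)" by (metis left_inverse rhom_mult[OF rhom_Const] rhom_1[OF rhom_Const])
 thus ?thesis by (simp add: mult.assoc[symmetric])
qed

section \<open>Spans of bounded monomials and their growth\<close>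

definition boxes :: "nat => nat => (nat => nat) set" where
 "boxes e C = {..<e} \<rightarrow>\<^sub>E {..C}"

lemma card_boxes: "card (boxes e C) = Suc C^e" and finite_boxes: "finite (boxes e C)" by (auto simp: boxes_def card_PiE intro: finite_PiE)

definition mons :: "(nat => 'a::comm_ring_1) => nat => (nat => nat) => 'a" where
 "mons w e b = (PROD j<e. w j^b j)"

text \<open>Elements that are, modulo a, in the k-span of products of a member of R and a monomial
  in w with all exponents at most C. For finite R, modulo a, this span has dimension at most card R
  times (C + 1)^e.\<close>

definition monspan :: "('v, 'k::field) mpoly set => (nat => ('v, 'k) mpoly) => nat =>
  ('v, 'k) mpoly set => nat => ('v, 'k) mpoly set" where
 "monspan a w e R C = {F. EX g:ksp.span ((%(b, \<rho>). mons w e b * \<rho>) ` (boxes e C \<times> R)). F - g : a}"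

lemma monspan_0: "isideal a ==> F : a ==> F : monspan a w e R C" unfolding monspan_def by (auto intro!: bexI[of _ 0] ksp.span_zero)

lemma monspan_add: assumes "isideal a" "F : monspan a w e R C" "G : monspan a w e R C" shows "F + G : monspan a w e R C" proof -
 obtain f g where "f : ksp.span ((%(b, \<rho>). mons w e b * \<rho>) ` (boxes e C \<times> R))"
  "g : ksp.span ((%(b, \<rho>). mons w e b * \<rho>) ` (boxes e C \<times> R))" "F - f : a" "G - g : a" using assms(2,3) by (auto simp: monspan_def)
 moreover have "F + G - (f + g) = (F - f) + (G - g)" by simp
 ultimately show ?thesis unfolding monspan_def by (intro CollectI bexI[of _ "f + g"] ksp.span_add) (simp_all only: ideal_add[OF assms(1)])
qed

lemma monspan_Const_mult: assumes "isideal a" "F : monspan a w e R C" shows "Const c * F : monspan a w e R C" proof -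
 obtain f where "f : ksp.span ((%(b, \<rho>). mons w e b * \<rho>) ` (boxes e C \<times> R))" "F - f : a" using assms(2) by (auto simp: monspan_def)
 thus ?thesis unfolding monspan_def by (intro CollectI bexI[of _ "Const c * f"] ksp.span_scale)
   (simp_all add: ideal_mult_l[OF assms(1)] flip: right_diff_distrib)
qed

lemma monspan_sum: assumes "isideal a" "!!i. i : I ==> f i : monspan a w e R C" shows "sum f I : monspan a w e R C"
 using assms(2) by (induction I rule: infinite_finite_induct)
  (auto intro: monspan_add monspan_0 assms(1) ideal_0)

lemma monspan_base: assumes "isideal a" "!!j. j < e ==> b j <= C" "\<rho> : R" shows "mons w e b * \<rho> : monspan a w e R C" proof -
 have "mons w e b = mons w e (restrict b {..<e})" by (auto simp: mons_def)
 moreover have "restrict b {..<e} : boxes e C" using assms by (auto simp: boxes_def)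
 ultimately show ?thesis unfolding monspan_def using assms(3)
  by (intro CollectI bexI[of _ "mons w e b * \<rho>"] ksp.span_base) (auto simp: ideal_0 assms(1) image_iff intro!: bexI)
qed

lemma monspan_induct: assumes a: "isideal a" and F: "F : monspan a w e R C"
  and b: "!!b \<rho>. (!!j. j < e ==> b j <= C) ==> \<rho> : R ==> P (mons w e b * \<rho>)"
  and z: "!!F. F : a ==> P F" and ad: "!!F G. P F ==> P G ==> P (F + G)" and c: "!!c F. P F ==> P (Const c * F)" shows "P F" proof -
 obtain f where f: "f : ksp.span ((%(b, \<rho>). mons w e b * \<rho>) ` (boxes e C \<times> R))" "F - f : a" using F by (auto simp: monspan_def)
 have "P f" using f(1) proof (induction rule: ksp.span_induct_alt)
  case base show ?case by (rule z[OF ideal_0[OF a]])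
 next
  case (step c x y)
  hence "P x" using b by (auto simp: boxes_def PiE_def Pi_def)
  with step show ?case by (auto intro: ad assms(6))
 qed
 with ad z[OF f(2)] show ?thesis by (metis diff_add_cancel)
qed

lemma monspan_mons_mult: assumes a: "isideal a" and F: "F : monspan a w e R C" and b: "!!j. j < e ==> b j <= D"
 shows "mons w e b * F : monspan a w e R (C + D)" using a F proof (rule monspan_induct)
 fix b' \<rho> assume *: "!!j. j < e ==> b' j <= C" "\<rho> : R"
 have "mons w e b*(mons w e b' * \<rho>) = mons w e (%j. b j + b' j)*\<rho>" by (simp add: mons_def power_add prod.distrib mult.assoc)
 also have "... : monspan a w e R (C + D)" by (rule monspan_base[OF a]) (use * b add_mono in "fastforce simp: add.commute")+
 finally show "mons w e b*(mons w e b' * \<rho>) : monspan a w e R (C + D)" .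
next
 fix c F assume "mons w e b * F : monspan a w e R (C + D)"
 thus "mons w e b*(Const c * F) : monspan a w e R (C + D)" using monspan_Const_mult[OF a] by (simp add: mult.left_commute)
qed (auto simp: distrib_left intro: monspan_add a monspan_0 ideal_mult_l)

lemma monspan_mult: assumes a: "isideal a" and F: "F : monspan a w e R C" and G: "!!\<rho>. \<rho> : R ==> G * \<rho> : monspan a w e R D"
 shows "G * F : monspan a w e R (C + D)" using a F proof (rule monspan_induct)
 fix b \<rho> assume "!!j. j < e ==> b j <= C" "\<rho> : R"
 thus "G*(mons w e b * \<rho>) : monspan a w e R (C + D)" using monspan_mons_mult[OF a G, of \<rho> b C] by (simp add: mult.left_commute add.commute)
next
 fix c F assume "G * F : monspan a w e R (C + D)"
 thus "G*(Const c * F) : monspan a w e R (C + D)" using monspan_Const_mult[OF a, of "G * F"] by (simp add: mult.left_commute)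
qed (auto simp: distrib_left intro: monspan_add a monspan_0 ideal_mult_l)

lemma wdeg_tot_Suc: assumes "m ~= 0" shows "EX v n. m = sgl v 1 + n & wdeg tot m = Suc (wdeg tot n)" proof -
 obtain v where "lk m v ~= 0" using assms by (metis lookup_zero pm_eqI)
 hence "1 <= lk m v" by simp
 from exponent_split[OF this] obtain n where "m = n + sgl v 1" by blast
 thus ?thesis by (intro exI[of _ v] exI[of _ n]) (simp add: wdeg_add add.commute)
qed

lemma wdeg_tot_0: "wdeg tot m = 0 ==> m = 0" using wdeg_tot_Suc[of m] by auto

definition degle :: "nat => ('v, 'k::comm_ring_1) mpoly => bool" where
 "degle E F \<longleftrightarrow> (ALL m:kys F. wdeg tot m <= E)"

lemma degle_mult: "degle D F ==> degle E G ==> degle (D + E) (F*G)" unfolding degle_def proof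
 fix m assume a: "ALL m:kys F. wdeg tot m <= D" "ALL m:kys G. wdeg tot m <= E" "m : kys (F*G)"
 then obtain k l where "k : kys F" "l : kys G" "m = k + l" using keys_mult[of F G] by blast
 with a(1,2) show "wdeg tot m <= D + E" by (auto simp: wdeg_add intro: add_mono)
qed

lemma degle_1: "degle 0 1" by (auto simp: degle_def)

lemma degle_power: "degle D F ==> degle (n*D) (F^n)" by (induction n) (auto intro: degle_mult degle_1)

lemma degle_prod: "finite A ==> (!!a. a : A ==> degle (d a) (f a)) ==> degle (sum d A) (prod f A)"
 by (induction A rule: finite_induct) (auto intro: degle_mult degle_1)

lemma degle_mono: "degle D F ==> D <= E ==> degle E F" by (auto simp: degle_def)

lemma degle_ex: "EX D. degle D F" by (rule exI[of _ "SUM m:kys F. wdeg tot m"]) (auto simp: degle_def intro!: member_le_sum)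

text \<open>Each variable of a monomial costs one factor lam and raises the exponent bound by C. The
  factor lam plays the part of a common denominator: R generates the quotient over k[w] only once
  lam is inverted.\<close>

lemma growth_deg: assumes a: "isideal a" and R: "!!\<rho>. \<rho> : R ==> lam * \<rho> : monspan a w e R C"
   "!!\<rho> v. \<rho> : R ==> lam * Var v * \<rho> : monspan a w e R C" and F: "degle E F" and \<rho>: "\<rho> : R"
 shows "lam^E*F * \<rho> : monspan a w e R (E*C)" proof -
 have m: "lam^E*mev Var m * \<rho> : monspan a w e R (E*C)" if "wdeg tot m <= E" for m E using that proof (induction E arbitrary: m)
  case 0
  hence "m = 0" using wdeg_tot_0 by simp
  thus ?case using monspan_base[OF a, of e "%_. 0" 0 \<rho> R w] \<rho> by (simp add: mons_def)
 next
  case (Suc E)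
  show ?case proof (cases "wdeg tot m <= E")
   case True
   have "lam*(lam^E*mev Var m * \<rho>) : monspan a w e R (E*C + C)" using Suc.IH[OF True] R(1) by (intro monspan_mult a)
   thus ?thesis by (simp add: algebra_simps)
  next
   case False
   hence "m ~= 0" by auto
   then obtain v n where n: "m = sgl v 1 + n" "wdeg tot m = Suc (wdeg tot n)" using wdeg_tot_Suc by blast
   have "(lam*Var v)*(lam^E*mev Var n * \<rho>) : monspan a w e R (E*C + C)" using Suc.IH[of n] Suc.prems n R(2) by (intro monspan_mult a) auto
   thus ?thesis by (simp add: n(1) mev_add algebra_simps)
  qed
 qed
 have "lam^E*F * \<rho> = (SUM m:kys F. Const (lk F m)*(lam^E*mev Var m * \<rho>))" by (subst mpoly_expand[of F])
   (simp add: single_eq_prod sum_distrib_left sum_distrib_right algebra_simps)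
 also have "... : monspan a w e R (E*C)" using F by (intro monspan_sum monspan_Const_mult a m) (auto simp: degle_def)
 finally show ?thesis .
qed

lemma growth_nat: "EX M>0. K*(Suc (D*M))^e < (M::nat)^Suc e" proof (intro exI[of _ "Suc (K*Suc D^e)"] conjI)
 let ?M = "Suc (K*Suc D^e)"
 have "Suc (D * ?M) <= Suc D * ?M" by simp
 hence "K*(Suc (D * ?M))^e <= K*(Suc D * ?M)^e" by (intro mult_le_mono2 power_mono) auto
 also have "... = (K*Suc D^e) * ?M^e" by (simp only: power_mult_distrib mult.assoc)
 also have "... < ?M * ?M^e" by (intro mult_strict_right_mono) auto
 finally show "K*(Suc (D * ?M))^e < ?M^Suc e" by (simp only: power_Suc)
qed simp

text \<open>A polynomial count: the products of powers below \<open>M\<close> of \<open>r\<close> independent elements give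
  \<open>M ^ r\<close> linearly independent elements, while the span they lie in has dimension \<open>O(M ^ e)\<close>.\<close>

lemma growth: fixes a :: "('v, 'k::field) mpoly set" assumes a: "isideal a" and lam: "!!F. lam * F : a ==> F : a" and fR: "finite R" and R1: "1 : R"
  and R: "!!\<rho>. \<rho> : R ==> lam * \<rho> : monspan a w e R C"
   "!!\<rho> v. \<rho> : R ==> lam * Var v * \<rho> : monspan a w e R C" shows "dimle a e" unfolding dimle_def proof (intro allI impI, rule ccontr)
 fix r t assume i: "indep a r t" and "~ r <= e"
 hence i: "indep a (Suc e) t" by (auto intro: indep_less)
 have lamp: "lam^n*F : a ==> F : a" for n F by (induction n) (auto simp: mult.assoc intro: lam)
 have "EX D. ALL j<Suc e. degle D (t j)" proof -
  have "ALL j. EX D. degle D (t j)" using degle_ex by blast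
  then obtain D where D: "!!j. degle (D j) (t j)" unfolding choice_iff by blast
  hence "!!j. j < Suc e ==> degle (SUM j<Suc e. D j) (t j)" by (rule degle_mono) (intro member_le_sum, auto)
  thus ?thesis by blast
 qed
 then obtain D where D: "!!j. j < Suc e ==> degle D (t j)" by blast
 \<comment> \<open>The bound E on degrees is proportional to M, so the span has dimension of order
   M^e, which is smaller than M^(e+1) for this M.\<close>
 obtain M where M: "card R*(Suc ((Suc e * D * C)*M))^e < M^Suc e" "M > 0" using growth_nat[of "card R" "Suc e * D * C" e] by blast
 \<comment> \<open>A product of e + 1 powers, with exponents below M, of elements of degree at most
   D has degree at most E.\<close>
 define E where "E = Suc e*(M*D)"
 define J where "J = boxes (Suc e) (M - 1)"
 have bM: "b j <= M" if "b : J" "j < Suc e" for b j proof -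
  have "b j <= M - 1" using that by (auto simp: J_def boxes_def PiE_def Pi_def)
  thus ?thesis by simp
 qed
 have dg: "degle E (mons t (Suc e) b)" if "b : J" for b proof -
  have "degle (SUM j<Suc e. b j * D) (mons t (Suc e) b)" unfolding mons_def by (intro degle_prod degle_power D) auto
  moreover have "(SUM j<Suc e. b j * D) <= (SUM j<Suc e. M * D)" by (intro sum_mono mult_right_mono bM that) auto
  ultimately show ?thesis by (auto simp: E_def intro: degle_mono)
 qed
 have "card J <= card ((%(b, \<rho>). mons w e b * \<rho>) ` (boxes e (E*C) \<times> R))"
 proof (rule independent_mod_bound[OF _ _ a, of _ _ "%b. lam^E*mons t (Suc e) b"])
  show "finite J" "finite ((%(b, \<rho>). mons w e b * \<rho>) ` (boxes e (E*C) \<times> R))" using fR by (auto simp: J_def finite_boxes)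
  show "EX g:ksp.span ((%(b, \<rho>). mons w e b * \<rho>) ` (boxes e (E*C) \<times> R)). lam^E*mons t (Suc e) b - g : a"
   if "b : J" for b using growth_deg[OF a R dg[OF that] R1] by (simp add: monspan_def)
  fix c assume "(SUM b:J. Const (c b)*(lam^E*mons t (Suc e) b)) : a"
  hence "lam^E*(SUM b:J. Const (c b)*mons t (Suc e) b) : a" by (simp add: sum_distrib_left mult.left_commute)
  hence s: "(SUM b:J. Const (c b)*mons t (Suc e) b) : a" by (rule lamp)
  define ex where "ex = (%b. Abs_poly_mapping (%j. if j < Suc e then b j else (0::nat)))"
  have lex: "lk (ex b) j = (if j < Suc e then b j else 0)" for b j unfolding ex_def by (subst lookup_Abs_poly_mapping) auto
  have kex: "kys (ex b) <= {..<Suc e}" for b by (auto simp: in_keys_iff lex split: if_splits)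
  have mex: "mev t (ex b) = mons t (Suc e) b" for b by (simp add: mev_superset[OF _ kex] lex mons_def)
  have inj: "inj_on ex J" proof (rule inj_onI)
   fix b b' assume *: "b : J" "b' : J" "ex b = ex b'"
   show "b = b'" proof
    fix j
    have "(if j < Suc e then b j else 0) = (if j < Suc e then b' j else 0)" using arg_cong[OF *(3), of "%m. lk m j"] by (simp only: lex)
    thus "b j = b' j" using *(1,2) by (cases "j < Suc e") (auto simp: J_def boxes_def PiE_def extensional_def)
   qed
  qed
  define F where "F = (SUM b:J. sgl (ex b) (c b))"
  have fJ: "finite J" by (simp add: J_def finite_boxes)
  have lF: "lk F (ex b) = c b" if "b : J" for b proof -
   have "lk F (ex b) = (SUM b':J. if b' = b then c b' else 0)" unfolding F_def lookup_sum lookup_single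
    by (intro sum.cong refl) (use inj that in "auto simp: when_def inj_on_def")
   thus ?thesis using that fJ by simp
  qed
  have "vin {..<Suc e} F" unfolding vin_def proof
   fix m assume "m : kys F"
   then obtain b where "m = ex b" unfolding F_def in_keys_iff lookup_sum lookup_single by (metis (mono_tags, lifting) sum.neutral when_def)
   thus "kys m <= {..<Suc e}" using kex by simp
  qed
  moreover have "ev Const t F = (SUM b:J. Const (c b)*mons t (Suc e) b)" by (simp add: F_def ev_sum ev_single rhom_Const Const_simps mex)
  ultimately have "F = 0" using i s by (simp add: indep_def)
  thus "ALL b:J. c b = 0" using lF by force
 qed
 also have "... <= card (boxes e (E*C) \<times> R)" by (rule card_image_le) (auto simp: fR finite_boxes)
 also have "... = card R*(Suc ((Suc e * D * C)*M))^e" by (simp only: card_cartesian_product card_boxes E_def mult_ac)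
 also note M(1)
 finally show False using M(2) by (simp add: J_def card_boxes)
qed

lemma mons_delta: "j < e ==> mons w e (%i. if i = j then 1 else 0) = w j" by (simp add: mons_def if_distrib[of "%k. w _^k"] cong: if_cong)

lemma monspan_mono: "isideal a ==> F : monspan a w e R C ==> C <= D ==> F : monspan a w e R D"
 using monspan_mons_mult[of a F w e R C "%_. 0" "D - C"] by (simp add: mons_def)

section \<open>Homogeneous parameters\<close>

lemma finite_bounded_exponents: "finite {m :: 'v::finite \<Rightarrow>\<^sub>0 nat. ALL v. lk m v <= M}"
proof (rule inj_on_finite[of lk _ "UNIV \<rightarrow>\<^sub>E {..M}"])
 show "finite ((UNIV :: 'v set) \<rightarrow>\<^sub>E {..M})" by (rule finite_PiE) auto
qed (auto simp: inj_on_def intro: pm_eqI)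

lemma uniform_power: assumes "isideal a" "!!v :: 'v::finite. x v : rad a" shows "EX M>0. ALL v. x v^M : a" proof -
 obtain N where N: "!!v. x v^N v : a" using assms(2) unfolding rad_def by (auto intro: that) metis
 have "x v^Suc (SUM v:UNIV. N v) : a" for v proof -
  have "N v <= Suc (SUM v:UNIV. N v)" by (auto intro!: le_SucI member_le_sum)
  hence "x v^Suc (SUM v:UNIV. N v) = x v^(Suc (SUM v:UNIV. N v) - N v)*x v^N v" by (metis le_add_diff_inverse2 power_add)
  thus ?thesis using N assms(1) by (metis ideal_mult_l)
 qed
 thus ?thesis by blast
qed

text \<open>Homogeneous parameters: forms of positive degree that together with a cut out at most
  the origin. The number e may be any such number, minimal or not.\<close>

definition sop :: "('v::finite, 'k::field) mpoly set => nat => (nat => ('v, 'k) mpoly) => bool" where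
 "sop a e y \<longleftrightarrow> (ALL j<e. EX d>0. y j : homg tot d) & (ALL v. Var v : rad (igen (a Un y ` {..<e})))"

text \<open>By the graded Nakayama argument, monomials with bounded exponents generate the quotient
  as a module over k[y], so \<open>growth\<close> applies with lam = 1.\<close>

lemma sop_dimle: fixes a :: "('v::finite, 'k::field) mpoly set" assumes a: "hideal tot a" and s: "sop a e y" shows "dimle a e" proof -
 have ia: "isideal a" using a by (simp add: hideal_def)
 obtain dg where dg: "!!j. j < e ==> dg j > 0 & y j : homg tot (dg j)" using s unfolding sop_def by metis
 obtain M where M: "M > 0" "!!v. Var v^M : igen (a Un y ` {..<e})"
  using uniform_power[OF isideal_igen, of Var "a Un y ` {..<e}"] s by (auto simp: sop_def)
 \<comment> \<open>Taking components of degree M makes each coefficient c j a form of complementary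
   degree; replacing \<open>Var v^M\<close> then reduces a monomial to forms of smaller
   degree.\<close>
 have V: "EX \<alpha>:a. EX c. (ALL j<e. c j : homg tot (M - dg j) & (dg j > M --> c j = 0)) & Var v^M = \<alpha> + (SUM j<e. c j * y j)" for v
 proof -
  obtain \<alpha> \<beta> where ab: "Var v^M = \<alpha> + \<beta>" "\<alpha> : igen a" "\<beta> : igen (y ` {..<e})"
   using M(2)[of v] unfolding idl.span_Un by auto
  then obtain c where c: "\<beta> = (SUM j<e. c j * y j)" using igen_image[of "{..<e}" \<beta> y] by auto
  have "Var v^M = hcomp tot M (Var v^M)" using hcomp_of_homg[OF homg_power[OF homg_Var[of v tot], of M], of M] by (metis mult_1_right)
  also have "... = hcomp tot M \<alpha> + (SUM j<e. hcomp tot M (y j * c j))" by (simp add: ab c hcomp_add hcomp_sum mult.commute)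
  also have "(SUM j<e. hcomp tot M (y j * c j)) = (SUM j<e. (if dg j <= M then hcomp tot (M - dg j) (c j) else 0)*y j)"
   by (intro sum.cong refl, subst hcomp_mult_homg) (use dg in "auto simp: mult.commute")
  finally show ?thesis using ab a by (intro bexI[of _ "hcomp tot M \<alpha>"] exI[of _ "%j. if dg j <= M then hcomp tot (M - dg j) (c j) else 0"])
    (auto simp: hideal_def igen_ideal)
 qed
 define R :: "('v, 'k) mpoly set" where "R = mev Var ` {m. ALL v. lk m v <= M}"
 have "finite R" unfolding R_def by (intro finite_imageI finite_bounded_exponents)
 have "1 : R" unfolding R_def by (auto intro!: image_eqI[of _ _ 0])
 have F: "F : monspan a y e R d" if "F : homg tot d" for F d using that proof (induction d arbitrary: F rule: less_induct)
  case (less d)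
  have "mev Var m : monspan a y e R d" if m: "wdeg tot m = d" for m proof (cases "ALL v. lk m v <= M")
   case True
   thus ?thesis using monspan_base[OF ia, of e "%_. 0" d "mev Var m" R y] by (auto simp: R_def mons_def)
  next
   case False
   then obtain v where "M <= lk m v" by (meson nat_le_linear)
   from exponent_split[OF this] obtain l where l: "m = l + sgl v M" by blast
   hence d: "d = wdeg tot l + M" using m by (simp add: wdeg_add)
   from V[of v] obtain \<alpha> c where c0: "\<alpha> : a" "ALL j<e. c j : homg tot (M - dg j) & (dg j > M --> c j = 0)"
    "Var v^M = \<alpha> + (SUM j<e. c j * y j)" by blast
   have c: "\<alpha> : a" "!!j. j < e ==> c j : homg tot (M - dg j) & (dg j > M --> c j = 0)"
    "Var v^M = \<alpha> + (SUM j<e. c j * y j)" using c0 by simp_all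
   have "mev Var m = mev Var l * \<alpha> + (SUM j<e. y j*(mev Var l * c j))" by (simp add: l mev_add c distrib_left sum_distrib_left algebra_simps)
   also have "... : monspan a y e R d" proof (intro monspan_add ia monspan_sum)
    show "mev Var l * \<alpha> : monspan a y e R d" using c by (intro monspan_0 ia ideal_mult_l)
    fix j assume "j : {..<e}"
    hence j: "j < e" by simp
    show "y j*(mev Var l * c j) : monspan a y e R d" proof (cases "dg j <= M")
     case True
     have ml: "(mev Var l :: ('v, 'k) mpoly) : homg tot (wdeg tot l)" using homg_single[of l "1::'k" tot] by (simp add: single_eq_prod Const_simps)
     have "mev Var l * c j : homg tot (d - dg j)" using homg_mult[OF ml, of "c j" "M - dg j"] c(2)[OF j] True d by simp
     hence "mev Var l * c j : monspan a y e R (d - dg j)" by (rule less.IH[rotated]) (use True dg[OF j] d M in auto)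
     from monspan_mons_mult[OF ia this, of "%i. if i = j then 1 else 0" 1]
     have "y j*(mev Var l * c j) : monspan a y e R (d - dg j + 1)" by (simp add: mons_delta j del: One_nat_def)
     thus ?thesis by (rule monspan_mono[OF ia]) (use True dg[OF j] d in auto)
    qed (use c(2)[OF j] in "simp add: monspan_0 ia ideal_0")
   qed
   finally show ?thesis .
  qed
  hence "(SUM m:kys F. Const (lk F m)*mev Var m) : monspan a y e R d"
   using less.prems by (intro monspan_sum monspan_Const_mult ia) (auto simp: homg_def)
  thus ?case by (subst mpoly_expand) (simp add: single_eq_prod)
 qed
 \<comment> \<open>A member of R has degree at most \<open>CARD('v)*M\<close>, and multiplication by
   1 or a variable adds at most one.\<close>
 have R2: "G * \<rho> : monspan a y e R (1 + CARD('v)*M)" if rG: "\<rho> : R" "EX d<=1. G : homg tot d" for \<rho> G proof -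
  obtain m where m: "\<rho> = mev Var m" "ALL v. lk m v <= M" using rG by (auto simp: R_def)
  obtain d where d: "G : homg tot d" "d <= 1" using rG by auto
  have "wdeg tot m = (SUM v:UNIV. lk m v)" by (subst wdeg_superset[of UNIV]) auto
  also have "... <= (SUM v:(UNIV::'v set). M)" by (rule sum_mono) (use m in auto)
  finally have "wdeg tot m <= CARD('v)*M" by simp
  moreover have "G * \<rho> : homg tot (d + wdeg tot m)"
   using homg_mult[OF d(1) homg_single[of m "1::'k" tot]] by (simp add: m single_eq_prod Const_simps)
  ultimately show ?thesis using F monspan_mono[OF ia] d by (meson add_mono)
 qed
 have "(Var v :: ('v, 'k) mpoly) : homg tot 1" for v using homg_Var[of v tot] by simp
 hence "Var v * \<rho> : monspan a y e R (1 + CARD('v)*M)" if "\<rho> : R" for v \<rho> using R2[OF that] by blast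
 moreover have "1 * \<rho> : monspan a y e R (1 + CARD('v)*M)" if "\<rho> : R" for \<rho> by (rule R2[OF that]) (blast intro: homg_1)
 ultimately show ?thesis by (intro growth[OF ia _ `finite R` `1 : R`, of 1 y e "1 + CARD('v)*M"]) simp_all
qed

lemma sop_vars: obtains y where "sop {0::('v::finite, 'k::field) mpoly} (CARD('v)) y" "!!j. j < CARD('v) ==> y j : homg tot 1"
  "!!v. Var v : y ` {..<CARD('v)}" proof -
 obtain g where g: "bij_betw g {..<CARD('v)} (UNIV :: 'v set)" using ex_bij_betw_nat_finite[of "UNIV :: 'v set"] by (auto simp: atLeast0LessThan)
 have v: "Var v : (%j. Var (g j)) ` {..<CARD('v)}" for v :: 'v proof -
  obtain j where "j < CARD('v)" "g j = v" using g by (metis bij_betw_def imageE lessThan_iff UNIV_I)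
  thus ?thesis by auto
 qed
 have "Var v : rad (igen ({0} Un (%j. Var (g j)) ` {..<CARD('v)}))" for v :: 'v by (rule gen_in_rad) (use v[of v] in auto)
 moreover have "EX d>0. Var (g j) : homg (tot :: 'v => nat) d" for j using homg_Var[of "g j" tot] by blast
 ultimately have s: "sop {0::('v, 'k) mpoly} (CARD('v)) (%j. Var (g j))" unfolding sop_def by blast
 show ?thesis by (rule that[OF s homg_Var v])
qed

lemma hideal_0: "hideal wt {0}" by (simp add: hideal_def)

lemma dimle_0: "dimle ({0} :: ('v::finite, 'k::field) mpoly set) (CARD('v))" by (rule sop_vars) (rule sop_dimle[OF hideal_0])

lemma dimle_prime_nonzero: assumes "isprime (p :: ('v::finite, 'k::field) mpoly set)" "g : p" "g ~= 0" shows "dimle p (CARD('v) - 1)"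
 unfolding dimle_def proof (intro allI impI)
 fix r t assume "indep p r t"
 hence "indep {0} (Suc r) (t(r := g))" using assms by (intro indep_strict[of _ p] prime_zero isprime_ideal) (auto simp: ideal_0 isprime_ideal)
 thus "r <= CARD('v) - 1" using dimle_0 unfolding dimle_def by fastforce
qed

subsection \<open>Noether normalization by linear forms\<close>

lemma ev_homg_linear: assumes y: "!!j. j : V ==> y j : homg tot 1" and F: "vin V F" shows "hcomp tot d (ev Const y F) = ev Const y (hcomp tot d F)"
proof -
 have "Const (lk F m)*mev y m : homg tot (wdeg tot m)" if "m : kys F" for m proof -
  have "mev y m : homg tot (SUM i:kys m. lk m i * 1)" unfolding mev_def by (intro homg_prod homg_power y) (use F that in "auto simp: vin_def")
  thus ?thesis by (simp add: wdeg_def homg_Const_mult)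
 qed
 hence "hcomp tot d (ev Const y F) = (SUM m:kys F. if d = wdeg tot m then Const (lk F m)*mev y m else 0)"
  unfolding ev_def hcomp_sum by (intro sum.cong refl hcomp_of_homg)
 also have "... = ev Const y (hcomp tot d F)"
  by (subst ev_superset[of _ "kys F"]) (auto simp: lookup_hcomp in_keys_iff Const_simps intro!: sum.cong split: if_splits)
 finally show ?thesis .
qed

lemma ev_homg_scale: assumes h: "rhom h" and F: "F : homg tot D" shows "ev h (%j. c j * z) F = ev h c F * z^D" proof -
 have "mev (%j. c j * z) m = mev c m * z^wdeg tot m" for m by (simp add: mev_def power_mult_distrib prod.distrib wdeg_def power_sum)
 thus ?thesis using F by (simp add: ev_def sum_distrib_right homg_def mult.assoc)
qed

lemma ev_ideal_cong: assumes a: "isideal a" and v: "!!j. j : V ==> v j - w j : a" and F: "vin V F" shows "ev Const v F - ev Const w F : a" proof -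
 have pw: "x^n - y^n : a" if "x - y : a" for x y n using that a by (simp add: power_diff_sumr2 ideal_mult_r)
 have pr: "prod f K - prod g K : a" if "!!i. i : K ==> f i - g i : a" for f g K using that proof (induction K rule: infinite_finite_induct)
  case (insert x K)
  have "prod f (insert x K) - prod g (insert x K) = (f x - g x)*prod f K + g x*(prod f K - prod g K)" using insert by (simp add: algebra_simps)
  also have "... : a" using insert by (intro ideal_add[OF a] ideal_mult_r[OF a] ideal_mult_l[OF a]) auto
  finally show ?case .
 qed (auto simp: a ideal_0)
 have "ev Const v F - ev Const w F = (SUM m:kys F. Const (lk F m)*(mev v m - mev w m))" by (simp add: ev_def sum_subtractf right_diff_distrib)
 also have "... : a" unfolding mev_def by (intro ideal_sum[OF a] ideal_mult_l[OF a] pr pw v) (use F in "auto simp: vin_def")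
 finally show ?thesis .
qed

text \<open>Take a homogeneous relation w = F(y) in b and a point c with F(c) and c_i nonzero. The
  new forms are y_j - (c_j/c_i) y_i; modulo them F(y) equals F(c) (y_i/c_i)^D, so modulo them and w
  the form y_i is nilpotent.\<close>

lemma noether_step: fixes y :: "nat => ('v, 'k::field) mpoly"
 assumes k: "infinite (UNIV :: 'k set)" and b: "hideal tot b" "1 ~: b" and y: "!!j. j < e ==> y j : homg tot 1" and d: "~ indep b e y"
 shows "e > 0 & (EX w:b. EX y'. (EX D. w : homg tot D) & (ALL j<e - 1. y' j : homg tot 1) &
  (ALL j<e. y j : rad (igen (insert w (y' ` {..<e - 1})))))" proof -
 obtain F0 where F0: "vin {..<e} F0" "ev Const y F0 : b" "F0 ~= 0" using d by (auto simp: indep_def)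
 then obtain D where D: "hcomp tot D F0 ~= 0" using hcomp_eqI[of tot F0 0] by auto
 define F where "F = hcomp tot D F0"
 have Fv: "vin {..<e} F" unfolding F_def by (rule vin_hcomp[OF F0(1)])
 have Fh: "F : homg tot D" by (simp add: F_def)
 have Fb: "ev Const y F : b" unfolding F_def using ev_homg_linear[of "{..<e}" y F0 D, OF _ F0(1)] F0(2) y b(1)
  unfolding hideal_def by (metis lessThan_iff)
 have b1: "isideal b" using b by (simp add: hideal_def)
 \<comment> \<open>A relation of degree 0 would be a nonzero constant in b.\<close>
 have D0: "D > 0" proof (rule ccontr)
  assume "~ ?thesis"
  hence "!!m. m ~= 0 ==> lk F m = 0" using Fh wdeg_tot_0 by (auto simp: homg_iff)
  hence "F = Const (lk F 0)" by (intro pm_eqI) (auto simp: Const_def lookup_single when_def)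
  then obtain c where c: "F = Const c" by blast
  with D have "c ~= 0" by (auto simp: F_def)
  hence "Const (inverse c)*ev Const y F = 1" using Const_inverse[of c 1] by (simp add: c ev_Const rhom_Const)
  with ideal_mult_l[OF b1 Fb] b(2) show False by metis
 qed
 obtain c where c: "ev (%x. x) c F ~= 0" using mpoly_nonvanishing[OF k, of F] D by (auto simp: F_def)
 have "EX i<e. c i ~= 0" proof (rule ccontr)
  assume "~ ?thesis"
  hence "ev (%x. x) c F = ev (%x. x) (%i. c i * 0) F" by (intro ev_cong) (use Fv in "auto simp: vin_def")
  also have "... = 0" using D0 by (simp only: ev_homg_scale[OF rhom_id Fh]) simp
  finally show False using c by simp
 qed
 then obtain i where i: "i < e" "c i ~= 0" by blast
 \<comment> \<open>s enumerates the indices other than i.\<close>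
 define s where "s = (%j. if j < i then j else Suc j)"
 define y' where "y' = (%j. y (s j) - Const (c (s j) / c i)*y i)"
 have sj: "s j < e" if "j < e - 1" for j using that by (auto simp: s_def)
 have sx: "EX l<e - 1. s l = j" if "j < e" "j ~= i" for j using that i by (intro exI[of _ "if j < i then j else j - 1"]) (auto simp: s_def)
 let ?I = "igen (insert (ev Const y F) (y' ` {..<e - 1}))"
 have yy: "y j - Const (c j / c i)*y i : ?I" if "j < e" for j proof (cases "j = i")
  case True thus ?thesis using i by (simp add: Const_simps idl.span_zero)
 next
  case False
  with sx[OF `j < e`] obtain l where "l < e - 1" "s l = j" by blast
  thus ?thesis by (intro igen_base) (auto simp: y'_def)
 qed
 have "ev Const y F - ev Const (%j. Const (c j / c i)*y i) F : ?I" by (rule ev_ideal_cong[OF _ _ Fv]) (use yy in auto)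
 hence "ev Const (%j. Const (c j / c i)*y i) F : ?I" using ideal_mem_cong[OF isideal_igen] igen_base[of "ev Const y F"] by blast
 also have "ev Const (%j. Const (c j / c i)*y i) F = ev Const (%j. Const (c j / c i)) F * y i^D" by (rule ev_homg_scale[OF rhom_Const Fh])
 also have "ev Const (%j. Const (c j / c i)) F = Const (ev (%x. x) (%j. c j * inverse (c i)) F)"
  by (simp add: ev_comp[OF rhom_Const rhom_id] divide_inverse)
 also have "ev (%x. x) (%j. c j * inverse (c i)) F = ev (%x. x) c F * inverse (c i)^D" by (rule ev_homg_scale[OF rhom_id Fh])
 finally have *: "Const (ev (%x. x) c F * inverse (c i)^D)*y i^D : ?I" .
 have "Const (inverse (ev (%x. x) c F * inverse (c i)^D))*(Const (ev (%x. x) c F * inverse (c i)^D)*y i^D) : ?I" by (rule idl.span_scale[OF *])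
 moreover have "Const (inverse (ev (%x. x) c F * inverse (c i)^D))*(Const (ev (%x. x) c F * inverse (c i)^D)*y i^D) = y i^D"
  by (rule Const_inverse) (use c i in simp)
 ultimately have yi: "y i : rad ?I" by (auto simp: rad_def)
 have "y j : rad ?I" if "j < e" for j proof -
  have "y j - Const (c j / c i)*y i : rad ?I" using yy[OF that] rad_superset[of ?I] by blast
  from ideal_add[OF rad_ideal[OF isideal_igen] this ideal_mult_l[OF rad_ideal[OF isideal_igen] yi, where r = "Const (c j / c i)"]]
  show ?thesis by simp
 qed
 moreover have "y' j : homg tot 1" if "j < e - 1" for j using that i sj unfolding y'_def by (intro homg_diff homg_Const_mult y) auto
 moreover have "ev Const y F : homg tot D" proof -
  have "hcomp tot D (ev Const y F) = ev Const y (hcomp tot D F)" by (rule ev_homg_linear[OF _ Fv]) (use y in auto)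
  hence eq: "hcomp tot D (ev Const y F) = ev Const y F" by (simp only: hcomp_of_homg[OF Fh] refl if_True)
  show ?thesis by (subst eq[symmetric]) (rule hcomp_homg)
 qed
 ultimately show ?thesis using Fb i by (intro conjI bexI[of _ "ev Const y F"] exI[of _ y'] exI[of _ D] allI impI) simp_all
qed

lemma sop_linear_step: fixes y :: "nat => ('v::finite, 'k::field) mpoly"
 assumes k: "infinite (UNIV :: 'k set)" and b: "hideal tot b" "1 ~: b" and y: "!!j. j < e ==> y j : homg tot 1"
  and d: "~ indep b e y" and s: "sop a e y"
 shows "e > 0 & (EX w:b. EX y'. (EX D. w : homg tot D) & (ALL j<e - 1. y' j : homg tot 1) & sop (insert w a) (e - 1) y')" proof -
 obtain w y' where w: "e > 0" "w : b" "EX D. w : homg tot D" "ALL j<e - 1. y' j : homg tot 1"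
  "ALL j<e. y j : rad (igen (insert w (y' ` {..<e - 1})))" using noether_step[OF k b y d] by blast
 let ?Y = "insert w a Un y' ` {..<e - 1}"
 have "igen (insert w (y' ` {..<e - 1})) <= igen ?Y" by (rule igen_mono) auto
 hence "y j : rad (igen ?Y)" if "j < e" for j using w(5) that by (fastforce simp: rad_def)
 moreover have "a <= rad (igen ?Y)" using subset_trans[OF idl.span_superset rad_superset, of ?Y] by auto
 ultimately have "igen (a Un y ` {..<e}) <= rad (igen ?Y)" by (intro igen_subset_rad) auto
 hence "Var v : rad (rad (igen ?Y))" for v using s by (fastforce simp: sop_def rad_def)
 hence "sop (insert w a) (e - 1) y'" using w(4) rad_rad by (auto simp: sop_def intro!: exI[of _ 1])
 with w show ?thesis by blast
qed

text \<open>Take linear parameters of least number e; a relation among them would let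
  \<open>sop_linear_step\<close> shorten the list.\<close>

theorem noether_normalization:
 fixes a :: "('v::finite, 'k::field) mpoly set" assumes k: "infinite (UNIV :: 'k set)" and a: "hideal tot a" "1 ~: a"
 shows "EX e y. (ALL j<e. y j : homg tot 1) & indep a e y & sop a e y" proof -
 define P where "P = (%e. EX y. (ALL j<e. y j : homg tot 1) & sop a e y)"
 have "P (CARD('v))" proof (rule sop_vars)
  fix y assume y: "sop {0::('v, 'k) mpoly} (CARD('v)) y" "!!j. j < CARD('v) ==> y j : homg tot 1"
  have "igen ({0} Un y ` {..<CARD('v)}) <= igen (a Un y ` {..<CARD('v)})" using a by (intro igen_mono) (auto simp: hideal_def ideal_0)
  hence "sop a (CARD('v)) y" using y(1) by (fastforce simp: sop_def rad_def)
  with y(2) show ?thesis unfolding P_def by blast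
 qed
 define e where "e = (LEAST e. P e)"
 have "P e" unfolding e_def by (rule LeastI) fact
 then obtain y where y: "!!j. j < e ==> y j : homg tot 1" "sop a e y" unfolding P_def by blast
 have "indep a e y" proof (rule ccontr)
  assume "~ ?thesis"
  then obtain w y' where w: "e > 0" "w : a" "ALL j<e - 1. y' j : homg tot 1" "sop (insert w a) (e - 1) y'"
   using sop_linear_step[OF k a y(1) _ y(2)] by blast
  hence "P (e - 1)" unfolding P_def by (auto simp: insert_absorb)
  hence "e <= e - 1" unfolding e_def by (rule Least_le)
  with w(1) show False by simp
 qed
 with y show ?thesis by blast
qed

lemma sop_1: "1 : a ==> sop a 0 y" using ideal_mult_l[OF isideal_igen igen_base[of 1 a]] by (force simp: sop_def rad_def)

lemma dimle_sop: fixes a :: "('v::finite, 'k::field) mpoly set" assumes k: "infinite (UNIV :: 'k set)" and a: "hideal tot a" "dimle a e"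
 shows "EX e' y. e' <= e & sop a e' y & (ALL j<e'. y j : homg tot 1)" proof (cases "1 : a")
 case True thus ?thesis using sop_1 by (intro exI[of _ 0]) auto
next
 case False
 thus ?thesis using noether_normalization[OF k a(1)] a(2) unfolding dimle_def by metis
qed

text \<open>Parameters modulo a and g, together with g itself, are parameters modulo a.\<close>

lemma dimle_insert: fixes a :: "('v::finite, 'k::field) mpoly set" assumes k: "infinite (UNIV :: 'k set)" and a: "hideal tot a" and g: "g : homg tot d" "d > 0"
  and dim: "dimle (igen (insert g a)) e" shows "dimle a (Suc e)" proof -
 obtain e' y where y: "e' <= e" "sop (igen (insert g a)) e' y" using dimle_sop[OF k hideal_insert[OF a g(1)] dim] by blast
 define z where "z = y(e' := g)"
 have "a Un z ` {..<Suc e'} = insert g a Un y ` {..<e'}" by (auto simp: z_def less_Suc_eq image_iff)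
 moreover have "igen (insert g a Un y ` {..<e'}) = igen (igen (insert g a) Un y ` {..<e'})" unfolding idl.span_Un by (simp only: idl.span_span)
 ultimately have "sop a (Suc e') z" using y(2) g by (auto simp: sop_def z_def less_Suc_eq)
 thus ?thesis using sop_dimle[OF a] y(1) unfolding dimle_def by fastforce
qed

text \<open>This takes the place of prime avoidance. If a has e + 1 linear parameters, they are
  dependent modulo b, and the relation is a form w of b that lowers the dimension of a; if a already
  has at most e parameters, w = 0 serves.\<close>

lemma generic_element: fixes a :: "('v::finite, 'k::field) mpoly set" assumes k: "infinite (UNIV :: 'k set)" and a: "hideal tot a" "dimle a (Suc e)"
  and b: "hideal tot b" "dimle b e" shows "EX w:b. (EX D. w : homg tot D) & (EX e' y. e' <= e & sop (insert w a) e' y & (ALL j<e'. y j : homg tot 1))"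
proof (cases "1 : b")
 case True
 thus ?thesis by (intro bexI[of _ 1] conjI exI[of _ 0] exI[of _ "%_. 0"] sop_1) (auto intro: homg_1)
next
 case False
 obtain e' y where y: "e' <= Suc e" "sop a e' y" "ALL j<e'. y j : homg tot 1" using dimle_sop[OF k a] by blast
 show ?thesis proof (cases "e' <= e")
  case True
  have "0 : b" "(0 :: ('v, 'k) mpoly) : homg tot 0" "0 : a" using b a by (auto simp: hideal_def ideal_0)
  with True y show ?thesis by (metis insert_absorb)
 next
  case False
  hence "~ indep b e' y" using b by (auto simp: dimle_def)
  from sop_linear_step[OF k b(1) `1 ~: b` _ this y(2)] y(3,1)
  show ?thesis by (metis le_diff_conv plus_1_eq_Suc add.commute)
 qed
qed

section \<open>Exterior algebra and Koszul complexes\<close>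

text \<open>An element \<open>w\<close> of the exterior algebra on \<open>e\<^sub>0, e\<^sub>1, \<dots>\<close> is given by its coefficients \<open>w I\<close>.
  \<open>wed k\<close> is exterior multiplication by \<open>e\<^sub>k\<close> and \<open>ctr k\<close> is the contraction against it.\<close>

definition sg :: "nat => nat set => 'a::comm_ring_1" where
 "sg k I = (- 1)^card {i : I. i < k}"

definition wed :: "nat => (nat set => 'a::comm_ring_1) => nat set => 'a" where
 "wed k w = (%I. if k : I then sg k I * w (I - {k}) else 0)"

definition ctr :: "nat => (nat set => 'a::comm_ring_1) => nat set => 'a" where
 "ctr k w = (%I. if k : I then 0 else sg k I * w (insert k I))"

definition Wed :: "nat => (nat => 'a::comm_ring_1) => (nat set => 'a) => nat set => 'a" where
 "Wed n u w = (%I. SUM k<n. u k * wed k w I)"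

definition Ctr :: "nat => (nat => 'a::comm_ring_1) => (nat set => 'a) => nat set => 'a" where
 "Ctr n v w = (%I. SUM k<n. v k * ctr k w I)"

definition sc :: "'a::comm_ring_1 => ('b => 'a) => 'b => 'a" where
 "sc r w = (%I. r * w I)"

lemma sg_sg: "sg k I * sg k I = 1" "sg k I*(sg k I * x) = x" by (simp_all add: sg_def flip: power_mult_distrib mult.assoc)

lemma sg_self: "sg k {k} = 1" proof -
 have "{i : {k}. i < k} = {}" by auto
 thus ?thesis by (simp only: sg_def card.empty power_0)
qed

lemma sg_less: "j <= k ==> sg j (insert k I) = sg j I" "j <= k ==> sg j (I - {k}) = sg j I"
 unfolding sg_def by (intro arg_cong[of _ _ "%S. (- 1)^card S"]; auto)+

lemma sg_greater: assumes "k < j" shows "k ~: I ==> sg j (insert k I) = - sg j I" "k : I ==> sg j (I - {k}) = - sg j I" proof -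
 have fin: "finite {i : I. i < j}" for I by (rule finite_subset[of _ "{..<j}"]) auto
 have *: "sg j (insert k I) = - sg j I" if "k ~: I" for I proof -
  have "{i : insert k I. i < j} = insert k {i : I. i < j}" using assms by auto
  thus ?thesis using that fin by (simp add: sg_def)
 qed
 show "k ~: I ==> sg j (insert k I) = - sg j I" by (rule *)
 show "k : I ==> sg j (I - {k}) = - sg j I" proof -
  assume "k : I"
  hence "sg j I = - sg j (I - {k})" using *[of "I - {k}"] by (simp add: insert_absorb)
  thus ?thesis by (metis minus_minus)
 qed
qed

lemma wed_wed: "wed k (wed k w) = 0" and ctr_ctr: "ctr k (ctr k w) = 0" by (auto simp: wed_def ctr_def fun_eq_iff)

lemma wed_anti: "j ~= k ==> wed j (wed k w) I = - wed k (wed j w) I" proof (induction j k rule: linorder_wlog)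
 case (le j k)
 thus ?case by (auto simp: wed_def sg_less sg_greater Diff_insert2[symmetric] insert_commute
    Diff_insert[symmetric] mult.left_commute simp del: Diff_insert0)
next
 case (sym j k)
 thus ?case by (metis minus_minus)
qed

lemma ctr_anti: "j ~= k ==> ctr j (ctr k w) I = - ctr k (ctr j w) I" proof (induction j k rule: linorder_wlog)
 case (le j k)
 thus ?case by (auto simp: ctr_def sg_less sg_greater insert_commute mult.left_commute)
next
 case (sym j k)
 thus ?case by (metis minus_minus)
qed

lemma ctr_wed_anti: "j ~= k ==> ctr j (wed k w) I = - wed k (ctr j w) I"
 by (cases "j < k") (auto simp: ctr_def wed_def sg_less sg_greater mult.left_commute insert_Diff_if)

lemma ctr_wed: "ctr k (wed k w) I + wed k (ctr k w) I = w I" by (auto simp: ctr_def wed_def sg_less sg_sg insert_absorb)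

lemma wed_linear: "wed k (a + b) = wed k a + wed k b" "wed k (- a) = - wed k a" "wed k (a - b) = wed k a - wed k b"
  "wed k 0 = 0" "wed k (sc r a) = sc r (wed k a)" by (auto simp: wed_def sc_def fun_eq_iff algebra_simps)

lemma ctr_linear: "ctr k (a + b) = ctr k a + ctr k b" "ctr k (- a) = - ctr k a" "ctr k (a - b) = ctr k a - ctr k b"
  "ctr k 0 = 0" "ctr k (sc r a) = sc r (ctr k a)" by (auto simp: ctr_def sc_def fun_eq_iff algebra_simps)

lemma Wed_linear: "Wed n u (a + b) = Wed n u a + Wed n u b" "Wed n u (- a) = - Wed n u a"
  "Wed n u (a - b) = Wed n u a - Wed n u b" "Wed n u 0 = 0" "Wed n u (sc r a) = sc r (Wed n u a)"
 by (auto simp: Wed_def wed_linear fun_eq_iff algebra_simps sum.distrib sum_negf sum_subtractf)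
  (auto simp: sc_def sum_distrib_left mult.left_commute)

lemma Ctr_linear: "Ctr n u (a + b) = Ctr n u a + Ctr n u b" "Ctr n u (- a) = - Ctr n u a"
  "Ctr n u (a - b) = Ctr n u a - Ctr n u b" "Ctr n u 0 = 0" "Ctr n u (sc r a) = sc r (Ctr n u a)"
 by (auto simp: Ctr_def ctr_linear fun_eq_iff algebra_simps sum.distrib sum_negf sum_subtractf)
  (auto simp: sc_def sum_distrib_left mult.left_commute)

lemma sc_linear: "sc r (a + b) = sc r a + sc r b" "sc r (- a) = - sc r a" "sc r (a - b) = sc r a - sc r b"
  "sc r 0 = 0" "sc r (sc q a) = sc (r*q) a" "sc 1 a = a" "sc 0 a = 0" by (auto simp: sc_def fun_eq_iff algebra_simps)

lemma wed_sum: "wed j (%I. SUM k<n. u k * a k I) I = (SUM k<n. u k * wed j (a k) I)"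
 and ctr_sum: "ctr j (%I. SUM k<n. u k * a k I) I = (SUM k<n. u k * ctr j (a k) I)"
 by (simp_all add: wed_def ctr_def sum_distrib_left mult.left_commute)

lemma wed_Wed: "wed j (Wed n u w) I = (SUM k<n. u k * wed j (wed k w) I)" and ctr_Wed: "ctr j (Wed n u w) I = (SUM k<n. u k * ctr j (wed k w) I)"
 and wed_Ctr: "wed j (Ctr n u w) I = (SUM k<n. u k * wed j (ctr k w) I)" and ctr_Ctr: "ctr j (Ctr n u w) I = (SUM k<n. u k * ctr j (ctr k w) I)"
 unfolding Wed_def Ctr_def by (rule wed_sum, rule ctr_sum, rule wed_sum, rule ctr_sum)

lemma alternating_sum_zero: fixes a :: "nat => nat => 'a::comm_ring_1" assumes "!!j k. j ~= k ==> a j k = - a k j" "!!j. a j j = 0" shows "(SUM j<n. SUM k<n. a j k) = 0"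
proof (induction n)
 case (Suc n)
 have "(SUM j<n. a j n) = (SUM j<n. - a n j)" by (intro sum.cong refl assms(1)) auto
 thus ?case using Suc assms(2)[of n] by (simp add: sum.distrib sum_negf)
qed simp

lemma Wed_Wed: "Wed n u (Wed n u w) = 0" proof
 fix I
 have "Wed n u (Wed n u w) I = (SUM j<n. SUM k<n. u j * u k * wed j (wed k w) I)" by (subst Wed_def) (simp add: wed_Wed sum_distrib_left mult.assoc)
 also have "... = 0" proof (rule alternating_sum_zero)
  fix j k :: nat assume "j ~= k"
  thus "u j * u k * wed j (wed k w) I = - (u k * u j * wed k (wed j w) I)" by (simp add: wed_anti[of j k] mult.commute)
 qed (simp add: wed_wed)
 finally show "Wed n u (Wed n u w) I = 0 I" by simp
qed

lemma Ctr_Ctr: "Ctr n u (Ctr n u w) = 0" proof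
 fix I
 have "Ctr n u (Ctr n u w) I = (SUM j<n. SUM k<n. u j * u k * ctr j (ctr k w) I)" by (subst Ctr_def) (simp add: ctr_Ctr sum_distrib_left mult.assoc)
 also have "... = 0" proof (rule alternating_sum_zero)
  fix j k :: nat assume "j ~= k"
  thus "u j * u k * ctr j (ctr k w) I = - (u k * u j * ctr k (ctr j w) I)" by (simp add: ctr_anti[of j k] mult.commute)
 qed (simp add: ctr_ctr)
 finally show "Ctr n u (Ctr n u w) I = 0 I" by simp
qed

lemma ctr_Wed_anticommute: "j < n ==> ctr j (Wed n u w) + Wed n u (ctr j w) = sc (u j) w" proof
 fix I assume j: "j < n"
 have "ctr j (Wed n u w) I + Wed n u (ctr j w) I = (SUM k<n. u k*(ctr j (wed k w) I + wed k (ctr j w) I))"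
  by (simp add: ctr_Wed Wed_def[of n u "ctr j w"] sum.distrib distrib_left)
 also have "... = (SUM k<n. if k = j then u j * w I else 0)" by (intro sum.cong refl) (use ctr_wed_anti[of j _ w I] in "auto simp: ctr_wed")
 finally show "(ctr j (Wed n u w) + Wed n u (ctr j w)) I = sc (u j) w I" using j by (simp add: sc_def)
qed

text \<open>It serves two purposes: if u pairs to zero with v, the two maps anticommute; if u pairs
  to a power of a variable, \<open>Wed n u\<close> is a homotopy for multiplication by that
  power.\<close>

lemma Ctr_Wed_anticommute: assumes "n <= s" shows "Ctr s v (Wed n u w) + Wed n u (Ctr s v w) = sc (SUM k<n. u k * v k) w" proof
 fix I
 have "Ctr s v (Wed n u w) I + Wed n u (Ctr s v w) I
   = (SUM j<s. v j*(SUM k<n. u k * ctr j (wed k w) I)) + (SUM k<n. u k*(SUM j<s. v j * wed k (ctr j w) I))"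
  by (simp add: Ctr_def[of s v "Wed _ _ _"] Wed_def[of n u "Ctr _ _ _"] ctr_Wed wed_Ctr)
 also have "... = (SUM k<n. SUM j<s. u k * v j*(ctr j (wed k w) I + wed k (ctr j w) I))"
  by (simp add: sum_distrib_left sum.swap[of _ "{..<s}"] sum.distrib distrib_left algebra_simps)
 also have "... = (SUM k<n. SUM j<s. if j = k then u k * v k * w I else 0)"
  by (intro sum.cong refl) (use ctr_wed_anti[of _ _ w I] in "auto simp: ctr_wed")
 also have "... = (SUM k<n. u k * v k * w I)" using assms by (intro sum.cong refl) auto
 finally show "(Ctr s v (Wed n u w) + Wed n u (Ctr s v w)) I = sc (SUM k<n. u k * v k) w I" by (simp add: sc_def sum_distrib_right)
qed

section \<open>Homogeneous pieces of the exterior algebra\<close>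

definition Lam :: "nat => nat => (nat set => 'a::comm_ring_1) set" where
 "Lam s i = {w. ALL I. w I ~= 0 --> I <= {..<s} & card I = i}"

lemma Lam_iff: "w : Lam s i \<longleftrightarrow> (ALL I. ~ (I <= {..<s} & card I = i) --> w I = 0)" by (auto simp: Lam_def)

lemma Lam_closed: "0 : Lam s i" "a : Lam s i ==> b : Lam s i ==> a + b : Lam s i"
  "a : Lam s i ==> - a : Lam s i" "a : Lam s i ==> b : Lam s i ==> a - b : Lam s i"
  "a : Lam s i ==> sc r a : Lam s i" by (simp_all add: Lam_iff sc_def)

lemma Lam_sum: "(!!k. k : K ==> a k : Lam s i) ==> (%I. SUM k:K. u k * a k I) : Lam s i" by (simp add: Lam_iff)

lemma wed_Lam: "w : Lam s i ==> k < s ==> wed k w : Lam s (Suc i)" unfolding Lam_def proof (intro CollectI allI impI)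
 fix I assume *: "w : {w. ALL I. w I ~= 0 --> I <= {..<s} & card I = i}" "k < s" "wed k w I ~= 0"
 hence I: "k : I" "w (I - {k}) ~= 0" by (auto simp: wed_def split: if_splits)
 with * have "I - {k} <= {..<s}" "card (I - {k}) = i" by blast+
 moreover from this(1) have "finite I" using finite_subset[of "I - {k}" "{..<s}"] by simp
 ultimately show "I <= {..<s} & card I = Suc i" using I *(2) card_Suc_Diff1[of I k] by auto
qed

lemma ctr_Lam: "w : Lam s (Suc i) ==> ctr k w : Lam s i" unfolding Lam_def proof (intro CollectI allI impI)
 fix I assume *: "w : {w. ALL I. w I ~= 0 --> I <= {..<s} & card I = Suc i}" "ctr k w I ~= 0"
 hence I: "k ~: I" "w (insert k I) ~= 0" by (auto simp: ctr_def split: if_splits)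
 with * have "insert k I <= {..<s}" "card (insert k I) = Suc i" by blast+
 moreover from this have "finite I" by (meson finite_insert finite_subset finite_lessThan)
 ultimately show "I <= {..<s} & card I = i" using I by auto
qed

lemma Wed_Lam: "w : Lam s i ==> n <= s ==> Wed n u w : Lam s (Suc i)" unfolding Wed_def by (intro Lam_sum wed_Lam) auto

lemma Ctr_Lam: "w : Lam s (Suc i) ==> Ctr n u w : Lam s i" unfolding Ctr_def by (intro Lam_sum ctr_Lam)

lemma Lam_0_iff: "w : Lam s 0 \<longleftrightarrow> (ALL I. I ~= {} --> w I = 0)" proof -
 have "I <= {..<s} & card I = 0 \<longleftrightarrow> I = {}" for I using finite_subset[of I "{..<s}"] by auto
 thus ?thesis by (simp add: Lam_iff)
qed

lemma Lam_gt: "s < i ==> w : Lam s i ==> w = 0" proof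
 fix I assume "s < i" "w : Lam s i"
 thus "w I = 0 I" by (simp add: Lam_def) (metis card_lessThan card_mono finite_lessThan not_le)
qed

lemma Lam_mono: "w : Lam s i ==> s <= s' ==> w : Lam s' i" by (fastforce simp: Lam_def)

definition unit_form :: "'a::comm_ring_1 => nat set => 'a" where
 "unit_form F = (%I. if I = {} then F else 0)"

lemma Ctr_Lam1: assumes "w : Lam s 1" shows "Ctr s v w = unit_form (SUM k<s. v k * w {k})" proof
 fix I
 show "Ctr s v w I = unit_form (SUM k<s. v k * w {k}) I" proof (cases "I = {}")
  case True
  thus ?thesis by (simp add: Ctr_def unit_form_def ctr_def sg_def)
 next
  case False
  have "Ctr s v w : Lam s 0" using assms by (intro Ctr_Lam) simp
  with False show ?thesis by (simp add: Lam_0_iff unit_form_def)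
 qed
qed

definition one_form :: "nat => (nat => 'a::comm_ring_1) => nat set => 'a" where
 "one_form s c = (%I. if EX k<s. I = {k} then c (the_elem I) else 0)"

lemma one_form: "one_form s c : Lam s 1" "k < s ==> one_form s c {k} = c k" by (auto simp: one_form_def Lam_def split: if_splits)

lemma Wed_unit_form: "Wed n u (unit_form F) = one_form n (%k. u k * F)" proof
 fix I
 have "Wed n u (unit_form F) I = (SUM k<n. if I = {k} then u k * F else 0)" unfolding Wed_def proof (intro sum.cong refl)
  fix k
  show "u k * wed k (unit_form F) I = (if I = {k} then u k * F else 0)" by (cases "I = {k}") (auto simp: wed_def unit_form_def sg_self)
 qed
 also have "... = one_form n (%k. u k * F) I" by (cases "EX k<n. I = {k}") (auto simp: one_form_def)
 finally show "Wed n u (unit_form F) I = one_form n (%k. u k * F) I" .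
qed

subsection \<open>The Koszul complex on powers of variables\<close>

primrec vrems :: "(nat => 'v) => nat => nat => ('v, 'a::comm_ring_1) mpoly => ('v, 'a) mpoly" where
 "vrems vr M 0 F = F"
| "vrems vr M (Suc k) F = vrem (vr k) M (vrems vr M k F)"

lemma vrem_0 [simp]: "vrem i M 0 = 0" by (rule pm_eqI) (simp add: lookup_vrem)

lemma vdiv_sg: "vdiv i M (sg k I * F) = sg k I * vdiv i M (F :: ('v, 'a::comm_ring_1) mpoly)" proof -
 have "sg k I = (1 :: ('v, 'a) mpoly) \<or> sg k I = (- 1 :: ('v, 'a) mpoly)" by (metis sg_def neg_one_even_power neg_one_odd_power)
 thus ?thesis by (auto simp: vdiv_minus)
qed

text \<open>Dividing by \<open>T\<^sub>k\<^sup>M\<close> and contracting gives a homotopy between the identity and the projection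
  onto the part with \<open>k \<in> A\<close> and exponents of \<open>T\<^sub>k\<close> less than \<open>M\<close>.\<close>

lemma koszul_powers: fixes z :: "nat set => ('v, 'a::comm_ring_1) mpoly" assumes inj: "inj_on vr {..<n}" and z: "Wed n (%k. Var (vr k)^M) z = 0"
  and G: "!!A. z A : G A" "!!A k F. F : G A ==> vrem (vr k) M F : G A" "!!A. 0 : G A"
  and H: "!!A. 0 : H A" "!!A F F'. F : H A ==> F' : H A ==> F + F' : H A" "!!A F. F : H A ==> - F : H A"
   "!!A k F. k < n ==> k ~: A ==> F : G (insert k A) ==> vdiv (vr k) M F : H A" and R: "!!A. {..<n} <= A ==> z A ~= 0 ==> vrems vr M n (z A) = 0"
 shows "EX y. (ALL A. y A : H A) & z = Wed n (%k. Var (vr k)^M) y" proof -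
 let ?u = "%k. Var (vr k)^M"
 \<comment> \<open>\<open>\<pi> k\<close> is what survives the first k projections.\<close>
 define \<pi> where "\<pi> = (%k A. if {..<k} <= A then vrems vr M k (z A) else 0)"
 have \<pi>0: "\<pi> 0 = z" by (simp add: \<pi>_def fun_eq_iff)
 have \<pi>S: "\<pi> (Suc k) A = (if k : A then vrem (vr k) M (\<pi> k A) else 0)" for k A by (auto simp: \<pi>_def lessThan_Suc)
 have \<pi>G: "\<pi> k A : G A" for k A by (induction k) (auto simp: \<pi>0 \<pi>S G)
 define \<sigma> where "\<sigma> = (%k (w :: nat set => ('v, 'a) mpoly) A. vdiv (vr k) M (ctr k w A))"
 \<comment> \<open>Only j = k contributes. For other j, contraction and exterior multiplication
   anticommute, and division by one variable commutes with multiplication by another.\<close>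
 have hom: "Wed n ?u (\<sigma> k w) A + \<sigma> k (Wed n ?u w) A = w A - (if k : A then vrem (vr k) M (w A) else 0)" if "k < n" for k w A proof -
  have vs: "vdiv (vr k) M (sum f K) = (SUM j:K. vdiv (vr k) M (f j))" for f and K :: "nat set"
   by (induction K rule: infinite_finite_induct) (auto simp: vdiv_add)
  have wv: "wed j (\<sigma> k w) A = vdiv (vr k) M (wed j (ctr k w) A)" for j by (simp add: wed_def \<sigma>_def vdiv_sg)
  have j: "?u j * wed j (\<sigma> k w) A + vdiv (vr k) M (?u j * ctr k (wed j w) A)
    = (if j = k then w A - (if k : A then vrem (vr k) M (w A) else 0) else 0)" if "j < n" for j proof (cases "j = k")
   case True
   have e: "vdiv (vr k) M (?u k * F) = F" for F by (rule vdiv_mult)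
   have "?u k * vdiv (vr k) M (wed k (ctr k w) A) = wed k (ctr k w) A - vrem (vr k) M (wed k (ctr k w) A)"
    using vdiv_vrem[of "wed k (ctr k w) A" "vr k" M] by (simp add: algebra_simps)
   moreover have "wed k (ctr k w) A = (if k : A then w A else 0)" by (auto simp: wed_def ctr_def sg_less sg_sg insert_absorb)
   moreover have "ctr k (wed k w) A = (if k : A then 0 else w A)" by (auto simp: wed_def ctr_def sg_less sg_sg)
   ultimately show ?thesis using True by (simp add: e wv)
  next
   case False
   hence "vr k ~= vr j" using inj `k < n` that by (auto simp: inj_on_def)
   thus ?thesis using False by (simp add: wv vdiv_Var_mult ctr_wed_anti vdiv_minus)
  qed
  have "Wed n ?u (\<sigma> k w) A + \<sigma> k (Wed n ?u w) A = (SUM j<n. ?u j * wed j (\<sigma> k w) A + vdiv (vr k) M (?u j * ctr k (wed j w) A))"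
  proof -
   have "\<sigma> k (Wed n ?u w) A = vdiv (vr k) M (ctr k (Wed n ?u w) A)" by (simp add: \<sigma>_def)
   thus ?thesis by (simp add: Wed_def[of n ?u "\<sigma> k w"] ctr_Wed vs sum.distrib)
  qed
  also have "... = (SUM j<n. if j = k then w A - (if k : A then vrem (vr k) M (w A) else 0) else 0)" by (intro sum.cong refl j) auto
  finally show ?thesis using `k < n` by simp
 qed
 have \<sigma>0: "\<sigma> k 0 A = 0" for k A by (simp add: \<sigma>_def ctr_linear)
 have cl: "Wed n ?u (\<pi> k) = 0" if "k <= n" for k using that proof (induction k)
  case 0 show ?case by (simp add: \<pi>0 z)
 next
  case (Suc k)
  have w0: "Wed n ?u (\<pi> k) = 0" by (rule Suc.IH) (use Suc.prems in simp)
  have "\<pi> k - \<pi> (Suc k) = Wed n ?u (\<sigma> k (\<pi> k))" proof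
   fix A show "(\<pi> k - \<pi> (Suc k)) A = Wed n ?u (\<sigma> k (\<pi> k)) A"
    using hom[of k "\<pi> k" A] Suc.prems by (simp add: \<pi>S w0 \<sigma>0)
  qed
  hence "\<pi> (Suc k) = \<pi> k - Wed n ?u (\<sigma> k (\<pi> k))" by (simp add: algebra_simps)
  thus ?case by (simp only: Wed_linear Wed_Wed w0 diff_0_right)
 qed
 \<comment> \<open>The homotopies of the n successive projections add up to a preimage of z, because
   the last projection of z is zero by R.\<close>
 define y where "y = (%A. SUM k<n. \<sigma> k (\<pi> k) A)"
 have step: "\<pi> k A = Wed n ?u (\<sigma> k (\<pi> k)) A + \<pi> (Suc k) A" if "k < n" for k A
  using hom[of k "\<pi> k" A] that by (simp add: \<pi>S cl \<sigma>0 algebra_simps)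
 have tel: "z A = Wed n ?u (%A. SUM j<k. \<sigma> j (\<pi> j) A) A + \<pi> k A" if "k <= n" for k A using that proof (induction k)
  case 0
  have "Wed n ?u (%A. 0) A = 0" by (auto simp: Wed_def wed_def intro!: sum.neutral)
  thus ?case by (simp add: \<pi>0)
 next
  case (Suc k)
  have "Wed n ?u (%A. SUM j<Suc k. \<sigma> j (\<pi> j) A) = Wed n ?u ((%A. SUM j<k. \<sigma> j (\<pi> j) A) + \<sigma> k (\<pi> k))"
   by (intro arg_cong[of _ _ "Wed n ?u"]) (simp add: fun_eq_iff)
  thus ?case using Suc step[of k A] by (simp add: Wed_linear)
 qed
 \<comment> \<open>G and H carry conditions on support and degree, so that the preimage found lies
   in the expected graded piece.\<close>
 have "y A : H A" for A proof -
  have m: "vdiv (vr k) M (sg k A * F) : H A" if "vdiv (vr k) M F : H A" for k F using that H(3) by (auto simp: sg_def minus_one_power_iff vdiv_minus)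
  have "\<sigma> k (\<pi> k) A : H A" if "k < n" for k unfolding \<sigma>_def ctr_def using H(1,4) \<pi>G that m by auto
  thus ?thesis unfolding y_def by (induction n) (auto simp: H)
 qed
 moreover have "z A = Wed n ?u y A" for A proof -
  have "vrems vr M n 0 = (0 :: ('v, 'a) mpoly)" by (induction n) simp_all
  hence "\<pi> n A = 0" using R[of A] by (cases "z A = 0") (auto simp: \<pi>_def)
  thus ?thesis using tel[of n A] by (simp add: y_def)
 qed
 hence "z = Wed n ?u y" by (rule ext)
 ultimately show ?thesis by blast
qed

lemma lookup_vrems:
 "lk (vrems vr M n F) m = (if ALL k<n. lk m (vr k) < M then lk F m else 0)" by (induction n) (auto simp: lookup_vrem less_Suc_eq)

text \<open>A monomial whose exponents in the n variables are all below M has weight at most n(M -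
  1).\<close>

lemma vrems_eq_0: fixes F :: "('v, 'a::comm_ring_1) mpoly" assumes inj: "inj_on vr {..<n}" and wt: "!!i. wt i = (if i : vr ` {..<n} then 1 else 0)"
  and F: "!!m. lk F m ~= 0 ==> wdeg wt m > n*(M - 1)" shows "vrems vr M n F = 0" proof (rule pm_eqI)
 fix m
 have "wdeg wt m <= n*(M - 1)" if "ALL k<n. lk m (vr k) < M" proof -
  have "wdeg wt m = (SUM i:kys m Un vr ` {..<n}. wt i * lk m i)" by (rule wdeg_superset) auto
  also have "... = (SUM i:vr ` {..<n}. lk m i)" by (rule sum.mono_neutral_cong_right) (auto simp: wt)
  also have "... = (SUM k<n. lk m (vr k))" by (simp add: sum.reindex[OF inj])
  also have "... <= (SUM k<n. M - 1)" by (rule sum_mono) (use that in force)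
  finally show ?thesis by simp
 qed
 thus "lk (vrems vr M n F) m = lk 0 m" using F by (force simp: lookup_vrems)
qed

subsection \<open>Double complexes\<close>

lemma Ctr_lincomb: "Ctr s v (%I. SUM l:K. r l * g l I) = (%I. SUM l:K. r l * Ctr s v (g l) I)"
 and Wed_lincomb: "Wed s v (%I. SUM l:K. r l * g l I) = (%I. SUM l:K. r l * Wed s v (g l) I)" proof -
 have *: "(%I. SUM l:K. r l * g l I) = (SUM l:K. sc (r l) (g l))" for g by (induction K rule: infinite_finite_induct) (auto simp: sc_def fun_eq_iff)
 have "Ctr s v (SUM l:K. sc (r l) (g l)) = (SUM l:K. sc (r l) (Ctr s v (g l)))"
  by (induction K rule: infinite_finite_induct) (simp_all only: sum.infinite sum.empty sum.insert not_False_eq_True Ctr_linear)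
 thus "Ctr s v (%I. SUM l:K. r l * g l I) = (%I. SUM l:K. r l * Ctr s v (g l) I)" by (simp only: *)
 have "Wed s v (SUM l:K. sc (r l) (g l)) = (SUM l:K. sc (r l) (Wed s v (g l)))"
  by (induction K rule: infinite_finite_induct) (simp_all only: sum.infinite sum.empty sum.insert not_False_eq_True Wed_linear)
 thus "Wed s v (%I. SUM l:K. r l * g l I) = (%I. SUM l:K. r l * Wed s v (g l) I)" by (simp only: *)
qed

text \<open>In a family c A I, the set A is the Cech index and I the Koszul index. This is exterior
  multiplication by the M-th powers, acting on A only.\<close>

definition Del :: "(nat => 'v) => nat => nat => (nat set => nat set => ('v, 'a::comm_ring_1) mpoly) =>
  nat set => nat set => ('v, 'a) mpoly" where
 "Del vr n M c = (%A I. SUM l<n. (Var (vr l)^M * sg l A)*(if l : A then c (A - {l}) else 0) I)"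

lemma Del_apply: "Del vr n M c A I = Wed n (%k. Var (vr k)^M) (%A. c A I) A" by (auto simp: Del_def Wed_def wed_def mult.assoc intro!: sum.cong)

lemma Del_Del: "Del vr n M (Del vr n M c) = 0" proof (intro ext)
 fix A I
 have "Del vr n M (Del vr n M c) A I = Wed n (%k. Var (vr k)^M) (Wed n (%k. Var (vr k)^M) (%A. c A I)) A" by (simp add: Del_apply)
 thus "Del vr n M (Del vr n M c) A I = 0 A I" by (simp add: Wed_Wed)
qed

lemma Del_diff: "Del vr n M (c - d) = Del vr n M c - Del vr n M d" proof (intro ext)
 fix A I
 have "(%A. (c - d) A I) = (%A. c A I) - (%A. d A I)" by auto
 thus "Del vr n M (c - d) A I = (Del vr n M c - Del vr n M d) A I" by (simp only: Del_apply minus_apply Wed_linear)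
qed

definition Bd :: "nat => (nat => 'a::comm_ring_1) => ('b => nat set => 'a) => 'b => nat set => 'a" where
 "Bd s v c = (%A. Ctr s v (c A))"

lemma Bd_Del: "Bd s v (Del vr n M c) = Del vr n M (Bd s v c)"
 unfolding Bd_def Del_def by (subst Ctr_lincomb) (auto simp: fun_eq_iff Ctr_linear intro!: sum.cong)

lemma Wed_Del: "Wed s v (Del vr n M c A) = Del vr n M (%A. Wed s v (c A)) A"
 unfolding Del_def by (subst Wed_lincomb) (auto simp: fun_eq_iff Wed_linear intro!: sum.cong)

text \<open>The transition map from exponent M to exponent M + N in the direct system whose limit is
  the Cech complex; \<open>raise_Del\<close> is the compatibility.\<close>

definition raise :: "(nat => 'v) => nat => nat => (nat set => nat set => ('v, 'a::comm_ring_1) mpoly) =>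
  nat set => nat set => ('v, 'a) mpoly" where
 "raise vr n N c = (%A. sc (PROD k:A Int {..<n}. Var (vr k)^N) (c A))"

lemma raise_Del: fixes c :: "nat set => nat set => ('v, 'a::comm_ring_1) mpoly" shows "raise vr n N (Del vr n M c) = Del vr n (M + N) (raise vr n N c)"
proof (intro ext)
 fix A I
 have "(PROD k:A Int {..<n}. Var (vr k)^N)*(Var (vr l)^M * sg l A*(if l : A then c (A - {l}) else 0) I)
   = Var (vr l)^(M + N) * sg l A*(if l : A then raise vr n N c (A - {l}) else 0) I" if "l < n" for l proof (cases "l : A")
  case True
  hence "A Int {..<n} = insert l ((A - {l}) Int {..<n})" using that by auto
  hence "(PROD k:A Int {..<n}. Var (vr k)^N) = Var (vr l)^N*(PROD k:(A - {l}) Int {..<n}. Var (vr k)^N :: ('v, 'a) mpoly)" by simp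
  thus ?thesis using True by (simp add: raise_def sc_def power_add algebra_simps)
 qed simp
 moreover have "raise vr n N (Del vr n M c) A I = (PROD k:A Int {..<n}. Var (vr k)^N)*Del vr n M c A I" by (simp add: raise_def sc_def)
 ultimately show "raise vr n N (Del vr n M c) A I = Del vr n (M + N) (raise vr n N c) A I"
  by (simp only: Del_def sum_distrib_left) (intro sum.cong refl, simp)
qed

lemma raise_raise: "raise vr n N (raise vr n N' c) = raise vr n (N' + N) c"
 by (simp add: raise_def sc_linear power_add prod.distrib fun_eq_iff mult.commute)

lemma raise_Bd: "raise vr n N (Bd s v c) = Bd s v (raise vr n N c)" by (simp add: raise_def Bd_def Ctr_linear)

lemma Bd_diff: "Bd s v (c - d) = Bd s v c - Bd s v d" by (simp add: Bd_def fun_eq_iff) (simp add: Ctr_linear)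

text \<open>Descending induction along the double complex formed by the Koszul complex of \<open>v\<close> and the
  direct limit over \<open>M\<close> of the Koszul complexes of the powers \<open>T\<^sub>k\<^sup>M\<close>, that is, the Cech complex.\<close>

lemma cech_claim: assumes sub: "!!M j i a b. a : CC M j i ==> b : CC M j i ==> a - b : CC M j i"
  and del: "!!M j i c. c : CC M j i ==> Del vr n M c : CC M (Suc j) i" and bd: "!!M j i c. c : CC M j (Suc i) ==> Bd s v c : CC M j i"
  and ra: "!!M N j i c. c : CC M j i ==> raise vr n N c : CC (M + N) j i" and big: "!!M j i c. c : CC M j i ==> n < j ==> c = 0"
  and LE: "!!M j c. c : CC M (Suc (Suc j)) (Suc j + i0) ==> Bd s v c = 0 ==>
    EX N. EX c':CC (M + N) (Suc (Suc j)) (Suc (Suc j) + i0). raise vr n N c = Bd s v c'"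
  and V: "!!M j c. c : CC M (Suc j) (Suc j + i0) ==> Del vr n M c = 0 ==> EX y:CC M j (Suc j + i0). c = Del vr n M y"
  and c: "c : CC M (Suc j) (Suc j + i0)" "Bd s v (Del vr n M c) = 0"
 shows "EX N. EX y:CC (M + N) j (Suc j + i0). Bd s v (raise vr n N c) = Bd s v (Del vr n (M + N) y)" using c
proof (induction "n - j" arbitrary: j c M rule: less_induct)
 case less
 show ?case proof (cases "n <= j")
  case True
  have "Del vr n M c = 0" by (rule big[OF del[OF less.prems(1)]]) (use True in simp)
  from V[OF less.prems(1) this] obtain y where "y : CC M j (Suc j + i0)" "c = Del vr n M y" by blast
  thus ?thesis by (intro exI[of _ 0] bexI[of _ y]) (auto simp: raise_def sc_linear)
 next
  case False
  \<comment> \<open>The Cech boundary of c is a Koszul cycle, so after raising it is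
    \<open>Bd\<close> of some y one step further along. The induction hypothesis gives y'; then c,
    raised, minus \<open>Bd\<close> of y' is closed under \<open>Del\<close> and has a
    preimage.\<close>
  obtain N y where y: "y : CC (M + N) (Suc (Suc j)) (Suc (Suc j) + i0)" "raise vr n N (Del vr n M c) = Bd s v y"
   using LE[OF del[OF less.prems(1)] less.prems(2)] by blast
  have "Bd s v (Del vr n (M + N) y) = Del vr n (M + N) (Del vr n (M + N) (raise vr n N c))" by (simp only: Bd_Del y(2)[symmetric] raise_Del)
  hence "Bd s v (Del vr n (M + N) y) = 0" by (simp only: Del_Del)
  from less.hyps[OF _ y(1) this] False obtain N' y' where
   y': "y' : CC (M + N + N') (Suc j) (Suc (Suc j) + i0)"
    "Bd s v (raise vr n N' y) = Bd s v (Del vr n (M + N + N') y')" by fastforce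
  have "Del vr n (M + N + N') (raise vr n (N + N') c - Bd s v y') = raise vr n N' (raise vr n N (Del vr n M c)) - Bd s v (Del vr n (M + N + N') y')"
   by (simp only: Del_diff raise_raise raise_Del Bd_Del add.assoc)
  also have "... = 0" by (simp only: y(2) raise_Bd y'(2) diff_self)
  finally have d0: "Del vr n (M + N + N') (raise vr n (N + N') c - Bd s v y') = 0" .
  have "raise vr n (N + N') c - Bd s v y' : CC (M + N + N') (Suc j) (Suc j + i0)"
   using ra[OF less.prems(1), of "N + N'"] bd[of y' "M + N + N'" "Suc j" "Suc j + i0"] y'(1) by (intro sub) (simp_all add: add.assoc)
  from V[OF this d0] obtain z where z: "z : CC (M + N + N') j (Suc j + i0)"
   "raise vr n (N + N') c - Bd s v y' = Del vr n (M + N + N') z" by blast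
  have "Bd s v (raise vr n (N + N') c) - Bd s v (Bd s v y') = Bd s v (Del vr n (M + N + N') z)"
   using arg_cong[OF z(2), of "Bd s v"] by (simp only: Bd_diff)
  moreover have "Bd s v (Bd s v y') = 0" by (simp add: Bd_def Ctr_Ctr fun_eq_iff)
  ultimately show ?thesis using z(1) by (intro exI[of _ "N + N'"] bexI[of _ z]) (simp_all add: add.assoc)
 qed
qed

definition CL :: "nat => nat => nat => nat => (nat set => nat set => 'a::comm_ring_1) set" where
 "CL n s j i = {c. ALL A. c A : Lam s i & (c A ~= 0 --> A <= {..<n} & card A = j)}"

lemma CL_iff: "c : CL n s j i \<longleftrightarrow> (ALL A. c A : Lam s i) & (ALL A. ~ (A <= {..<n} & card A = j) --> c A = 0)" by (auto simp: CL_def)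

lemma CL_sub: "a : CL n s j i ==> b : CL n s j i ==> a - b : CL n s j i" by (auto simp: CL_iff intro: Lam_closed)

lemma CL_Del: "c : CL n s j i ==> Del vr n M c : CL n s (Suc j) i" unfolding CL_iff proof (intro conjI allI impI)
 fix A assume c: "(ALL A. c A : Lam s i) & (ALL A. ~ (A <= {..<n} & card A = j) --> c A = 0)"
 show "Del vr n M c A : Lam s i" unfolding Del_def by (intro Lam_sum) (use c in "auto intro: Lam_closed")
 assume A: "~ (A <= {..<n} & card A = Suc j)"
 have "(if l : A then c (A - {l}) else 0) = 0" if "l < n" for l proof (cases "l : A & c (A - {l}) ~= 0")
  case True
  hence "A - {l} <= {..<n}" "card (A - {l}) = j" using c[THEN conjunct2, rule_format, of "A - {l}"] by argo+
  moreover from this(1) have "finite A" using finite_subset[of "A - {l}" "{..<n}"] by simp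
  ultimately have "A <= {..<n} & card A = Suc j" using True that card_Suc_Diff1[of A l] by auto
  with A show ?thesis by blast
 qed auto
 thus "Del vr n M c A = 0" by (auto simp: Del_def fun_eq_iff intro!: sum.neutral)
qed

lemma CL_Bd: "c : CL n s j (Suc i) ==> Bd s v c : CL n s j i" by (auto simp: CL_iff Bd_def Ctr_linear intro: Ctr_Lam)

lemma CL_raise: "c : CL n s j i ==> raise vr n N c : CL n s j i" by (auto simp: CL_iff raise_def sc_linear intro: Lam_closed)

lemma CL_big: "c : CL n s j i ==> n < j ==> c = 0" proof
 fix A assume c: "c : CL n s j i" "n < j"
 have "~ (A <= {..<n} & card A = j)" using card_mono[of "{..<n}" A] c(2) by auto
 with c show "c A = 0 A" by (auto simp: CL_iff)
qed

lemma Del_single: assumes "k < n" shows "Del vr n M (%A. if A = {} then z else 0) {k} = sc (Var (vr k)^M) z" proof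
 fix I
 have "Del vr n M (%A. if A = {} then z else 0) {k} I = (SUM l<n. if l = k then Var (vr k)^M*z I else 0)"
  unfolding Del_def by (intro sum.cong refl) (auto simp: sg_self)
 thus "Del vr n M (%A. if A = {} then z else 0) {k} I = sc (Var (vr k)^M) z I" using assms by (simp add: sc_def)
qed

lemma Del_nonsingle: assumes "!!k. k < n ==> A ~= {k}" shows "Del vr n M (%A. if A = {} then z else 0) A = 0" proof
 fix I
 have "l : A ==> A - {l} ~= {}" if "l < n" for l using assms[OF that] by auto
 thus "Del vr n M (%A. if A = {} then z else 0) A I = 0 I" by (auto simp: Del_def intro!: sum.neutral)
qed

lemma Var_power_cancel: "Var i^M*F = 0 ==> (F :: ('v, 'a::comm_ring_1) mpoly) = 0" using vdiv_mult[of i M F] by simp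

text \<open>The common beginning and end of the arguments by \<open>cech_claim\<close>.\<close>

lemma cech_start: assumes n: "n > 0" and z: "!!k. k < n ==> Ctr s v (w k) = sc (Var (vr k)^M) z"
  and claim: "!!c. c = (%A. if EX k<n. A = {k} then w (the_elem A) else 0) ==> Bd s v (Del vr n M c) = 0 ==>
    EX N. EX y:CC N. (ALL A. A ~= {} --> y A = 0) & Bd s v (raise vr n N c) = Bd s v (Del vr n (M + N) y)" shows "EX N. EX y:CC N. z = Ctr s v (y {})"
proof -
 define c where "c = (%A. if EX k<n. A = {k} then w (the_elem A) else 0)"
 define zz where "zz = (%A :: nat set. if A = {} then z else 0)"
 \<comment> \<open>The family of local preimages w k has as Koszul boundary the Cech boundary of
   z.\<close>
 have Bc: "Bd s v c = Del vr n M zz" proof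
  fix A
  show "Bd s v c A = Del vr n M zz A" proof (cases "EX k<n. A = {k}")
   case True
   then obtain k where "k < n" "A = {k}" by blast
   thus ?thesis by (simp add: Bd_def c_def zz_def Del_single z)
  next
   case False
   hence "c A = 0" unfolding c_def by (rule if_not_P)
   moreover have "Del vr n M zz A = 0" unfolding zz_def by (rule Del_nonsingle) (use False in blast)
   ultimately show ?thesis by (simp only: Bd_def Ctr_linear)
  qed
 qed
 have "Bd s v (Del vr n M c) = 0" by (simp only: Bd_Del Bc Del_Del)
 from claim[OF c_def this] obtain N y where y: "y : CC N" "ALL A. A ~= {} --> y A = 0"
  "Bd s v (raise vr n N c) = Bd s v (Del vr n (M + N) y)" by blast
 have rz: "raise vr n N zz = zz" by (auto simp: raise_def zz_def sc_linear fun_eq_iff sc_def)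
 have "Del vr n (M + N) zz = Del vr n (M + N) (Bd s v y)" using y(3) by (simp only: raise_Bd[symmetric] Bc raise_Del rz Bd_Del)
 moreover have "Bd s v y = (%A. if A = {} then Ctr s v (y {}) else 0)" proof
  fix A show "Bd s v y A = (if A = {} then Ctr s v (y {}) else 0)"
  proof (cases "A = {}")
   case False
   hence "y A = 0" using y(2) by blast
   with False show ?thesis by (simp only: Bd_def Ctr_linear if_False)
  qed (simp add: Bd_def)
 qed
 \<comment> \<open>Compare the components at A = {0}; the power of the variable then
   cancels.\<close>
 ultimately have "sc (Var (vr 0)^(M + N)) z = sc (Var (vr 0)^(M + N)) (Ctr s v (y {}))"
  using Del_single[OF n, of vr "M + N"] unfolding zz_def by metis
 hence "Var (vr 0)^(M + N)*(z I - Ctr s v (y {}) I) = 0" for I by (simp add: sc_def fun_eq_iff right_diff_distrib)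
 hence "z I = Ctr s v (y {}) I" for I using Var_power_cancel[of "vr 0" "M + N"] by force
 thus ?thesis using y(1) by blast
qed

subsection \<open>Vanishing of Koszul homology\<close>

text \<open>Vanishing of the i-th Koszul homology of v_0, ..., v_{s-1}.\<close>

definition Hvan :: "nat => (nat => 'a::comm_ring_1) => nat => bool" where
 "Hvan s v i \<longleftrightarrow> (ALL z:Lam s i. Ctr s v z = 0 --> (EX w:Lam s (Suc i). z = Ctr s v w))"

text \<open>The origin has depth n in n variables, so Koszul homology vanishes above degree s - n.
  The complex is contractible wherever one variable is inverted, since a power of that variable lies
  in (v), and exterior multiplication by the powers of all variables is exact below the top.\<close>

lemma depth_vanishing: fixes v :: "nat => ('v::finite, 'k::field) mpoly" assumes rad: "!!x. Var x : rad (igen (v ` {..<s}))" and i: "s < i + CARD('v)" shows "Hvan s v i"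
 unfolding Hvan_def proof (intro ballI impI)
 fix z assume z: "z : Lam s i" "Ctr s v z = 0"
 define n where "n = CARD('v)"
 obtain vr where vr: "bij_betw vr {..<n} (UNIV :: 'v set)" using ex_bij_betw_nat_finite[of "UNIV :: 'v set"] by (auto simp: atLeast0LessThan n_def)
 hence inj: "inj_on vr {..<n}" by (simp add: bij_betw_def)
 have n0: "n > 0" by (simp add: n_def)
 obtain M where M: "M > 0" "!!x. Var x^M : igen (v ` {..<s})" using uniform_power[OF isideal_igen, of Var] rad by blast
 hence "ALL k. EX c. Var (vr k)^M = (SUM j<s. c j * v j)" using igen_image[of "{..<s}" _ v] by auto
 then obtain a where a: "!!k. Var (vr k)^M = (SUM j<s. a k j * v j)" unfolding choice_iff by blast
 have bw: "Ctr s v (Wed s (a k) y) = sc (Var (vr k)^M) y" if "Ctr s v y = 0" for k y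
  using Ctr_Wed_anticommute[of s s v "a k" y] that by (simp add: a Wed_linear)
 have "EX N::nat. EX y:CL n s 0 (Suc i). z = Ctr s v (y {})" proof (rule cech_start[OF n0, of s v "%k. Wed s (a k) z" vr M z "%_. CL n s 0 (Suc i)"])
  show "Ctr s v (Wed s (a k) z) = sc (Var (vr k)^M) z" for k by (rule bw[OF z(2)])
  fix c assume c: "c = (%A. if EX k<n. A = {k} then Wed s (a (the_elem A)) z else 0)" "Bd s v (Del vr n M c) = 0"
  have "c : CL n s (Suc 0) (Suc 0 + i)" using z by (auto simp: CL_iff c(1) intro: Wed_Lam Lam_closed)
  have "EX N. EX y:CL n s 0 (Suc 0 + i). Bd s v (raise vr n N c) = Bd s v (Del vr n (M + N) y)" proof (rule cech_claim[where CC = "%_. CL n s"])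
   show "c : CL n s (Suc 0) (Suc 0 + i)" by fact
   show "Bd s v (Del vr n M c) = 0" by fact
  next
   fix M' j and c :: "nat set => nat set => ('v, 'k) mpoly"
   assume c: "c : CL n s (Suc (Suc j)) (Suc j + i)" "Bd s v c = 0"
   \<comment> \<open>Any variable of A may serve for the contraction; k chooses one, and the others
     only contribute factors.\<close>
   define k where "k = (%A :: nat set. SOME k. k : A)"
   define c' where "c' = (%A. sc (PROD l:A Int {..<n} - {k A}. Var (vr l)^M) (Wed s (a (k A)) (c A)))"
   have "c' : CL n s (Suc (Suc j)) (Suc (Suc j) + i)" using c(1) by (auto simp: CL_iff c'_def Wed_linear sc_linear intro: Lam_closed Wed_Lam)
   moreover have "raise vr n M c A = Bd s v c' A" for A proof (cases "c A = 0")
    case True thus ?thesis by (simp add: raise_def Bd_def c'_def sc_linear Wed_linear Ctr_linear)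
   next
    case False
    hence A: "A <= {..<n}" "card A = Suc (Suc j)" using c(1) by (auto simp: CL_def)
    hence "A ~= {}" by auto
    hence k: "k A : A" by (auto simp: k_def intro: someI)
    have "(PROD l:A Int {..<n}. Var (vr l)^M) = (PROD l:A Int {..<n} - {k A}. Var (vr l)^M)*(Var (vr (k A))^M :: ('v, 'k) mpoly)"
     using k A by (subst prod.remove[of _ "k A"]) (auto simp: mult.commute)
    moreover have "Ctr s v (c A) = 0" using c(2) by (simp add: Bd_def fun_eq_iff)
    ultimately show ?thesis by (simp add: raise_def Bd_def c'_def Ctr_linear bw sc_linear)
   qed
   ultimately show "EX N. EX c':CL n s (Suc (Suc j)) (Suc (Suc j) + i). raise vr n N c = Bd s v c'" by (intro exI[of _ M] bexI[of _ c']) auto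
  next
   fix M' j and c :: "nat set => nat set => ('v, 'k) mpoly"
   assume c: "c : CL n s (Suc j) (Suc j + i)" "Del vr n M' c = 0"
   define G where "G = (%r I A. {F :: ('v, 'k) mpoly. F ~= 0 --> A <= {..<n} & card A = r & I <= {..<s} & card I = Suc j + i})"
   have "EX y. (ALL A. y A : G j I A) & (%A. c A I) = Wed n (%k. Var (vr k)^M') y" for I proof (rule koszul_powers[where G = "G (Suc j) I", OF inj])
    show "Wed n (%k. Var (vr k)^M') (%A. c A I) = 0" proof
     fix A show "Wed n (%k. Var (vr k)^M') (%A. c A I) A = 0 A"
      unfolding Del_apply[symmetric] c(2) by simp
    qed
    show "c A I : G (Suc j) I A" for A proof (cases "c A I = 0")
     case False
     hence "c A ~= 0" by auto
     with False show ?thesis using c(1) by (simp add: CL_def Lam_def G_def)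
    qed (simp add: G_def)
    fix A k F assume "k < n" "k ~: A" "F : G (Suc j) I (insert k A)"
    thus "vdiv (vr k) M' F : G j I A" using finite_subset[of A "{..<n}"] by (cases "F = 0") (auto simp: G_def)
   next
    \<comment> \<open>In Cech degree n the Koszul degree would be n + i, which exceeds s.\<close>
    fix A assume "{..<n} <= A" "c A I ~= 0"
    moreover from this(2) have "c A ~= 0" by auto
    ultimately have "A = {..<n}" "card A = Suc j" "I <= {..<s}" "card I = Suc j + i" using c(1) by (auto simp: CL_def Lam_def)
    moreover have "card I <= s" using card_mono[OF _ `I <= {..<s}`] by simp
    ultimately show "vrems vr M' n (c A I) = 0" using i `card I = Suc j + i` by (simp add: n_def)
   qed (auto simp: G_def)
   then obtain y where y: "!!I A. y I A : G j I A" "!!I. (%A. c A I) = Wed n (%k. Var (vr k)^M') (y I)" by metis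
   have y': "A <= {..<n} & card A = j & I <= {..<s} & card I = Suc j + i" if "y I A ~= 0" for I A using y(1)[of I A] that by (simp add: G_def)
   have "(%A I. y I A) : CL n s j (Suc j + i)" unfolding CL_def Lam_def by (auto simp: fun_eq_iff dest!: y')
   moreover have "c = Del vr n M' (%A I. y I A)" by (intro ext) (simp add: Del_apply y(2)[symmetric])
   ultimately show "EX y:CL n s j (Suc j + i). c = Del vr n M' y" by blast
  qed (auto intro: CL_sub CL_Del CL_Bd CL_raise CL_big)
  moreover have "y A = 0" if "y : CL n s 0 (Suc i)" "A ~= {}" for y A using that finite_subset[of A "{..<n}"] by (auto simp: CL_iff card_eq_0_iff)
  ultimately show "EX N. EX y:CL n s 0 (Suc i). (ALL A. A ~= {} --> y A = 0) & Bd s v (raise vr n N c) = Bd s v (Del vr n (M + N) y)"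
   by (metis plus_1_eq_Suc One_nat_def)
 qed
 thus "EX w:Lam s (Suc i). z = Ctr s v w" by (auto simp: CL_def)
qed

section \<open>Gradings of the exterior algebra\<close>

lemma Ctr_sum: "Ctr s v (sum f K) = (SUM k:K. Ctr s v (f k))"
 by (induction K rule: infinite_finite_induct) (simp_all only: sum.infinite sum.empty sum.insert not_False_eq_True Ctr_linear)

lemma sum_Lam: "(!!k. k : K ==> f k : Lam s i) ==> sum f K : Lam s i" by (induction K rule: infinite_finite_induct) (auto intro: Lam_closed)

text \<open>The component of total degree d when the k-th basis vector has degree dg k; contraction
  by v with v k of degree dg k then preserves the degree. The condition guards a truncated
  subtraction.\<close>

definition wcomp :: "('v => nat) => (nat => nat) => nat => (nat set => ('v, 'a::comm_ring_1) mpoly) =>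
  nat set => ('v, 'a) mpoly" where
 "wcomp wt dg d z = (%I. if sum dg I <= d then hcomp wt (d - sum dg I) (z I) else 0)"

lemma wcomp_linear: "wcomp wt dg d (a + b) = wcomp wt dg d a + wcomp wt dg d b"
  "wcomp wt dg d (- a) = - wcomp wt dg d a" "wcomp wt dg d (a - b) = wcomp wt dg d a - wcomp wt dg d b"
  "wcomp wt dg d 0 = 0" by (auto simp: wcomp_def fun_eq_iff hcomp_add hcomp_minus hcomp_diff)

lemma wcomp_Lam: "z : Lam s i ==> wcomp wt dg d z : Lam s i" by (simp add: Lam_iff wcomp_def)

lemma wcomp_wcomp: "wcomp wt dg d (wcomp wt dg d z) = wcomp wt dg d z" by (auto simp: wcomp_def fun_eq_iff hcomp_of_homg[OF hcomp_homg])

lemma wcomp_sc: "r : homg wt e ==> wcomp wt dg (d + e) (sc r z) = sc r (wcomp wt dg d z)" by (auto simp: wcomp_def sc_def fun_eq_iff hcomp_mult_homg)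

lemma sg_cases: "sg k I = (1 :: 'a::comm_ring_1) \<or> sg k I = (- 1 :: 'a)" by (metis sg_def neg_one_even_power neg_one_odd_power)

lemma hcomp_sg: "hcomp wt d (sg k I * F) = sg k I * hcomp wt d (F :: ('v, 'a::comm_ring_1) mpoly)"
 using sg_cases[of k I, where 'a = "('v, 'a) mpoly"] by (auto simp: hcomp_minus)

lemma wcomp_Ctr: assumes "!!k. k < s ==> v k : homg wt (dg k)" "z : Lam s' i" shows "wcomp wt dg d (Ctr s v z) = Ctr s v (wcomp wt dg d z)" proof
 fix I
 have "(if sum dg I <= d then hcomp wt (d - sum dg I) (v k * ctr k z I) else 0) = v k * ctr k (wcomp wt dg d z) I" if "k < s" for k
 proof (cases "k : I \<or> infinite I")
  case True
  hence "z (insert k I) = 0 \<or> k : I" using assms(2) finite_subset[of "insert k I" "{..<s'}"] by (auto simp: Lam_def)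
  thus ?thesis by (auto simp: ctr_def wcomp_def)
 next
  case False
  hence "sum dg (insert k I) = dg k + sum dg I" by simp
  thus ?thesis using False assms(1)[OF that] by (auto simp: ctr_def wcomp_def hcomp_mult_homg hcomp_sg add.commute)
 qed
 thus "wcomp wt dg d (Ctr s v z) I = Ctr s v (wcomp wt dg d z) I" unfolding Ctr_def wcomp_def[of _ _ _ "%I. SUM k<s. _ k I"]
  by (auto simp: hcomp_sum intro!: sum.cong)
qed

lemma wcomp_Wed: assumes "!!k. k < n ==> u k : homg wt (e k) & dg k + e k = c" "z : Lam s i"
 shows "wcomp wt dg (d + c) (Wed n u z) = Wed n u (wcomp wt dg d z)" proof
 fix I
 have "(if sum dg I <= d + c then hcomp wt (d + c - sum dg I) (u k * wed k z I) else 0) = u k * wed k (wcomp wt dg d z) I" if "k < n" for k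
 proof (cases "k : I & finite I")
  case True
  define S where "S = sum dg (I - {k})"
  have S: "sum dg I = dg k + S" using True by (simp add: sum.remove S_def)
  have u: "u k : homg wt (e k)" "c = dg k + e k" using assms(1)[OF that] by simp_all
  show ?thesis using True by (cases "S <= d") (auto simp: wed_def wcomp_def hcomp_mult_homg[OF u(1)] hcomp_sg u(2) S S_def[symmetric])
 next
  case False
  hence "z (I - {k}) = 0 \<or> k ~: I" using assms(2) finite_subset[of "I - {k}" "{..<s}"] by (auto simp: Lam_def)
  thus ?thesis by (auto simp: wed_def wcomp_def)
 qed
 thus "wcomp wt dg (d + c) (Wed n u z) I = Wed n u (wcomp wt dg d z) I" unfolding Wed_def wcomp_def[of _ _ _ "%I. SUM k<n. _ k I"]
  by (auto simp: hcomp_sum intro!: sum.cong)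
qed

lemma wcomp_decomp: assumes "z : Lam s i" shows "EX D. z = (SUM d<=D. wcomp wt dg d z)" proof -
 have "ALL I. EX D. ALL E>=D. z I = (SUM d<=E. hcomp wt d (z I))" using hcomp_decomp by blast
 then obtain D where D: "!!I E. D I <= E ==> z I = (SUM d<=E. hcomp wt d (z I))" unfolding choice_iff by blast
 define E where "E = (SUM I:Pow {..<s}. D I + sum dg I)"
 have "z I = (SUM d<=E. wcomp wt dg d z) I" for I proof (cases "I <= {..<s}")
  case True
  hence le: "D I + sum dg I <= E" unfolding E_def by (intro member_le_sum) auto
  have "(SUM d<=E. wcomp wt dg d z) I = (SUM d<=E. wcomp wt dg d z I)" by (induction E) auto
  also have "... = (SUM d:{sum dg I..E}. hcomp wt (d - sum dg I) (z I))" unfolding wcomp_def by (rule sum.mono_neutral_cong_right) auto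
  also have "... = (SUM d<=E - sum dg I. hcomp wt d (z I))"
   by (rule sum.reindex_bij_witness[of _ "%d. d + sum dg I" "%d. d - sum dg I"]) (use le in auto)
  also have "... = z I" using D[of I "E - sum dg I"] le by simp
  finally show ?thesis by simp
 next
  case False
  hence "z I = 0" using assms by (auto simp: Lam_def)
  moreover have "(SUM d<=E. wcomp wt dg d z) I = (SUM d<=E. wcomp wt dg d z I)" by (induction E) auto
  ultimately show ?thesis by (simp add: wcomp_def sum.neutral)
 qed
 thus ?thesis by blast
qed

lemma Ctr_zero: "z : Lam s i ==> ctr s z = 0"
 by (auto simp: ctr_def Lam_def fun_eq_iff) (metis insertI1 lessThan_iff less_irrefl mult_zero_right subsetD)

lemma Ctr_Suc: "Ctr (Suc t) v z = Ctr t v z + sc (v t) (ctr t z)" by (auto simp: Ctr_def sc_def fun_eq_iff)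

text \<open>A form of the graded Nakayama lemma.\<close>

lemma Hvan_step: fixes v :: "nat => ('v, 'a::comm_ring_1) mpoly" assumes H: "Hvan (Suc t) v i" and v: "!!k. k <= t ==> v k : homg tot (dg k)" and pos: "dg t > 0"
 shows "Hvan t v i" proof -
 have *: "EX w:Lam t (Suc i). z = Ctr t v w" if "z : Lam t i" "Ctr t v z = 0" "wcomp tot dg d z = z" for z d using that
 proof (induction d arbitrary: z rule: less_induct)
  case (less d)
  have "Ctr (Suc t) v z = 0" by (simp only: Ctr_Suc Ctr_zero[OF less.prems(1)] less.prems(2) sc_linear add_0_right)
  moreover have "z : Lam (Suc t) i" using less.prems(1) by (rule Lam_mono) simp
  ultimately obtain W0 where W0: "W0 : Lam (Suc t) (Suc i)" "z = Ctr (Suc t) v W0" using H by (auto simp: Hvan_def)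
  define W where "W = wcomp tot dg d W0"
  have WL: "W : Lam (Suc t) (Suc i)" unfolding W_def by (rule wcomp_Lam[OF W0(1)])
  have zW: "z = Ctr (Suc t) v W" using less.prems(3) wcomp_Ctr[of "Suc t" v tot dg, OF _ W0(1), of d] v W0(2) by (simp add: W_def less_Suc_eq_le)
  \<comment> \<open>Wz is the part of W free of the t-th basis vector and W1 the coefficient of that
    vector. In z = Ctr Wz + v_t W1 the coefficient W1 is a cycle of smaller degree, so the induction
    makes it a boundary.\<close>
  define W1 where "W1 = ctr t W"
  define Wz where "Wz = (%I. if t : I then 0 else W I)"
  have W1L: "W1 : Lam t i" proof -
   have "W1 : Lam (Suc t) i" unfolding W1_def by (rule ctr_Lam[OF WL])
   moreover have "t : I ==> W1 I = 0" for I by (simp add: W1_def ctr_def)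
   ultimately show ?thesis by (auto simp: Lam_def less_Suc_eq subset_iff) (metis order_less_irrefl)
  qed
  have WzL: "Wz : Lam t (Suc i)" using WL by (auto simp: Lam_def Wz_def less_Suc_eq subset_iff)
  have c1: "Ctr t v W1 = 0" proof
   fix I
   have "ctr t z = 0" by (rule Ctr_zero[OF less.prems(1)])
   moreover have "ctr t (Ctr (Suc t) v W) I = - Ctr t v W1 I" proof -
    have "ctr t (Ctr (Suc t) v W) I = (SUM k<t. v k * ctr t (ctr k W) I)" by (simp add: ctr_Ctr ctr_ctr)
    also have "... = (SUM k<t. - (v k * ctr k (ctr t W) I))" by (intro sum.cong refl) (simp add: ctr_anti[of t])
    finally show ?thesis by (simp add: Ctr_def W1_def sum_negf)
   qed
   ultimately show "Ctr t v W1 I = 0 I" using zW by simp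
  qed
  have zI: "z = Ctr t v Wz + sc (v t) W1" proof
   fix I
   show "z I = (Ctr t v Wz + sc (v t) W1) I" proof (cases "t : I")
    case True
    hence "z I = 0" using less.prems(1) by (auto simp: Lam_def)
    moreover have "Ctr t v Wz I = 0" using True by (auto simp: Ctr_def ctr_def Wz_def intro!: sum.neutral)
    ultimately show ?thesis using True by (simp add: sc_def W1_def ctr_def)
   next
    case False
    hence "Ctr t v Wz I = Ctr t v W I" by (auto simp: Ctr_def ctr_def Wz_def intro!: sum.cong)
    thus ?thesis by (simp add: zW Ctr_Suc W1_def)
   qed
  qed
  have "EX w1:Lam t (Suc i). W1 = Ctr t v w1" proof (cases "dg t <= d")
   case True
   have "wcomp tot dg (d - dg t) W1 = W1" proof
    fix I
    show "wcomp tot dg (d - dg t) W1 I = W1 I" proof (cases "W1 I = 0")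
     case False
     hence I: "t ~: I" "finite I" using W1L finite_subset[of I "{..<t}"] by (auto simp: Lam_def)
     have "W1 I = sg t I * wcomp tot dg d W (insert t I)" using I by (simp add: W1_def ctr_def W_def wcomp_wcomp)
     also have "... = (if dg t + sum dg I <= d then hcomp tot (d - (dg t + sum dg I)) (sg t I * W (insert t I)) else 0)"
      using I by (simp add: wcomp_def hcomp_sg)
     also have "... = wcomp tot dg (d - dg t) W1 I" using I True by (auto simp: wcomp_def W1_def ctr_def)
     finally show ?thesis by simp
    qed (simp add: wcomp_def)
   qed
   with less.IH[OF _ W1L c1, of "d - dg t"] pos True show ?thesis by simp
  next
   case False
   have "W1 = 0" proof
    fix I
    have "W (insert t I) = 0 \<or> t : I" proof (cases "finite I & t ~: I")
     case True
     hence "wcomp tot dg d W0 (insert t I) = 0" using False by (simp add: wcomp_def)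
     thus ?thesis by (simp add: W_def)
    next
     case False
     thus ?thesis using WL finite_subset[of "insert t I" "{..<Suc t}"] by (auto simp: Lam_def)
    qed
    thus "W1 I = 0 I" by (auto simp: W1_def ctr_def)
   qed
   thus ?thesis by (intro bexI[of _ 0]) (simp_all only: Ctr_linear Lam_closed)
  qed
  then obtain w1 where "w1 : Lam t (Suc i)" "W1 = Ctr t v w1" by blast
  thus ?case using zI WzL by (intro bexI[of _ "Wz + sc (v t) w1"]) (simp_all only: Ctr_linear Lam_closed)
 qed
 show ?thesis unfolding Hvan_def proof (intro ballI impI)
  fix z assume z: "z : Lam t i" "Ctr t v z = 0"
  have "EX w:Lam t (Suc i). wcomp tot dg d z = Ctr t v w" for d proof (rule *[where d = d])
   have "wcomp tot dg d (Ctr t v z) = Ctr t v (wcomp tot dg d z)" by (rule wcomp_Ctr[OF _ z(1)]) (use v in auto)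
   thus "Ctr t v (wcomp tot dg d z) = 0" by (simp only: z(2) wcomp_linear)
  qed (simp_all only: wcomp_Lam[OF z(1)] wcomp_wcomp)
  then obtain w where w: "!!d. w d : Lam t (Suc i)" "!!d. wcomp tot dg d z = Ctr t v (w d)" by metis
  obtain D where D: "z = (SUM d<=D. wcomp tot dg d z)" using wcomp_decomp[OF z(1)] by blast
  have "z = Ctr t v (SUM d<=D. w d)" by (subst D) (simp only: Ctr_sum w(2))
  moreover have "(SUM d<=D. w d) : Lam t (Suc i)" by (rule sum_Lam) (rule w(1))
  ultimately show "EX w:Lam t (Suc i). z = Ctr t v w" by (rule bexI)
 qed
qed

lemma Ctr_cong: "(!!k. k < s ==> v k = v' k) ==> Ctr s v = Ctr s v'" by (intro ext) (simp add: Ctr_def)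

text \<open>\<open>depth_vanishing\<close> applies to v followed by the parameters y;
  \<open>Hvan_step\<close> then removes the parameters one at a time, which requires their degrees
  to be positive.\<close>

theorem koszul_vanishing:
 fixes v :: "nat => ('v::finite, 'k::field) mpoly" assumes v: "!!k. k < s ==> EX d. v k : homg tot d" and y: "sop (igen (v ` {..<s})) e y"
  and i: "s + e < i + CARD('v)" shows "Hvan s v i" proof -
 define v' where "v' = (%k. if k < s then v k else y (k - s))"
 have im: "v' ` {..<s + e} = v ` {..<s} Un y ` {..<e}" proof -
  have "(%j. s + j) ` {..<e} = {s..<s + e}" using image_add_atLeastLessThan[of s 0 e] by (simp add: lessThan_atLeast0 add.commute)
  hence "{..<s + e} = {..<s} Un (%j. s + j) ` {..<e}" by auto
  moreover have "v' ` (%j. s + j) ` {..<e} = y ` {..<e}" unfolding image_image by (simp add: v'_def)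
  moreover have "v' ` {..<s} = v ` {..<s}" by (auto simp: v'_def)
  ultimately show ?thesis by (simp add: image_Un)
 qed
 have "igen (igen (v ` {..<s}) Un y ` {..<e}) = igen (v' ` {..<s + e})" unfolding im idl.span_Un by (simp only: idl.span_span)
 hence 0: "Hvan (s + e) v' i" using y i by (intro depth_vanishing) (auto simp: sop_def)
 have hom: "EX d. v' k : homg tot d & (s <= k --> d > 0)" if "k < s + e" for k proof (cases "k < s")
  case True
  thus ?thesis using v[OF True] by (auto simp: v'_def)
 next
  case False
  hence "k - s < e" using that by simp
  thus ?thesis using y False by (auto simp: v'_def sop_def)
 qed
 define dg where "dg = (%k. SOME d. v' k : homg tot d & (s <= k --> d > 0))"
 have dg: "v' k : homg tot (dg k) & (s <= k --> dg k > 0)" if "k < s + e" for k unfolding dg_def by (rule someI_ex[OF hom[OF that]])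
 have "Hvan (s + (e - j)) v' i" if "j <= e" for j using that proof (induction j)
  case (Suc j)
  moreover have "Suc (s + (e - Suc j)) = s + (e - j)" using Suc.prems by simp
  ultimately have "Hvan (Suc (s + (e - Suc j))) v' i" by simp
  thus ?case by (rule Hvan_step[of _ _ _ dg]) (use dg Suc.prems in auto)
 qed (use 0 in simp)
 from this[of e] have "Hvan s v' i" by simp
 moreover have "Ctr s v' = Ctr s v" by (rule Ctr_cong) (simp add: v'_def)
 ultimately show ?thesis by (simp add: Hvan_def)
qed

subsection \<open>Koszul complexes with a relation\<close>

text \<open>The Koszul complex of a sequence with the relation sum T_k v_k = 0. The relation makes
  exterior multiplication by T anticommute with the differential. It is itself a cycle in degree 1,
  so vanishing is assumed only from degree 2 on.\<close>

locale twisted_koszul =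
 fixes n s :: nat and vr :: "nat => 'v" and v :: "nat => ('v, 'k::field) mpoly"
 assumes ns: "n <= s" and rel: "(SUM k<n. Var (vr k) * v k) = 0" and van: "!!i. 2 <= i ==> Hvan s v i"
begin

abbreviation "tau == Wed n (%k. Var (vr k))"
abbreviation "bd == Ctr s v"

lemma bd_tau: "bd (tau w) = - tau (bd w)" using Ctr_Wed_anticommute[OF ns, of v "%k. Var (vr k)" w] rel by (simp add: sc_linear add_eq_0_iff2)

lemma tau_local: "k < n ==> tau w = 0 ==> sc (Var (vr k)) w = tau (ctr k w)"
 using ctr_Wed_anticommute[of k n "%k. Var (vr k)" w] by (simp add: ctr_linear)

text \<open>Descending induction on i. A preimage w of z need not be killed by \<open>tau\<close>,
  but \<open>tau w\<close> is a cycle two degrees higher, hence locally a boundary of some u killed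
  by \<open>tau\<close>; contracting u gives the correction of w.\<close>

lemma local_exactness: assumes k: "k < n" and i: "2 <= i" and z: "z : Lam s i" "tau z = 0" "bd z = 0"
 shows "EX N. EX w:Lam s (Suc i). tau w = 0 & sc (Var (vr k)^N) z = bd w" using i z proof (induction "Suc s - i" arbitrary: i z rule: less_induct)
 case less
 show ?case proof (cases "s < i")
  case True
  hence "z = 0" using Lam_gt less.prems by blast
  thus ?thesis by (intro exI[of _ 0] bexI[of _ 0]) (simp_all only: sc_linear Wed_linear Ctr_linear Lam_closed simp_thms)
 next
  case False
  obtain w where w: "w : Lam s (Suc i)" "z = bd w" using van less.prems unfolding Hvan_def by blast
  have "bd (tau w) = 0" by (simp only: bd_tau w(2)[symmetric] less.prems minus_zero)
  moreover have "Suc s - Suc (Suc i) < Suc s - i" using False by linarith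
  ultimately obtain N u where
   u: "u : Lam s (Suc (Suc (Suc i)))" "tau u = 0" "sc (Var (vr k)^N) (tau w) = bd u"
   using less.hyps[of "Suc (Suc i)" "tau w"] less.prems(1) Wed_Lam[OF w(1) ns, of "%k. Var (vr k)"] Wed_Wed[of n "%k. Var (vr k)" w] by auto
  define w' where "w' = sc (Var (vr k)^Suc N) w + bd (ctr k u)"
  have "tau (bd (ctr k u)) = - bd (sc (Var (vr k)) u)" using bd_tau[of "ctr k u"] tau_local[OF k u(2)] by simp
  also have "... = - sc (Var (vr k)) (sc (Var (vr k)^N) (tau w))" by (simp only: Ctr_linear u(3))
  finally have "tau w' = 0" by (simp add: w'_def Wed_linear sc_linear)
  moreover have "w' : Lam s (Suc i)" unfolding w'_def by (intro Lam_closed w(1) Ctr_Lam ctr_Lam u(1))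
  moreover have "sc (Var (vr k)^Suc N) z = bd w'" by (simp only: w'_def Ctr_linear Ctr_Ctr w(2) add_0_right)
  ultimately show ?thesis by blast
 qed
qed

text \<open>The hypothesis is a one-cycle z with entry -F at r. Locally a boundary corrects z so
  that \<open>tau\<close> kills it, and then it is a multiple of the vector T, whose entry at r is
  zero because n <= r. So F is, up to a power, the entry at r of a boundary.\<close>

lemma nonzerodivisor_locally: assumes s: "s = Suc r" "n <= r" and k: "k < n" and F: "v r * F : igen (v ` {..<r})"
 shows "EX N. Var (vr k)^N*F : igen (v ` {..<r})" proof -
 obtain c where c: "v r * F = (SUM j<r. c j * v j)" using F igen_image[of "{..<r}" _ v] by auto
 define z where "z = one_form s (%j. if j < r then c j else - F)"
 have zL: "z : Lam s 1" unfolding z_def by (rule one_form)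
 have "(SUM k<s. v k * z {k}) = 0" unfolding s using c by (simp add: z_def s one_form mult.commute)
 hence bz: "bd z = 0" by (simp add: Ctr_Lam1[OF zL]) (simp add: unit_form_def fun_eq_iff)
 have "tau z : Lam s 2" using Wed_Lam[OF zL ns] by (simp add: numeral_2_eq_2)
 moreover have "bd (tau z) = 0" by (simp only: bd_tau bz Wed_linear minus_zero)
 ultimately obtain N w where w: "w : Lam s 3" "tau w = 0" "sc (Var (vr k)^N) (tau z) = bd w"
  using local_exactness[OF k _ _ Wed_Wed, of 2 z] by (auto simp: numeral_3_eq_3 numeral_2_eq_2)
 define y where "y = sc (Var (vr k)^Suc N) z + bd (ctr k w)"
 have cw: "ctr k w : Lam s 2" using w(1) ctr_Lam[of w s 2 k] by (simp add: numeral_3_eq_3 numeral_2_eq_2)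
 have yL: "y : Lam s 1" unfolding y_def using Ctr_Lam[of "ctr k w" s 1] cw by (intro Lam_closed zL) (simp add: numeral_2_eq_2)
 have "tau (bd (ctr k w)) = - bd (sc (Var (vr k)) w)" using bd_tau[of "ctr k w"] tau_local[OF k w(2)] by simp
 also have "... = - sc (Var (vr k)) (sc (Var (vr k)^N) (tau z))" by (simp only: Ctr_linear w(3))
 finally have "tau y = 0" by (simp add: y_def Wed_linear sc_linear)
 hence "sc (Var (vr k)) y = tau (ctr k y)" by (rule tau_local[OF k])
 hence "Var (vr k)*y {r} = tau (ctr k y) {r}" by (simp add: sc_def fun_eq_iff)
 also have "ctr k y : Lam s 0" using ctr_Lam[of y s 0] yL by simp
 hence "ctr k y = unit_form (ctr k y {})" by (auto simp: Lam_0_iff unit_form_def fun_eq_iff)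
 hence "tau (ctr k y) {r} = one_form n (%j. Var (vr j)*ctr k y {}) {r}" by (metis Wed_unit_form)
 also have "... = 0" using s by (auto simp: one_form_def)
 finally have "y {r} = 0" using Var_power_cancel[of "vr k" 1 "y {r}"] by simp
 hence "Var (vr k)^Suc N * F = bd (ctr k w) {r}" by (simp add: y_def z_def sc_def one_form s add_eq_0_iff)
 also have "... = (SUM j<r. ctr j (ctr k w) {r} * v j)" by (simp add: Ctr_def s mult.commute) (simp add: ctr_def)
 also have "... : igen (v ` {..<r})" by (auto simp: igen_image)
 finally show ?thesis by blast
qed

end

subsection \<open>Torsion with respect to the variables of the relation\<close>

lemma vdiv_homg: assumes "F : homg wt a" "wt i = 1" shows "M <= a ==> vdiv i M F : homg wt (a - M)" "a < M ==> vdiv i M F = 0" proof -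
 have *: "wdeg wt m + M = a" if "lk (vdiv i M F) m ~= 0" for m using that assms by (force simp: lookup_vdiv homg_iff wdeg_add)
 show "M <= a ==> vdiv i M F : homg wt (a - M)" unfolding homg_iff using * by (metis add_diff_cancel_right')
 show "a < M ==> vdiv i M F = 0" by (rule pm_eqI) (use * in force)
qed

lemma vrem_homg: "F : homg wt a ==> vrem i M F : homg wt a" by (auto simp: homg_iff lookup_vrem)

text \<open>The coefficients allowed at I in weight d when each basis vector of index below n has
  weight 1; the second conjunct is the case of negative weight.\<close>

definition wdg :: "nat => nat => nat set => ('v => nat) => ('v, 'a::comm_ring_1) mpoly set" where
 "wdg d n I wt = {F. (card (I Int {..<n}) <= d --> F : homg wt (d - card (I Int {..<n}))) & (d < card (I Int {..<n}) --> F = 0)}"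

text \<open>The weight is the T-degree. It is needed because top local cohomology in T lives in
  weights at most -n, and a weight count is what excludes it.\<close>

locale twisted_koszul_graded = twisted_koszul n s vr v
 for n s :: nat and vr :: "nat => 'v" and v :: "nat => ('v, 'k::field) mpoly" +
 fixes wt :: "'v => nat" assumes inj: "inj_on vr {..<n}" and n3: "3 <= n" and wt: "!!i. wt i = (if i : vr ` {..<n} then 1 else 0)"
  and v_homg: "!!k. k < s ==> v k : homg wt (if k < n then 1 else 0)"
begin

abbreviation "dgn == %k. if k < n then 1 else 0 :: nat"

lemma Var_homg: "k < n ==> (Var (vr k)^N :: ('v, 'k) mpoly) : homg wt N" using homg_power[OF homg_Var[of "vr k" wt], of N] wt by simp

lemma tau_weights: "k < n ==> (Var (vr k) :: ('v, 'k) mpoly) : homg wt 1 & dgn k + 1 = 2" using Var_homg[of k 1] by simp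

lemma homgD: "F : homg wt d ==> lk F m ~= 0 ==> wdeg wt m = d" by (auto simp: homg_iff)

lemma sum_dgn: "finite I ==> sum dgn I = card (I Int {..<n})" by (simp add: sum.If_cases Collect_conj_eq lessThan_def)

definition HZ :: "nat => (nat set => ('v, 'k) mpoly) set" where
 "HZ d = {z. wcomp wt dgn d z = z}"

lemma HZ_closed: "0 : HZ d" "a : HZ d ==> b : HZ d ==> a - b : HZ d" "a : HZ d ==> - a : HZ d" by (simp_all only: HZ_def mem_Collect_eq wcomp_linear)

text \<open>One unit of weight comes from the variable and one from the basis vector.\<close>

lemma HZ_tau: "z : Lam s i ==> z : HZ d ==> tau z : HZ (d + 2)" proof -
 assume z: "z : Lam s i" "z : HZ d"
 have "wcomp wt dgn (d + 2) (tau z) = tau (wcomp wt dgn d z)" by (rule wcomp_Wed[OF tau_weights z(1)])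
 thus ?thesis using z(2) by (simp add: HZ_def)
qed

lemma wcomp_bd: "z : Lam s i ==> wcomp wt dgn d (bd z) = bd (wcomp wt dgn d z)" by (rule wcomp_Ctr[OF v_homg])

lemma HZ_bd: "z : Lam s i ==> z : HZ d ==> bd z : HZ d" by (simp add: HZ_def wcomp_bd)

lemma HZ_sc: "r : homg wt e ==> z : HZ d ==> sc r z : HZ (d + e)" by (simp add: HZ_def wcomp_sc)

lemma HZ_iff: assumes "z : Lam s i" shows "z : HZ d \<longleftrightarrow> (ALL I. I <= {..<s} --> z I : wdg d n I wt)" proof -
 have e: "(wcomp wt dgn d z I = z I) \<longleftrightarrow> (I <= {..<s} --> z I : wdg d n I wt)" for I proof (cases "I <= {..<s}")
  case True
  hence fin: "finite I" by (rule finite_subset) simp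
  have "hcomp wt a F = F \<longleftrightarrow> F : homg wt a" for a and F :: "('v, 'k) mpoly"
   using hcomp_homg[of wt a F] hcomp_of_homg[of F wt a a] by metis
  thus ?thesis using True by (auto simp: wcomp_def sum_dgn[OF fin] wdg_def)
 next
  case False
  hence "z I = 0" using assms by (auto simp: Lam_def)
  with False show ?thesis by (simp add: wcomp_def)
 qed
 show ?thesis unfolding HZ_def mem_Collect_eq fun_eq_iff using e by simp
qed

lemma wdg_closed: "0 : wdg d n I wt" "F : wdg d n I wt ==> G : wdg d n I wt ==> F + G : wdg d n I wt"
  "F : wdg d n I wt ==> - F : wdg d n I wt" by (auto simp: wdg_def intro: homg_add homg_minus)

lemma wdg_vdiv: "k < n ==> F : wdg (d + M) n I wt ==> vdiv (vr k) M F : wdg d n I wt" proof -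
 assume k: "k < n" and F: "F : wdg (d + M) n I wt"
 have w: "wt (vr k) = 1" using k wt by simp
 show ?thesis proof (cases "card (I Int {..<n}) <= d + M")
  case True
  thus ?thesis using F w vdiv_homg(1)[of F wt "d + M - card (I Int {..<n})" "vr k" M]
   vdiv_homg(2)[of F wt "d + M - card (I Int {..<n})" "vr k" M] by (cases "card (I Int {..<n}) <= d") (auto simp: wdg_def)
 next
  case False
  thus ?thesis using F by (simp add: wdg_def)
 qed
qed

lemma wdg_vrem: "F : wdg d n I wt ==> vrem i M F : wdg d n I wt" by (auto simp: wdg_def vrem_homg)

text \<open>Each of the j Cech steps multiplies by M-th powers, which accounts for M*j; the
  remaining w is the weight in the limit.\<close>

definition CV :: "nat => nat => nat => nat => (nat set => nat set => ('v, 'k) mpoly) set" where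
 "CV w M j i = {c : CL n s j i. ALL A. c A : HZ (w + M*j)}"

lemma CV_Del: "c : CV w M j i ==> Del vr n M c : CV w M (Suc j) i" unfolding CV_def proof (intro CollectI conjI allI)
 fix A assume c: "c : {c : CL n s j i. ALL A. c A : HZ (w + M*j)}"
 show D: "Del vr n M c : CL n s (Suc j) i" using c by (auto intro: CL_Del)
 have h: "sc (Var (vr l)^M * sg l A) (if l : A then c (A - {l}) else 0) : HZ (w + M*j + M)" if "l < n" for l proof -
  have "(Var (vr l)^M * sg l A :: ('v, 'k) mpoly) : homg wt M"
   using Var_homg[OF that, of M] sg_cases[of l A, where 'a = "('v, 'k) mpoly"] by (auto intro: homg_minus)
  moreover have "(if l : A then c (A - {l}) else 0) : HZ (w + M*j)" using c HZ_closed by auto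
  ultimately show ?thesis by (rule HZ_sc)
 qed
 have eq: "Del vr n M c A = (SUM l<n. sc (Var (vr l)^M * sg l A) (if l : A then c (A - {l}) else 0))" proof -
  have "finite K ==> (SUM l:K. sc (Var (vr l)^M * sg l A) (if l : A then c (A - {l}) else 0)) I
   = (SUM l:K. (Var (vr l)^M * sg l A)*(if l : A then c (A - {l}) else 0) I)" for K I by (induction K rule: finite_induct) (auto simp: sc_def)
  thus ?thesis by (auto simp: Del_def fun_eq_iff)
 qed
 have sm: "sum f K : HZ d" if "!!l. l : K ==> f l : HZ d" for f K d using that proof (induction K rule: infinite_finite_induct)
  case (insert x F)
  hence "f x - (- sum f F) : HZ d" by (intro HZ_closed) auto
  with insert show ?case by (simp only: sum.insert diff_minus_eq_add not_False_eq_True)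
 qed (simp_all only: sum.infinite sum.empty HZ_closed not_False_eq_True)
 have "Del vr n M c A : HZ (w + M*j + M)" unfolding eq by (rule sm) (use h in auto)
 thus "Del vr n M c A : HZ (w + M*Suc j)" by (simp add: algebra_simps)
qed

text \<open>Below the top, exactness holds in every weight. At the top, j + 1 = n, the obstruction
  has weight at most -n; basis vectors use up at most i of the weight w, so i < w + n excludes
  it.\<close>

lemma Del_exact: assumes M: "M > 0" and c: "c : CV w M (Suc j) i" and d: "Del vr n M c = 0" and le: "i < w + Suc j"
 shows "EX y:CV w M j i. c = Del vr n M y" proof -
 have cL: "c : CL n s (Suc j) i" "!!A. c A : HZ (w + M*Suc j)" using c by (auto simp: CV_def)
 hence cA: "c A : Lam s i" for A by (simp add: CL_def)
 have hz: "I <= {..<s} ==> c A I : wdg (w + M*j + M) n I wt" for A I using cL(2)[of A] HZ_iff[OF cA, of A] by (simp add: algebra_simps)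
 define G where "G = (%r I A. {F :: ('v, 'k) mpoly. (F ~= 0 --> A <= {..<n} & card A = r & I <= {..<s} & card I = i) & F : wdg (w + M*r) n I wt})"
 have "EX y. (ALL A. y A : G j I A) & (%A. c A I) = Wed n (%k. Var (vr k)^M) y" for I proof (rule koszul_powers[where G = "G (Suc j) I", OF inj])
  show "Wed n (%k. Var (vr k)^M) (%A. c A I) = 0" proof
   fix A show "Wed n (%k. Var (vr k)^M) (%A. c A I) A = 0 A"
    unfolding Del_apply[symmetric] d by simp
  qed
  show "c A I : G (Suc j) I A" for A proof (cases "c A I = 0")
   case False
   hence "c A ~= 0" by auto
   with False show ?thesis using cL(1) hz[of I A] by (auto simp: CL_def Lam_def G_def algebra_simps)
  qed (simp add: G_def wdg_closed)
  fix A k F assume "k < n" "k ~: A" "F : G (Suc j) I (insert k A)"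
  thus "vdiv (vr k) M F : G j I A" using finite_subset[of A "{..<n}"] wdg_vdiv[of k F "w + M*j" M I]
   by (cases "F = 0") (auto simp: G_def wdg_closed algebra_simps)
 next
  show "vrem (vr k) M F : G (Suc j) I A" if "F : G (Suc j) I A" for A k F using that wdg_vrem by (cases "F = 0") (auto simp: G_def)
 next
  fix A assume "{..<n} <= A" "c A I ~= 0"
  moreover from this(2) have "c A ~= 0" by auto
  ultimately have I: "I <= {..<s}" "card I = i" and "A = {..<n}" "card A = Suc j" using cA[of A] cL(1) by (auto simp: Lam_def CL_def)
  hence nj: "Suc j = n" by simp
  have "finite I" using I(1) finite_subset by blast
  hence "card (I Int {..<n}) <= i" using I(2) card_mono[of I "I Int {..<n}"] by auto
  hence ge: "w + M*n - card (I Int {..<n}) > n*(M - 1)" "card (I Int {..<n}) <= w + M*n" using le nj M by (cases M; simp add: algebra_simps)+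
  have "c A I : homg wt (w + M*n - card (I Int {..<n}))" using hz[OF I(1), of A] nj ge(2) by (auto simp: wdg_def algebra_simps)
  thus "vrems vr M n (c A I) = 0" using ge(1) by (intro vrems_eq_0[OF inj wt]) (auto dest: homgD)
 qed (auto simp: G_def wdg_closed)
 then obtain y where y: "!!I A. y I A : G j I A" "!!I. (%A. c A I) = Wed n (%k. Var (vr k)^M) (y I)" by metis
 have y': "A <= {..<n} & card A = j & I <= {..<s} & card I = i" if "y I A ~= 0" for I A using y(1)[of I A] that by (simp add: G_def)
 have yL: "(%A I. y I A) : CL n s j i" unfolding CL_def Lam_def by (auto simp: fun_eq_iff dest!: y')
 hence "(%I. y I A) : Lam s i" for A by (auto simp: CL_def)
 from HZ_iff[OF this] have "(%I. y I A) : HZ (w + M*j)" for A using y(1)[of _ A] by (auto simp: G_def)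
 with yL have "(%A I. y I A) : CV w M j i" by (simp add: CV_def)
 moreover have "c = Del vr n M (%A I. y I A)" by (intro ext) (simp add: Del_apply y(2)[symmetric])
 ultimately show ?thesis by blast
qed

lemma Del_injective: assumes c: "c : CV w M 0 i" and d: "Del vr n M c = 0" shows "c = 0" proof -
 have *: "c = (%A. if A = {} then c {} else 0)" proof
  fix A show "c A = (if A = {} then c {} else 0)"
   using c finite_subset[of A "{..<n}"] by (auto simp: CV_def CL_iff card_eq_0_iff)
 qed
 have "Del vr n M (%A. if A = {} then c {} else 0) {0} = 0" using d * by (metis zero_fun_apply)
 hence "sc (Var (vr 0)^M) (c {}) = 0" using Del_single[of 0 n vr M "c {}"] n3 by simp
 hence c0: "c {} = 0" using Var_power_cancel[of "vr 0" M "c {} _"] by (auto simp: sc_def fun_eq_iff)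
 show ?thesis proof
  fix A show "c A = 0 A" using fun_cong[OF *, of A] c0 by (cases "A = {}") auto
 qed
qed

text \<open>Exterior multiplication by the variables is exact except at the top, where the
  obstruction sits in weight n; the last hypothesis avoids it.\<close>

lemma tau_exact: assumes z: "z : Lam s (Suc i)" "tau z = 0" "z : HZ (d + 2)" and d: "Suc i < n \<or> n < d + 2"
 shows "EX y:Lam s i. y : HZ d & z = tau y" proof -
 have hz: "I <= {..<s} ==> z I : wdg (d + 2) n I wt" for I using z(3) unfolding HZ_iff[OF z(1)] by simp
 define G where "G = (%i e I. {F :: ('v, 'k) mpoly. (F ~= 0 --> I <= {..<s} & card I = i) & F : wdg e n I wt})"
 have "EX y. (ALL I. y I : G i d I) & z = Wed n (%k. Var (vr k)^1) y" proof (rule koszul_powers[where G = "G (Suc i) (d + 2)", OF inj])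
  show "Wed n (%k. Var (vr k)^1) z = 0" using z(2) by simp
  show "z I : G (Suc i) (d + 2) I" for I using z(1) hz[of I] by (cases "z I = 0") (auto simp: G_def Lam_def wdg_closed)
  fix I k F assume *: "k < n" "k ~: I" "F : G (Suc i) (d + 2) (insert k I)"
  show "vdiv (vr k) 1 F : G i d I" proof (cases "F = 0")
   case False
   hence I: "insert k I <= {..<s}" "card (insert k I) = Suc i" "F : wdg (d + 2) n (insert k I) wt" using *(3) by (auto simp: G_def)
   hence fin: "finite I" using finite_subset[of I "{..<s}"] by simp
   have "insert k I Int {..<n} = insert k (I Int {..<n})" using * by auto
   hence ci: "card (insert k I Int {..<n}) = Suc (card (I Int {..<n}))" using fin *(2) by simp
   have "F : wdg (d + 1) n I wt" using I(3) by (auto simp: wdg_def ci)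
   hence "vdiv (vr k) 1 F : wdg d n I wt" by (rule wdg_vdiv[OF *(1)])
   thus ?thesis using I fin *(2) by (auto simp: G_def)
  qed (simp add: G_def wdg_closed)
 next
  show "vrem (vr k) 1 F : G (Suc i) (d + 2) I" if "F : G (Suc i) (d + 2) I" for I k F using that wdg_vrem by (cases "F = 0") (auto simp: G_def)
 next
  fix I assume z0: "{..<n} <= I" "z I ~= 0"
  hence I: "I <= {..<s}" "card I = Suc i" using z(1) by (auto simp: Lam_def)
  hence "finite I" using finite_subset by blast
  hence "n <= Suc i" using I(2) z0 card_mono[of I "{..<n}"] by simp
  hence "n < d + 2" using d by simp
  moreover have "I Int {..<n} = {..<n}" using z0 by blast
  ultimately have "z I : homg wt (d + 2 - n)" using hz[OF I(1)] by (auto simp: wdg_def)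
  thus "vrems vr 1 n (z I) = 0" using `n < d + 2` by (intro vrems_eq_0[OF inj wt]) (auto dest: homgD)
 qed (auto simp: G_def wdg_closed)
 then obtain y where y: "!!I. y I : G i d I" "z = tau y" by auto
 have yL: "y : Lam s i" using y(1) by (auto simp: Lam_def G_def)
 moreover have "y : HZ d" using y(1) by (auto simp: HZ_iff[OF yL] G_def)
 ultimately show ?thesis using y(2) by blast
qed

lemma CV_sub: "a : CV w M j i ==> b : CV w M j i ==> a - b : CV w M j i" by (auto simp: CV_def CL_sub HZ_closed)

text \<open>A preimage y0 under \<open>Del\<close> is corrected to be killed by \<open>tau\<close>.
  The family \<open>tau\<close> y0 has Cech degree one lower than z, Koszul degree one higher and
  weight two higher, and the equation w + j = b + 1 + i is preserved.\<close>

lemma tau_closed_exact: assumes M: "M > 0" and b: "b > 0"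
 shows "w + j = b + 1 + i ==> z : CV w M j i ==> Del vr n M z = 0 ==> (!!A. tau (z A) = 0) ==>
  (j = 0 --> z = 0) & (ALL j'. j = Suc j' --> (EX y:CV w M j' i. (ALL A. tau (y A) = 0) & z = Del vr n M y))" proof (induction j arbitrary: w i z)
 case 0
 show ?case proof (intro conjI allI impI)
  show "z = 0" by (rule Del_injective[OF 0(2,3)])
 qed simp
next
 case (Suc j)
 obtain y0 where y0: "y0 : CV w M j i" "z = Del vr n M y0" using Del_exact[OF M Suc.prems(2,3)] Suc.prems(1) by auto
 define ty where "ty = (%A. tau (y0 A))"
 have tyC: "ty : CV (w + 2) M j (Suc i)" proof -
  have y: "y0 A : Lam s i" "y0 A : HZ (w + M*j)" "~ (A <= {..<n} & card A = j) --> y0 A = 0" for A using y0(1) by (auto simp: CV_def CL_iff)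
  have "ty A : Lam s (Suc i)" for A unfolding ty_def by (rule Wed_Lam[OF y(1) ns])
  moreover have "ty A : HZ (w + 2 + M*j)" for A unfolding ty_def using HZ_tau[OF y(1,2), of A] by (simp add: algebra_simps)
  moreover have "~ (A <= {..<n} & card A = j) --> ty A = 0" for A
   using y(3)[of A] Wed_linear(4)[of n "%k. Var (vr k) :: ('v, 'k) mpoly"] by (auto simp: ty_def)
  ultimately show ?thesis unfolding CV_def CL_iff by blast
 qed
 have Dty: "Del vr n M ty = 0" proof
  fix A
  have "Del vr n M ty A = tau (z A)" unfolding ty_def y0(2) by (rule Wed_Del[symmetric])
  thus "Del vr n M ty A = 0 A" using Suc.prems(4) by (metis zero_fun_apply)
 qed
 have IH: "(j = 0 --> ty = 0) & (ALL j'. j = Suc j' --> (EX y:CV (w + 2) M j' (Suc i). (ALL A. tau (y A) = 0) & ty = Del vr n M y))"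
  by (rule Suc.IH[OF _ tyC Dty]) (use Suc.prems(1) in "auto simp: ty_def Wed_Wed")
 have fin: ?case if "EX y:CV w M j i. (ALL A. tau (y A) = 0) & z = Del vr n M y" proof (intro conjI allI impI)
  fix j' assume "Suc j = Suc j'"
  thus "EX y:CV w M j' i. (ALL A. tau (y A) = 0) & z = Del vr n M y" using that by (simp only: nat.inject)
 qed simp
 show ?case proof (cases j)
  case 0
  hence "ty A = 0" for A using IH by (metis zero_fun_apply)
  hence "EX y:CV w M 0 i. (ALL A. tau (y A) = 0) & z = Del vr n M y" using y0 0 unfolding ty_def by blast
  thus ?thesis using fin 0 by blast
 next
  case (Suc j')
  then obtain y1 where y1: "y1 : CV (w + 2) M j' (Suc i)" "ALL A. tau (y1 A) = 0" "ty = Del vr n M y1" using IH by blast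
  have "EX y:Lam s i. y : HZ (w + M*j') & y1 A = tau y" for A proof (rule tau_exact)
   show "y1 A : Lam s (Suc i)" "tau (y1 A) = 0" using y1 by (auto simp: CV_def CL_def)
   have "y1 A : HZ (w + 2 + M*j')" using y1(1) by (auto simp: CV_def)
   thus "y1 A : HZ (w + M*j' + 2)" by (simp add: algebra_simps)
   \<comment> \<open>If Suc i >= n, then b > 0 pushes the weight above n, so
     \<open>tau_exact\<close> applies in either case.\<close>
   have "j' <= M*j'" using M by simp
   hence "i + b <= w + M*j' + 1" using Suc.prems(1) Suc by linarith
   thus "Suc i < n \<or> n < w + M*j' + 2" using b by linarith
  qed
  then obtain y2 where y2: "!!A. y2 A : Lam s i" "!!A. y2 A : HZ (w + M*j')" "!!A. y1 A = tau (y2 A)" by metis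
  define y3 where "y3 = (%A. if y1 A = 0 then 0 else y2 A)"
  have y3: "y3 : CV w M j' i" "!!A. y1 A = tau (y3 A)" using y1(1) y2 by (auto simp: CV_def CL_def y3_def Wed_linear HZ_closed Lam_closed)
  define y where "y = y0 - Del vr n M y3"
  have "tau (y A) = ty A - Del vr n M (%A. tau (y3 A)) A" for A proof -
   have "y A = y0 A - Del vr n M y3 A" unfolding y_def by (rule minus_apply)
   thus ?thesis by (simp only: Wed_linear Wed_Del ty_def)
  qed
  hence "tau (y A) = 0" for A by (simp add: y3(2)[symmetric] y1(3))
  moreover have "y : CV w M j i" unfolding y_def Suc by (rule CV_sub[OF _ CV_Del[OF y3(1)]]) (use y0(1) Suc in simp)
  moreover have "z = Del vr n M y" unfolding y_def Del_diff by (simp only: Del_Del y0(2) diff_0_right)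
  ultimately show ?thesis by (intro fin) blast
 qed
qed

lemma HZ_local_exactness: assumes z: "z : Lam s i" "z : HZ d" "tau z = 0" "bd z = 0" and k: "k < n" and i: "2 <= i"
 shows "EX N. EX w:Lam s (Suc i). w : HZ (d + N) & tau w = 0 & sc (Var (vr k)^N) z = bd w" proof -
 obtain N w where w: "w : Lam s (Suc i)" "tau w = 0" "sc (Var (vr k)^N) z = bd w" using local_exactness[OF k i z(1,3,4)] by blast
 have "sc (Var (vr k)^N) z : HZ (d + N)" by (rule HZ_sc[OF Var_homg[OF k] z(2)])
 hence "sc (Var (vr k)^N) z = bd (wcomp wt dgn (d + N) w)" using wcomp_bd[OF w(1), of "d + N"] by (simp add: HZ_def w(3))
 moreover have "tau (wcomp wt dgn (d + N) w) = wcomp wt dgn (d + N + 2) (tau w)" by (rule wcomp_Wed[OF tau_weights w(1), symmetric])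
 moreover have "wcomp wt dgn (d + N) w : HZ (d + N)" by (simp add: HZ_def wcomp_wcomp)
 ultimately show ?thesis using wcomp_Lam[OF w(1)] w(2) by (metis wcomp_linear(4))
qed

text \<open>Local expressions of F by the v_j differ by one-cycles, which need not be boundaries.
  After \<open>tau\<close> is applied the local lifts lie in degree 2 of the subcomplex killed by
  \<open>tau\<close>, where lifting is possible. The global lift y of -tau F has the form tau x, and
  this gives F = bd x.\<close>

theorem torsion_free: assumes F: "F : homg wt b" "b > 0" and t: "!!k. k < n ==> EX N. Var (vr k)^N*F : igen (v ` {..<s})"
 shows "F : igen (v ` {..<s})" proof -
 have "EX M>0. ALL k<n. Var (vr k)^M*F : igen (v ` {..<s})" proof -
  obtain N where N: "!!k. k < n ==> Var (vr k)^N k * F : igen (v ` {..<s})" using t by metis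
  have "Var (vr k)^Suc (SUM k<n. N k)*F : igen (v ` {..<s})" if "k < n" for k proof -
   have "N k <= (SUM k<n. N k)" using that by (intro member_le_sum) auto
   hence e: "Suc (SUM k<n. N k) = (Suc (SUM k<n. N k) - N k) + N k" by simp
   show ?thesis by (subst e) (simp only: power_add mult.assoc idl.span_scale[OF N[OF that]])
  qed
  thus ?thesis by blast
 qed
 then obtain M where M: "M > 0" "!!k. k < n ==> Var (vr k)^M*F : igen (v ` {..<s})" by blast
 hence "ALL k. EX c. k < n --> Var (vr k)^M*F = (SUM j<s. c j * v j)" using igen_image[of "{..<s}" _ v] by auto
 then obtain a where a: "!!k. k < n ==> Var (vr k)^M*F = (SUM j<s. a k j * v j)" unfolding choice_iff by blast
 define al where "al = (%k. wcomp wt dgn (b + M) (one_form s (a k)))"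
 have alL: "al k : Lam s 1" and alH: "al k : HZ (b + M)" for k unfolding al_def by (rule wcomp_Lam[OF one_form(1)], simp add: HZ_def wcomp_wcomp)
 have uH: "G : homg wt e ==> unit_form G : HZ e" for G e by (auto simp: HZ_def wcomp_def unit_form_def fun_eq_iff hcomp_of_homg)
 have bal: "bd (al k) = unit_form (Var (vr k)^M*F)" if "k < n" for k proof -
  have "bd (one_form s (a k)) = unit_form (SUM j<s. v j * one_form s (a k) {j})" by (rule Ctr_Lam1[OF one_form(1)])
  also have "(SUM j<s. v j * one_form s (a k) {j}) = Var (vr k)^M*F"
   unfolding a[OF that] by (intro sum.cong refl) (simp add: one_form(2) mult.commute)
  finally have e: "bd (one_form s (a k)) = unit_form (Var (vr k)^M*F)" .
  have "Var (vr k)^M*F : homg wt (b + M)" using homg_mult[OF Var_homg[OF that] F(1), of M] by (simp add: add.commute)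
  from uH[OF this] show ?thesis unfolding al_def using wcomp_bd[OF one_form(1), of "b + M" "a k"] e by (simp add: HZ_def)
 qed
 define z where "z = - tau (unit_form F)"
 have "EX N. EX y:{y : CV (b + 2) (M + N) 0 2. ALL A. tau (y A) = 0}. z = bd (y {})"
 proof (rule cech_start[of n s v "%k. tau (al k)" vr M z "%N. {y : CV (b + 2) (M + N) 0 2. ALL A. tau (y A) = 0}"])
  show "0 < n" using n3 by simp
  show "bd (tau (al k)) = sc (Var (vr k)^M) z" if "k < n" for k proof -
   have "unit_form (Var (vr k)^M*F) = sc (Var (vr k)^M) (unit_form F)" by (auto simp: unit_form_def sc_def)
   thus ?thesis unfolding z_def bd_tau bal[OF that] by (simp only: Wed_linear sc_linear)
  qed
  fix c assume c: "c = (%A. if EX k<n. A = {k} then tau (al (the_elem A)) else 0)" "Bd s v (Del vr n M c) = 0"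
  \<comment> \<open>The double complex is restricted to families killed by \<open>tau\<close>; b + 2
    is the weight of \<open>tau\<close> applied to F.\<close>
  define CC where "CC = (%M' j i. {c : CV (b + 2) M' j i. M' > 0 & (ALL A. tau (c A) = 0)})"
  have "c : CC M (Suc 0) (Suc 0 + 1)" proof -
   have t: "tau (al k) : Lam s 2" "tau (al k) : HZ (b + 2 + M)" for k
    using Wed_Lam[OF alL ns] HZ_tau[OF alL alH] by (auto simp: numeral_2_eq_2 algebra_simps)
   have "c A : Lam s 2 & c A : HZ (b + 2 + M) & tau (c A) = 0 & (c A ~= 0 --> A <= {..<n} & card A = 1)" for A
    unfolding c(1) using t by (auto simp: Lam_closed HZ_closed Wed_Wed Wed_linear)
   thus ?thesis using M(1) by (simp add: CC_def CV_def CL_def numeral_2_eq_2)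
  qed
  have "EX N. EX y:CC (M + N) 0 (Suc 0 + 1). Bd s v (raise vr n N c) = Bd s v (Del vr n (M + N) y)" proof (rule cech_claim[where CC = CC])
   show "c : CC M (Suc 0) (Suc 0 + 1)" by fact
   show "Bd s v (Del vr n M c) = 0" by fact
   fix M' j and c :: "nat set => nat set => ('v, 'k) mpoly"
   { assume c: "c : CC M' (Suc j) (Suc j + 1)" "Del vr n M' c = 0"
    thus "EX y:CC M' j (Suc j + 1). c = Del vr n M' y" using tau_closed_exact[of M' b "b + 2" "Suc j" "Suc j + 1" c] F(2) by (auto simp: CC_def) }
   assume c: "c : CC M' (Suc (Suc j)) (Suc j + 1)" "Bd s v c = 0"
   have "EX N. EX w:Lam s (Suc (Suc j + 1)). w : HZ (b + 2 + M'*Suc (Suc j) + N) & tau w = 0 & sc (Var (vr k)^N) (c A) = bd w" if "k < n" for k A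
    by (rule HZ_local_exactness) (use c that in "auto simp: CC_def CV_def CL_def Bd_def fun_eq_iff")
   then obtain N w where Nw: "!!k A. k < n ==> w k A : Lam s (Suc (Suc j + 1)) & w k A : HZ (b + 2 + M'*Suc (Suc j) + N k A)
     & tau (w k A) = 0 & sc (Var (vr k)^N k A) (c A) = bd (w k A)" by metis
   define k where "k = (%A :: nat set. SOME k. k : A)"
   \<comment> \<open>K is one exponent that serves all A and k at once.\<close>
   define K where "K = (SUM A:Pow {..<n}. SUM k<n. N k A)"
   define c' where "c' = (%A. if c A = 0 then 0 else
     sc (PROD l:A Int {..<n} - {k A}. Var (vr l)^K) (sc (Var (vr (k A))^(K - N (k A) A)) (w (k A) A)))"
   have A: "A <= {..<n} & card A = Suc (Suc j) & k A : A & k A < n & N (k A) A <= K" if "c A ~= 0" for A proof -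
    have 1: "A <= {..<n}" "card A = Suc (Suc j)" using c(1) that by (auto simp: CC_def CV_def CL_def)
    hence "A ~= {}" by auto
    hence 2: "k A : A" by (auto simp: k_def intro: someI)
    with 1 have 3: "k A < n" by auto
    have "N (k A) A <= (SUM k<n. N k A)" using 3 by (intro member_le_sum[of _ _ "%k. N k A"]) auto
    also have "... <= K" unfolding K_def using 1 by (intro member_le_sum[of _ _ "%A. SUM k<n. N k A"]) auto
    finally show ?thesis using 1 2 3 by blast
   qed
   have hc': "c' A : Lam s (Suc (Suc j + 1)) & c' A : HZ (b + 2 + (M' + K)*Suc (Suc j)) & tau (c' A) = 0 &
     (c' A ~= 0 --> A <= {..<n} & card A = Suc (Suc j)) & raise vr n K c A = Bd s v c' A" for A proof (cases "c A = 0")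
    case True
    thus ?thesis by (simp add: c'_def Lam_closed HZ_closed Wed_linear raise_def Bd_def Ctr_linear sc_linear)
   next
    case False
    note a = A[OF False] and w = Nw[OF A[OF False, THEN conjunct2, THEN conjunct2, THEN conjunct2, THEN conjunct1], of A]
    have fin: "finite A" using a finite_subset by blast
    have AI: "A Int {..<n} = A" using a by blast
    note hV = Var_homg
    have hP: "(PROD l:A - {k A}. Var (vr l)^K :: ('v, 'k) mpoly) : homg wt (SUM l:A - {k A}. K)" by (rule homg_prod) (use fin a hV in auto)
    have "sc (PROD l:A - {k A}. Var (vr l)^K) (sc (Var (vr (k A))^(K - N (k A) A)) (w (k A) A))
      : HZ (b + 2 + M'*Suc (Suc j) + N (k A) A + (K - N (k A) A) + (SUM l:A - {k A}. K))" by (rule HZ_sc[OF hP HZ_sc[OF hV]]) (use w a in auto)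
    also have "b + 2 + M'*Suc (Suc j) + N (k A) A + (K - N (k A) A) + (SUM l:A - {k A}. K) = b + 2 + (M' + K)*Suc (Suc j)"
     using a fin by (simp add: algebra_simps)
    finally have "c' A : HZ (b + 2 + (M' + K)*Suc (Suc j))" by (simp only: c'_def False if_False AI)
    moreover have "raise vr n K c A = Bd s v c' A" proof -
     have "(PROD l:A. Var (vr l)^K) = (PROD l:A - {k A}. Var (vr l)^K)*(Var (vr (k A))^K :: ('v, 'k) mpoly)"
      using a fin by (subst prod.remove[of _ "k A"]) (auto simp: mult.commute)
     also have "Var (vr (k A))^K = (Var (vr (k A))^(K - N (k A) A)*Var (vr (k A))^N (k A) A :: ('v, 'k) mpoly)" using a by (simp flip: power_add)
     finally have e: "(PROD l:A. Var (vr l)^K) = (PROD l:A - {k A}. Var (vr l)^K)*(Var (vr (k A))^(K - N (k A) A)*Var (vr (k A))^N (k A) A :: ('v, 'k) mpoly)" .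
     have Bc: "Bd s v c' A = sc (PROD l:A - {k A}. Var (vr l)^K) (sc (Var (vr (k A))^(K - N (k A) A)) (bd (w (k A) A)))"
      using False by (simp add: Bd_def c'_def AI Ctr_linear)
     have wN: "sc (Var (vr (k A))^N (k A) A) (c A) = bd (w (k A) A)" using w by blast
     show ?thesis unfolding raise_def AI e Bc wN[symmetric] sc_linear(5) mult.assoc ..
    qed
    ultimately show ?thesis using False a w by (simp add: c'_def Lam_closed Wed_linear) (simp add: sc_linear)
   qed
   hence "c' : CC (M' + K) (Suc (Suc j)) (Suc (Suc j) + 1)" using c(1) by (simp add: CC_def CV_def CL_def)
   moreover have "raise vr n K c = Bd s v c'" using hc' by (intro ext) metis
   ultimately show "EX N. EX c':CC (M' + N) (Suc (Suc j)) (Suc (Suc j) + 1). raise vr n N c = Bd s v c'" by blast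
  next
   fix M' N j i c assume c: "c : CC M' j i"
   show "Del vr n M' c : CC M' (Suc j) i" using c CV_Del by (auto simp: CC_def Wed_Del) (auto simp: Del_def Wed_linear fun_eq_iff intro!: sum.neutral)
   have "(PROD k:A Int {..<n}. Var (vr k)^N :: ('v, 'k) mpoly) : homg wt (N*j)" if "c A ~= 0" for A proof -
    have a: "A <= {..<n}" "card A = j" using c that by (auto simp: CC_def CV_def CL_def)
    have "(PROD k:A Int {..<n}. Var (vr k)^N :: ('v, 'k) mpoly) : homg wt (SUM k:A Int {..<n}. N * wt (vr k))"
     by (intro homg_prod homg_power homg_Var) auto
    also have "(SUM k:A Int {..<n}. N * wt (vr k)) = (SUM k:A. N)" using a by (intro sum.cong) (auto simp: wt)
    finally show ?thesis using a by (simp add: mult.commute)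
   qed
   hence "raise vr n N c A : HZ (b + 2 + (M' + N)*j)" for A using HZ_sc[of _ "N * j" "c A" "b + 2 + M'*j"] c
    by (cases "c A = 0") (auto simp: raise_def sc_linear HZ_closed CC_def CV_def algebra_simps)
   thus "raise vr n N c : CC (M' + N) j i" using c by (auto simp: CC_def CV_def CL_raise) (auto simp: raise_def Wed_linear sc_linear)
  next
   fix M' j i c assume c: "c : CC M' j (Suc i)"
   have "bd (c A) : HZ (b + 2 + M'*j)" for A by (rule HZ_bd[of _ "Suc i"]) (use c in "simp_all add: CC_def CV_def CL_def")
   moreover have "tau (bd (c A)) = 0" for A proof -
    have "tau (c A) = 0" using c by (simp add: CC_def)
    hence "tau (bd (c A)) = - bd 0" using bd_tau[of "c A"] by (metis minus_minus)
    thus ?thesis by (simp only: Ctr_linear minus_zero)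
   qed
   moreover have "Bd s v c : CL n s j i" using c by (simp add: CC_def CV_def CL_Bd)
   ultimately show "Bd s v c : CC M' j i" using c by (simp add: CC_def CV_def Bd_def)
  next
   fix M' j i a' b' assume "a' : CC M' j i" "b' : CC M' j i"
   thus "a' - b' : CC M' j i" by (simp add: CC_def CV_sub) (simp add: Wed_linear)
  next
   show "n < j ==> c = 0" if "c : CC M' j i" for M' j i c using that CL_big by (auto simp: CC_def CV_def)
  qed
  then obtain N y where y: "y : CC (M + N) 0 (Suc 0 + 1)" "Bd s v (raise vr n N c) = Bd s v (Del vr n (M + N) y)" by blast
  have "y A = 0" if "A ~= {}" for A using y(1) that finite_subset[of A "{..<n}"] by (auto simp: CC_def CV_def CL_iff card_eq_0_iff)
  moreover have "y : CV (b + 2) (M + N) 0 2" "ALL A. tau (y A) = 0" using y(1) by (simp_all add: CC_def numeral_2_eq_2)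
  ultimately show "EX N. EX y:{y : CV (b + 2) (M + N) 0 2. ALL A. tau (y A) = 0}. (ALL A. A ~= {} --> y A = 0) & Bd s v (raise vr n N c) = Bd s v (Del vr n (M + N) y)"
   using y(2) by blast
 qed
 then obtain N y where y: "y : CV (b + 2) (M + N) 0 2" "tau (y {}) = 0" "z = bd (y {})" by blast
 hence "y {} : Lam s (Suc 1)" "y {} : HZ (b + 2)" by (auto simp: CV_def CL_def numeral_2_eq_2)
 from tau_exact[OF this(1) y(2) this(2)] n3 obtain x where x: "x : Lam s 1" "y {} = tau x" by auto
 have "z = - tau (bd x)" using y(3) x(2) bd_tau by simp
 hence "tau (unit_form F) = tau (bd x)" by (simp add: z_def)
 also have "bd x = unit_form (SUM k<s. v k * x {k})" by (rule Ctr_Lam1[OF x(1)])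
 finally have "one_form n (%k. Var (vr k)*F) {0} = one_form n (%j. Var (vr j)*(SUM k<s. v k * x {k})) {0}" by (simp only: Wed_unit_form)
 hence "Var (vr 0)^1*(F - (SUM k<s. v k * x {k})) = 0" using n3 by (simp add: one_form(2) right_diff_distrib)
 from Var_power_cancel[OF this] have "F = (SUM k<s. x {k} * v k)" by (simp add: mult.commute)
 thus ?thesis by (auto simp: igen_image)
qed

end

section \<open>Localizations and the condition on the number of generators\<close>

lemma rng_simps [simp]: "carrier rng = UNIV" "x \<otimes>\<^bsub>rng\<^esub> y = x*y" "x \<oplus>\<^bsub>rng\<^esub> y = x + y" "\<one>\<^bsub>rng\<^esub> = 1" "\<zero>\<^bsub>rng\<^esub> = 0"
 by (simp_all add: ring_of_type_algebra_def)

lemma ring_rng: "ring (rng :: 'a::comm_ring_1 ring)" and cring_rng: "cring (rng :: 'a::comm_ring_1 ring)"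
 by (rule ring_from_type_algebra, rule cring_from_type_algebra)

lemma a_inv_rng: "\<ominus>\<^bsub>rng\<^esub> x = - (x :: 'a::comm_ring_1)" proof -
 interpret ring "rng :: 'a ring" by (rule ring_rng)
 show ?thesis using minus_equality[of "- x" x] by simp
qed

lemma ideal_rng_iff: "ideal I (rng :: 'a::comm_ring_1 ring) \<longleftrightarrow> isideal I" proof
 assume "ideal I (rng :: 'a ring)"
 then interpret ideal I "rng :: 'a ring" .
 show "isideal I" by (rule idl.subspaceI)
   (use additive_subgroup.zero_closed[OF additive_subgroup_axioms] additive_subgroup.a_closed[OF additive_subgroup_axioms] I_l_closed in auto)
next
 assume I: "isideal I"
 interpret ring "rng :: 'a ring" by (rule ring_rng)
 show "ideal I (rng :: 'a ring)" proof (rule idealI)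
  show "subgroup I (add_monoid (rng :: 'a ring))" proof -
   have inv: "inv\<^bsub>add_monoid rng\<^esub> x = - x" for x :: 'a using a_inv_rng[of x] unfolding a_inv_def .
   show ?thesis by (rule subgroup.intro) (use I inv[simplified] in "auto simp: ideal_0 ideal_add ideal_neg")
  qed
 qed (use I in "auto simp: ring_rng ideal_mult_l ideal_mult_r")
qed

lemma Idl_rng: "Idl\<^bsub>rng\<^esub> Z = igen Z" unfolding genideal_def ideal_rng_iff proof (rule antisym)
 show "\<Inter> {I. isideal I & Z <= I} <= igen Z" by (rule Inter_lower) (auto simp: igen_base)
 show "igen Z <= \<Inter> {I. isideal I & Z <= I}" by (rule Inter_greatest) (auto intro: igen_subset[THEN subsetD])
qed

lemma primeideal_rng_iff: "primeideal p (rng :: 'a::comm_ring_1 ring) \<longleftrightarrow> isprime p" proof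
 assume "primeideal p (rng :: 'a ring)"
 then interpret primeideal p "rng :: 'a ring" .
 show "isprime p" using I_prime I_notcarr one_imp_carrier ideal_axioms by (auto simp: isprime_def ideal_rng_iff)
next
 assume "isprime p"
 thus "primeideal p (rng :: 'a ring)" by (intro primeidealI) (auto simp: isprime_def ideal_rng_iff cring_rng)
qed

text \<open>The operations of \<open>localization\<close> are unions over all representatives; they
  are evaluated once the summands are known to agree.\<close>

lemma UN_pair_const: assumes "x : A" "y : B" "!!a s b t. (a, s) : A ==> (b, t) : B ==> g a s b t = K"
 shows "(UN (a, s):A. UN (b, t):B. g a s b t) = K" proof (rule antisym)
 show "(UN (a, s):A. UN (b, t):B. g a s b t) <= K" using assms(3) by auto
 obtain a s b t where xy: "x = (a, s)" "y = (b, t)" by (cases x; cases y)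
 hence "g a s b t = K" using assms by blast
 thus "K <= (UN (a, s):A. UN (b, t):B. g a s b t)" using assms(1,2) xy by (intro subsetI UN_I[of x] ; simp) (intro bexI[of _ y]; simp)
qed

section \<open>Localization at a prime\<close>

locale prime_localization =
 fixes p :: "'r::comm_ring_1 set" assumes p: "isprime p"
begin

abbreviation "fr == fraction rng p"
abbreviation "Rp == localization rng p"

lemma pm: "s ~: p ==> t ~: p ==> s * t ~: p" and p1: "1 ~: p" using p by (auto simp: isprime_def)

lemma fr_mem: "(b, t) : fr a s \<longleftrightarrow> t ~: p & (EX u. u ~: p & u*(a * t) = u*(b * s))" by (auto simp: fraction_def)

lemma fr_eq: assumes "s ~: p" "t ~: p" shows "fr a s = fr b t \<longleftrightarrow> (EX u. u ~: p & u*(a * t) = u*(b * s))" proof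
 assume "fr a s = fr b t"
 moreover have "(b, t) : fr b t" using assms p1 by (auto simp: fr_mem)
 ultimately have "(b, t) : fr a s" by simp
 thus "EX u. u ~: p & u*(a * t) = u*(b * s)" by (auto simp: fr_mem)
next
 have tr: "fr a s <= fr b t" if st: "s ~: p" "t ~: p" and u: "u ~: p" "u*(a * t) = u*(b * s)" for a b s t u proof
  fix x assume "x : fr a s"
  then obtain c r w where x: "x = (c, r)" "r ~: p" "w ~: p" "w*(a*r) = w*(c * s)" by (cases x) (auto simp: fr_mem)
  have "(u*w * s)*(b*r) = (w*r)*(u*(b * s))" by (simp add: mult_ac)
  also have "... = (w*r)*(u*(a * t))" by (simp only: u(2))
  also have "... = u * t*(w*(a*r))" by (simp add: mult_ac)
  also have "... = u * t*(w*(c * s))" by (simp only: x(4))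
  also have "... = (u*w * s)*(c * t)" by (simp add: mult_ac)
  finally show "x : fr b t" using x st u pm by (auto simp: fr_mem intro!: exI[of _ "u * w * s"])
 qed
 assume "EX u. u ~: p & u*(a * t) = u*(b * s)"
 then obtain u where u: "u ~: p" "u*(a * t) = u*(b * s)" by blast
 show "fr a s = fr b t" using tr[OF assms u] tr[OF assms(2,1) u(1) u(2)[symmetric]] by (rule antisym)
qed

lemma fr_eqI: "s ~: p ==> t ~: p ==> a * t = b * s ==> fr a s = fr b t" using p1 by (subst fr_eq) (auto intro!: exI[of _ 1])

lemma fr_self: "s ~: p ==> (a, s) : fr a s" using p1 by (auto simp: fr_mem)

lemma Rp_simps:
 "carrier Rp = {fr a s | a s. s ~: p}" "\<one>\<^bsub>Rp\<^esub> = fr 1 1" "\<zero>\<^bsub>Rp\<^esub> = fr 0 1" by (auto simp: localization_def)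

lemma fr_mult: assumes "s ~: p" "t ~: p" shows "fr a s \<otimes>\<^bsub>Rp\<^esub> fr b t = fr (a*b) (s * t)" proof -
 have *: "fr (a'*b') (s' * t') = fr (a*b) (s * t)" if h: "(a', s') : fr a s" "(b', t') : fr b t" for a' s' b' t' proof -
  obtain u w where u: "u ~: p" "u*(a * s') = u*(a' * s)" "w ~: p" "w*(b * t') = w*(b' * t)" "s' ~: p" "t' ~: p" using h by (auto simp: fr_mem)
  have "u * w*(a*b*(s' * t')) = (u*(a * s'))*(w*(b * t'))" by (simp add: mult_ac)
  also have "... = u*w*(a'*b'*(s * t))" by (simp only: u) (simp add: mult_ac)
  finally show ?thesis by (intro fr_eq[THEN iffD2, OF pm[OF u(5,6)] pm[OF assms]] exI[of _ "u * w"] conjI pm u(1,3)) (rule sym)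
 qed
 have "fr a s \<otimes>\<^bsub>Rp\<^esub> fr b t = (UN (a', s'):fr a s. UN (b', t'):fr b t. fr (a'*b') (s' * t'))" by (simp add: localization_def)
 also have "... = fr (a*b) (s * t)" by (rule UN_pair_const[OF fr_self[OF assms(1), of a] fr_self[OF assms(2), of b] *])
 finally show ?thesis .
qed

lemma fr_add: assumes "s ~: p" "t ~: p" shows "fr a s \<oplus>\<^bsub>Rp\<^esub> fr b t = fr (a * t + b * s) (s * t)" proof -
 have *: "fr (a' * t' + b' * s') (s' * t') = fr (a * t + b * s) (s * t)" if h: "(a', s') : fr a s" "(b', t') : fr b t" for a' s' b' t' proof -
  obtain u w where u: "u ~: p" "u*(a * s') = u*(a' * s)" "w ~: p" "w*(b * t') = w*(b' * t)" "s' ~: p" "t' ~: p" using h by (auto simp: fr_mem)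
  have "u * w*((a * t + b * s)*(s' * t')) = w * t * t'*(u*(a * s')) + u * s * s'*(w*(b * t'))" by (simp add: algebra_simps)
  also have "... = u*w*((a' * t' + b' * s')*(s * t))" by (simp only: u) (simp add: algebra_simps)
  finally show ?thesis by (intro fr_eq[THEN iffD2, OF pm[OF u(5,6)] pm[OF assms]] exI[of _ "u * w"] conjI pm u(1,3)) (rule sym)
 qed
 have "fr a s \<oplus>\<^bsub>Rp\<^esub> fr b t = (UN (a', s'):fr a s. UN (b', t'):fr b t. fr (a' * t' + b' * s') (s' * t'))"
  by (simp add: localization_def)
 also have "... = fr (a * t + b * s) (s * t)" by (rule UN_pair_const[OF fr_self[OF assms(1), of a] fr_self[OF assms(2), of b] *])
 finally show ?thesis .
qed

lemma cring_Rp: "cring Rp" proof (rule cringI)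
 show "abelian_group Rp" proof (rule abelian_groupI)
  fix x assume "x : carrier Rp"
  then obtain a s where x: "x = fr a s" "s ~: p" by (auto simp: Rp_simps)
  have "fr (- a) s \<oplus>\<^bsub>Rp\<^esub> x = \<zero>\<^bsub>Rp\<^esub>"
   unfolding x(1) fr_add[OF x(2,2)] Rp_simps by (rule fr_eqI) (use x p1 pm in auto)
  with x(2) show "EX y:carrier Rp. y \<oplus>\<^bsub>Rp\<^esub> x = \<zero>\<^bsub>Rp\<^esub>" by (auto simp: Rp_simps)
 next
  fix x y assume "x : carrier Rp" "y : carrier Rp"
  then obtain a s b t where *: "x = fr a s" "s ~: p" "y = fr b t" "t ~: p" by (auto simp: Rp_simps)
  show "x \<oplus>\<^bsub>Rp\<^esub> y : carrier Rp" using * pm by (auto simp: Rp_simps fr_add)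
  show "x \<oplus>\<^bsub>Rp\<^esub> y = y \<oplus>\<^bsub>Rp\<^esub> x" using * by (simp add: fr_add pm algebra_simps)
  fix z assume "z : carrier Rp"
  then obtain c u where "z = fr c u" "u ~: p" by (auto simp: Rp_simps)
  with * show "x \<oplus>\<^bsub>Rp\<^esub> y \<oplus>\<^bsub>Rp\<^esub> z = x \<oplus>\<^bsub>Rp\<^esub> (y \<oplus>\<^bsub>Rp\<^esub> z)"
   by (simp add: fr_add pm algebra_simps)
 next
  fix x assume "x : carrier Rp"
  thus "\<zero>\<^bsub>Rp\<^esub> \<oplus>\<^bsub>Rp\<^esub> x = x" by (auto simp: Rp_simps fr_add p1)
 next
  show "\<zero>\<^bsub>Rp\<^esub> : carrier Rp" using p1 by (auto simp: Rp_simps)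
 qed
 show "comm_monoid Rp" proof (rule comm_monoidI)
  fix x y assume "x : carrier Rp" "y : carrier Rp"
  then obtain a s b t where *: "x = fr a s" "s ~: p" "y = fr b t" "t ~: p" by (auto simp: Rp_simps)
  show "x \<otimes>\<^bsub>Rp\<^esub> y : carrier Rp" using * pm by (auto simp: Rp_simps fr_mult)
  show "x \<otimes>\<^bsub>Rp\<^esub> y = y \<otimes>\<^bsub>Rp\<^esub> x" using * by (simp add: fr_mult pm mult_ac)
  fix z assume "z : carrier Rp"
  then obtain c u where "z = fr c u" "u ~: p" by (auto simp: Rp_simps)
  with * show "x \<otimes>\<^bsub>Rp\<^esub> y \<otimes>\<^bsub>Rp\<^esub> z = x \<otimes>\<^bsub>Rp\<^esub> (y \<otimes>\<^bsub>Rp\<^esub> z)" by (simp add: fr_mult pm mult_ac)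
 next
  fix x assume "x : carrier Rp"
  thus "\<one>\<^bsub>Rp\<^esub> \<otimes>\<^bsub>Rp\<^esub> x = x" by (auto simp: Rp_simps fr_mult p1)
 next
  show "\<one>\<^bsub>Rp\<^esub> : carrier Rp" using p1 by (auto simp: Rp_simps)
 qed
 fix x y z assume "x : carrier Rp" "y : carrier Rp" "z : carrier Rp"
 then obtain a s b t c u where *: "x = fr a s" "s ~: p" "y = fr b t" "t ~: p" "z = fr c u" "u ~: p" by (auto simp: Rp_simps)
 have "fr ((a * t + b * s)*c) (s * t * u) = fr (a*c*(t*u) + b*c*(s*u)) (s*u*(t*u))" by (rule fr_eqI) (use * pm in "simp_all add: algebra_simps")
 with * show "(x \<oplus>\<^bsub>Rp\<^esub> y) \<otimes>\<^bsub>Rp\<^esub> z = x \<otimes>\<^bsub>Rp\<^esub> z \<oplus>\<^bsub>Rp\<^esub> y \<otimes>\<^bsub>Rp\<^esub> z"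
  by (simp add: fr_add fr_mult pm)
qed

lemma ideal_fractions: assumes I: "isideal I" shows "ideal {fr a s | a s. a : I & s ~: p} Rp" proof (rule idealI)
 interpret cring Rp by (rule cring_Rp)
 show "ring Rp" by (rule ring_axioms)
 show "subgroup {fr a s | a s. a : I & s ~: p} (add_monoid Rp)" proof (rule group.subgroupI)
  show "group (add_monoid Rp)" by (rule a_group)
  show "{fr a s | a s. a : I & s ~: p} <= carrier (add_monoid Rp)" by (auto simp: Rp_simps)
  show "{fr a s | a s. a : I & s ~: p} ~= {}" using ideal_0[OF I] p1 by auto
  fix x y assume x: "x : {fr a s | a s. a : I & s ~: p}"
  then obtain a s where a: "x = fr a s" "a : I" "s ~: p" by auto
  have "fr (- a) s \<oplus>\<^bsub>Rp\<^esub> x = \<zero>\<^bsub>Rp\<^esub>"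
   unfolding a(1) fr_add[OF a(3,3)] Rp_simps by (rule fr_eqI) (use a p1 pm in auto)
  hence "\<ominus>\<^bsub>Rp\<^esub> x = fr (- a) s" using a by (intro minus_equality) (auto simp: Rp_simps)
  thus "inv\<^bsub>add_monoid Rp\<^esub> x : {fr a s | a s. a : I & s ~: p}" unfolding a_inv_def using a ideal_neg[OF I] by auto
  assume "y : {fr a s | a s. a : I & s ~: p}"
  then obtain b t where b: "y = fr b t" "b : I" "t ~: p" by auto
  have "a * t + b * s : I" using a b I by (intro ideal_add) (auto intro: ideal_mult_r)
  thus "x \<otimes>\<^bsub>add_monoid Rp\<^esub> y : {fr a s | a s. a : I & s ~: p}" using a b pm by (auto simp: fr_add)
 qed
 fix x y assume "x : {fr a s | a s. a : I & s ~: p}" "y : carrier Rp"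
 then obtain a s b t where *: "x = fr a s" "a : I" "s ~: p" "y = fr b t" "t ~: p" by (auto simp: Rp_simps)
 thus "y \<otimes>\<^bsub>Rp\<^esub> x : {fr a s | a s. a : I & s ~: p}" "x \<otimes>\<^bsub>Rp\<^esub> y : {fr a s | a s. a : I & s ~: p}"
  using pm ideal_mult_l[OF I] ideal_mult_r[OF I] by (auto simp: fr_mult) blast+
qed

text \<open>Generating fractions are replaced by their numerators, which generate the same local
  ideal; clearing denominators gives a factor outside p.\<close>

lemma local_generators: assumes I: "isideal I" and ng: "num_gens Rp (carrier Rp) (local_ideal rng p I) <= enat e"
 shows "EX e'<=e. EX b. (ALL j<e'. b j : I) & (ALL a:I. EX c. c ~: p & c * a : igen (b ` {..<e'}))" proof -
 interpret cring Rp by (rule cring_Rp)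
 have "num_gens Rp (carrier Rp) (local_ideal rng p I) < enat (Suc e)" using ng by (simp add: order_le_less_trans)
 then obtain G where G: "finite G" "G <= carrier Rp" "Idl\<^bsub>Rp\<^esub> G = local_ideal rng p I" "card G <= e"
  unfolding num_gens_def by (auto simp: Inf_less_iff)
 have "local_ideal rng p I <= {fr a s | a s. a : I & s ~: p}"
  unfolding local_ideal_def by (rule genideal_minimal[OF ideal_fractions[OF I]]) (use p1 in auto)
 moreover have "G <= Idl\<^bsub>Rp\<^esub> G" by (rule genideal_self[OF G(2)])
 ultimately have GI: "ALL g:G. EX b s. b : I & s ~: p & g = fr b s" using G(3) by blast
 then obtain b s where bs: "!!g. g : G ==> b g : I & s g ~: p & g = fr (b g) (s g)" by metis
 obtain h where h: "bij_betw h {..<card G} G" using ex_bij_betw_nat_finite[OF G(1)] by (auto simp: atLeast0LessThan)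
 define b' where "b' = (%j. b (h j))"
 have b': "b' ` {..<card G} = b ` G" using h by (auto simp: b'_def bij_betw_def image_image[symmetric])
 have sub: "Idl\<^bsub>Rp\<^esub> G <= {fr a s | a s. a : igen (b ` G) & s ~: p}" proof (rule genideal_minimal[OF ideal_fractions[OF isideal_igen]])
  show "G <= {fr a s | a s. a : igen (b ` G) & s ~: p}" proof
   fix g assume "g : G"
   hence "b g : igen (b ` G)" "s g ~: p" "g = fr (b g) (s g)" using bs by (auto intro: igen_base)
   thus "g : {fr a s | a s. a : igen (b ` G) & s ~: p}" by blast
  qed
 qed
 have "EX c. c ~: p & c * a : igen (b' ` {..<card G})" if "a : I" for a proof -
  have "fr a 1 : local_ideal rng p I" unfolding local_ideal_def by (rule genideal_self[THEN subsetD]) (use that p1 in "auto simp: Rp_simps")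
  then obtain b0 c where "fr a 1 = fr b0 c" "b0 : igen (b ` G)" "c ~: p" using sub G(3) by blast
  moreover from this obtain u where "u ~: p" "u*(a*c) = u*(b0*1)" using fr_eq p1 by blast
  ultimately have "(u*c)*a : igen (b ` G)" "u * c ~: p" using idl.span_scale[of b0 "b ` G" u] pm by (auto simp: mult_ac)
  thus ?thesis unfolding b' by blast
 qed
 moreover have "ALL j<card G. b' j : I" using bs h by (auto simp: b'_def bij_betw_def)
 ultimately show ?thesis using G(4) by blast
qed

lemma contract_prime: assumes P: "primeideal P Rp" shows "isprime {a. fr a 1 : P}" "{a. fr a 1 : P} <= p" proof -
 interpret primeideal P Rp by fact
 have car: "fr a 1 : carrier Rp" for a using p1 by (auto simp: Rp_simps)
 have one: "fr 1 1 ~: P" using one_imp_carrier I_notcarr by (auto simp: Rp_simps(2))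
 have m: "fr (a*b) 1 = fr a 1 \<otimes>\<^bsub>Rp\<^esub> fr b 1" for a b using fr_mult[OF p1 p1] by simp
 show "isprime {a. fr a 1 : P}" unfolding isprime_def proof (intro conjI allI impI)
  show "isideal {a. fr a 1 : P}" proof (rule idl.subspaceI)
   show "0 : {a. fr a 1 : P}" using additive_subgroup.zero_closed[OF additive_subgroup_axioms] by (simp add: Rp_simps(3))
   fix x y assume "x : {a. fr a 1 : P}" "y : {a. fr a 1 : P}"
   hence "fr x 1 \<oplus>\<^bsub>Rp\<^esub> fr y 1 : P" by (intro additive_subgroup.a_closed[OF additive_subgroup_axioms]) auto
   thus "x + y : {a. fr a 1 : P}" using fr_add[OF p1 p1, of x y] by simp
  next
   fix r x assume "x : {a. fr a 1 : P}"
   thus "r * x : {a. fr a 1 : P}" using I_l_closed[OF _ car[of r]] by (simp add: m)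
  qed
  show "1 ~: {a. fr a 1 : P}" using one by simp
  fix x y assume "x * y : {a. fr a 1 : P}"
  thus "x : {a. fr a 1 : P} \<or> y : {a. fr a 1 : P}" using I_prime[OF car car] by (simp add: m)
 qed
 show "{a. fr a 1 : P} <= p" proof
  fix a assume "a : {a. fr a 1 : P}"
  hence aP: "fr a 1 : P" by simp
  show "a : p" proof (rule ccontr)
   assume "a ~: p"
   hence "fr 1 a : carrier Rp" by (auto simp: Rp_simps)
   from I_l_closed[OF aP this] have "fr a a : P" using fr_mult[OF `a ~: p` p1, of 1 a] by simp
   moreover have "fr a a = fr 1 1" by (rule fr_eqI) (use `a ~: p` p1 in auto)
   ultimately show False using one by simp
  qed
 qed
qed

lemma contract_strict: assumes P: "primeideal P Rp" "primeideal P' Rp" "P \<subset> P'" shows "{a. fr a 1 : P} \<subset> {a. fr a 1 : P'}" proof -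
 interpret P: primeideal P Rp by fact
 interpret P': primeideal P' Rp by fact
 obtain x where x: "x : P'" "x ~: P" using P(3) by blast
 hence "x : carrier Rp" using P'.a_subset by blast
 then obtain a s where a: "x = fr a s" "s ~: p" by (auto simp: Rp_simps)
 have "fr s 1 : carrier Rp" "fr 1 s : carrier Rp" using a p1 by (auto simp: Rp_simps)
 hence "fr s 1 \<otimes>\<^bsub>Rp\<^esub> x : P'" and n: "fr a 1 : P ==> fr 1 s \<otimes>\<^bsub>Rp\<^esub> fr a 1 : P"
  using P'.I_l_closed[OF x(1)] P.I_l_closed by auto
 moreover have "fr s 1 \<otimes>\<^bsub>Rp\<^esub> x = fr a 1"
  unfolding a(1) fr_mult[OF p1 a(2)] by (rule fr_eqI) (use a p1 pm in "auto simp: mult_ac")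
 moreover have "fr 1 s \<otimes>\<^bsub>Rp\<^esub> fr a 1 = x" using fr_mult[OF a(2) p1, of 1 a] a by simp
 ultimately have "fr a 1 : P'" "fr a 1 ~: P" using x(2) by auto
 thus ?thesis using P(3) by blast
qed

end

lemma krull_dim_le: assumes "!!n P. (ALL i<=n. primeideal (P i) R) ==> (ALL i<n. P i \<subset> P (Suc i)) ==> n <= e" shows "krull_dim R <= enat e"
 unfolding krull_dim_def by (rule Sup_least) (use assms in auto)

text \<open>Each step down the chain adds one element by \<open>indep_strict\<close>; this links
  Krull dimension with \<open>dimle\<close>.\<close>

lemma indep_chain: assumes "!!i. i <= n ==> isprime (P i)" "!!i. i < n ==> P i \<subset> P (Suc i)" "indep (P n) r t"
 shows "EX t. indep (P 0) (n + r) t" using assms proof (induction n arbitrary: r t)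
 case (Suc n)
 then obtain g where g: "g : P (Suc n)" "g ~: P n" by blast
 have "indep (P n) (Suc r) (t(r := g))" by (rule indep_strict[OF _ _ _ g]) (use Suc.prems in "auto intro: isprime_ideal")
 from Suc.IH[OF _ _ this] Suc.prems show ?case by simp
qed auto

subsection \<open>Matrices of columns of the presentation\<close>

lemma rhom_det: "rhom h ==> h (det A) = det (\<chi> i j. h (A $ i $ j))" proof -
 assume h: "rhom h"
 have "h (of_int z) = of_int z" for z proof (cases z)
  case (nonneg n) have "h (of_nat n) = of_nat n" by (induction n) (auto simp: rhom_simps[OF h])
  thus ?thesis using nonneg by simp
 next
  case (neg n) have "h (of_nat k) = of_nat k" for k by (induction k) (auto simp: rhom_simps[OF h])
  thus ?thesis using neg by (simp add: rhom_simps[OF h])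
 qed
 thus ?thesis by (simp add: det_def rhom_simps[OF h])
qed

text \<open>The columns E times the matrix Z give c times the identity modulo q, with determinant
  outside q. By multilinearity some square choice of columns of E also has determinant outside
  q.\<close>

lemma prime_det_expand: fixes E :: "'c => 'a::comm_ring_1 ^ 'n" assumes q: "isprime q" and C: "finite C" and c: "c ~: q"
  and eq: "!!i j. (if i = j then c else 0) - (SUM m:C. E m $ i * Z m j) : q"
 shows "EX \<sigma>. (ALL j. \<sigma> j : C) & inj \<sigma> & det (\<chi> i j. E (\<sigma> j) $ i) ~: q" proof -
 have qi: "isideal q" using q by (rule isprime_ideal)
 have detq: "det A - det B : q" if "!!i j. A $ i $ j - B $ i $ j : q" for A B :: "'a ^ 'n ^ 'n" proof -
  have pr: "prod f K - prod g K : q" if "!!i. i : K ==> f i - g i : q" for f g :: "'n => 'a" and K using that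
  proof (induction K rule: infinite_finite_induct)
   case (insert x K)
   have "prod f (insert x K) - prod g (insert x K) = (f x - g x)*prod f K + g x*(prod f K - prod g K)" using insert by (simp add: algebra_simps)
   also have "... : q" using insert by (intro ideal_add[OF qi] ideal_mult_r[OF qi] ideal_mult_l[OF qi]) auto
   finally show ?case .
  qed (auto simp: qi ideal_0)
  have "det A - det B = (SUM p:{p. p permutes UNIV}. of_int (sign p)*((PROD i:UNIV. A $ i $ p i) - (PROD i:UNIV. B $ i $ p i)))"
   by (simp add: det_def sum_subtractf right_diff_distrib)
  also have "... : q" by (intro ideal_sum[OF qi] ideal_mult_l[OF qi] pr that)
  finally show ?thesis .
 qed
 define A :: "'a ^ 'n ^ 'n" where "A = (\<chi> j. SUM m:C. Z m j *s E m)"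
 have "det A - det (\<chi> i j. if i = j then c else 0 :: 'a ^ 'n ^ 'n) : q" proof (rule detq)
  fix i j
  have "A $ i $ j = (SUM m:C. E m $ j * Z m i)" by (simp add: A_def mult.commute)
  thus "A $ i $ j - (\<chi> i j. if i = j then c else 0) $ i $ j : q" using ideal_neg[OF qi eq[of j i]] by (simp add: eq_commute)
 qed
 moreover have "det (\<chi> i j. if i = j then c else 0 :: 'a ^ 'n ^ 'n) = c^CARD('n)" by (subst det_diagonal) auto
 moreover have "c^CARD('n) ~: q" using prime_powerD[OF q] c by blast
 ultimately have "det A ~: q" using ideal_mem_cong[OF qi] by metis
 \<comment> \<open>The rows of A are exchanged one at a time for members of E.\<close>
 have "EX \<sigma>. (ALL j. \<sigma> j : C) & det (\<chi> j. if j : T then E (\<sigma> j) else A $ j) ~: q" if "finite T" for T using that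
 proof (induction T rule: finite_induct)
  case empty
  have "C ~= {}" proof
   assume "C = {}"
   hence "A = 0" by (simp add: A_def vec_eq_iff)
   thus False using `det A ~: q` ideal_0[OF qi] det_row_0[of undefined "%_. 0 :: 'a ^ 'n"] by (simp add: zero_vec_def cong: if_cong)
  qed
  with `det A ~: q` show ?case by (intro exI[of _ "%_. SOME m. m : C"]) (auto simp: some_in_eq)
 next
  case (insert k T)
  then obtain \<sigma> where \<sigma>: "ALL j. \<sigma> j : C" "det (\<chi> j. if j : T then E (\<sigma> j) else A $ j) ~: q" by blast
  let ?c = "%j. if j : T then E (\<sigma> j) else A $ j"
  have "(\<chi> j. ?c j) = (\<chi> j. if j = k then (SUM m:C. Z m k *s E m) else ?c j)" using insert(2) by (auto simp: vec_eq_iff A_def)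
  hence "det (\<chi> j. ?c j) = (SUM m:C. det (\<chi> j. if j = k then Z m k *s E m else ?c j))" by (simp add: det_linear_row_sum[OF C])
  also have "... = (SUM m:C. Z m k * det (\<chi> j. if j = k then E m else ?c j))" by (simp add: det_row_mul)
  finally have eq: "det (\<chi> j. ?c j) = (SUM m:C. Z m k * det (\<chi> j. if j = k then E m else ?c j))" .
  have "EX m:C. det (\<chi> j. if j = k then E m else ?c j) ~: q" proof (rule ccontr)
   assume "~ ?thesis"
   hence "det (\<chi> j. ?c j) : q" unfolding eq by (intro ideal_sum[OF qi] ideal_mult_l[OF qi]) auto
   with \<sigma>(2) show False by blast
  qed
  then obtain m where m: "m : C" "det (\<chi> j. if j = k then E m else ?c j) ~: q" by blast
  have "(\<chi> j. if j = k then E m else ?c j) = (\<chi> j. if j : insert k T then E ((\<sigma>(k := m)) j) else A $ j)"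
   using insert(2) by (auto simp: vec_eq_iff)
  with m \<sigma>(1) show ?case by (intro exI[of _ "\<sigma>(k := m)"]) auto
 qed
 from this[of UNIV] obtain \<sigma> where s: "ALL j. \<sigma> j : C" and dq: "det (\<chi> j. E (\<sigma> j)) ~: q" by auto
 have "inj \<sigma>" proof (rule injI, rule ccontr)
  fix x y assume "\<sigma> x = \<sigma> y" "x ~= y"
  hence "det (\<chi> j. E (\<sigma> j)) = 0" by (intro det_identical_rows[of x y]) (auto simp: row_def)
  with dq show False using ideal_0[OF qi] by simp
 qed
 moreover have "det (\<chi> j. E (\<sigma> j)) = det (\<chi> i j. E (\<sigma> j) $ i)" by (subst det_transpose[symmetric]) (simp add: transpose_def)
 ultimately show ?thesis using s dq by auto
qed

text \<open>Up to a factor c0 outside q each a_i is a combination of the b_j, and these are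
  combinations of the a_i. The difference is a syzygy, hence in the image of \<phi>. So c0 times the
  identity factors modulo q through the columns of \<psi> and e further ones.\<close>

lemma presentation_columns: fixes \<psi> :: "'s::comm_ring_1 ^ 'n ^ 'n" and \<pi> :: "'s => 'r::comm_ring_1" and a :: "'r ^ 'n" and \<phi> :: "'r ^ 'n ^ 'n"
 assumes \<pi>: "rhom \<pi>" "surj \<pi>" and q: "isprime q" and ker: "!!x. \<pi> x = 0 ==> x : q"
  and pres: "!!v. (SUM i:UNIV. a $ i * v $ i) = 0 ==> EX w. v = \<phi> *v w" and \<psi>: "!!i j. \<pi> (\<psi> $ i $ j) = \<phi> $ i $ j"
  and b: "!!j. j < e ==> b j : igen (range (%i. a $ i))" and c: "!!i. EX c. c ~: \<pi> ` q & c * a $ i : igen (b ` {..<e})"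
 shows "EX (M :: 's ^ 'n ^ 'n) K. det M ~: q & card K <= e & (ALL j. j ~: K --> (EX k. ALL i. M $ i $ j = \<psi> $ i $ k))" proof -
 have \<pi>q: "\<pi> x : \<pi> ` q ==> x : q" for x proof -
  assume "\<pi> x : \<pi> ` q"
  then obtain y where "y : q" "\<pi> (x - y) = 0" by (auto simp: rhom_simps[OF \<pi>(1)])
  thus "x : q" using ker[of "x - y"] ideal_mem_cong[OF isprime_ideal[OF q]] by blast
 qed
 have up: "EX x. \<pi> x = y" for y using \<pi>(2) by (metis surjD)
 have "ALL i. EX c. c ~: q & \<pi> c * a $ i : igen (b ` {..<e})" proof
  fix i obtain c where "c ~: \<pi> ` q" "c * a $ i : igen (b ` {..<e})" using c by blast
  thus "EX c. c ~: q & \<pi> c * a $ i : igen (b ` {..<e})" using up[of c] by blast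
 qed
 then obtain cc where cc: "!!i. cc i ~: q" "!!i. \<pi> (cc i)*a $ i : igen (b ` {..<e})" by metis
 define c0 where "c0 = (PROD i:UNIV. cc i)"
 have c0: "c0 ~: q" using prime_prodD[OF q] cc(1) unfolding c0_def by blast
 have "\<pi> c0 * a $ i : igen (b ` {..<e})" for i proof -
  have "c0 = (PROD j:UNIV - {i}. cc j)*cc i" unfolding c0_def by (subst prod.remove[of _ i]) (auto simp: mult.commute)
  hence "\<pi> c0 * a $ i = \<pi> (PROD j:UNIV - {i}. cc j)*(\<pi> (cc i)*a $ i)" by (simp add: rhom_mult[OF \<pi>(1)] mult.assoc)
  thus ?thesis using idl.span_scale[OF cc(2)[of i]] by simp
 qed
 hence "ALL i. EX V. \<pi> c0 * a $ i = (SUM j<e. V j * b j)" using igen_image[of "{..<e}" _ b] by auto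
 then obtain V where V: "!!i. \<pi> c0 * a $ i = (SUM j<e. V i j * b j)" by metis
 have "ALL j. EX W. j < e --> b j = (SUM i:UNIV. W i * a $ i)" using b igen_image[of UNIV _ "%i. a $ i"] by auto
 then obtain W where W: "!!j. j < e ==> b j = (SUM i:UNIV. W j i * a $ i)" by metis
 have "EX w. (\<chi> i'. (if i' = i then \<pi> c0 else 0) - (SUM j<e. W j i' * V i j)) = \<phi> *v w" for i proof (rule pres)
  have "(SUM i':UNIV. a $ i'*(if i' = i then \<pi> c0 else 0)) = \<pi> c0 * a $ i"
   by (simp add: if_distrib[of "%x. _ * x"] mult.commute cong: if_cong)
  moreover have "(SUM i':UNIV. a $ i'*(SUM j<e. W j i' * V i j)) = (SUM j<e. V i j*(SUM i':UNIV. W j i' * a $ i'))"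
   by (simp add: sum_distrib_left sum.swap[of _ "{..<e}"] mult_ac)
  moreover have "... = (SUM j<e. V i j * b j)" by (intro sum.cong refl) (simp add: W)
  ultimately show "(SUM i':UNIV. a $ i'*(\<chi> i'. (if i' = i then \<pi> c0 else 0) - (SUM j<e. W j i' * V i j)) $ i') = 0"
   by (simp add: right_diff_distrib sum_subtractf V)
 qed
 then obtain y where y: "!!i. (\<chi> i'. (if i' = i then \<pi> c0 else 0) - (SUM j<e. W j i' * V i j)) = \<phi> *v y i" by metis
 define W' V' Y' where "W' = (%j i. inv_into UNIV \<pi> (W j i))" and "V' = (%i j. inv_into UNIV \<pi> (V i j))" and "Y' = (%i k. inv_into UNIV \<pi> (y i $ k))"
 have l: "!!j i. \<pi> (W' j i) = W j i" "!!i j. \<pi> (V' i j) = V i j" "!!i k. \<pi> (Y' i k) = y i $ k"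
  by (simp_all add: W'_def V'_def Y'_def surj_f_inv_f[OF \<pi>(2)])
 define C :: "('n + nat) set" where "C = range Inl Un Inr ` {..<e}"
 define E :: "'n + nat => 's ^ 'n" where "E = case_sum (%k. \<chi> i. \<psi> $ i $ k) (%j. \<chi> i. W' j i)"
 define Z where "Z = case_sum (%k i. Y' i k) (%j i. V' i j)"
 have split: "(SUM m:C. g m) = (SUM k:UNIV. g (Inl k)) + (SUM j<e. g (Inr j))" for g :: "'n + nat => 's"
  unfolding C_def by (subst sum.union_disjoint) (auto simp: sum.reindex)
 have "(if i' = i then c0 else 0) - (SUM m:C. E m $ i' * Z m i) : q" for i' i proof (rule ker)
  have "(if i' = i then \<pi> c0 else 0) - (SUM j<e. W j i' * V i j) = (SUM k:UNIV. \<phi> $ i' $ k * y i $ k)"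
   using arg_cong[OF y[of i], of "%v. v $ i'"] by (simp add: matrix_vector_mult_def)
  thus "\<pi> ((if i' = i then c0 else 0) - (SUM m:C. E m $ i' * Z m i)) = 0"
   by (simp add: split E_def Z_def rhom_simps[OF \<pi>(1)] l \<psi> if_distrib[of \<pi>] algebra_simps cong: if_cong)
 qed
 from prime_det_expand[OF q _ c0 this] obtain \<sigma> where
  \<sigma>: "ALL j. \<sigma> j : C" "inj \<sigma>" "det (\<chi> i j. E (\<sigma> j) $ i) ~: q" by (auto simp: C_def)
 define K where "K = {j. \<sigma> j : Inr ` {..<e}}"
 have "card K <= card (Inr ` {..<e} :: ('n + nat) set)" by (rule card_inj_on_le[of \<sigma>]) (use \<sigma>(2) in "auto simp: K_def inj_on_def")
 also have "... <= e" using card_image_le[of "{..<e}"] by simp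
 finally have "card K <= e" .
 moreover have "EX k. ALL i. (\<chi> i j. E (\<sigma> j) $ i) $ i $ j = \<psi> $ i $ k" if jK: "j ~: K" for j proof -
  obtain k where "\<sigma> j = Inl k" using jK \<sigma>(1) by (auto simp: K_def C_def)
  thus ?thesis by (auto simp: E_def)
 qed
 ultimately show ?thesis using \<sigma>(3) by blast
qed

no_notation fps_nth (infixl "$" 75)

text \<open>If r elements are independent modulo q, the localization of R at the image of q has
  dimension at most d - r, so G_d provides at most d - r local generators of I. If I is not
  contained in the image, I is locally the unit ideal and one generator suffices.\<close>

lemma gorenstein_matrix: fixes \<psi> :: "('n::finite, 'k::field) mpoly ^ 'n ^ 'n" and \<pi> :: "('n, 'k) mpoly => 'r::comm_ring_1"
  and a :: "'r ^ 'n" and \<phi> :: "'r ^ 'n ^ 'n" assumes card: "CARD('n) = d + 1" and f: "f ~= 0"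
  and \<pi>: "rhom \<pi>" "surj \<pi>" and ker: "!!x. \<pi> x = 0 \<longleftrightarrow> x : igen {f}"
  and pres: "presents \<phi> a I" and \<psi>: "!!i j. \<pi> (\<psi> $ i $ j) = \<phi> $ i $ j" and G: "satisfies_G rng d I"
  and q: "isprime q" "f : q" "indep q r t" "r >= 1"
 shows "EX (M :: ('n, 'k) mpoly ^ 'n ^ 'n) K. det M ~: q & (ALL j. j ~: K --> (EX k. ALL i. M $ i $ j = \<psi> $ i $ k)) &
  (I <= \<pi> ` q --> card K + r <= d) & (~ I <= \<pi> ` q --> card K <= 1)" proof -
 have qi: "isideal q" using q(1) by (rule isprime_ideal)
 have kerq: "\<pi> x = 0 ==> x : q" for x unfolding ker using igen_subset[of "{f}" q] q(2) qi by blast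
 have \<pi>q: "\<pi> x : \<pi> ` q \<longleftrightarrow> x : q" for x proof
  assume "\<pi> x : \<pi> ` q"
  then obtain y where "y : q" "\<pi> (x - y) = 0" by (auto simp: rhom_simps[OF \<pi>(1)])
  thus "x : q" using kerq ideal_mem_cong[OF qi] by blast
 qed simp
 have up: "EX x. y = \<pi> x" for y using \<pi>(2) by (metis surjD)
 have p: "isprime (\<pi> ` q)" unfolding isprime_def proof (intro conjI allI impI)
  show "isideal (\<pi> ` q)" proof (rule idl.subspaceI)
   show "0 : \<pi> ` q" using ideal_0[OF qi] rhom_0[OF \<pi>(1)] by force
   fix x y assume "x : \<pi> ` q" "y : \<pi> ` q"
   thus "x + y : \<pi> ` q" using ideal_add[OF qi] by (force simp flip: rhom_add[OF \<pi>(1)])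
  next
   fix c x assume "x : \<pi> ` q"
   thus "c * x : \<pi> ` q" using ideal_mult_l[OF qi] up[of c] by (force simp flip: rhom_mult[OF \<pi>(1)])
  qed
  show "1 ~: \<pi> ` q" using \<pi>q[of 1] q(1) by (simp add: rhom_1[OF \<pi>(1)] isprime_def)
  fix x y assume xy: "x * y : \<pi> ` q"
  obtain x' y' where "x = \<pi> x'" "y = \<pi> y'" using up by metis
  with xy show "x : \<pi> ` q \<or> y : \<pi> ` q" using prime_multD[OF q(1), of x' y'] \<pi>q by (simp flip: rhom_mult[OF \<pi>(1)])
 qed
 have I: "I = igen (range (%i. a $ i))" and ex: "!!v. (SUM i:UNIV. a $ i * v $ i) = 0 ==> EX w. v = \<phi> *v w"
  using pres by (auto simp: presents_def Idl_rng)
 hence aI: "a $ i : I" for i by (auto intro: igen_base)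
 have dq: "dimle P d" if "isprime P" "f : P" for P :: "('n, 'k) mpoly set" using dimle_prime_nonzero[OF that f] card by simp
 note pc = presentation_columns[OF \<pi> q(1) kerq ex \<psi>]
 show ?thesis proof (cases "I <= \<pi> ` q")
  case True
  interpret prime_localization "\<pi> ` q" by unfold_locales (rule p)
  \<comment> \<open>A chain of primes of the local ring contracts to a chain in S between f and q;
    together with the r elements independent modulo q, its length is bounded by the dimension d of
    f.\<close>
  have "krull_dim Rp <= enat (d - r)" proof (rule krull_dim_le)
   fix n P assume P: "ALL i<=n. primeideal (P i) Rp" "ALL i<n. P i \<subset> P (Suc i)"
   define P' where "P' = (%i. {x. \<pi> x : {a. fr a 1 : P i}})"
   have pr: "isprime (P' i)" if "i <= n" for i unfolding P'_def using P that by (intro prime_vimage \<pi> contract_prime) auto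
   have st: "P' i \<subset> P' (Suc i)" if "i < n" for i proof -
    have "{a. fr a 1 : P i} \<subset> {a. fr a 1 : P (Suc i)}" using P that by (intro contract_strict) auto
    then obtain y where "fr y 1 : P (Suc i)" "fr y 1 ~: P i" "{a. fr a 1 : P i} <= {a. fr a 1 : P (Suc i)}" by blast
    thus ?thesis using up[of y] by (auto simp: P'_def)
   qed
   have "{a. fr a 1 : P n} <= \<pi> ` q" using P by (intro contract_prime) auto
   hence "P' n <= q" using \<pi>q by (auto simp: P'_def)
   hence "indep (P' n) r t" by (rule indep_mono[OF q(3)])
   from indep_chain[OF pr st this] obtain t' where "indep (P' 0) (n + r) t'" by blast
   moreover have "f : P' 0" proof -
    have "\<pi> f = 0" unfolding ker by (simp add: igen_base)
    thus ?thesis using ideal_0[OF isprime_ideal[OF contract_prime(1), of "P 0"]] P by (simp add: P'_def)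
   qed
   ultimately have "n + r <= d" using dq[OF pr[of 0]] unfolding dimle_def by blast
   thus "n <= d - r" by simp
  qed
  moreover have rd: "r <= d" using dq[OF q(1,2)] q(3) by (auto simp: dimle_def)
  ultimately have "krull_dim Rp + 1 <= enat (d - r) + 1" by (intro add_right_mono)
  also have "... <= enat d" using rd q(4) by (simp add: one_enat_def)
  finally have "num_gens Rp (carrier Rp) (local_ideal rng (\<pi> ` q) I) <= krull_dim Rp"
   using G True p unfolding satisfies_G_def primeideal_rng_iff by blast
  also note `krull_dim Rp <= enat (d - r)`
  finally obtain e b where e: "e <= d - r" "ALL j<e. b j : I" "ALL a:I. EX c. c ~: \<pi> ` q & c * a : igen (b ` {..<e})"
   using local_generators[of I "d - r"] I by auto
  have "EX (M :: ('n, 'k) mpoly ^ 'n ^ 'n) K. det M ~: q & card K <= e & (ALL j. j ~: K --> (EX k. ALL i. M $ i $ j = \<psi> $ i $ k))"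
   by (rule pc[where e = e and b = b]) (use e aI I in auto)
  then obtain M K where "det M ~: q" "card K <= e" "ALL j. j ~: K --> (EX k. ALL i. M $ i $ j = \<psi> $ i $ k)" by blast
  with e(1) rd True show ?thesis by (intro exI[of _ M] exI[of _ K]) auto
 next
  case False
  then obtain b where b: "b : I" "b ~: \<pi> ` q" by blast
  have "EX (M :: ('n, 'k) mpoly ^ 'n ^ 'n) K. det M ~: q & card K <= 1 & (ALL j. j ~: K --> (EX k. ALL i. M $ i $ j = \<psi> $ i $ k))"
  proof (rule pc[where e = 1 and b = "%_. b"])
   show "EX c. c ~: \<pi> ` q & c * a $ i : igen ((%_. b) ` {..<1::nat})" for i
    using b(2) ideal_mult_r[OF isideal_igen igen_base[of b "{b}"], of "a $ i"] by (intro exI[of _ b]) (simp add: image_constant_conv lessThan_Suc)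
  qed (use b I in auto)
  with False show ?thesis by blast
 qed
qed

section \<open>Dimension of the fibres\<close>

definition xP :: "('n, 'k::comm_ring_1) mpoly => ('n + 'n, 'k) mpoly" where
 "xP = ev Const (%i. xv i)"

definition tP :: "('n, 'k::comm_ring_1) mpoly => ('n + 'n, 'k) mpoly" where
 "tP = ev Const (%i. tv i)"

lemma rhom_xP: "rhom xP" and rhom_tP: "rhom tP" by (simp_all add: xP_def tP_def rhom_ev rhom_Const)

lemma xP_simps: "xP (Const c) = Const c" "xP (Var i) = xv i" "tP (Const c) = Const c" "tP (Var i) = tv i"
 by (simp_all add: xP_def tP_def ev_Const ev_Var rhom_Const)

text \<open>Determinants with one row replaced by a unit vector are cofactors; this is entry r of t
  A adj(A) = det(A) t.\<close>

lemma cramer_row: fixes A :: "'a::comm_ring_1 ^ 'n ^ 'n"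
 shows "t r * det A = (SUM k:UNIV. (SUM i:UNIV. t i * A $ i $ k)*det (\<chi> i. if i = r then axis k 1 else A $ i))" proof -
 let ?D = "%v. det (\<chi> i. if i = r then v else A $ i)"
 have "?D (SUM i:UNIV. t i *s A $ i) = (SUM j:UNIV. t j * ?D (A $ j))"
  by (simp add: det_linear_row_sum[OF finite, of r "%i j. t j *s A $ j"] det_row_mul)
 also have "... = (SUM j:UNIV. if j = r then t r * det A else 0)" proof (intro sum.cong refl)
  fix j
  show "t j * ?D (A $ j) = (if j = r then t r * det A else 0)" proof (cases "j = r")
   case True
   hence "(\<chi> i. if i = r then A $ j else A $ i) = A" by (auto simp: vec_eq_iff)
   with True show ?thesis by simp
  next
   case False
   hence "?D (A $ j) = 0" by (intro det_identical_rows[of j r]) (auto simp: row_def vec_eq_iff)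
   with False show ?thesis by simp
  qed
 qed
 also have "... = t r * det A" by simp
 finally have 1: "?D (SUM i:UNIV. t i *s A $ i) = t r * det A" .
 have "(SUM i:UNIV. t i *s A $ i) = (SUM k:UNIV. (SUM i:UNIV. t i * A $ i $ k) *s axis k 1)"
  by (simp add: vec_eq_iff axis_def if_distrib[of "%x. _ * x"] cong: if_cong)
 hence "?D (SUM i:UNIV. t i *s A $ i) = ?D (SUM k:UNIV. (SUM i:UNIV. t i * A $ i $ k) *s axis k 1)" by (rule arg_cong)
 also have "... = (SUM k:UNIV. (SUM i:UNIV. t i * A $ i $ k) * ?D (axis k 1))"
  by (simp add: det_linear_row_sum[OF finite, of r "%i k. (SUM i:UNIV. t i * A $ i $ k) *s axis k 1"] det_row_mul)
 finally show ?thesis using 1 by simp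
qed

lemma vin_empty: assumes "vin {} F" obtains c where "F = Const c" proof -
 have "lk F m = 0" if "m ~= 0" for m proof (rule ccontr)
  assume "lk F m ~= 0"
  hence "kys m <= {}" using assms by (auto simp: vin_def in_keys_iff)
  hence "m = 0" by (intro pm_eqI) (auto simp: in_keys_iff)
  with that show False by simp
 qed
 hence "F = Const (lk F 0)" by (intro pm_eqI) (auto simp: Const_def lookup_single when_def)
 thus ?thesis by (rule that)
qed

lemma indep_0: "isprime p ==> indep p 0 t" unfolding indep_def by (auto elim!: vin_empty simp: ev_Const rhom_Const) (metis const_notin_prime)

lemma uniform_bound: assumes "finite A" "!!x. x : A ==> EX C. P x C" "!!x C D. P x C ==> C <= D ==> P x (D::nat)" shows "EX C. ALL x:A. P x C" proof -
 obtain c where c: "!!x. x : A ==> P x (c x)" using assms(2) by metis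
 have "P x (sum c A)" if "x : A" for x by (rule assms(3)[OF c[OF that]]) (use assms(1) that in "auto intro: member_le_sum")
 thus ?thesis by blast
qed

text \<open>The bound depends on G only and can be fixed before R.\<close>

lemma ev_monspan: assumes a: "isideal a" and G: "vin {..<e} G" shows "EX C. ALL R. ALL \<rho>:R. ev Const t G * \<rho> : monspan a t e R C" proof -
 define C where "C = (SUM m:kys G. SUM j:kys m. lk m j)"
 have "Const (lk G m)*(mev t m * \<rho>) : monspan a t e R C" if "m : kys G" "\<rho> : R" for m \<rho> R proof -
  have "mev t m = mons t e (lk m)" using G that by (auto simp: mons_def vin_def intro!: mev_superset)
  moreover have "lk m j <= C" for j proof (cases "j : kys m")
   case True
   have "lk m j <= (SUM j:kys m. lk m j)" using True by (intro member_le_sum) auto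
   also have "... <= C" unfolding C_def using that by (intro member_le_sum[of _ _ "%m. SUM j:kys m. lk m j"]) auto
   finally show ?thesis .
  qed (simp add: in_keys_iff)
  ultimately show ?thesis using that by (intro monspan_Const_mult monspan_base a) (auto simp: monspan_base[OF a])
 qed
 hence "ALL R. ALL \<rho>:R. (SUM m:kys G. Const (lk G m)*(mev t m * \<rho>)) : monspan a t e R C" by (auto intro: monspan_sum a)
 thus ?thesis by (auto simp: ev_def sum_distrib_right mult.assoc)
qed

lemma monspan_mult_right: assumes a: "isideal a" and F: "F : monspan a w e R' C" and H: "!!\<rho>. \<rho> : R' ==> \<rho> * H : R"
 shows "F * H : monspan a w e R C" using a F proof (rule monspan_induct)
 fix b \<rho> assume "!!j. j < e ==> b j <= C" "\<rho> : R'"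
 thus "mons w e b * \<rho> * H : monspan a w e R C" using monspan_base[OF a, of e b C "\<rho> * H" R w] H by (simp add: mult.assoc)
next
 fix c F assume "F * H : monspan a w e R C"
 thus "Const c * F * H : monspan a w e R C" using monspan_Const_mult[OF a, of "F * H"] by (simp add: mult.assoc)
qed (auto simp: distrib_right intro: monspan_add a monspan_0 ideal_mult_r)

section \<open>Generic finiteness over a transcendence base\<close>

lemma vdiv_vdiv: "vdiv i 1 (vdiv i n F) = vdiv i (Suc n) F" by (rule pm_eqI) (simp add: lookup_vdiv add.assoc flip: single_add)

lemma vdiv_Suc_0: "EX n. vdiv i n F = 0" proof -
 have "lk F (m + sgl i (Suc (SUM m:kys F. lk m i))) = 0" for m proof (rule ccontr)
  assume "~ ?thesis"
  hence "m + sgl i (Suc (SUM m:kys F. lk m i)) : kys F" by (simp add: in_keys_iff)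
  hence "lk (m + sgl i (Suc (SUM m:kys F. lk m i))) i <= (SUM m:kys F. lk m i)" by (intro member_le_sum[of _ _ "%m. lk m i"]) auto
  thus False by (simp add: lookup_add)
 qed
 thus ?thesis by (intro exI pm_eqI) (auto simp: lookup_vdiv)
qed

lemma variable_expansion: assumes "vin {..<Suc e} F" obtains D c where "F = (SUM i<D. Var e^i*c i)" "!!i. vin {..<e} (c i)" proof -
 have v: "vin {..<Suc e} (vdiv e k F)" for k proof (induction k)
  case 0 have "vdiv e 0 F = F" by (rule pm_eqI) (simp add: lookup_vdiv)
  thus ?case using assms by simp
 next
  case (Suc k) thus ?case using vin_split_var(2) by (metis vdiv_vdiv)
 qed
 have exp: "F = (SUM k<n. Var e^k * vrem e 1 (vdiv e k F)) + Var e^n * vdiv e n F" for n proof (induction n)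
  case 0 show ?case by (simp, rule pm_eqI) (simp add: lookup_vdiv)
 next
  case (Suc n)
  let ?S = "SUM k<n. Var e^k * vrem e 1 (vdiv e k F)"
  have *: "vdiv e n F = Var e * vdiv e (Suc n) F + vrem e 1 (vdiv e n F)" using vdiv_vrem[of "vdiv e n F" e 1] unfolding vdiv_vdiv by simp
  have "(SUM k<Suc n. Var e^k * vrem e 1 (vdiv e k F)) + Var e^Suc n * vdiv e (Suc n) F
    = ?S + Var e^n*(Var e * vdiv e (Suc n) F + vrem e 1 (vdiv e n F))" by (simp add: algebra_simps)
  also have "... = ?S + Var e^n * vdiv e n F" by (simp only: *[symmetric])
  also have "... = F" by (rule Suc[symmetric])
  finally show ?case by (rule sym)
 qed
 obtain n where "vdiv e n F = 0" using vdiv_Suc_0[of e F] ..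
 hence z: "Var e^n * vdiv e n F = 0" by simp
 have "F = (SUM k<n. Var e^k * vrem e 1 (vdiv e k F)) + Var e^n * vdiv e n F" by (rule exp)
 also have "... = (SUM k<n. Var e^k * vrem e 1 (vdiv e k F))" by (simp only: z add_0_right)
 finally have "F = (SUM k<n. Var e^k * vrem e 1 (vdiv e k F))" .
 thus ?thesis by (rule that) (rule vin_split_var(1)[OF v])
qed

text \<open>Expand a relation in as few powers of z as possible; its leading coefficient is then a
  nonzero polynomial in t, hence outside p.\<close>

lemma algebraic_relation: assumes p: "isprime p" and t: "indep p e t" and n: "~ indep p (Suc e) (t(e := z))"
 shows "EX G D C. vin {..<e} G & ev Const t G ~: p & ev Const t G * z^D : monspan p t e ((%k. z^k) ` {..<D}) C" proof -
 have pI: "isideal p" using p by (rule isprime_ideal)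
 obtain F where F: "vin {..<Suc e} F" "ev Const (t(e := z)) F : p" "F ~= 0" using n by (auto simp: indep_def)
 have ex: "EX D c. F = (SUM i<D. Var e^i*c i) & (ALL i. vin {..<e} (c i))" using variable_expansion[OF F(1)] by metis
 define n where "n = (LEAST D. EX c. F = (SUM i<D. Var e^i*c i) & (ALL i. vin {..<e} (c i)))"
 obtain Fk where exp: "F = (SUM k<n. Var e^k*Fk k)" and vF: "!!k. vin {..<e} (Fk k)" using LeastI_ex[OF ex] unfolding n_def by blast
 have "n ~= 0" using exp F(3) by (intro notI) simp
 then obtain D where D: "n = Suc D" using not0_implies_Suc by blast
 have "Fk D ~= 0" proof
  assume "Fk D = 0"
  hence "F = (SUM k<D. Var e^k*Fk k)" using exp D by simp
  hence "n <= D" unfolding n_def using vF by (intro Least_le) blast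
  with D show False by simp
 qed
 hence nz: "ev Const t (Fk D) ~: p" using t vF[of D] unfolding indep_def by metis
 have ee: "ev Const (t(e := z)) (Fk k) = ev Const t (Fk k)" for k proof (rule ev_cong)
  fix i m assume "m : kys (Fk k)" "i : kys m"
  hence "i < e" using vF[of k] unfolding vin_def by blast
  thus "(t(e := z)) i = t i" by simp
 qed
 have "ev Const (t(e := z)) F = (SUM k<D. ev Const t (Fk k)*z^k) + ev Const t (Fk D)*z^D" by (subst exp)
   (simp add: D ev_add ev_sum ev_mult rhom_Const ee rhom_power[OF rhom_ev] ev_Var mult.commute)
 hence eq: "ev Const t (Fk D)*z^D = ev Const (t(e := z)) F + (SUM k<D. Const (- 1)*(ev Const t (Fk k)*z^k))" by (simp add: Const_simps sum_negf)
 have "EX C. ALL k:{..<D}. ev Const t (Fk k)*z^k : monspan p t e ((%k. z^k) ` {..<D}) C" proof (rule uniform_bound)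
  show "EX C. ev Const t (Fk k)*z^k : monspan p t e ((%k. z^k) ` {..<D}) C" if "k : {..<D}" for k using ev_monspan[OF pI vF[of k], of t] that by blast
 qed (auto intro: monspan_mono pI)
 then obtain C where "ALL k:{..<D}. ev Const t (Fk k)*z^k : monspan p t e ((%k. z^k) ` {..<D}) C" by blast
 hence "ev Const t (Fk D)*z^D : monspan p t e ((%k. z^k) ` {..<D}) C"
  unfolding eq by (intro monspan_add[OF pI monspan_0[OF pI F(2)]] monspan_sum[OF pI] monspan_Const_mult[OF pI]) auto
 with nz vF show ?thesis by blast
qed

text \<open>Over a maximal independent set of variables, the coordinate ring of a prime becomes finite
  after inverting one element.\<close>

lemma transcendence_base: fixes q :: "('n::finite, 'k::field) mpoly set" assumes q: "isprime q" and d: "dimle q \<tau>"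
 shows "EX e t R lam C. e <= \<tau> & finite R & 1 : R & lam ~: q &
  (ALL \<rho>:R. lam * \<rho> : monspan q t e R C) & (ALL \<rho>:R. ALL v. lam * Var v * \<rho> : monspan q t e R C)" proof -
 have qi: "isideal q" using q by (rule isprime_ideal)
 \<comment> \<open>The independent elements are chosen among the variables. With e maximal, every
   variable is algebraic over the chosen ones.\<close>
 define E where "E = {e. EX ys. indep q e (%j. Var (ys j))}"
 have E: "E <= {..\<tau>}" "0 : E" using d indep_0[OF q] by (auto simp: E_def dimle_def)
 define e where "e = Max E"
 have fE: "finite E" using E(1) finite_subset by blast
 have "e : E" unfolding e_def using E(2) fE by (intro Max_in) auto
 then obtain ys where ys: "indep q e (%j. Var (ys j))" by (auto simp: E_def)
 define t where "t = (%j. Var (ys j) :: ('n, 'k) mpoly)"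
 have "~ indep q (Suc e) (t(e := Var i))" for i proof
  assume "indep q (Suc e) (t(e := Var i))"
  moreover have "t(e := Var i) = (%j. Var ((ys(e := i)) j))" by (auto simp: t_def)
  ultimately have "Suc e : E" by (auto simp: E_def)
  thus False unfolding e_def using Max_ge[OF fE] by fastforce
 qed
 with algebraic_relation[OF q ys[folded t_def]]
 have "ALL i. EX G D C. vin {..<e} G & ev Const t G ~: q & ev Const t G * Var i^D : monspan q t e ((%k. Var i^k) ` {..<D}) C" by blast
 then obtain G D C where G: "!!i. vin {..<e} (G i)" "!!i. ev Const t (G i) ~: q"
  "!!i. ev Const t (G i)*Var i^D i : monspan q t e ((%k. Var i^k) ` {..<D i}) (C i)" by metis
 have D0: "D i > 0" for i proof (rule ccontr)
  assume "~ ?thesis"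
  hence "ev Const t (G i) : q" using G(3)[of i] by (simp add: monspan_def)
  with G(2) show False by blast
 qed
 \<comment> \<open>Monomials in which each variable stays below the degree of its own
   relation.\<close>
 define R where "R = (mev Var ` {m. ALL i. lk m i < D i} :: ('n, 'k) mpoly set)"
 define \<Lambda> where "\<Lambda> = (%S. ev Const t (PROD i:S. G i) :: ('n, 'k) mpoly)"
 have vG: "vin {..<e} (PROD i:S. G i)" if "finite S" for S using that proof (induction S rule: finite_induct)
  case empty show ?case by (simp add: vin_def)
 qed (simp add: vin_mult G(1))
 have fR: "finite R" proof -
  have "{m. ALL i. lk m i < D i} <= {m. ALL i. lk m i <= (SUM i:UNIV. D i)}" proof
   fix m assume m: "m : {m. ALL i. lk m i < D i}"
   have "lk m i <= (SUM i:UNIV. D i)" for i proof -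
    have "D i <= (SUM i:UNIV. D i)" by (rule member_le_sum) auto
    thus ?thesis using m by (auto dest: spec[of _ i])
   qed
   thus "m : {m. ALL i. lk m i <= (SUM i:UNIV. D i)}" by blast
  qed
  thus ?thesis unfolding R_def using finite_subset[OF _ finite_bounded_exponents] by blast
 qed
 have R1: "1 : R" unfolding R_def using D0 by (auto intro!: image_eqI[of _ _ 0])
 have 1: "EX C. \<Lambda> UNIV * \<rho> : monspan q t e R C" if "\<rho> : R" for \<rho>
  unfolding \<Lambda>_def using ev_monspan[OF qi vG[of UNIV], of t] that by auto
 have 2: "EX C. \<Lambda> UNIV * Var i * \<rho> : monspan q t e R C" if r: "\<rho> : R" for i \<rho> proof -
  obtain m where m: "\<rho> = mev Var m" "ALL i. lk m i < D i" using r by (auto simp: R_def)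
  show ?thesis proof (cases "Suc (lk m i) < D i")
   case True
   have "ALL j. lk (sgl i 1 + m) j < D j" using True m(2) by (auto simp: lookup_add lookup_single when_def)
   hence "mev Var (sgl i 1 + m) : R" unfolding R_def by blast
   moreover have "mev Var (sgl i 1 + m) = Var i * \<rho>" by (simp add: m(1) mev_add)
   ultimately show ?thesis using 1[of "Var i * \<rho>"] by (simp add: mult.assoc)
  next
   \<comment> \<open>The exponent reaches the degree of the relation of \<open>Var i\<close>, which
     rewrites the power; the leading coefficients of the other variables complete the
     factor.\<close>
   case False
   hence Di: "D i = Suc (lk m i)" using m(2) by (metis Suc_lessI)
   obtain m0 where m0: "m = m0 + sgl i (lk m i)" using exponent_split[of "lk m i" m i] by blast
   hence "lk m i = lk m0 i + lk m i" by (metis lookup_add lookup_single_eq)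
   hence m0i: "lk m0 i = 0" by simp
   have R': "x * mev Var m0 : R" if x: "x : (%k. Var i^k) ` {..<D i}" for x proof -
    obtain k where k: "x = Var i^k" "k < D i" using x by auto
    have "lk m0 j <= lk m j" for j using arg_cong[OF m0, of "%m. lk m j"] by (simp only: lookup_add)
    hence "ALL j. lk (sgl i k + m0) j < D j" using m(2) m0i k(2) le_less_trans by (fastforce simp: lookup_add lookup_single when_def)
    hence "mev Var (sgl i k + m0) : R" unfolding R_def by blast
    thus ?thesis by (simp add: k(1) mev_add)
   qed
   have "ev Const t (G i)*Var i^D i * mev Var m0 : monspan q t e R (C i)" by (rule monspan_mult_right[OF qi G(3) R'])
   moreover obtain C' where "ALL R. ALL \<rho>:R. ev Const t (PROD i:UNIV - {i}. G i)*\<rho> : monspan q t e R C'"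
    using ev_monspan[OF qi vG[of "UNIV - {i}"], of t] by auto
   ultimately have "\<Lambda> (UNIV - {i})*(ev Const t (G i)*Var i^D i * mev Var m0) : monspan q t e R (C i + C')"
    unfolding \<Lambda>_def by (intro monspan_mult qi) auto
   moreover have "\<Lambda> UNIV = \<Lambda> (UNIV - {i})*ev Const t (G i)"
    unfolding \<Lambda>_def by (subst prod.remove[of UNIV i]) (auto simp: ev_mult rhom_Const mult.commute)
   moreover have "Var i * \<rho> = Var i^D i * mev Var m0" unfolding m(1) by (subst m0) (simp add: mev_add Di mult_ac)
   ultimately show ?thesis by (auto simp: mult.assoc)
  qed
 qed
 have "EX C. ALL \<rho>:R. \<Lambda> UNIV * \<rho> : monspan q t e R C" by (rule uniform_bound[OF fR 1]) (auto intro: monspan_mono qi)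
 moreover have "EX C. ALL x:R \<times> UNIV. \<Lambda> UNIV * Var (snd x)*fst x : monspan q t e R C"
  by (rule uniform_bound) (use fR 2 in "auto intro: monspan_mono qi")
 ultimately obtain C1 C2 where C: "ALL \<rho>:R. \<Lambda> UNIV * \<rho> : monspan q t e R C1" "ALL x:R \<times> UNIV. \<Lambda> UNIV * Var (snd x)*fst x : monspan q t e R C2" by blast
 have "\<Lambda> UNIV = (PROD i:UNIV. ev Const t (G i))" by (simp add: \<Lambda>_def rhom_prod[OF rhom_ev[OF rhom_Const]])
 hence "\<Lambda> UNIV ~: q" using prime_prodD[OF q] G(2) by metis
 moreover have "e <= \<tau>" using `e : E` E(1) by auto
 moreover have "ALL \<rho>:R. \<Lambda> UNIV * \<rho> : monspan q t e R (max C1 C2)" using C(1) by (blast intro: monspan_mono[OF qi _ max.cobounded1])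
 moreover have "ALL \<rho>:R. ALL v. \<Lambda> UNIV * Var v * \<rho> : monspan q t e R (max C1 C2)" proof (intro ballI allI)
  fix \<rho> v assume "\<rho> : R"
  hence "\<Lambda> UNIV * Var v * \<rho> : monspan q t e R C2" using C(2)[rule_format, of "(\<rho>, v)"] by simp
  thus "\<Lambda> UNIV * Var v * \<rho> : monspan q t e R (max C1 C2)" by (rule monspan_mono[OF qi _ max.cobounded2])
 qed
 ultimately show ?thesis using fR R1 by blast
qed

text \<open>By Cramer's rule T_r det M is a combination of the entries of T M, and those outside K
  lie in Q. So generically the quotient by Q is finite over a transcendence base of the contraction
  and the card K remaining entries.\<close>

lemma fibre_dim: fixes Q :: "('n::finite + 'n, 'k::field) mpoly set" and M :: "('n, 'k) mpoly ^ 'n ^ 'n" assumes Q: "isprime Q" and M: "xP (det M) ~: Q"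
  and K: "!!i. i ~: K ==> (SUM r:UNIV. tv r * xP (M $ r $ i)) : Q" and d: "dimle {F. xP F : Q} \<tau>" shows "dimle Q (\<tau> + card K)" proof -
 have Qi: "isideal Q" using Q by (rule isprime_ideal)
 let ?q = "{F. xP F : Q}"
 have qi: "isideal ?q" by (rule ideal_vimage[OF rhom_xP Qi])
 obtain e t R lam C where b: "e <= \<tau>" "finite R" "1 : R" "lam ~: ?q"
  "!!\<rho>. \<rho> : R ==> lam * \<rho> : monspan ?q t e R C" "!!\<rho> v. \<rho> : R ==> lam * Var v * \<rho> : monspan ?q t e R C"
  using transcendence_base[OF prime_vimage[OF rhom_xP Q] d] by blast
 obtain h where h: "bij_betw h {..<card K} K" using ex_bij_betw_nat_finite[of K] by (auto simp: atLeast0LessThan)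
 define U where "U = (%i. SUM r:UNIV. tv r * xP (M $ r $ i))"
 \<comment> \<open>The first e parameters come from the base, the others are the entries of T M with
   index in K.\<close>
 define w where "w = (%j. if j < e then xP (t j) else U (h (j - e)))"
 let ?e = "e + card K"
 define cof where "cof = (%r k. det (\<chi> i. if i = r then axis k 1 else M $ i))"
 have "EX E. ALL F:{det M} Un range (%i. det M * Var i) Un range (%(r, k). cof r k). degle E F"
  by (rule uniform_bound) (auto intro: degle_ex degle_mono)
 then obtain E where E: "degle E (det M)" "!!i. degle E (det M * Var i)" "!!r k. degle E (cof r k)" by fastforce
 have trans: "xP F : monspan Q w ?e (xP ` R) D" if "F : monspan ?q t e R D" for F D using qi that proof (rule monspan_induct)
  fix b \<rho> assume *: "!!j. j < e ==> b j <= D" "\<rho> : R"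
  have "mons w ?e (%j. if j < e then b j else 0) = (PROD j<e. w j^b j)" unfolding mons_def by (rule prod.mono_neutral_cong_right) auto
  also have "... = xP (mons t e b)" by (simp add: mons_def rhom_prod[OF rhom_xP] rhom_power[OF rhom_xP] w_def)
  finally show "xP (mons t e b * \<rho>) : monspan Q w ?e (xP ` R) D"
   using monspan_base[OF Qi, of ?e "%j. if j < e then b j else 0" D "xP \<rho>" "xP ` R" w] * by (simp add: rhom_mult[OF rhom_xP])
 qed (auto simp: rhom_add[OF rhom_xP] rhom_mult[OF rhom_xP] xP_simps intro: monspan_0 Qi monspan_add monspan_Const_mult)
 have g: "xP (lam^E*F * \<rho>) : monspan Q w ?e (xP ` R) (E*C)" if "degle E F" "\<rho> : R" for F \<rho>
  by (rule trans[OF growth_deg[OF qi b(5,6) that]])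
 define lam' where "lam' = xP (det M * lam^E)"
 have "lam' ~: Q" proof
  assume "lam' : Q"
  hence "xP lam^E : Q" using prime_multD[OF Q] M by (auto simp: lam'_def rhom_mult[OF rhom_xP] rhom_power[OF rhom_xP])
  with prime_powerD[OF Q] b(4) show False by blast
 qed
 have "dimle Q ?e" proof (rule growth[OF Qi, of lam' "xP ` R" w ?e "E * C + 1"])
  show "F : Q" if "lam' * F : Q" for F using prime_multD[OF Q that] `lam' ~: Q` by blast
  show "finite (xP ` R)" using b(2) by simp
  show "1 : xP ` R" using b(3) rhom_1[OF rhom_xP] by force
  fix \<rho>' assume "\<rho>' : xP ` R"
  then obtain \<rho> where r: "\<rho>' = xP \<rho>" "\<rho> : R" by blast
  have "lam' * \<rho>' = xP (lam^E*det M * \<rho>)" by (simp add: lam'_def r rhom_mult[OF rhom_xP] mult_ac)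
  thus "lam' * \<rho>' : monspan Q w ?e (xP ` R) (E*C + 1)" using monspan_mono[OF Qi g[OF E(1) r(2)]] by simp
  fix v :: "'n + 'n"
  show "lam' * Var v * \<rho>' : monspan Q w ?e (xP ` R) (E*C + 1)" proof (cases v)
   case (Inl i)
   hence "lam' * Var v * \<rho>' = xP (lam^E*(det M * Var i)*\<rho>)" by (simp add: lam'_def r rhom_mult[OF rhom_xP] xP_simps mult_ac)
   thus ?thesis using monspan_mono[OF Qi g[OF E(2) r(2)]] by simp
  next
   case (Inr r0)
   have cofP: "det (\<chi> i. if i = r0 then axis k 1 else (\<chi> i j. xP (M $ i $ j)) $ i) = xP (cof r0 k)" for k
    unfolding cof_def rhom_det[OF rhom_xP] by (intro arg_cong[of _ _ det]) (auto simp: vec_eq_iff axis_def rhom_0[OF rhom_xP] rhom_1[OF rhom_xP])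
   have "tv r0 * xP (det M) = (SUM k:UNIV. U k * xP (cof r0 k))" using cramer_row[of "%i. tv i" r0 "\<chi> i j. xP (M $ i $ j)"]
    unfolding cofP by (simp add: rhom_det[OF rhom_xP, symmetric] U_def)
   hence "lam' * Var v * \<rho>' = (SUM k:UNIV. U k * xP (cof r0 k))*xP (lam^E*\<rho>)"
    by (simp only: lam'_def r Inr rhom_mult[OF rhom_xP] mult_ac) (metis (no_types, lifting) mult.assoc mult.commute)
   also have "... = (SUM k:UNIV. U k * xP (lam^E*cof r0 k * \<rho>))" by (simp only: sum_distrib_right rhom_mult[OF rhom_xP]) (simp only: mult_ac)
   also have "... : monspan Q w ?e (xP ` R) (E*C + 1)" proof (rule monspan_sum[OF Qi])
    fix k
    show "U k * xP (lam^E*cof r0 k * \<rho>) : monspan Q w ?e (xP ` R) (E*C + 1)" proof (cases "k : K")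
     case True
     then obtain j where j: "j < card K" "h j = k" using h by (metis bij_betw_imp_surj_on imageE lessThan_iff)
     hence "U k = mons w ?e (%i. if i = e + j then 1 else 0)" using mons_delta[of "e + j" ?e w] by (simp add: w_def)
     thus ?thesis using monspan_mons_mult[OF Qi g[OF E(3) r(2)], of "%i. if i = e + j then 1 else 0" 1] by simp
    next
     case False
     thus ?thesis using K[OF False] by (intro monspan_0 Qi ideal_mult_r) (simp_all add: U_def)
    qed
   qed
   finally show ?thesis .
  qed
 qed
 thus ?thesis by (rule dimle_mono) (use b(1) in auto)
qed

section \<open>Linear alternating presentations\<close>

lemma det_row_expand: fixes A :: "'a::comm_ring_1 ^ 'n ^ 'n"
 shows "det (\<chi> i. if i = r then v else A $ i) = (SUM k:UNIV. v $ k * det (\<chi> i. if i = r then axis k 1 else A $ i))" proof -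
 have "v = (SUM k:UNIV. v $ k *s axis k 1)" by (simp add: vec_eq_iff axis_def if_distrib[of "%x. _ * x"] cong: if_cong)
 hence "det (\<chi> i. if i = r then v else A $ i) = det (\<chi> i. if i = r then (SUM k:UNIV. v $ k *s axis k 1) else A $ i)" by (rule arg_cong)
 also have "... = (SUM k:UNIV. v $ k * det (\<chi> i. if i = r then axis k 1 else A $ i))"
  by (simp add: det_linear_row_sum[OF finite, of r "%i k. v $ k *s axis k 1"] det_row_mul)
 finally show ?thesis .
qed

lemma det_unit_columns: fixes v :: "'n::finite => 'a::comm_ring_1" shows "det (\<chi> i j. if j = a then v i else if i = j then 1 else 0) = v a" (is "det ?M = _") proof -
 have "det ?M = det (transpose ?M)" by simp
 also have "transpose ?M = (\<chi> i. if i = a then (\<chi> k. v k) else (mat 1 :: 'a ^ 'n ^ 'n) $ i)"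
  by (auto simp: transpose_def vec_eq_iff mat_def)
 also have "det ... = (SUM k:UNIV. v k * det (\<chi> i. if i = a then axis k 1 else (mat 1 :: 'a ^ 'n ^ 'n) $ i))" by (subst det_row_expand) simp
 also have "... = (SUM k:UNIV. if k = a then v a else 0)" proof (intro sum.cong refl)
  fix k
  have axis: "(mat 1 :: 'a ^ 'n ^ 'n) $ i = axis i 1" for i by (simp add: vec_eq_iff mat_def axis_def)
  show "v k * det (\<chi> i. if i = a then axis k 1 else (mat 1 :: 'a ^ 'n ^ 'n) $ i) = (if k = a then v a else 0)" proof (cases "k = a")
   case True
   hence "(\<chi> i. if i = a then axis k 1 else (mat 1 :: 'a ^ 'n ^ 'n) $ i) = mat 1" by (simp add: vec_eq_iff axis)
   with True show ?thesis by simp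
  next
   case False
   hence "det (\<chi> i. if i = a then axis k 1 else (mat 1 :: 'a ^ 'n ^ 'n) $ i) = 0"
    by (intro det_identical_rows[of a k]) (auto simp: row_def vec_eq_iff axis)
   with False show ?thesis by simp
  qed
 qed
 also have "... = v a" by simp
 finally show ?thesis .
qed

lemma max_indep: assumes "isprime q" "dimle q e" obtains r t where "r <= e" "indep q r t" "dimle q r" proof -
 let ?P = "%r. EX t. indep q r t"
 define r where "r = (GREATEST r. ?P r)"
 have b: "ALL r. ?P r --> r <= e" using assms(2) by (auto simp: dimle_def)
 have "?P 0" using indep_0[OF assms(1)] by blast
 hence "?P r" unfolding r_def by (rule GreatestI_nat) (use b in blast)
 moreover have "dimle q r" unfolding dimle_def r_def using Greatest_le_nat[of ?P _ e] b by blast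
 ultimately show ?thesis using b that[of r] by blast
qed

lemma ev_homg: assumes v: "!!i. v i : homg wt' (wt i)" and F: "F : homg wt e" shows "ev Const v F : homg wt' e" unfolding ev_def
proof (intro homg_sum homg_Const_mult)
 fix m assume "m : kys F"
 hence "wdeg wt m = e" using F by (auto simp: homg_iff in_keys_iff)
 moreover have "(PROD i:kys m. v i^lk m i) : homg wt' (SUM i:kys m. lk m i * wt i)" by (intro homg_prod homg_power v) auto
 ultimately show "mev v m : homg wt' e" by (simp add: mev_def wdeg_def mult.commute)
qed

lemma ev_hcomp: assumes v: "!!i. v i : homg wt' (wt i)" shows "hcomp wt' d (ev Const v F) = ev Const v (hcomp wt d F)" proof -
 obtain D where D: "F = (SUM e<=max d D. hcomp wt e F)" using hcomp_decomp[of F wt] by (metis max.cobounded2)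
 have "hcomp wt' d (ev Const v F) = (SUM e<=max d D. hcomp wt' d (ev Const v (hcomp wt e F)))" by (subst D) (simp add: ev_sum rhom_Const hcomp_sum)
 also have "... = (SUM e<=max d D. if e = d then ev Const v (hcomp wt d F) else 0)"
  by (intro sum.cong refl) (simp add: hcomp_of_homg[OF ev_homg[OF v hcomp_homg]])
 also have "... = ev Const v (hcomp wt d F)" by simp
 finally show ?thesis .
qed

lemma hcomp_product:
 "hcomp wt k (F*G) = (SUM i<=k. hcomp wt i F * hcomp wt (k - i) G)" proof -
 obtain D where D: "F = (SUM i<=max k D. hcomp wt i F)" using hcomp_decomp[of F wt] by (metis max.cobounded2)
 have "hcomp wt k (F*G) = (SUM i<=max k D. hcomp wt k (hcomp wt i F * G))" by (subst D) (simp add: sum_distrib_right hcomp_sum)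
 also have "... = (SUM i<=max k D. if i <= k then hcomp wt i F * hcomp wt (k - i) G else 0)"
  by (intro sum.cong refl) (simp add: hcomp_mult_homg[OF hcomp_homg])
 also have "... = (SUM i<=k. hcomp wt i F * hcomp wt (k - i) G)" by (rule sum.mono_neutral_cong_right) auto
 finally show ?thesis .
qed

text \<open>The largest graded ideal inside Q. It is prime if Q is, by looking at the lowest
  components outside Q, and elements independent modulo Q stay independent modulo it.\<close>

definition star :: "('i => nat) => ('i, 'a::comm_ring_1) mpoly set => ('i, 'a) mpoly set" where
 "star wt Q = {F. ALL d. hcomp wt d F : Q}"

lemma star_subset: assumes "isideal Q" shows "star wt Q <= Q" proof
 fix F assume F: "F : star wt Q"
 obtain D where D: "F = (SUM i<=D. hcomp wt i F)" using hcomp_decomp[of F wt] by blast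
 have "(SUM i<=D. hcomp wt i F) : Q" using F assms by (intro ideal_sum) (auto simp: star_def)
 thus "F : Q" by (subst D)
qed

lemma star_superset: "isideal Q ==> hideal wt a ==> a <= Q ==> a <= star wt Q" by (auto simp: star_def hideal_def)

lemma star_ideal: assumes Q: "isideal Q" shows "isideal (star wt Q)" proof (rule idl.subspaceI)
 show "0 : star wt Q" using ideal_0[OF Q] by (simp add: star_def)
 show "x + y : star wt Q" if "x : star wt Q" "y : star wt Q" for x y using that by (simp add: star_def hcomp_add ideal_add[OF Q])
 show "c * x : star wt Q" if "x : star wt Q" for c x using that by (auto simp: star_def hcomp_product intro!: ideal_sum[OF Q] ideal_mult_l[OF Q])
qed

lemma hideal_star: "isideal Q ==> hideal wt (star wt Q)"
 using star_ideal[of Q wt] ideal_0[of Q] by (auto simp: hideal_def star_def hcomp_of_homg[OF hcomp_homg])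

lemma star_prime: assumes Q: "isprime Q" shows "isprime (star wt Q)" unfolding isprime_def proof (intro conjI allI impI)
 have Qi: "isideal Q" using Q by (rule isprime_ideal)
 show "isideal (star wt Q)" using Qi by (rule star_ideal)
 show "1 ~: star wt Q" using star_subset[OF Qi, of wt] Q by (auto simp: isprime_def)
 fix F G assume FG: "F * G : star wt Q"
 show "F : star wt Q \<or> G : star wt Q" proof (rule ccontr)
  assume "~ ?thesis"
  hence ex: "EX d. hcomp wt d F ~: Q" "EX d. hcomp wt d G ~: Q" by (auto simp: star_def)
  define a b where "a = (LEAST d. hcomp wt d F ~: Q)" and "b = (LEAST d. hcomp wt d G ~: Q)"
  have a: "hcomp wt a F ~: Q" "!!i. i < a ==> hcomp wt i F : Q" unfolding a_def using LeastI_ex[OF ex(1)] apply assumption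
   using not_less_Least[of _ "%d. hcomp wt d F ~: Q"] by blast
  have b: "hcomp wt b G ~: Q" "!!i. i < b ==> hcomp wt i G : Q" unfolding b_def using LeastI_ex[OF ex(2)] apply assumption
   using not_less_Least[of _ "%d. hcomp wt d G ~: Q"] by blast
  have "hcomp wt (a + b) (F*G) = hcomp wt a F * hcomp wt b G
    + (SUM i:{..a + b} - {a}. hcomp wt i F * hcomp wt (a + b - i) G)" unfolding hcomp_product by (subst sum.remove[of _ a]) auto
  moreover have "(SUM i:{..a + b} - {a}. hcomp wt i F * hcomp wt (a + b - i) G) : Q" proof (rule ideal_sum[OF Qi])
   fix i assume i: "i : {..a + b} - {a}"
   show "hcomp wt i F * hcomp wt (a + b - i) G : Q" proof (cases "i < a")
    case True thus ?thesis by (intro ideal_mult_r Qi a(2))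
   next
    case False thus ?thesis using i by (intro ideal_mult_l Qi b(2)) auto
   qed
  qed
  moreover have "hcomp wt (a + b) (F*G) : Q" using FG by (simp add: star_def)
  ultimately have "hcomp wt a F * hcomp wt b G : Q" using idl.subspace_diff[OF Qi] by fastforce
  thus False using prime_multD[OF Q] a(1) b(1) by blast
 qed
qed

section \<open>The bigrading by x-degree and T-degree\<close>

abbreviation xw :: "'n + 'n => nat" where "xw == case_sum (%_. 1) (%_. 0)"
abbreviation tw :: "'n + 'n => nat" where "tw == case_sum (%_. 0) (%_. 1)"

lemma xP_homg: "F : homg tot e ==> xP F : homg tot e" "F : homg tot e ==> xP F : homg xw e" "xP F : homg tw 0" unfolding xP_def proof -
 show "F : homg tot e ==> ev Const (%i. xv i) F : homg tot e" by (rule ev_homg[where wt = tot]) (rule homg_Var[of _ tot])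
 show "F : homg tot e ==> ev Const (%i. xv i) F : homg xw e" by (rule ev_homg) (use homg_Var[of "Inl _" xw] in simp_all)
 have "F : homg (%_. 0) 0" by (auto simp: homg_iff wdeg_def)
 thus "ev Const (%i. xv i) F : homg tw 0" by (rule ev_homg[rotated]) (use homg_Var[of "Inl _" tw] in simp_all)
qed

lemma tP_homg: "F : homg tot e ==> tP F : homg tot e" "F : homg tot e ==> tP F : homg tw e" "tP F : homg xw 0" unfolding tP_def proof -
 show "F : homg tot e ==> ev Const (%i. tv i) F : homg tot e" by (rule ev_homg[where wt = tot]) (rule homg_Var[of _ tot])
 show "F : homg tot e ==> ev Const (%i. tv i) F : homg tw e" by (rule ev_homg) (use homg_Var[of "Inr _" tw] in simp_all)
 have "F : homg (%_. 0) 0" by (auto simp: homg_iff wdeg_def)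
 thus "ev Const (%i. tv i) F : homg xw 0" by (rule ev_homg[rotated]) (use homg_Var[of "Inr _" xw] in simp_all)
qed

lemma hcomp_xP: "hcomp xw d (xP F) = xP (hcomp tot d F)" unfolding xP_def by (rule ev_hcomp) (use homg_Var[of "Inl _" xw] in simp_all)

lemma hideal_contract_x: assumes "hideal xw Q" shows "hideal tot {F. xP F : Q}"
 using assms ideal_vimage[OF rhom_xP, of Q] unfolding hideal_def mem_Collect_eq hcomp_xP[symmetric] by blast

text \<open>\<open>ent\<close> expresses that the variables lie in I_1(\<psi>): an ideal that misses
  a variable misses an entry.\<close>

locale linear_alternating =
 fixes d m :: nat and f :: "('n::finite, 'k::field) mpoly" and \<pi> :: "('n, 'k) mpoly => 'r::comm_ring_1"
  and I :: "'r set" and \<phi> :: "'r ^ 'n ^ 'n" and a :: "'r ^ 'n" and \<psi> :: "('n, 'k) mpoly ^ 'n ^ 'n"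
 assumes k: "infinite (UNIV :: 'k set)" and card: "CARD('n) = d + 1" and f: "f ~= 0" "f : homg tot m" and m: "m >= 1"
  and \<pi>: "rhom \<pi>" "surj \<pi>" and ker: "!!x. \<pi> x = 0 \<longleftrightarrow> x : igen {f}"
  and pres: "presents \<phi> a I" and \<phi>: "!!i j. \<pi> (\<psi> $ i $ j) = \<phi> $ i $ j" and G: "satisfies_G rng d I"
  and alt: "!!i j. \<psi> $ i $ j = - (\<psi> $ j $ i)" "!!i. \<psi> $ i $ i = 0" and lin: "!!i j. \<psi> $ i $ j : homg tot 1"
  and ent: "!!q i. isideal q ==> (!!i j. \<psi> $ i $ j : q) ==> Var i : q"
begin

definition l :: "'n => ('n + 'n, 'k) mpoly" where
 "l j = (SUM i:UNIV. tv i * xP (\<psi> $ i $ j))"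

lemma l_homg: "l j : homg tot 2" "l j : homg xw 1" "l j : homg tw 1" proof -
 have "tv i * xP (\<psi> $ i $ j) : homg tot (1 + 1)" for i by (intro homg_mult xP_homg lin homg_Var[of "Inr i" tot])
 thus "l j : homg tot 2" unfolding l_def by (intro homg_sum) (simp add: numeral_2_eq_2)
 have "tv i * xP (\<psi> $ i $ j) : homg xw (0 + 1)" for i using homg_Var[of "Inr i" xw] by (intro homg_mult xP_homg lin) simp
 thus "l j : homg xw 1" unfolding l_def by (intro homg_sum) simp
 have "tv i * xP (\<psi> $ i $ j) : homg tw (1 + 0)" for i using homg_Var[of "Inr i" tw] by (intro homg_mult xP_homg lin) simp
 thus "l j : homg tw 1" unfolding l_def by (intro homg_sum) simp
qed

lemma fibre_columns: assumes Q: "isprime Q" "!!j. l j : Q" and M: "det M ~: {F. xP F : Q}"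
  and K: "!!j. j ~: K ==> EX k. ALL i. M $ i $ j = \<psi> $ i $ k" and dim: "dimle {F. xP F : Q} \<tau>" shows "dimle Q (\<tau> + card K)"
proof (rule fibre_dim[OF Q(1) _ _ dim])
 show "xP (det M) ~: Q" using M by simp
 fix j assume "j ~: K"
 then obtain k where "!!i. M $ i $ j = \<psi> $ i $ k" using K by blast
 thus "(SUM r:UNIV. tv r * xP (M $ r $ j)) : Q" using Q(2)[of k] by (simp add: l_def)
qed

lemma fibre_zero: assumes Q: "isprime Q" "!!j. l j : Q" and dim: "dimle {F. xP F : Q} \<tau>" shows "dimle Q (\<tau> + CARD('n))"
proof (rule fibre_columns[OF Q, where M = "mat 1" and K = UNIV])
 show "det (mat 1) ~: {F. xP F : Q}" using prime_vimage[OF rhom_xP Q(1)] by (simp add: isprime_def)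
qed (use dim in auto)

text \<open>A column of \<psi> with an entry outside Q, completed by unit columns, is an invertible
  matrix that gives one equation for T.\<close>

lemma fibre_entry: assumes Q: "isprime Q" "!!j. l j : Q" and x: "xv i ~: Q" and dim: "dimle {F. xP F : Q} \<tau>" shows "dimle Q (\<tau> + d)" proof -
 have "Var i ~: {F. xP F : Q}" using x by (simp add: xP_simps)
 then obtain a b where ab: "\<psi> $ a $ b ~: {F. xP F : Q}" using ent[OF ideal_vimage[OF rhom_xP isprime_ideal[OF Q(1)]]] by blast
 have "dimle Q (\<tau> + card (UNIV - {a}))"
 proof (rule fibre_columns[OF Q, where M = "\<chi> i j. if j = a then \<psi> $ i $ b else if i = j then 1 else 0"])
  show "det (\<chi> i j. if j = a then \<psi> $ i $ b else if i = j then 1 else 0) ~: {F. xP F : Q}" using ab by (simp add: det_unit_columns)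
 qed (use dim in auto)
 thus ?thesis by (simp add: card card_Diff_singleton)
qed

lemma gorenstein_columns: assumes q: "isprime q" "f : q" "indep q r t" "r >= 1"
 obtains M :: "('n, 'k) mpoly ^ 'n ^ 'n" and K where "det M ~: q" "!!j. j ~: K ==> EX k. ALL i. M $ i $ j = \<psi> $ i $ k"
  "I <= \<pi> ` q ==> card K + r <= d" "~ I <= \<pi> ` q ==> card K <= 1" using gorenstein_matrix[OF card f(1) \<pi> ker pres \<phi> G q] by metis

lemma dim_over_f: assumes "isprime q" "f : q" shows "dimle q d" using dimle_prime_nonzero[OF assms f(1)] card by simp

text \<open>Over a base of dimension r > 0 the condition G_d leaves at most d - r, or one, free
  coordinates T; over a base of dimension 0 all d + 1 coordinates are allowed.\<close>

lemma dim_prime_lf: assumes Q: "isprime Q" "!!j. l j : Q" "xP f : Q" shows "dimle Q (d + 1)" proof -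
 let ?q = "{F. xP F : Q}"
 have q: "isprime ?q" "f : ?q" using prime_vimage[OF rhom_xP Q(1)] Q(3) by simp_all
 obtain r t where r: "r <= d" "indep ?q r t" "dimle ?q r" using max_indep[OF q(1) dim_over_f[OF q]] .
 show ?thesis proof (cases "r = 0")
  case True
  thus ?thesis using fibre_zero[OF Q(1,2) r(3)] card by simp
 next
  case False
  hence "r >= 1" by simp
  from gorenstein_columns[OF q r(2) this] obtain M :: "('n, 'k) mpoly ^ 'n ^ 'n" and K where M: "det M ~: ?q" "!!j. j ~: K ==> EX k. ALL i. M $ i $ j = \<psi> $ i $ k"
   "I <= \<pi> ` ?q ==> card K + r <= d" "~ I <= \<pi> ` ?q ==> card K <= 1" by metis
  have "r + card K <= d + 1" using M(3,4) r(1) by (cases "I <= \<pi> ` ?q") auto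
  with fibre_columns[OF Q(1,2) M(1,2) r(3)] show ?thesis by (meson dimle_mono subset_refl)
 qed
qed

text \<open>Away from x = 0 and over V(I) the bound improves by one: for r = 0 a nonvanishing entry
  gives an equation, for r > 0 only the first alternative of \<open>gorenstein_columns\<close>
  occurs.\<close>

lemma dim_prime_lfI: assumes Q: "isprime Q" "!!j. l j : Q" "xP f : Q" and J: "I <= \<pi> ` {F. xP F : Q}" and x: "xv i ~: Q" shows "dimle Q d" proof -
 let ?q = "{F. xP F : Q}"
 have q: "isprime ?q" "f : ?q" using prime_vimage[OF rhom_xP Q(1)] Q(3) by simp_all
 obtain r t where r: "r <= d" "indep ?q r t" "dimle ?q r" using max_indep[OF q(1) dim_over_f[OF q]] .
 show ?thesis proof (cases "r = 0")
  case True
  thus ?thesis using fibre_entry[OF Q(1,2) x r(3)] by simp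
 next
  case False
  hence "r >= 1" by simp
  from gorenstein_columns[OF q r(2) this] obtain M :: "('n, 'k) mpoly ^ 'n ^ 'n" and K where M: "det M ~: ?q" "!!j. j ~: K ==> EX k. ALL i. M $ i $ j = \<psi> $ i $ k"
   "card K + r <= d" using J by metis
  hence "r + card K <= d" by simp
  with fibre_columns[OF Q(1,2) M(1,2) r(3)] show ?thesis by (meson dimle_mono subset_refl)
 qed
qed

lemma dim_lf: "dimle (igen (insert (xP f) (range l))) (d + 1)" proof (rule dimle_primes)
 fix Q assume Q: "isprime Q" "igen (insert (xP f) (range l)) <= Q"
 have "x : Q" if "x : insert (xP f) (range l)" for x using Q(2) igen_base[OF that] by blast
 thus "dimle Q (d + 1)" by (intro dim_prime_lf Q(1)) auto
qed (rule isideal_igen)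

lemma hideal_l: "hideal tot (igen (range l))" "hideal xw (igen (range l))" "hideal tw (igen (range l))" using l_homg by (auto intro!: hideal_igen)

lemma dim_l: "dimle (igen (range l)) (d + 2)" proof -
 have "dimle (igen (insert (xP f) (igen (range l)))) (d + 1)" by (rule dimle_mono[OF dim_lf]) (auto intro!: idl.span_mono intro: igen_base)
 from dimle_insert[OF k hideal_l(1) xP_homg(1)[OF f(2)] _ this] m show ?thesis by simp
qed

text \<open>Primes of dimension d + 2 over (l) dominate the x-space. Otherwise the contraction has
  dimension at most d. In dimension s + 2 it need not contain f, so G_d is applied at a larger prime
  over f with s + 1 independent elements; the matrix found there is also invertible at the
  contraction and forces dimension at most d + 1.\<close>

lemma dominant_prime: assumes Q: "isprime Q" "hideal xw Q" "!!j. l j : Q" and w: "indep Q (d + 2) w" and F: "xP F : Q" shows "F = 0"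
proof (rule ccontr)
 assume "F ~= 0"
 let ?q = "{F. xP F : Q}"
 have contra: False if "dimle Q (d + 1)" using that w unfolding dimle_def by fastforce
 have q: "isprime ?q" "hideal tot ?q" using prime_vimage[OF rhom_xP Q(1)] hideal_contract_x[OF Q(2)] by simp_all
 have "dimle ?q d" using dimle_prime_nonzero[OF q(1), of F] F `F ~= 0` card by simp
 from max_indep[OF q(1) this] obtain \<tau> t where t: "\<tau> <= d" "indep ?q \<tau> t" "dimle ?q \<tau>" .
 consider "\<tau> = 0" | "\<tau> = 1" | s where "\<tau> = Suc (Suc s)" by (metis One_nat_def not0_implies_Suc)
 thus False proof cases
  case 1
  thus False using fibre_zero[OF Q(1,3) t(3)] card contra by simp
 next
  case 2
  have "EX i. xv i ~: Q" proof (rule ccontr)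
   assume "~ ?thesis"
   hence "Var i : ?q" for i by (simp add: xP_simps)
   hence "sop ?q 0 y" for y unfolding sop_def by (auto intro: gen_in_rad)
   from sop_dimle[OF q(2) this] have "dimle ?q 0" .
   with t(2) 2 show False unfolding dimle_def by fastforce
  qed
  thus False using fibre_entry[OF Q(1,3) _ t(3)] contra 2 by (auto simp: add.commute)
 next
  case 3
  let ?a = "igen (insert f ?q)"
  \<comment> \<open>The contraction is graded, so adding the form f lowers its dimension by at most
    one.\<close>
  have "~ dimle ?a s" proof
   assume "dimle ?a s"
   hence "dimle ?q (Suc s)" by (rule dimle_insert[OF k q(2) f(2), rotated]) (use m in simp)
   with t(2) 3 show False unfolding dimle_def by fastforce
  qed
  then obtain r t' where r: "indep ?a r t'" "r > s" unfolding dimle_def by (meson not_le_imp_less)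
  have "indep ?a (Suc s) t'" by (rule indep_less[OF r(1)]) (use r(2) in simp)
  from indep_prime[OF isideal_igen this] obtain p where p: "isprime p" "?a <= p" "indep p (Suc s) t'" by blast
  have "f : p" "?q <= p" using p(2) igen_base[of _ "insert f ?q"] by blast+
  have "1 <= Suc s" by simp
  from gorenstein_columns[OF p(1) `f : p` p(3) this] obtain M :: "('n, 'k) mpoly ^ 'n ^ 'n" and K where M: "det M ~: p" "!!j. j ~: K ==> EX k. ALL i. M $ i $ j = \<psi> $ i $ k"
   "I <= \<pi> ` p ==> card K + Suc s <= d" "~ I <= \<pi> ` p ==> card K <= 1" by metis
  have "\<tau> + card K <= d + 1" using M(3,4) t(1) 3 by (cases "I <= \<pi> ` p") auto
  moreover have "det M ~: ?q" using M(1) `?q <= p` by blast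
  ultimately have "dimle Q (d + 1)" using fibre_columns[OF Q(1,3) _ M(2) t(3)] by (meson dimle_mono subset_refl)
  thus False by (rule contra)
 qed
qed

end

section \<open>Null vectors and cofactors\<close>

text \<open>The expression at b s minus b^D times the expression at s is free of the last
  coefficient; b is chosen with b^i different from b^D for all i < D.\<close>

lemma vandermonde: fixes c :: "nat => ('v, 'k::field) mpoly" assumes k: "infinite (UNIV :: 'k set)" and a: "isideal a"
 shows "(!!s. (SUM i<D. Const (s^i)*c i) : a) ==> i < D ==> c i : a" proof (induction D arbitrary: c i)
 case (Suc D)
 define p where "p = (PROD i<D. Polynomial.monom 1 i - Polynomial.monom (1 :: 'k) D)"
 have "Polynomial.monom 1 i - Polynomial.monom (1 :: 'k) D ~= 0" if "i < D" for i proof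
  assume "Polynomial.monom 1 i - Polynomial.monom (1 :: 'k) D = 0"
  from arg_cong[OF this, of "%p. coeff p i"] that show False by simp
 qed
 hence "p ~= 0" by (simp add: p_def)
 hence "finite {x. poly p x = 0}" by (rule poly_roots_finite)
 then obtain b where b: "poly p b ~= 0" using ex_new_if_finite[OF k] by blast
 hence b: "b^i - b^D ~= 0" if "i < D" for i using that by (auto simp: p_def poly_prod poly_monom)
 have low: "c i : a" if i: "i < D" for i proof -
  have "Const (b^i - b^D)*c i : a" proof (rule Suc.IH[of "%i. Const (b^i - b^D)*c i", OF _ i])
   fix s
   have "(SUM i<D. Const (s^i)*(Const (b^i - b^D)*c i))
     = (SUM i<Suc D. Const ((b * s)^i)*c i) - Const (b^D)*(SUM i<Suc D. Const (s^i)*c i)"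
    by (simp add: Const_simps sum_distrib_left sum_subtractf[symmetric] power_mult_distrib algebra_simps)
   also have "... : a" by (intro idl.subspace_diff[OF a] ideal_mult_l[OF a] Suc.prems(1))
   finally show "(SUM i<D. Const (s^i)*(Const (b^i - b^D)*c i)) : a" .
  qed
  hence "Const (inverse (b^i - b^D))*(Const (b^i - b^D)*c i) : a" by (rule ideal_mult_l[OF a])
  thus ?thesis using Const_inverse[OF b[OF i]] by metis
 qed
 show ?case proof (cases "i = D")
  case True
  have "(SUM i<Suc D. Const (1^i)*c i) - (SUM i<D. c i) : a" by (rule idl.subspace_diff[OF a Suc.prems(1) ideal_sum[OF a]]) (use low in simp)
  thus ?thesis using True by (simp add: Const_simps)
 next
  case False
  thus ?thesis using low Suc.prems(2) by simp
 qed
qed simp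

lemma ev_upd_vin: "vin {..<e::nat} F ==> ev h (y(e := z)) F = ev h y F" proof (rule ev_cong)
 fix i m assume "vin {..<e} F" "m : kys F" "i : kys m"
 hence "i < e" unfolding vin_def by blast
 thus "(y(e := z)) i = y i" by auto
qed

lemma line_coefficients: fixes y :: "nat => ('v, 'k::field) mpoly" assumes k: "infinite (UNIV :: 'k set)" and rr: "isprime rr" and \<Delta>: "\<Delta> ~: rr"
  and F: "F = (SUM i<D. Var e^i*c i)" "!!i. vin {..<e} (c i)" and z: "!!s. ev Const (y(e := Const s * \<Delta>)) F : rr" and i: "i < D"
 shows "ev Const y (c i) : rr" proof -
 have "\<Delta>^i*ev Const y (c i) : rr" proof (rule vandermonde[OF k isprime_ideal[OF rr] _ i])
  fix s
  have "ev Const (y(e := Const s * \<Delta>)) F = (SUM i<D. Const (s^i)*(\<Delta>^i*ev Const y (c i)))"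
   unfolding F(1) by (simp add: ev_sum rhom_Const ev_mult rhom_power[OF rhom_ev] ev_Var ev_upd_vin[OF F(2)]
    power_mult_distrib Const_simps mult_ac)
  thus "(SUM i<D. Const (s^i)*(\<Delta>^i*ev Const y (c i))) : rr" using z[of s] by simp
 qed
 thus ?thesis using prime_multD[OF rr] prime_powerD[OF rr] \<Delta> by blast
qed

text \<open>The maps \<open>h s t\<close> carry Q into rr and the two extra elements to s \<Delta>
  and t \<Delta>. As s and t range over an infinite field, a relation modulo Q vanishes coefficient
  by coefficient.\<close>

lemma indep_pencil: fixes y :: "nat => ('v, 'k::field) mpoly" and h :: "'k => 'k => ('w, 'k) mpoly => ('v, 'k) mpoly"
 assumes k: "infinite (UNIV :: 'k set)" and rr: "isprime rr" "\<Delta> ~: rr" and y: "indep rr r y"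
  and h: "!!s t. rhom (h s t)" "!!s t c. h s t (Const c) = Const c" "!!s t F. F : Q ==> h s t F : rr"
  and w: "!!s t j. j < r ==> h s t (w j) = y j" "!!s t. h s t (w r) = Const s * \<Delta>" "!!s t. h s t (w (Suc r)) = Const t * \<Delta>"
 shows "indep Q (r + 2) w" unfolding indep_def proof (intro allI impI)
 fix G assume G: "vin {..<r + 2} G & ev Const w G : Q"
 hence "vin {..<Suc (Suc r)} G" by simp
 then obtain D c where c: "G = (SUM i<D. Var (Suc r)^i*c i)" "!!i. vin {..<Suc r} (c i)" using variable_expansion by metis
 have hw: "h s t (ev Const w G) = ev Const ((y(r := Const s * \<Delta>))(Suc r := Const t * \<Delta>)) G" for s t proof -
  have "h s t (ev Const w G) = ev Const (%i. h s t (w i)) G" using ev_comp[OF h(1) rhom_Const, of s t w G] by (simp add: h(2))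
  also have "... = ev Const ((y(r := Const s * \<Delta>))(Suc r := Const t * \<Delta>)) G" proof (rule ev_cong)
   fix i m assume "m : kys G" "i : kys m"
   hence "i < r + 2" using G unfolding vin_def by blast
   thus "h s t (w i) = ((y(r := Const s * \<Delta>))(Suc r := Const t * \<Delta>)) i" by (cases "i < r"; cases "i = r") (auto simp: w less_Suc_eq)
  qed
  finally show ?thesis .
 qed
 have "c i = 0" if i: "i < D" for i proof -
  have ci: "ev Const (y(r := Const s * \<Delta>)) (c i) : rr" for s proof (rule line_coefficients[OF k rr c _ i])
   show "ev Const ((y(r := Const s * \<Delta>))(Suc r := Const t * \<Delta>)) G : rr" for t using h(3) G unfolding hw[symmetric] by blast
  qed
  obtain E b where b: "c i = (SUM j<E. Var r^j*b j)" "!!j. vin {..<r} (b j)" using variable_expansion[OF c(2)[of i]] by metis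
  have "ev Const y (b j) : rr" if "j < E" for j by (rule line_coefficients[OF k rr b ci that])
  hence "b j = 0" if "j < E" for j using y b(2) that by (auto simp: indep_def)
  thus ?thesis unfolding b(1) by simp
 qed
 thus "G = 0" unfolding c(1) by simp
qed

text \<open>With v a unit vector the determinant is a cofactor; cofactors are written in this way
  throughout.\<close>

abbreviation rowrep :: "'a ^ 'n ^ 'n => 'n => 'a ^ 'n => 'a ^ 'n ^ 'n" where
 "rowrep A r v == (\<chi> i. if i = r then v else A $ i)"

lemma det_identical: fixes A :: "'a::comm_ring_1 ^ 'n ^ 'n" shows "i ~= j ==> A $ i = A $ j ==> det A = 0"
 by (rule det_identical_rows[of i j]) (simp_all add: row_def vec_eq_iff)

lemma det_swap: fixes A :: "'a::comm_ring_1 ^ 'n ^ 'n" assumes "i ~= j" shows "det (rowrep (rowrep A i u) j v) = - det (rowrep (rowrep A i v) j u)" proof -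
 have "rowrep (rowrep A i v) j u = (\<chi> r. rowrep (rowrep A i u) j v $ Transposition.transpose i j r)"
  using assms by (auto simp: vec_eq_iff Transposition.transpose_def)
 thus ?thesis using det_permute_rows[OF permutes_swap_id[of i UNIV j], of "rowrep (rowrep A i u) j v"] assms by (simp add: sign_swap_id)
qed

text \<open>If the corank is at least two modulo a prime, two independent null vectors are found by
  Cramer's rule from a nonvanishing minor of maximal size; minors are written as determinants in which
  the omitted rows are replaced by unit vectors.\<close>

lemma null_vectors: fixes W :: "'a::comm_ring_1 ^ 'n::finite ^ 'n" assumes rr: "isprime rr" and c: "!!r k. det (rowrep W r (axis k 1)) : rr"
 obtains \<alpha> \<beta> \<Delta> i0 i1 where "i0 ~= i1" "\<Delta> ~: rr" "\<alpha> i0 = \<Delta>" "\<alpha> i1 = 0" "\<beta> i0 = 0" "\<beta> i1 = \<Delta>"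
  "!!r. (SUM j:UNIV. W $ r $ j * \<alpha> j) : rr" "!!r. (SUM j:UNIV. W $ r $ j * \<beta> j) : rr" proof -
 have rri: "isideal rr" using rr by (rule isprime_ideal)
 \<comment> \<open>Up to sign, the determinant of \<open>E U \<sigma>\<close> is the minor of W that
   omits the rows U and the columns \<sigma>(U), or zero if \<sigma> is not injective on U. The
   least card U with nonzero minor is the corank.\<close>
 define E where "E = (%U \<sigma>. (\<chi> r. if r : U then axis (\<sigma> r) 1 else W $ r) :: 'a ^ 'n ^ 'n)"
 define P where "P = (%u. EX U \<sigma>. card U = u & det (E U \<sigma>) ~: rr)"
 define u where "u = (LEAST u. P u)"
 have "E UNIV id = mat 1" by (auto simp: E_def vec_eq_iff axis_def mat_def)
 hence "det (E UNIV id) ~: rr" using rr by (simp add: isprime_def)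
 hence "P (card (UNIV :: 'n set))" unfolding P_def by blast
 hence "P u" unfolding u_def by (rule LeastI)
 then obtain U \<sigma> where U: "card U = u" "det (E U \<sigma>) ~: rr" unfolding P_def by blast
 have min: "det (E U' \<sigma>') : rr" if "card U' < u" for U' \<sigma>' using not_less_Least[of "card U'" P] that unfolding u_def P_def by blast
 \<comment> \<open>The determinant and all cofactors of W lie in rr, so at least two rows are
   omitted.\<close>
 have "~ u <= 1" proof
  assume "u <= 1"
  then consider "U = {}" | r where "U = {r}" using U(1) card_1_singletonE[of U] by (cases u) auto
  thus False proof cases
   case 1
   hence "det (E U \<sigma>) = det W" by (simp add: E_def)
   also have "... = det (rowrep W (undefined) (W $ undefined))" by (rule arg_cong[of _ _ det]) (auto simp: vec_eq_iff)
   also have "... : rr" by (subst det_row_expand) (intro ideal_sum[OF rri] ideal_mult_l[OF rri] c)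
   finally show False using U(2) by blast
  next
   case 2
   hence "E U \<sigma> = rowrep W r (axis (\<sigma> r) 1)" by (auto simp: E_def vec_eq_iff)
   thus False using U(2) c by metis
  qed
 qed
 then obtain c0 c1 where cc: "c0 : U" "c1 : U" "c0 ~= c1" using U(1) by (metis card_le_Suc0_iff_eq One_nat_def finite)
 have \<sigma>: "\<sigma> c0 ~= \<sigma> c1" proof
  assume "\<sigma> c0 = \<sigma> c1"
  hence "det (E U \<sigma>) = 0" using cc by (intro det_identical[of c0 c1]) (auto simp: E_def)
  thus False using U(2) ideal_0[OF rri] by metis
 qed
 define \<alpha> where "\<alpha> = (%c0 j. det (rowrep (E U \<sigma>) c0 (axis j 1)))"
 have lin: "(SUM j:UNIV. W $ r $ j * \<alpha> c0 j) : rr" if c0: "c0 : U" for r c0 proof -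
  have "(SUM j:UNIV. W $ r $ j * \<alpha> c0 j) = det (rowrep (E U \<sigma>) c0 (W $ r))" unfolding \<alpha>_def by (rule det_row_expand[symmetric])
  also have "... : rr" proof (cases "r : U")
   case False
   hence "det (rowrep (E U \<sigma>) c0 (W $ r)) = 0" using c0 by (intro det_identical[of c0 r]) (auto simp: E_def)
   thus ?thesis using ideal_0[OF rri] by simp
  next
   case True
   have less: "card (U - {r}) < u" using True U(1) by (metis card_Diff1_less finite)
   show ?thesis proof (cases "r = c0")
    case True
    hence "rowrep (E U \<sigma>) c0 (W $ r) = E (U - {r}) \<sigma>" by (auto simp: E_def vec_eq_iff)
    thus ?thesis using min[OF less] by metis
   next
    case False
    have "rowrep (E U \<sigma>) c0 (W $ r) = rowrep (rowrep (E U \<sigma>) c0 (W $ r)) r (axis (\<sigma> r) 1)"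
     using False True by (auto simp: E_def vec_eq_iff)
    hence "det (rowrep (E U \<sigma>) c0 (W $ r)) = - det (rowrep (rowrep (E U \<sigma>) c0 (axis (\<sigma> r) 1)) r (W $ r))"
     using det_swap[of c0 r "axis (\<sigma> r) 1" "W $ r" "E U \<sigma>"] False by simp
    also have "rowrep (rowrep (E U \<sigma>) c0 (axis (\<sigma> r) 1)) r (W $ r) = E (U - {r}) (\<sigma>(c0 := \<sigma> r))"
     using False c0 by (auto simp: E_def vec_eq_iff)
    finally show ?thesis using min[OF less] ideal_neg[OF rri] by metis
   qed
  qed
  finally show ?thesis .
 qed
 have val: "\<alpha> c (\<sigma> c') = (if c' = c then det (E U \<sigma>) else 0)" if "c : U" "c' : U" for c c' proof (cases "c' = c")
  case True
  hence "rowrep (E U \<sigma>) c (axis (\<sigma> c') 1) = E U \<sigma>" using that by (auto simp: E_def vec_eq_iff)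
  with True show ?thesis unfolding \<alpha>_def by simp
 next
  case False
  hence "\<alpha> c (\<sigma> c') = 0" unfolding \<alpha>_def using that by (intro det_identical[of c c']) (auto simp: E_def)
  with False show ?thesis by simp
 qed
 show ?thesis by (rule that[OF \<sigma> U(2), of "\<alpha> c0" "\<alpha> c1"]) (use cc in "simp_all add: val lin")
qed

lemma cramer_column: fixes A :: "'a::comm_ring_1 ^ 'n ^ 'n" shows "z i * det A = (SUM k:UNIV. (SUM j:UNIV. A $ k $ j * z j)*det (rowrep (transpose A) i (axis k 1)))"
proof -
 have "(SUM j:UNIV. z j * transpose A $ j $ k) = (SUM j:UNIV. A $ k $ j * z j)" for k by (simp add: transpose_def mult.commute)
 thus ?thesis using cramer_row[of z i "transpose A"] by simp
qed

lemma det_row_split: fixes A :: "'a::comm_ring_1 ^ 'n ^ 'n" shows "det (rowrep A r (u + v)) = det (rowrep A r u) + det (rowrep A r v)" by (rule det_row_add)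

lemma det_row_scale: fixes A :: "'a::comm_ring_1 ^ 'n ^ 'n" shows "det (rowrep A r (c *s v)) = c*det (rowrep A r v)" by (rule det_row_mul)

lemma det_no_row: fixes A :: "'a::comm_ring_1 ^ 'n ^ 'n" assumes "A $ r = 0" shows "det A = 0" proof -
 have "A = rowrep A r 0" using assms by (auto simp: vec_eq_iff)
 also have "det ... = 0" by (rule det_row_0)
 finally show ?thesis .
qed

lemma det_no_column: fixes A :: "'a::comm_ring_1 ^ 'n ^ 'n" assumes "!!k. A $ k $ i = 0" shows "det A = 0" proof -
 have "transpose A $ i = 0" using assms by (simp add: vec_eq_iff transpose_def)
 from det_no_row[OF this] show ?thesis by simp
qed

text \<open>Cramer's rule for A with row r replaced by the unit vector at j: modulo a only the term
  of row r survives, with value z_j and with the cofactor at i.\<close>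

lemma cofactor_relation: fixes A :: "'a::comm_ring_1 ^ 'n ^ 'n" assumes a: "isideal a" and A: "!!k. k ~= r ==> (SUM j:UNIV. A $ k $ j * z j) : a"
 shows "z i * det (rowrep A r (axis j 1)) - z j * det (rowrep A r (axis i 1)) : a" proof -
 define C where "C = rowrep A r (axis j 1)"
 define V where "V = transpose (rowrep (transpose C) i (axis r 1))"
 define Y where "Y = rowrep A r (axis i 1)"
 define Z where "Z = rowrep V r (axis i 1)"
 have "det V = det Z" proof (cases "i = j")
  case True
  hence "V = Z" by (auto simp: V_def Z_def C_def vec_eq_iff transpose_def axis_def)
  thus ?thesis by simp
 next
  case False
  hence "V = rowrep V r (axis i 1 + axis j 1)" by (auto simp: V_def C_def vec_eq_iff transpose_def axis_def)
  hence "det V = det (rowrep V r (axis i 1 + axis j 1))" by (rule arg_cong)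
  also have "... = det Z + det (rowrep V r (axis j 1))" unfolding Z_def by (rule det_row_split)
  finally have "det V = det Z + det (rowrep V r (axis j 1))" .
  moreover have "det (rowrep V r (axis j 1)) = 0"
   by (rule det_no_column[of _ i]) (use False in "auto simp: V_def C_def vec_eq_iff transpose_def axis_def")
  ultimately show ?thesis by simp
 qed
 moreover have "det Y = det Z" proof -
  define w where "w = (\<chi> k. if k = r then 0 else A $ k $ i)"
  have "transpose Y = rowrep (transpose Y) i (axis r 1 + w)" by (auto simp: Y_def w_def vec_eq_iff transpose_def axis_def)
  hence "det (transpose Y) = det (rowrep (transpose Y) i (axis r 1 + w))" by (rule arg_cong)
  also have "... = det (rowrep (transpose Y) i (axis r 1)) + det (rowrep (transpose Y) i w)" by (rule det_row_split)
  finally have "det Y = det (rowrep (transpose Y) i (axis r 1)) + det (rowrep (transpose Y) i w)" by simp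
  moreover have "transpose Z = rowrep (transpose Y) i (axis r 1)" by (auto simp: Z_def V_def Y_def C_def vec_eq_iff transpose_def axis_def)
  hence "det Z = det (rowrep (transpose Y) i (axis r 1))" by (metis det_transpose)
  moreover have "det (rowrep (transpose Y) i w) = 0" by (rule det_no_column[of _ r]) (auto simp: Y_def w_def vec_eq_iff transpose_def axis_def)
  ultimately show ?thesis by simp
 qed
 ultimately have XY: "det (rowrep (transpose C) i (axis r 1)) = det Y" unfolding V_def by simp
 have Cz: "(SUM j':UNIV. C $ r $ j' * z j') = z j" by (simp add: C_def axis_def if_distrib[of "%x. x * _"] cong: if_cong)
 have "z i * det C = z j * det Y + (SUM k:UNIV - {r}. (SUM j:UNIV. C $ k $ j * z j)*det (rowrep (transpose C) i (axis k 1)))"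
  unfolding cramer_column[of z i C] by (subst sum.remove[of _ r]) (simp_all only: finite UNIV_I Cz XY)
 moreover have "(SUM k:UNIV - {r}. (SUM j:UNIV. C $ k $ j * z j)*det (rowrep (transpose C) i (axis k 1))) : a"
  by (rule ideal_sum[OF a], rule ideal_mult_r[OF a]) (use A in "simp add: C_def")
 ultimately show ?thesis by (simp add: C_def Y_def)
qed

text \<open>With row r of W replaced by a unit vector e, the combination of rows given by t equals
  t_r (e - W_r). Cramer's rule for t_r' then leaves a determinant with two equal rows and one with
  two rows swapped.\<close>

lemma dependent_rows_cofactor: fixes W :: "'a::comm_ring_1 ^ 'n ^ 'n" assumes t: "!!j. (SUM r:UNIV. t r * W $ r $ j) = 0"
 shows "t r' * det (rowrep W r (axis k 1)) = t r * det (rowrep W r' (axis k 1))" proof (cases "r' = r")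
 case False
 define A where "A = rowrep W r (axis k 1)"
 have s: "(SUM i:UNIV. t i * A $ i $ j) = (t r *s (axis k 1 - W $ r)) $ j" for j proof -
  have "(SUM i:UNIV. t i * A $ i $ j) = t r * axis k 1 $ j + (SUM i:UNIV - {r}. t i * W $ i $ j)" by (subst sum.remove[of _ r]) (simp_all add: A_def)
  also have "(SUM i:UNIV - {r}. t i * W $ i $ j) = - (t r * W $ r $ j)"
   using t[of j] by (subst (asm) sum.remove[of _ r]) (simp_all add: eq_neg_iff_add_eq_0 add.commute)
  finally show ?thesis by (simp add: algebra_simps)
 qed
 have "t r' * det A = (SUM j:UNIV. (t r *s (axis k 1 - W $ r)) $ j * det (rowrep A r' (axis j 1)))" unfolding cramer_row[of t r' A] s ..
 also have "... = det (rowrep A r' (t r *s (axis k 1 - W $ r)))" by (rule det_row_expand[symmetric])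
 also have "... = t r * det (rowrep A r' (axis k 1 - W $ r))" by (rule det_row_scale)
 also have "det (rowrep A r' (axis k 1 - W $ r)) = det (rowrep A r' (axis k 1)) + det (rowrep A r' ((- 1) *s W $ r))"
  unfolding det_row_split[symmetric] by (rule arg_cong[of _ _ det]) (simp add: vec_eq_iff)
 also have "det (rowrep A r' (axis k 1)) = 0" by (rule det_identical[of r r']) (use False in "auto simp: A_def")
 also have "det (rowrep A r' ((- 1) *s W $ r)) = - det (rowrep A r' (W $ r))" unfolding det_row_scale by simp
 also have "det (rowrep A r' (W $ r)) = - det (rowrep (rowrep W r (W $ r)) r' (axis k 1))" unfolding A_def by (rule det_swap) (use False in auto)
 also have "rowrep W r (W $ r) = W" by (auto simp: vec_eq_iff)
 finally show ?thesis by (simp add: A_def)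
qed simp

text \<open>Each column of the cofactor matrix is proportional to the vector of variables, hence a
  polynomial multiple of it, because distinct variables are coprime.\<close>

lemma cofactor_factor: fixes W :: "('n::finite, 'k::field) mpoly ^ 'n ^ 'n" assumes t: "!!j. (SUM r:UNIV. Var r * W $ r $ j) = 0" and n: "CARD('n) >= 2"
 obtains h where "!!r k. det (rowrep W r (axis k 1)) = Var r * h k" proof -
 define c where "c = (%r k. det (rowrep W r (axis k 1)))"
 have rel: "Var r' * c r k = Var r * c r' k" for r r' k unfolding c_def by (rule dependent_rows_cofactor) (rule t)
 have Vnz: "Var r ~= (0 :: ('n, 'k) mpoly)" for r
  using const_notin_prime[OF prime_zero, of 1] by (metis single_zero Var_def insertI1 lookup_single_eq lookup_zero zero_neq_one)
 have "EX g. c r k = Var r * g" for r k proof -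
  obtain r' where r': "r' ~= r" using n by (metis UNIV_I card_le_Suc0_iff_eq finite not_less_eq_eq numeral_2_eq_2)
  have "Var r' * c r k = Var r^1*c r' k" using rel by simp
  hence "vdiv r 1 (Var r' * c r k) = c r' k" by (metis vdiv_mult)
  moreover have "vdiv r 1 (Var r' * c r k) = Var r' * vdiv r 1 (c r k)" using vdiv_Var_mult[of r r' 1 1 "c r k"] r' by simp
  ultimately have "Var r' * c r k = Var r'*(Var r * vdiv r 1 (c r k))" using rel[of r' r k] by (simp add: mult_ac)
  thus ?thesis using mpoly_mult_cancel Vnz by blast
 qed
 then obtain g where g: "!!r k. c r k = Var r * g r k" by metis
 have "g r k = g r' k" for r r' k proof -
  have "(Var r' * Var r)*g r k = (Var r' * Var r)*g r' k" using rel[of r' r k] by (simp add: g mult_ac)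
  thus ?thesis using mpoly_mult_cancel mpoly_mult_eq_0 Vnz by metis
 qed
 hence "det (rowrep W r (axis k 1)) = Var r * g undefined k" for r k using g unfolding c_def by metis
 thus ?thesis by (rule that)
qed

text \<open>The relation is a one-cycle with entry -F at r, hence a boundary, and the entry at r of
  a boundary lies in the ideal of the first r elements.\<close>

lemma nonzerodivisor: assumes H: "Hvan (Suc r) v 1" and F: "v r * F : igen (v ` {..<r})" shows "F : igen (v ` {..<r})" proof -
 obtain c where c: "v r * F = (SUM j<r. c j * v j)" using F igen_image[of "{..<r}" _ v] by auto
 define z where "z = one_form (Suc r) (%j. if j < r then c j else - F)"
 have zL: "z : Lam (Suc r) 1" unfolding z_def by (rule one_form)
 have "(SUM k<Suc r. v k * z {k}) = 0" using c by (simp add: z_def one_form mult.commute)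
 hence "Ctr (Suc r) v z = 0" by (simp add: Ctr_Lam1[OF zL]) (simp add: unit_form_def fun_eq_iff)
 then obtain w where w: "z = Ctr (Suc r) v w" using H zL unfolding Hvan_def by blast
 have "- F = Ctr (Suc r) v w {r}" unfolding w[symmetric] by (simp add: z_def one_form)
 also have "... = (SUM j<r. ctr j w {r} * v j)" by (simp add: Ctr_def mult.commute) (simp add: ctr_def)
 also have "... : igen (v ` {..<r})" by (auto simp: igen_image)
 finally show ?thesis using ideal_neg[OF isideal_igen, of "- F"] by simp
qed

lemma linear_expand: assumes "F : homg tot 1" shows "F = (SUM s:UNIV. Const (lk F (sgl s 1))*Var (s :: 'v::finite))" proof (rule pm_eqI)
 fix n
 have "lk (SUM s:UNIV. Const (lk F (sgl s 1))*Var s) n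
   = (SUM s:UNIV. lk F (sgl s 1)*(1 when sgl s 1 = n))" by (simp add: lookup_sum lookup_Const_mult Var_def lookup_single)
 also have "... = lk F n" proof (cases "EX v. n = sgl v 1")
  case True
  then obtain v where v: "n = sgl v 1" by blast
  have inj: "sgl s (1::nat) = sgl v 1 \<longleftrightarrow> s = v" for s by (metis lookup_single_eq lookup_single_not_eq zero_neq_one)
  have "(SUM s:UNIV. lk F (sgl s 1)*(1 when sgl s 1 = n)) = (SUM s:UNIV. if s = v then lk F n else 0)"
   unfolding v inj by (intro sum.cong refl) (simp add: when_def)
  thus ?thesis by simp
 next
  case False
  have "lk F n = 0" proof (rule ccontr)
   assume "lk F n ~= 0"
   hence 1: "wdeg tot n = 1" using assms by (auto simp: homg_iff)
   hence "n ~= 0" by auto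
   from wdeg_tot_Suc[OF this] obtain v n' where n': "n = sgl v 1 + n'" "wdeg tot n = Suc (wdeg tot n')" by blast
   hence "n' = 0" using 1 wdeg_tot_0[of n'] by simp
   with n'(1) have "n = sgl v 1" by simp
   with False show False by blast
  qed
  with False show ?thesis by (auto simp: when_def intro!: sum.neutral)
 qed
 finally show "lk F n = lk (SUM s:UNIV. Const (lk F (sgl s 1))*Var s) n" ..
qed

lemma alternating_sum: fixes c :: "'i => 'i => 'a::comm_ring_1" assumes "finite A" "!!i j. c i j = - c j i" "!!i. c i i = 0" shows "(SUM i:A. SUM j:A. c i j) = 0"
 using assms(1) proof (induction A rule: finite_induct)
 case (insert x A)
 have "(SUM i:insert x A. SUM j:insert x A. c i j) = (SUM j:A. c x j) + (SUM i:A. c i x) + (SUM i:A. SUM j:A. c i j)"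
  using insert(1,2) assms(3) by (simp add: sum.distrib)
 moreover have "(SUM j:A. c x j) = - (SUM i:A. c i x)" unfolding sum_negf[symmetric] by (rule sum.cong[OF refl assms(2)])
 ultimately show ?case using insert(3) by simp
qed simp

lemma homg_det: fixes A :: "('v, 'k::comm_ring_1) mpoly ^ 'n ^ 'n" assumes "!!i j. A $ i $ j : homg wt (e i)" shows "det A : homg wt (SUM i:UNIV. e i)"
 unfolding det_def proof (rule homg_sum)
 fix p :: "'n => 'n"
 have "(PROD i:UNIV. A $ i $ p i) : homg wt (SUM i:UNIV. e i)" by (intro homg_prod assms finite)
 thus "of_int (sign p)*(PROD i:UNIV. A $ i $ p i) : homg wt (SUM i:UNIV. e i)" by (cases p rule: sign_cases) (simp_all add: homg_minus)
qed

lemma variables_indep: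
 obtains g :: "nat => 'v::finite" where "bij_betw g {..<CARD('v)} UNIV" "indep {0 :: ('v, 'k::field) mpoly} (CARD('v)) (%j. Var (g j))" proof -
 obtain g where g: "bij_betw g {..<CARD('v)} (UNIV :: 'v set)" using ex_bij_betw_nat_finite[of "UNIV :: 'v set"] by (auto simp: atLeast0LessThan)
 have "F = 0" if F: "vin {..<CARD('v)} F" "ev Const (%j. Var (g j)) F = (0 :: ('v, 'k) mpoly)" for F :: "(nat, 'k) mpoly" proof -
  let ?u = "inv_into {..<CARD('v)} g"
  have "0 = ev Const (%v. Var (?u v)) (ev Const (%j. Var (g j) :: ('v, 'k) mpoly) F)" by (simp add: F(2) ev_0)
  also have "... = ev Const (%j. Var (?u (g j))) F" by (subst ev_comp) (simp_all add: rhom_ev rhom_Const ev_Const ev_Var)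
  also have "... = ev Const Var F" proof (rule ev_cong)
   fix i n assume "n : kys F" "i : kys n"
   hence "i : {..<CARD('v)}" using F(1) unfolding vin_def by blast
   thus "Var (?u (g i)) = (Var i :: (nat, 'k) mpoly)" using inv_into_f_f[OF bij_betw_imp_inj_on[OF g]] by simp
  qed
  finally show ?thesis by simp
 qed
 hence "indep {0 :: ('v, 'k) mpoly} (CARD('v)) (%j. Var (g j))" unfolding indep_def by blast
 with g show ?thesis by (rule that)
qed

text \<open>\<open>evT \<alpha>\<close> puts x = \<alpha>(T) and keeps T; \<open>evS \<beta>\<close>
  puts T = \<beta>(x) and keeps x.\<close>

abbreviation evT :: "('n => ('n, 'k::comm_ring_1) mpoly) => ('n + 'n, 'k) mpoly => ('n, 'k) mpoly" where
 "evT \<alpha> == ev Const (case_sum \<alpha> Var)"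
abbreviation evS :: "('n => ('n, 'k::comm_ring_1) mpoly) => ('n + 'n, 'k) mpoly => ('n, 'k) mpoly" where
 "evS \<beta> == ev Const (case_sum Var \<beta>)"

lemma evT_tP [simp]: "evT \<alpha> (tP G) = G" by (rule rhom_ext[of "%G. evT \<alpha> (tP G)" "%G. G"])
  (simp_all add: rhom_ev rhom_Const xP_simps ev_Const ev_Var rhom_comp[OF rhom_ev[OF rhom_Const] rhom_tP] rhom_id)

lemma evS_xP [simp]: "evS \<beta> (xP F) = F" by (rule rhom_ext[of "%F. evS \<beta> (xP F)" "%G. G"])
  (simp_all add: rhom_ev rhom_Const xP_simps ev_Const ev_Var rhom_comp[OF rhom_ev[OF rhom_Const] rhom_xP] rhom_id)

lemma evT_xP: "evT \<alpha> (xP F) = ev Const \<alpha> F" by (rule rhom_ext[of "%F. evT \<alpha> (xP F)" "ev Const \<alpha>"])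
  (simp_all add: rhom_ev rhom_Const xP_simps ev_Const ev_Var rhom_comp[OF rhom_ev[OF rhom_Const] rhom_xP])

lemma sop_mono: "sop a e y ==> a <= b ==> sop b e y" proof -
 assume s: "sop a e y" and ab: "a <= b"
 have "igen (a Un y ` {..<e}) <= igen (b Un y ` {..<e})" using ab by (intro idl.span_mono) auto
 hence "rad (igen (a Un y ` {..<e})) <= rad (igen (b Un y ` {..<e}))" by (auto simp: rad_def)
 thus ?thesis using s unfolding sop_def by blast
qed

section \<open>The matrix W, the column h and the dimensions attached to them\<close>

context linear_alternating
begin

lemma card_ge_2: "CARD('n) >= 2" proof (rule ccontr)
 assume "~ ?thesis"
 hence "i = j" for i j :: 'n using card_le_Suc0_iff_eq[of "UNIV :: 'n set"] by auto
 hence "\<psi> $ i $ j = \<psi> $ j $ j" for i j by metis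
 hence "\<psi> $ i $ j : {0}" for i j using alt(2) by simp
 from ent[OF idl.subspace_single_0 this, of undefined] show False by (metis Var_def lookup_single_eq lookup_zero singletonD zero_neq_one)
qed

lemma other_index: "EX j :: 'n. j ~= i" using card_ge_2 by (metis UNIV_I card_le_Suc0_iff_eq finite not_less_eq_eq numeral_2_eq_2)

definition W :: "('n, 'k) mpoly ^ 'n ^ 'n" where
 "W = (\<chi> j s. SUM i:UNIV. Const (lk (\<psi> $ i $ j) (sgl s 1))*Var i)"

lemma l_W: "l j = (SUM s:UNIV. xv s * tP (W $ j $ s))" proof -
 have "xP (\<psi> $ i $ j) = (SUM s:UNIV. Const (lk (\<psi> $ i $ j) (sgl s 1))*xv s)" for i
  by (subst linear_expand[OF lin]) (simp add: rhom_sum[OF rhom_xP] rhom_mult[OF rhom_xP] xP_simps)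
 hence "l j = (SUM i:UNIV. SUM s:UNIV. xv s*(Const (lk (\<psi> $ i $ j) (sgl s 1)) * tv i))" by (simp add: l_def sum_distrib_left mult_ac)
 also have "... = (SUM s:UNIV. xv s * tP (W $ j $ s))"
  by (subst sum.swap) (simp add: W_def rhom_sum[OF rhom_tP] rhom_mult[OF rhom_tP] xP_simps sum_distrib_left)
 finally show ?thesis .
qed

lemma W_linear: "W $ j $ s : homg tot 1" unfolding W_def by (simp, intro homg_sum homg_Const_mult homg_Var[of _ tot, simplified])

lemma T_W: "(SUM j:UNIV. Var j * W $ j $ s) = 0" proof -
 have "(SUM j:UNIV. Var j * W $ j $ s)
   = (SUM j:UNIV. SUM i:UNIV. Const (lk (\<psi> $ i $ j) (sgl s 1))*(Var i * Var j))" by (simp add: W_def sum_distrib_left mult_ac)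
 also have "... = 0" proof (rule alternating_sum)
  fix j i
  have "lk (\<psi> $ i $ j) (sgl s 1) = - lk (\<psi> $ j $ i) (sgl s 1)" by (subst alt(1)) simp
  thus "Const (lk (\<psi> $ i $ j) (sgl s 1))*(Var i * Var j) =
   - (Const (lk (\<psi> $ j $ i) (sgl s 1))*(Var j * Var i))" by (simp add: Const_simps mult.commute)
 qed (simp_all add: alt(2))
 finally show ?thesis .
qed

lemma T_l: "(SUM j:UNIV. tv j * l j) = 0" proof -
 have "(SUM j:UNIV. tv j * l j) = (SUM j:UNIV. SUM s:UNIV. xv s * tP (Var j * W $ j $ s))"
  by (simp add: l_W sum_distrib_left rhom_mult[OF rhom_tP] xP_simps mult_ac)
 also have "... = (SUM s:UNIV. xv s * tP (SUM j:UNIV. Var j * W $ j $ s))" by (subst sum.swap) (simp add: rhom_sum[OF rhom_tP] sum_distrib_left)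
 finally show ?thesis by (simp only: T_W rhom_0[OF rhom_tP] mult_zero_right sum.neutral_const)
qed

lemma evT_l: "evT \<alpha> (l j) = (SUM s:UNIV. W $ j $ s * \<alpha> s)" unfolding l_W by (simp add: ev_sum ev_mult rhom_Const ev_Var mult.commute)

lemma evS_l: "evS \<beta> (l j) = (SUM i:UNIV. transpose \<psi> $ j $ i * \<beta> i)"
 unfolding l_def by (simp add: ev_sum ev_mult rhom_Const ev_Var mult.commute transpose_def)

text \<open>Where all cofactors of M vanish, two independent null vectors span a plane of solutions
  of l = 0. The lemma is applied over the T-space with W and over the x-space with the transpose of
  \<psi>.\<close>

lemma corank_two: fixes E :: "('n => ('n, 'k) mpoly) => ('n + 'n, 'k) mpoly => ('n, 'k) mpoly" and M :: "('n, 'k) mpoly ^ 'n ^ 'n"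
 assumes E: "!!\<alpha>. rhom (E \<alpha>)" "!!\<alpha> c. E \<alpha> (Const c) = Const c" "!!\<alpha> F. E \<alpha> (P F) = F" "!!\<alpha> i. E \<alpha> (Var (v i)) = \<alpha> i"
   "!!\<alpha> j. E \<alpha> (l j) = (SUM i:UNIV. M $ j $ i * \<alpha> i)"
  and rr: "isprime rr" and c: "!!r k. det (rowrep M r (axis k 1)) : rr" and y: "indep rr r y" shows "EX w. indep (igen (range l Un P ` rr)) (r + 2) w"
proof -
 have rri: "isideal rr" using rr by (rule isprime_ideal)
 obtain \<alpha> \<beta> \<Delta> i0 i1 where n: "i0 ~= i1" "\<Delta> ~: rr" "\<alpha> i0 = \<Delta>" "\<alpha> i1 = 0" "\<beta> i0 = 0" "\<beta> i1 = \<Delta>"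
  "!!r. (SUM j:UNIV. M $ r $ j * \<alpha> j) : rr" "!!r. (SUM j:UNIV. M $ r $ j * \<beta> j) : rr" by (rule null_vectors[OF rr c], rule that)
 define h where "h = (%s t. E (%i. Const s * \<alpha> i + Const t * \<beta> i))"
 define w where "w = (%j. if j < r then P (y j) else if j = r then Var (v i0) else Var (v i1))"
 have "range l Un P ` rr <= {F. h s t F : rr}" for s t proof -
  have "h s t (l j) = Const s*(SUM i:UNIV. M $ j $ i * \<alpha> i) + Const t*(SUM i:UNIV. M $ j $ i * \<beta> i)" for j
   unfolding h_def E(5) by (simp add: sum.distrib sum_distrib_left algebra_simps)
  thus ?thesis using n(7,8) by (auto simp: h_def E intro!: ideal_add[OF rri] ideal_mult_l[OF rri])
 qed
 hence Q: "igen (range l Un P ` rr) <= {F. h s t F : rr}" for s t unfolding h_def by (intro igen_subset ideal_vimage E rri)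
 show ?thesis by (intro exI[of _ w] indep_pencil[OF k rr n(2) y, of h]) (use Q in "auto simp: h_def w_def E n")
qed

lemma evTS_Var: "evT \<alpha> (xv i) = \<alpha> i" "evS \<beta> (tv i) = \<beta> i" by (simp_all add: ev_Var rhom_Const)

lemmas corank_two_T = corank_two[where E = evT and P = tP and v = Inl and M = W,
 OF rhom_ev[OF rhom_Const] ev_Const[OF rhom_Const] evT_tP evTS_Var(1) evT_l]
lemmas corank_two_S = corank_two[where E = evS and P = xP and v = Inr and M = "transpose \<psi>",
 OF rhom_ev[OF rhom_Const] ev_Const[OF rhom_Const] evS_xP evTS_Var(2) evS_l]

text \<open>Otherwise the corank is at least two everywhere and (l) would have dimension d +
  3.\<close>

lemma cofactors_nonzero: "EX r k. det (rowrep W r (axis k 1)) ~= 0" "EX r i. det (rowrep (transpose \<psi>) r (axis i 1)) ~= 0" proof -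
 obtain g :: "nat => 'n" where g: "indep {0 :: ('n, 'k) mpoly} (CARD('n)) (%j. Var (g j))" using variables_indep .
 have no: "\<nexists>w. indep (igen (range l Un P ` {0})) (CARD('n) + 2) w" if "P 0 = 0" for P :: "('n, 'k) mpoly => _" proof -
  have "igen (range l Un P ` {0}) = igen (range l)" using that by (auto simp: igen_insert)
  thus ?thesis using dim_l unfolding dimle_def card by fastforce
 qed
 show "EX r k. det (rowrep W r (axis k 1)) ~= 0" using corank_two_T[OF prime_zero _ g] no[of tP, OF rhom_0[OF rhom_tP]] by fastforce
 show "EX r i. det (rowrep (transpose \<psi>) r (axis i 1)) ~= 0" using corank_two_S[OF prime_zero _ g] no[of xP, OF rhom_0[OF rhom_xP]] by fastforce
qed

definition h :: "'n => ('n, 'k) mpoly" where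
 "h = (SOME h. ALL r k. det (rowrep W r (axis k 1)) = Var r * h k)"

lemma cofactor_h: "det (rowrep W r (axis k 1)) = Var r * h k" proof -
 obtain h' where "!!r k. det (rowrep W r (axis k 1)) = Var r * h' k" by (rule cofactor_factor[OF T_W card_ge_2], rule that)
 hence "EX h. ALL r k. det (rowrep W r (axis k 1)) = Var r * h k" by blast
 from someI_ex[OF this] show ?thesis unfolding h_def by blast
qed

lemma h_nonzero: "EX k. h k ~= 0" using cofactors_nonzero(1) unfolding cofactor_h by (metis mult_zero_right)

lemma h_homg: "h k : homg tot (d - 1)" proof -
 fix r :: 'n
 have "det (rowrep W r (axis k 1)) : homg tot (SUM i:UNIV. if i = r then 0 else 1)" by (rule homg_det) (use W_linear in "simp add: axis_def")
 moreover have "(SUM i:UNIV. if i = r then 0 else (1 :: nat)) = d" using card by (subst sum.remove[of _ r]) (simp_all add: card_Diff_singleton)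
 ultimately have "Var r^1*h k : homg tot d" unfolding cofactor_h by simp
 hence "vdiv r 1 (Var r^1*h k) : homg tot (d - 1)" by (rule vdiv_homg(1)) (use card card_ge_2 in simp_all)
 thus ?thesis unfolding vdiv_mult .
qed

lemma W_h: "(SUM s:UNIV. W $ j $ s * h s) = 0" proof -
 obtain r where r: "r ~= j" using other_index ..
 have "Var r*(SUM s:UNIV. W $ j $ s * h s) = (SUM s:UNIV. W $ j $ s * det (rowrep W r (axis s 1)))"
  unfolding cofactor_h by (simp add: sum_distrib_left mult_ac)
 also have "... = det (rowrep W r (W $ j))" by (rule det_row_expand[symmetric])
 also have "... = 0" by (rule det_identical[of r j]) (use r in auto)
 finally have "Var r^1*(SUM s:UNIV. W $ j $ s * h s) = 0" by simp
 thus ?thesis by (rule Var_power_cancel)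
qed

lemma evT_h_l: "evT h (l j) = 0" unfolding evT_l by (rule W_h)

text \<open>This is \<open>cofactor_relation\<close> with z = x, which W annihilates modulo (l); the
  factor T_r comes from the cofactors T_r h_k.\<close>

lemma x_h_relation: "tv r*(xv i * tP (h j) - xv j * tP (h i)) : igen (range l)" proof -
 let ?A = "\<chi> i j. tP (W $ i $ j)"
 have e: "rowrep ?A r (axis i 1) = (\<chi> i' j. tP (rowrep W r (axis i 1) $ i' $ j))" for i
  by (auto simp: vec_eq_iff axis_def rhom_0[OF rhom_tP] rhom_1[OF rhom_tP])
 have "xv i * det (rowrep ?A r (axis j 1)) - xv j * det (rowrep ?A r (axis i 1)) : igen (range l)"
 proof (rule cofactor_relation[OF isideal_igen, where z = "%i. xv i"])
  fix k
  have "(SUM j:UNIV. ?A $ k $ j * xv j) = l k" by (simp add: l_W mult.commute)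
  thus "(SUM j:UNIV. ?A $ k $ j * xv j) : igen (range l)" by (simp add: igen_base)
 qed
 thus ?thesis unfolding e rhom_det[OF rhom_tP, symmetric] cofactor_h by (simp add: rhom_mult[OF rhom_tP] xP_simps algebra_simps)
qed

lemma T_c_relation:
 "tv i * xP (det (rowrep (transpose \<psi>) r (axis j 1))) - tv j * xP (det (rowrep (transpose \<psi>) r (axis i 1))) : igen (range l)" proof -
 let ?A = "\<chi> i j. xP (transpose \<psi> $ i $ j)"
 have e: "rowrep ?A r (axis i 1) = (\<chi> i' j. xP (rowrep (transpose \<psi>) r (axis i 1) $ i' $ j))" for i
  by (auto simp: vec_eq_iff axis_def rhom_0[OF rhom_xP] rhom_1[OF rhom_xP])
 have "tv i * det (rowrep ?A r (axis j 1)) - tv j * det (rowrep ?A r (axis i 1)) : igen (range l)"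
 proof (rule cofactor_relation[OF isideal_igen, where z = "%i. tv i"])
  fix k
  have "(SUM j:UNIV. ?A $ k $ j * tv j) = l k" by (simp add: l_def mult.commute transpose_def)
  thus "(SUM j:UNIV. ?A $ k $ j * tv j) : igen (range l)" by (simp add: igen_base)
 qed
 thus ?thesis unfolding e rhom_det[OF rhom_xP, symmetric] .
qed

lemma x_homg_xw: "(xv i :: ('n + 'n, 'k) mpoly) : homg xw 1" using homg_Var[of "Inl i" xw] by simp

text \<open>The ideal of the closure of all points (\<lambda> h(T), T). Taking \<open>star\<close>
  in the x-grading replaces the graph of h by a cone, which raises the dimension from d + 1 to d +
  2.\<close>

definition Qh :: "('n + 'n, 'k) mpoly set" where
 "Qh = star xw {F. evT h F : {0}}"

lemma Qh: "isprime Qh" "hideal xw Qh" "l j : Qh" "EX w. indep Qh (d + 2) w" "tP q : Qh \<longleftrightarrow> q = 0" proof -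
 have p: "isprime {F. evT h F : {0}}" by (intro prime_vimage rhom_ev rhom_Const prime_zero)
 hence pi: "isideal {F. evT h F : {0}}" by (rule isprime_ideal)
 show "isprime Qh" unfolding Qh_def by (rule star_prime[OF p])
 hence Qi: "isideal Qh" by (rule isprime_ideal)
 show hQ: "hideal xw Qh" unfolding Qh_def by (rule hideal_star[OF pi])
 have mem: "F : Qh \<longleftrightarrow> evT h F = 0" if "F : homg xw a" for F a
  using that ideal_0[OF pi] by (auto simp: Qh_def star_def hcomp_of_homg ev_0)
 show "l j : Qh" unfolding mem[OF l_homg(2)] by (rule evT_h_l)
 show "tP q : Qh \<longleftrightarrow> q = 0" unfolding mem[OF tP_homg(3)] by simp
 obtain g :: "nat => 'n" where y: "indep {0 :: ('n, 'k) mpoly} (CARD('n)) (%j. Var (g j))" using variables_indep .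
 obtain k where k: "h k ~= 0" using h_nonzero by blast
 have n: "CARD('n) = Suc d" using card by simp
 define w where "w = (%j. if j < Suc d then tv (g j) else xv k :: ('n + 'n, 'k) mpoly)"
 have "indep Qh (d + 2) w" unfolding indep_def proof (intro allI impI)
  fix F assume F: "vin {..<d + 2} F & ev Const w F : Qh"
  hence "vin {..<Suc (Suc d)} F" by simp
  then obtain D c where c: "F = (SUM i<D. Var (Suc d)^i*c i)" "!!i. vin {..<Suc d} (c i)" by (rule variable_expansion) (rule that)
  have cw: "ev Const w (c i) = tP (ev Const (%j. Var (g j)) (c i))" for i proof -
   have "ev Const w (c i) = ev Const (%j. tv (g j)) (c i)" proof (rule ev_cong)
    fix j n assume "n : kys (c i)" "j : kys n"
    hence "j : {..<Suc d}" using c(2)[of i] unfolding vin_def by blast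
    thus "w j = tv (g j)" by (simp add: w_def)
   qed
   also have "... = tP (ev Const (%j. Var (g j)) (c i))" by (simp add: ev_comp[OF rhom_tP rhom_Const] xP_simps)
   finally show ?thesis .
  qed
  have exp: "ev Const w F = (SUM i<D. xv k^i * tP (ev Const (%j. Var (g j)) (c i)))"
   unfolding c(1) by (simp add: ev_sum rhom_Const ev_mult rhom_power[OF rhom_ev] ev_Var cw) (simp add: w_def)
  have "c i = 0" if i: "i < D" for i proof -
   have t: "xv k^j * tP G : homg xw j" for j and G :: "('n, 'k) mpoly" using homg_mult[OF homg_power[OF x_homg_xw, of k j] tP_homg(3)[of G]] by simp
   have "hcomp xw i (ev Const w F) = (SUM j<D. if j = i then xv k^i * tP (ev Const (%j. Var (g j)) (c i)) else 0)"
    unfolding exp hcomp_sum by (intro sum.cong refl) (subst hcomp_of_homg[OF t], auto)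
   hence "xv k^i * tP (ev Const (%j. Var (g j)) (c i)) : Qh" using hQ F i unfolding hideal_def by (simp add: sum.delta) metis
   hence "h k^i*ev Const (%j. Var (g j)) (c i) = 0" unfolding mem[OF t] by (simp add: ev_mult rhom_Const rhom_power[OF rhom_ev] ev_Var)
   hence "ev Const (%j. Var (g j)) (c i) = (0 :: ('n, 'k) mpoly)" using k mpoly_mult_eq_0 mpoly_power_eq_0 by blast
   thus ?thesis using y c(2)[of i] unfolding indep_def n by blast
  qed
  thus "F = 0" unfolding c(1) by simp
 qed
 thus "EX w. indep Qh (d + 2) w" by (rule exI[of _ w])
qed

text \<open>A form vanishing at h lies in \<open>Qh\<close>, which has dimension d + 2 and hence
  dominates the x-space.\<close>

lemma f_h_nonzero: assumes "F : homg tot e" "F ~= 0" shows "ev Const h F ~= 0" proof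
 assume z: "ev Const h F = 0"
 obtain w where w: "indep Qh (d + 2) w" using Qh(4) by blast
 have "hcomp xw i (xP F) = (if i = e then xP F else 0)" for i by (rule hcomp_of_homg[OF xP_homg(2)[OF assms(1)]])
 hence "xP F : Qh" unfolding Qh_def star_def using z by (simp add: evT_xP ev_0)
 from dominant_prime[OF Qh(1,2,3) w this] assms(2) show False by simp
qed

lemma dim_T: "dimle (igen (range (%i. tv i)) :: ('n + 'n, 'k) mpoly set) (d + 1)" proof -
 let ?a = "igen (range (%i. tv i)) :: ('n + 'n, 'k) mpoly set"
 obtain g :: "nat => 'n" where g: "bij_betw g {..<CARD('n)} UNIV" using variables_indep .
 have "sop ?a (CARD('n)) (%j. xv (g j))" unfolding sop_def proof (intro conjI allI impI)
  show "EX d>0. (xv (g j) :: ('n + 'n, 'k) mpoly) : homg tot d" for j using homg_Var[of "Inl (g j)" tot] by blast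
  fix v :: "'n + 'n"
  have "v : range Inr \<or> v : (%j. Inl (g j)) ` {..<CARD('n)}" using bij_betw_imp_surj_on[OF g] by (cases v) (auto simp flip: image_image[of Inl g])
  thus "Var v : rad (igen (?a Un (%j. xv (g j)) ` {..<CARD('n)}))" by (intro gen_in_rad) (auto intro: igen_base)
 qed
 moreover have "hideal tot ?a" by (rule hideal_igen) (use homg_Var[of "Inr _ :: 'n + 'n" tot] in blast)
 ultimately have "dimle ?a (CARD('n))" by (intro sop_dimle)
 thus ?thesis unfolding card .
qed

text \<open>On a prime of dimension d + 2 the cofactors c of the transpose of \<psi> satisfy T_i c_a
  = T_a c_i, so q(T) = 0 becomes q(c) T_a^D = 0. As q(c) is nonzero, which is tested on
  \<open>Qh\<close>, and the prime dominates the x-space, all T_i would vanish; but x alone has only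
  d + 1 coordinates.\<close>

lemma dim_lq: assumes q: "q : homg tot D" "q ~= 0" shows "dimle (igen (insert (tP q) (range l))) (d + 1)" proof (rule dimle_primes)
 fix Q assume Q: "isprime Q" "igen (insert (tP q) (range l)) <= Q"
 have Qi: "isideal Q" using Q(1) by (rule isprime_ideal)
 show "dimle Q (d + 1)" proof (rule ccontr)
  assume "~ ?thesis"
  then obtain r w where "indep Q r w" "r > d + 1" unfolding dimle_def by (meson not_le_imp_less)
  hence "indep Q (d + 2) w" by (auto intro: indep_less)
  define Q' where "Q' = star xw Q"
  have p: "isprime Q'" and hQ: "hideal xw Q'" and w: "indep Q' (d + 2) w"
   unfolding Q'_def by (rule star_prime[OF Q(1)], rule hideal_star[OF Qi], rule indep_mono[OF `indep Q (d + 2) w` star_subset[OF Qi]])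
  have "EX e. x : homg xw e" if "x : insert (tP q) (range l)" for x using that l_homg(2) tP_homg(3) by blast
  hence sub: "igen (insert (tP q) (range l)) <= Q'" unfolding Q'_def by (intro star_superset Qi Q(2) hideal_igen)
  hence lQ: "l j : Q'" for j using igen_base[of "l j" "insert (tP q) (range l)"] by blast
  have qQ: "tP q : Q'" using sub igen_base[of "tP q" "insert (tP q) (range l)"] by blast
  obtain r a where "det (rowrep (transpose \<psi>) r (axis a 1)) ~= 0" using cofactors_nonzero(2) by blast
  moreover define c where "c = (%i. det (rowrep (transpose \<psi>) r (axis i 1)))"
  ultimately have ca: "c a ~= 0" by simp
  have rel: "tv i * xP (c j) - tv j * xP (c i) : igen (range l)" for i j unfolding c_def by (rule T_c_relation)
  have "ev Const (%i. tv i * xP (c a)) q - ev Const (%i. xP (c i) * tv a) q : igen (range l)"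
   by (rule ev_ideal_cong[OF isideal_igen, of UNIV]) (use rel[of _ a] in "auto simp: vin_def mult.commute")
  hence key: "tP q * xP (c a)^D - xP (ev Const c q) * tv a^D : igen (range l)"
   unfolding ev_homg_scale[OF rhom_Const q(1)] by (simp add: tP_def ev_comp[OF rhom_xP rhom_Const] xP_simps)
  have lsub: "igen (range l) <= P" if "isideal P" "!!j. l j : P" for P using that by (intro igen_subset) auto
  have qc: "ev Const c q ~= 0" proof
   assume "ev Const c q = 0"
   hence "tP q * xP (c a)^D : Qh" using key lsub[OF isprime_ideal[OF Qh(1)] Qh(3)] by (auto simp: rhom_0[OF rhom_xP])
   moreover have "tP q ~: Qh" using Qh(5) q(2) by blast
   ultimately have "xP (c a) : Qh" using prime_multD[OF Qh(1)] prime_powerD[OF Qh(1)] by blast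
   thus False using dominant_prime[OF Qh(1,2,3)] Qh(4) ca by blast
  qed
  have "xP (ev Const c q) ~: Q'" using dominant_prime[OF p hQ lQ w] qc by blast
  moreover have "xP (ev Const c q) * tv a^D : Q'"
   using ideal_mem_cong[OF isprime_ideal[OF p], of "tP q * xP (c a)^D"] key lsub[OF isprime_ideal[OF p] lQ]
    ideal_mult_r[OF isprime_ideal[OF p] qQ] by blast
  ultimately have "tv a : Q'" using prime_multD[OF p] prime_powerD[OF p] by blast
  have "tv i : Q'" for i proof -
   have "tv i * xP (c a) - tv a * xP (c i) : Q'" using rel lsub[OF isprime_ideal[OF p] lQ] by blast
   hence "tv i * xP (c a) : Q'" using ideal_mem_cong[OF isprime_ideal[OF p]] ideal_mult_r[OF isprime_ideal[OF p] `tv a : Q'`] by blast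
   moreover have "xP (c a) ~: Q'" using dominant_prime[OF p hQ lQ w] ca by blast
   ultimately show ?thesis using prime_multD[OF p] by blast
  qed
  hence "igen (range (%i. tv i)) <= Q'" by (intro igen_subset isprime_ideal p) auto
  from dimle_mono[OF dim_T this, of "d + 1"] w show False unfolding dimle_def by fastforce
 qed
qed (rule isideal_igen)

lemma d_pos: "d >= 1" using card card_ge_2 by simp

text \<open>Where h vanishes W has corank at least two, which adds 2 to the dimension, while (l,
  h_k) has dimension at most d + 1.\<close>

lemma dim_h: "dimle (igen (range h)) (d - 1)" proof (rule dimle_primes)
 fix rr assume rr: "isprime rr" "igen (range h) <= rr"
 have hr: "h k : rr" for k using rr(2) igen_base[of "h k" "range h"] by blast
 obtain k where k: "h k ~= 0" using h_nonzero by blast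
 show "dimle rr (d - 1)" unfolding dimle_def proof (intro allI impI)
  fix r y assume y: "indep rr r y"
  have "det (rowrep W r (axis k 1)) : rr" for r k unfolding cofactor_h by (rule ideal_mult_l[OF isprime_ideal[OF rr(1)] hr])
  from corank_two_T[OF rr(1) this y] obtain w where w: "indep (igen (range l Un tP ` rr)) (r + 2) w" by blast
  have "indep (igen (insert (tP (h k)) (range l))) (r + 2) w" by (rule indep_mono[OF w], rule idl.span_mono) (use hr in auto)
  thus "r <= d - 1" using dim_lq[OF h_homg k] unfolding dimle_def by fastforce
 qed
qed (rule isideal_igen)

text \<open>The powers h_i^M generate an ideal of height at least two, which therefore contains a w
  regular modulo one of them, h_{i0}^M; hence h_{i0}^M divides c_{i0}.\<close>

lemma h_proportional: assumes c: "!!i j. c i * h j^M = c j * h i^M" shows "EX c0. ALL i. c i = c0*h i^M" proof (cases "M = 0")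
 case True
 hence "c i = c undefined" for i using c[of i undefined] by simp
 thus ?thesis using True by auto
next
 case False
 obtain i0 where i0: "h i0 ~= 0" using h_nonzero by blast
 define w1 where "w1 = h i0^M"
 have w1: "w1 ~= 0" using i0 mpoly_power_eq_0 unfolding w1_def by blast
 have homg: "h i^M : homg tot (M*(d - 1))" for i by (intro homg_power h_homg)
 have a: "hideal tot (igen {w1})" by (rule hideal_igen) (use homg in "auto simp: w1_def")
 have da: "dimle (igen {w1}) (Suc (d - 1))" proof (rule dimle_primes)
  fix Q assume Q: "isprime Q" "igen {w1} <= Q"
  have "w1 : Q" using Q(2) igen_base[of w1 "{w1}"] by blast
  from dimle_prime_nonzero[OF Q(1) this w1] show "dimle Q (Suc (d - 1))" using card d_pos by simp
 qed (rule isideal_igen)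
 let ?b = "igen (range (%i. h i^M))"
 have b: "hideal tot ?b" by (rule hideal_igen) (use homg in auto)
 have db: "dimle ?b (d - 1)" proof (rule dimle_primes)
  fix Q assume Q: "isprime Q" "?b <= Q"
  have "h i : Q" for i using prime_powerD[OF Q(1), of "h i" M] Q(2) igen_base[of "h i^M" "range (%i. h i^M)"] by blast
  hence "igen (range h) <= Q" by (intro igen_subset isprime_ideal Q(1)) auto
  thus "dimle Q (d - 1)" by (rule dimle_mono[OF dim_h]) simp
 qed (rule isideal_igen)
 obtain w e y where w: "w : ?b" "EX D. w : homg tot D" "e <= d - 1" "sop (insert w (igen {w1})) e y" using generic_element[OF k a da b db] by blast
 define v where "v = (%j :: nat. if j = 0 then w1 else w)"
 have im: "v ` {..<2} = {w1, w}" by (auto simp: v_def lessThan_Suc numeral_2_eq_2)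
 have "insert w (igen {w1}) <= igen (v ` {..<2})" unfolding im using idl.span_mono[of "{w1}" "{w1, w}"] igen_base[of w "{w1, w}"] by auto
 hence "sop (igen (v ` {..<2})) e y" by (rule sop_mono[OF w(4)])
 hence "Hvan 2 v 1" by (rule koszul_vanishing[rotated]) (use w(2,3) homg card d_pos in "auto simp: v_def w1_def")
 hence H: "Hvan (Suc 1) v 1" by (simp add: numeral_2_eq_2)
 obtain r where r: "w = (SUM i:UNIV. r i * h i^M)" using w(1) igen_image[of UNIV w "%i. h i^M"] by auto
 have "w * c i0 = (SUM i:UNIV. r i*(c i0 * h i^M))" unfolding r sum_distrib_right by (simp only: mult_ac)
 also have "... = (SUM i:UNIV. r i * c i)*w1" unfolding c[of i0] w1_def sum_distrib_right by (simp only: mult_ac)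
 also have "... : igen {w1}" by (intro ideal_mult_l isideal_igen igen_base) simp
 finally have "v 1 * c i0 : igen (v ` {..<1})" by (simp add: v_def lessThan_Suc)
 from nonzerodivisor[OF H this] have "c i0 : igen {w1}" by (simp add: v_def lessThan_Suc)
 then obtain c0 where c0: "c i0 = c0*w1" by (auto simp: idl.span_singleton)
 have "c j = c0*h j^M" for j proof -
  have "w1 * c j = w1*(c0*h j^M)" using c[of i0 j] c0 by (simp add: w1_def mult_ac)
  thus ?thesis using mpoly_mult_cancel w1 by blast
 qed
 thus ?thesis by blast
qed

end

section \<open>Local regularity and saturation\<close>

lemma ev_weight_scale: assumes h: "rhom h" and F: "F : homg wt e" shows "ev h (%i. v i * z^wt i) F = ev h v F * z^e" proof -
 have "mev (%i. v i * z^wt i) m = mev v m * z^wdeg wt m" for m by (simp add: mev_def wdeg_def power_mult_distrib prod.distrib power_mult power_sum)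
 moreover have "wdeg wt m = e" if "m : kys F" for m using F that by (auto simp: homg_iff in_keys_iff)
 ultimately have "ev h (%i. v i * z^wt i) F = (SUM m:kys F. h (lk F m)*mev v m * z^e)" by (simp add: ev_def mult.assoc)
 thus ?thesis by (simp add: ev_def sum_distrib_right)
qed

lemma indep_cong: assumes a: "isideal a" and i: "indep a r t" and c: "!!j. t' j - t j : a" shows "indep a r t'" unfolding indep_def
proof (intro allI impI)
 fix F assume F: "vin {..<r} F & ev Const t' F : a"
 hence "ev Const t' F - ev Const t F : a" by (intro ev_ideal_cong[OF a, of "{..<r}"] c) auto
 hence "ev Const t F : a" using F ideal_mem_cong[OF a] by blast
 thus "F = 0" using i F unfolding indep_def by blast
qed

lemma Var_coprime: assumes "i ~= j" "Var i^M*F = Var j^M*(G :: ('v, 'k::field) mpoly)" shows "EX H. G = Var i^M*H" proof -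
 have "F = vdiv i M (Var j^M*G)" unfolding assms(2)[symmetric] by (rule vdiv_mult[symmetric])
 also have "... = Var j^M * vdiv i M G" by (rule vdiv_Var_mult[OF assms(1)])
 finally have "Var j^M*(G - Var i^M * vdiv i M G) = 0" using assms(2) by (simp add: algebra_simps)
 hence "G - Var i^M * vdiv i M G = 0" by (rule Var_power_cancel)
 thus ?thesis by (intro exI[of _ "vdiv i M G"]) simp
qed

text \<open>The contraction of the extension of a to the ring with \<open>Var k\<close>
  inverted.\<close>

definition Vloc :: "'v => ('v, 'k::comm_ring_1) mpoly set => ('v, 'k) mpoly set" where
 "Vloc k a = {F. EX N. Var k^N*F : a}"

lemma Vloc_superset: "F : a ==> F : Vloc k a" unfolding Vloc_def by (auto intro: exI[of _ 0])

lemma Vloc_power: "Var k^N*F : Vloc k a \<longleftrightarrow> F : Vloc k a" if a: "isideal a" proof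
 assume "Var k^N*F : Vloc k a"
 then obtain N' where "Var k^(N' + N)*F : a" by (auto simp: Vloc_def power_add mult.assoc)
 thus "F : Vloc k a" unfolding Vloc_def by blast
next
 assume "F : Vloc k a"
 then obtain N' where "Var k^N'*F : a" by (auto simp: Vloc_def)
 hence "Var k^N*(Var k^N'*F) : a" by (rule ideal_mult_l[OF a])
 hence "Var k^N'*(Var k^N*F) : a" by (simp only: mult_ac)
 thus "Var k^N*F : Vloc k a" unfolding Vloc_def by blast
qed

lemma Vloc_uniform: assumes a: "isideal a" and F: "Var k^N*F : a" "N <= M" shows "Var k^M*F : a" proof -
 have "Var k^(M - N)*(Var k^N*F) : a" by (rule ideal_mult_l[OF a F(1)])
 thus ?thesis using F(2) by (simp flip: mult.assoc power_add)
qed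

lemma Vloc_ideal: assumes a: "isideal a" shows "isideal (Vloc k a)" proof (rule idl.subspaceI)
 show "0 : Vloc k a" by (rule Vloc_superset[OF ideal_0[OF a]])
 fix x y assume "x : Vloc k a" "y : Vloc k a"
 then obtain M N where "Var k^M*x : a" "Var k^N*y : a" unfolding Vloc_def by blast
 hence "Var k^(M + N)*x + Var k^(M + N)*y : a" by (intro ideal_add[OF a]) (erule Vloc_uniform[OF a], simp)+
 thus "x + y : Vloc k a" unfolding Vloc_def by (auto simp: distrib_left)
next
 fix c x assume "x : Vloc k a"
 then obtain N where "Var k^N*x : a" unfolding Vloc_def by blast
 hence "c*(Var k^N*x) : a" by (rule ideal_mult_l[OF a])
 hence "Var k^N*(c*x) : a" by (simp only: mult_ac)
 thus "c * x : Vloc k a" unfolding Vloc_def by blast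
qed

lemma Vloc_mono: "a <= b ==> Vloc k a <= Vloc k b" by (auto simp: Vloc_def)

lemma Vloc_hcomp: assumes a: "hideal wt a" and F: "F : Vloc k a" shows "hcomp wt e F : Vloc k a" proof -
 obtain N where "Var k^N*F : a" using F by (auto simp: Vloc_def)
 hence "hcomp wt (wt k * N + e) (Var k^N*F) : a" using a by (auto simp: hideal_def)
 thus ?thesis unfolding hcomp_of_Var_power_mult Vloc_def by blast
qed

abbreviation Tloc :: "'n => ('n + 'n, 'k::comm_ring_1) mpoly set => ('n + 'n, 'k) mpoly set" where
 "Tloc k == Vloc (Inr k)"

context linear_alternating
begin

text \<open>A 2 x 2 alternating matrix has one entry up to sign, and a single form cannot cut a
  plane down to the origin.\<close>

lemma card_ge_3: "CARD('n) >= 3" proof (rule ccontr)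
 assume "~ ?thesis"
 hence c: "CARD('n) = 2" using card_ge_2 by simp
 then obtain p q :: 'n where pq: "UNIV = {p, q}" "p ~= q" by (meson card_2_iff)
 let ?a = "igen (insert (\<psi> $ p $ q) {0})"
 have ai: "isideal ?a" by (rule isideal_igen)
 have 1: "\<psi> $ p $ q : ?a" by (rule igen_base) simp
 have 2: "\<psi> $ q $ p : ?a" using ideal_neg[OF ai 1] by (simp only: alt(1)[of q p])
 have 3: "\<psi> $ i $ i : ?a" for i using ideal_0[OF ai] by (simp only: alt(2))
 have e: "i = p \<or> i = q" for i using pq(1) by blast
 have "\<psi> $ i $ j : ?a" for i j using e[of i] e[of j] 1 2 3[of p] 3[of q] by (elim disjE) (hypsubst, assumption)+
 hence "Var i : ?a" for i by (rule ent[OF ai])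
 hence "sop ?a 0 y" for y unfolding sop_def by (auto intro: gen_in_rad)
 moreover have "hideal tot ?a" by (rule hideal_igen) (use lin homg_0 in blast)
 ultimately have "dimle ?a 0" by (intro sop_dimle)
 from dimle_insert[OF k hideal_0 lin _ this] have "dimle ({0} :: ('n, 'k) mpoly set) 1" by simp
 moreover obtain g :: "nat => 'n" where "indep {0 :: ('n, 'k) mpoly} (CARD('n)) (%j. Var (g j))" using variables_indep .
 ultimately show False unfolding c dimle_def by fastforce
qed

lemma d_ge_2: "d >= 2" using card card_ge_3 by simp

definition en :: "nat => 'n" where
 "en = (SOME g. bij_betw g {..<CARD('n)} UNIV)"

lemma en: "bij_betw en {..<CARD('n)} UNIV"
 unfolding en_def by (rule someI_ex[of "%g. bij_betw g {..<CARD('n)} UNIV"]) (use ex_bij_betw_nat_finite[of "UNIV :: 'n set"] in "simp add: atLeast0LessThan")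

definition vl :: "(nat => ('n + 'n, 'k) mpoly) => nat => ('n + 'n, 'k) mpoly" where
 "vl z k = (if k < CARD('n) then l (en k) else z (k - CARD('n)))"

lemma vl_image: "vl z ` {..<CARD('n) + e} = range l Un z ` {..<e}" proof -
 have "{..<CARD('n) + e} = {..<CARD('n)} Un (%j. CARD('n) + j) ` {..<e}"
  using image_add_atLeastLessThan[of "CARD('n)" 0 e] by (auto simp: lessThan_atLeast0)
 moreover have "vl z ` {..<CARD('n)} = l ` en ` {..<CARD('n)}" by (auto simp: vl_def image_image)
 moreover have "vl z ` (%j. CARD('n) + j) ` {..<e} = z ` {..<e}" unfolding image_image by (intro image_cong) (simp_all add: vl_def)
 ultimately show ?thesis unfolding bij_betw_imp_surj_on[OF en] by (simp only: image_Un)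
qed

text \<open>There are d + 1 + e elements and \<delta> parameters in 2d + 2 variables, so \<delta> +
  e <= d + 2 gives vanishing from degree 2 on.\<close>

lemma koszul_l: assumes z: "!!j. j < e ==> EX D. z j : homg tot D" and s: "sop (igen (range l Un z ` {..<e})) \<delta> y" "\<delta> + e <= d + 2"
 shows "twisted_koszul (CARD('n)) (CARD('n) + e) (%k. Inr (en k)) (vl z)" proof
 show "CARD('n) <= CARD('n) + e" by simp
 have "(SUM k<CARD('n). tv (en k) * vl z k) = (SUM k<CARD('n). tv (en k)*l (en k))" by (rule sum.cong) (auto simp: vl_def)
 also have "... = (SUM j:UNIV. tv j * l j)" by (rule sum.reindex_bij_betw[OF en])
 finally show "(SUM k<CARD('n). tv (en k) * vl z k) = 0" by (simp only: T_l)
 fix i :: nat assume i: "2 <= i"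
 show "Hvan (CARD('n) + e) (vl z) i" proof (rule koszul_vanishing)
  show "EX D. vl z k : homg tot D" if "k < CARD('n) + e" for k using that z[of "k - CARD('n)"] l_homg(1) by (auto simp: vl_def)
  show "sop (igen (vl z ` {..<CARD('n) + e})) \<delta> y" unfolding vl_image by (rule s(1))
  show "CARD('n) + e + \<delta> < i + CARD('n + 'n)" using s(2) i card by simp
 qed
qed

lemma reg: assumes z: "!!j. j < Suc e ==> EX D. z j : homg tot D" and s: "sop (igen (range l Un z ` {..<Suc e})) \<delta> y" "\<delta> + Suc e <= d + 2"
  and F: "z e * F : igen (range l Un z ` {..<e})" shows "F : Tloc k (igen (range l Un z ` {..<e}))" proof -
 interpret twisted_koszul "CARD('n)" "CARD('n) + Suc e" "%k. Inr (en k)" "vl z" by (rule koszul_l[OF z s])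
 obtain k' where k': "k' < CARD('n)" "en k' = k" using bij_betw_imp_surj_on[OF en] by (metis UNIV_I imageE lessThan_iff)
 have "vl z (CARD('n) + e)*F : igen (vl z ` {..<CARD('n) + e})" unfolding vl_image using F by (simp add: vl_def)
 from nonzerodivisor_locally[OF _ _ k'(1) this] show ?thesis unfolding vl_image k'(2) Vloc_def by simp
qed

lemma torsion_free_l: assumes z: "!!j. j < e ==> EX D. z j : homg tot D" "!!j. j < e ==> z j : homg tw 0"
  and s: "sop (igen (range l Un z ` {..<e})) \<delta> y" "\<delta> + e <= d + 2"
  and F: "F : homg tw b" "b > 0" "!!k. F : Tloc k (igen (range l Un z ` {..<e}))" shows "F : igen (range l Un z ` {..<e})" proof -
 interpret twisted_koszul "CARD('n)" "CARD('n) + e" "%k. Inr (en k)" "vl z" by (rule koszul_l[OF z(1) s])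
 have inr: "i : (%k. Inr (en k)) ` {..<CARD('n)} \<longleftrightarrow> (EX j. i = Inr j)" for i :: "'n + 'n"
  using bij_betw_imp_surj_on[OF en] by (auto simp flip: image_image[of Inr en])
 interpret twisted_koszul_graded "CARD('n)" "CARD('n) + e" "%k. Inr (en k)" "vl z" tw proof
  show "inj_on (%k. Inr (en k) :: 'n + 'n) {..<CARD('n)}" using bij_betw_imp_inj_on[OF en] by (auto simp: inj_on_def)
  show "3 <= CARD('n)" by (rule card_ge_3)
  show "tw i = (if i : (%k. Inr (en k)) ` {..<CARD('n)} then 1 else 0)" for i :: "'n + 'n" unfolding inr by (cases i) auto
  show "vl z k : homg tw (if k < CARD('n) then 1 else 0)" if "k < CARD('n) + e" for k
   using that z(2)[of "k - CARD('n)"] l_homg(3)[of "en k"] by (cases "k < CARD('n)") (simp_all add: vl_def)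
 qed
 have "F : igen (vl z ` {..<CARD('n) + e})" by (rule torsion_free[OF F(1,2)]) (use F(3) in "simp add: vl_image Vloc_def")
 thus ?thesis unfolding vl_image .
qed

abbreviation Ll :: "('n + 'n, 'k) mpoly set" where "Ll == igen (range l)"
abbreviation Lu :: "('n + 'n, 'k) mpoly => ('n + 'n, 'k) mpoly set" where "Lu u == igen (insert u (range l))"

lemma hideal_Lu: "u : homg tot D ==> hideal tot (Lu u)" "u : homg xw e ==> hideal xw (Lu u)" "u : homg tw b ==> hideal tw (Lu u)"
 by (intro hideal_igen; use l_homg in blast)+

lemma reg_1: assumes u: "u : homg tot D" "dimle (Lu u) (d + 1)" and F: "u * F : Tloc k Ll" shows "F : Tloc k Ll" proof -
 obtain N where "tv k^N*(u*F) : Ll" using F by (auto simp: Vloc_def)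
 hence N: "u*(tv k^N*F) : Ll" by (simp only: mult_ac)
 obtain e y where e: "e <= d + 1" "sop (Lu u) e y" using dimle_sop[OF k hideal_Lu(1)[OF u(1)] u(2)] by blast
 have "tv k^N*F : Tloc k (igen (range l Un (%_. u) ` {..<0::nat}))"
  by (rule reg[where z = "%_. u" and y = y and \<delta> = e]) (use u(1) e N in "auto simp: lessThan_Suc")
 thus ?thesis using Vloc_power[OF isideal_igen, of "Inr k" N F "range l"] by simp
qed

text \<open>B has smaller dimension than the bound d + 1 for (l, u), so a generic member w of B
  lowers that bound and \<open>reg\<close> applies to the sequence u, w.\<close>

lemma regular_element: assumes u: "u : homg tot D" "dimle (Lu u) (d + 1)" and B: "hideal tot B" "dimle B d"
 obtains w where "w : B" "!!G k. w * G : Tloc k (Lu u) ==> G : Tloc k (Lu u)" proof -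
 have "dimle (Lu u) (Suc d)" using u(2) by simp
 from generic_element[OF k hideal_Lu(1)[OF u(1)] this B] obtain w D' e y
  where w: "w : B" "w : homg tot D'" "e <= d" "sop (insert w (Lu u)) e y" by blast
 have "G : Tloc k (Lu u)" if G: "w * G : Tloc k (Lu u)" for G k proof -
  obtain N where "tv k^N*(w*G) : Lu u" using G by (auto simp: Vloc_def)
  hence N: "w*(tv k^N*G) : Lu u" by (simp only: mult_ac)
  define z where "z = (%j :: nat. if j = 0 then u else w)"
  have z1: "range l Un z ` {..<Suc 0} = insert u (range l)" by (auto simp: z_def)
  have z2: "range l Un z ` {..<Suc 1} = insert w (insert u (range l))" by (auto simp: z_def lessThan_Suc)
  have "insert w (Lu u) <= igen (insert w (insert u (range l)))"
   using idl.span_mono[of "insert u (range l)" "insert w (insert u (range l))"] igen_base[of w "insert w (insert u (range l))"] by auto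
  hence s: "sop (igen (range l Un z ` {..<Suc 1})) e y" unfolding z2 by (rule sop_mono[OF w(4)])
  have "tv k^N*G : Tloc k (igen (range l Un z ` {..<1}))" by (rule reg[OF _ s]) (use u(1) w N in "auto simp: z_def lessThan_Suc")
  thus ?thesis using z1 Vloc_power[OF isideal_igen, of "Inr k" N G "insert u (range l)"] by simp
 qed
 with w(1) show ?thesis by (rule that)
qed

lemma T_torsion_l: assumes F: "F : homg tw b" "b > 0" "!!k. F : Tloc k Ll" shows "F : Ll" proof -
 obtain e y where e: "e <= d + 2" "sop Ll e y" using dimle_sop[OF k hideal_l(1) dim_l] by blast
 have "F : igen (range l Un (%_. 0) ` {..<0::nat})" by (rule torsion_free_l[where y = y and \<delta> = e and b = b]) (use F e in simp_all)
 thus ?thesis by simp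
qed

lemma T_torsion_lf: assumes F: "F : homg tw b" "b > 0" "!!k. F : Tloc k (Lu (xP f))" shows "F : Lu (xP f)" proof -
 have im: "range l Un (%_. xP f) ` {..<1::nat} = insert (xP f) (range l)" by (auto simp: lessThan_Suc)
 obtain e y where e: "e <= d + 1" "sop (Lu (xP f)) e y" using dimle_sop[OF k hideal_Lu(1)[OF xP_homg(1)[OF f(2)]] dim_lf] by blast
 have "F : igen (range l Un (%_. xP f) ` {..<1::nat})" proof (rule torsion_free_l[where y = y and \<delta> = e and b = b])
  show "EX D. xP f : homg tot D" using xP_homg(1)[OF f(2)] by blast
  show "xP f : homg tw 0" by (rule xP_homg(3))
  show "sop (igen (range l Un (%_. xP f) ` {..<1::nat})) e y" unfolding im by (rule e(2))
  show "e + 1 <= d + 2" using e(1) by simp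
  show "F : Tloc k (igen (range l Un (%_. xP f) ` {..<1::nat}))" for k unfolding im by (rule F(3))
 qed (use F in auto)
 thus ?thesis unfolding im .
qed

lemma evT_h_Ll: "F : Ll ==> evT h F = 0" proof -
 have "range l <= {F. evT h F : {0}}" using evT_h_l by auto
 hence "Ll <= {F. evT h F : {0}}" by (intro igen_subset ideal_vimage rhom_ev rhom_Const idl.subspace_single_0)
 thus "F : Ll ==> evT h F = 0" by blast
qed

lemma evT_simps: "evT \<alpha> (F + G) = evT \<alpha> F + evT \<alpha> G" "evT \<alpha> (F - G) = evT \<alpha> F - evT \<alpha> G"
 "evT \<alpha> (F*G) = evT \<alpha> F * evT \<alpha> G" "evT \<alpha> (F^N) = evT \<alpha> F^N" "evT \<alpha> (xv i) = \<alpha> i" "evT \<alpha> (tv i) = Var i"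
 by (simp_all add: rhom_simps[OF rhom_ev[OF rhom_Const]] ev_Var rhom_Const)

text \<open>Locally in the variables \<open>T\<close>, the ideal of the forms \<open>l\<close> is the kernel of \<open>x \<mapsto> h\<close>.\<close>

lemma vanishing_at_h: assumes F: "F : homg xw e" "evT h F = 0" shows "F : Tloc r Ll" proof -
 obtain j where j: "h j ~= 0" using h_nonzero by blast
 \<comment> \<open>F is evaluated at x_i T_r h_j and at h_i T_r x_j, which agree modulo (l);
   homogeneity in x pulls the common factor out on both sides.\<close>
 let ?z = "tv r * tP (h j)"
 let ?u = "case_sum (%i. xv i * ?z) (%i. tv i)"
 let ?v = "case_sum (%i. tP (h i)*(tv r * xv j)) (%i. tv i)"
 have "ev Const ?u F - ev Const ?v F : Ll" proof (rule ev_ideal_cong[OF isideal_igen, of UNIV])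
  fix i :: "'n + 'n"
  show "?u i - ?v i : Ll" proof (cases i)
   case (Inl i')
   thus ?thesis using x_h_relation[of r i' j] by (simp add: algebra_simps)
  qed (simp add: ideal_0[OF isideal_igen])
 qed (simp add: vin_def)
 moreover have "ev Const ?u F = F * ?z^e" proof -
  have "?u = (%i. Var i * ?z^xw i)" by (auto simp: fun_eq_iff split: sum.split)
  thus ?thesis using ev_weight_scale[OF rhom_Const F(1), of Var ?z] by simp
 qed
 moreover have "ev Const ?v F = tP (evT h F)*(tv r * xv j)^e" proof -
  have "tP (evT h F) = ev Const (%i. tP (case_sum h Var i)) F" by (simp add: ev_comp[OF rhom_tP rhom_Const] xP_simps)
  moreover have "?v = (%i. tP (case_sum h Var i)*(tv r * xv j)^xw i)" by (auto simp: fun_eq_iff xP_simps split: sum.split)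
  ultimately show ?thesis using ev_weight_scale[OF rhom_Const F(1), of "%i. tP (case_sum h Var i)"] by simp
 qed
 ultimately have "F * ?z^e : Ll" using F(2) by (simp add: rhom_0[OF rhom_tP])
 hence "tP (h j)^e*(tv r^e*F) : Tloc r Ll" by (intro Vloc_superset) (simp add: power_mult_distrib mult_ac)
 \<comment> \<open>h_j is regular modulo (l) where T_r is inverted, because (l, h_j) has dimension
   at most d + 1.\<close>
 moreover have "G : Tloc r Ll" if "tP (h j)^b*G : Tloc r Ll" for b G using that proof (induction b)
  case (Suc b)
  hence "tP (h j)*(tP (h j)^b*G) : Tloc r Ll" by (simp only: power_Suc mult.assoc)
  hence "tP (h j)^b*G : Tloc r Ll" by (rule reg_1[OF tP_homg(1)[OF h_homg] dim_lq[OF h_homg j]])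
  thus ?case by (rule Suc.IH)
 qed simp
 ultimately have "tv r^e*F : Tloc r Ll" by blast
 thus ?thesis by (simp only: Vloc_power[OF isideal_igen])
qed

end

section \<open>Saturation with respect to x, locally in T\<close>

context linear_alternating
begin

abbreviation Lf :: "('n + 'n, 'k) mpoly set" where "Lf == Lu (xP f)"

lemma f_h: "ev Const h f ~= 0" by (rule f_h_nonzero[OF f(2,1)])

lemma Ll_Lu: "Ll <= Lu u" by (rule idl.span_mono) auto

lemma hcomp_Ll: "F : Ll ==> hcomp xw e F : Ll" using hideal_l(2) by (auto simp: hideal_def)

text \<open>At x = h the memberships read T_r^N h_j^N F(h) = c_j f(h). So c is proportional to the
  vector h_j^N, and \<open>h_proportional\<close> makes it a polynomial multiple.\<close>

lemma value_multiple: assumes F: "!!j. EX M. xv j^M*F : Tloc r Lf"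
 shows "EX N c y. Var r^N*evT h F = c*ev Const h f & (ALL j. tv r^N*(xv j^N*F) - y j * xP f : Ll)" proof -
 have Li: "isideal Lf" by (rule isideal_igen)
 have "EX N. ALL j:UNIV. tv r^N*(xv j^N*F) : Lf" proof (rule uniform_bound)
  fix j :: 'n
  obtain M where "xv j^M*F : Tloc r Lf" using F by blast
  then obtain N where "tv r^N*(xv j^M*F) : Lf" unfolding Vloc_def by blast
  hence "tv r^M*xv j^N*(tv r^N*(xv j^M*F)) : Lf" by (rule ideal_mult_l[OF Li])
  hence "tv r^(M + N)*(xv j^(M + N)*F) : Lf" by (simp only: power_add mult_ac)
  thus "EX N. tv r^N*(xv j^N*F) : Lf" by blast
 next
  fix j :: 'n and C D :: nat
  assume *: "tv r^C*(xv j^C*F) : Lf" "C <= D"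
  have "tv r^(D - C)*xv j^(D - C)*(tv r^C*(xv j^C*F)) : Lf" by (rule ideal_mult_l[OF Li *(1)])
  hence "tv r^(D - C + C)*(xv j^(D - C + C)*F) : Lf" by (simp only: power_add mult_ac)
  thus "tv r^D*(xv j^D*F) : Lf" using *(2) by simp
 qed simp
 then obtain N where N: "!!j. tv r^N*(xv j^N*F) : Lf" by blast
 hence "ALL j. EX y. tv r^N*(xv j^N*F) - y*xP f : Ll" unfolding igen_insert by blast
 then obtain y where y: "!!j. tv r^N*(xv j^N*F) - y j * xP f : Ll" by metis
 define c where "c = (%j. evT h (y j))"
 have c: "Var r^N*(h j^N*evT h F) = c j * ev Const h f" for j using evT_h_Ll[OF y[of j]] by (simp add: evT_simps evT_xP c_def)
 have "c i * h j^N = c j * h i^N" for i j proof -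
  have "ev Const h f*(c i * h j^N) = (c i * ev Const h f)*h j^N" by (simp only: mult_ac)
  also have "... = (c j * ev Const h f)*h i^N" unfolding c[symmetric] by (simp only: mult_ac)
  also have "... = ev Const h f*(c j * h i^N)" by (simp only: mult_ac)
  finally show ?thesis using mpoly_mult_cancel f_h by blast
 qed
 then obtain c0 where c0: "!!i. c i = c0*h i^N" using h_proportional[of c N] by blast
 obtain j where j: "h j ~= 0" using h_nonzero by blast
 have "h j^N*(Var r^N*evT h F) = h j^N*(c0*ev Const h f)" using c[of j] unfolding c0 by (simp only: mult_ac)
 hence "Var r^N*evT h F = c0*ev Const h f" using mpoly_mult_cancel mpoly_power_eq_0 j by blast
 with y show ?thesis by blast
qed

lemma evT_0_reduce: fixes F :: "('n + 'n, 'k) mpoly" shows "F - tP (evT (%_. 0) F) : igen (range (%i. xv i))" proof -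
 let ?a = "igen (range (%i. xv i)) :: ('n + 'n, 'k) mpoly set"
 have "ev Const Var F - ev Const (%i. tP (case_sum (%_. 0) Var i)) F : ?a" proof (rule ev_ideal_cong[OF isideal_igen, of UNIV])
  fix i :: "'n + 'n"
  show "Var i - tP (case_sum (%_. 0) Var i) : ?a" by (cases i) (auto simp: xP_simps rhom_0[OF rhom_tP] ideal_0[OF isideal_igen] intro: igen_base)
 qed (simp add: vin_def)
 thus ?thesis by (simp add: ev_comp[OF rhom_tP rhom_Const] xP_simps)
qed

text \<open>Modulo the x_i every polynomial is congruent to one in T, so the bound is that of q in
  k[T].\<close>

lemma dim_xq: assumes q: "q ~= 0" shows "dimle (igen (insert (tP q) (range (%i. xv i))) :: ('n + 'n, 'k) mpoly set) d" proof (rule dimle_primes)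
 fix Q :: "('n + 'n, 'k) mpoly set"
 assume Q: "isprime Q" "igen (insert (tP q) (range (%i. xv i))) <= Q"
 have "tP q : Q" using Q(2) igen_base[of "tP q" "insert (tP q) (range (%i. xv i))"] by blast
 have x: "igen (range (%i. xv i)) <= Q" using Q(2) idl.span_mono[of "range (%i. xv i)" "insert (tP q) (range (%i. xv i))"] by blast
 have p: "isprime {F. tP F : Q}" by (rule prime_vimage[OF rhom_tP Q(1)])
 have "dimle {F. tP F : Q} d" using dimle_prime_nonzero[OF p _ q] `tP q : Q` card by simp
 moreover have "indep {F. tP F : Q} r (%j. evT (%_. 0) (t j))" if t: "indep Q r t" for r t proof -
  have "indep Q r (%j. tP (evT (%_. 0) (t j)))" proof (rule indep_cong[OF isprime_ideal[OF Q(1)] t])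
   fix j
   have "t j - tP (evT (%_. 0) (t j)) : Q" using evT_0_reduce x by blast
   from ideal_neg[OF isprime_ideal[OF Q(1)] this] show "tP (evT (%_. 0) (t j)) - t j : Q" by simp
  qed
  thus ?thesis by (subst indep_vimage[OF rhom_tP]) (simp_all add: xP_simps)
 qed
 ultimately show "dimle Q d" unfolding dimle_def by blast
qed (rule isideal_igen)

text \<open>Since T_r^N F(h) = c f(h), it suffices to find a form s' of x-degree q = e - m whose
  value at h is c up to a power of T_r: then F and s' f agree at h, hence locally modulo (l). The
  form s' is obtained as the quotient of x_{j0}^q c by h_{j0}^q modulo (l).\<close>

lemma x_saturated_lf: assumes F: "F : homg xw e" "m <= e" and sat: "!!j. EX M. xv j^M*F : Tloc r Lf" shows "F : Tloc r Lf" proof -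
 define q where "q = e - m"
 have e: "e = q + m" using F(2) by (simp add: q_def)
 obtain N c y where c: "Var r^N*evT h F = c*ev Const h f" and y: "!!j. tv r^N*(xv j^N*F) - y j * xP f : Ll" using value_multiple[OF sat] by blast
 obtain j0 where j0: "h j0 ~= 0" using h_nonzero by blast
 define u where "u = tP (h j0^q)"
 have hq: "h j0^q : homg tot (q*(d - 1))" "h j0^q ~= 0" using homg_power[OF h_homg] j0 mpoly_power_eq_0 by blast+
 have u: "u : homg tot (q*(d - 1))" "u : homg xw 0" "dimle (Lu u) (d + 1)"
  unfolding u_def by (rule tP_homg(1)[OF hq(1)], rule tP_homg(3), rule dim_lq[OF hq])
 have T0: "(tv i^N :: ('n + 'n, 'k) mpoly) : homg xw 0" for i N using homg_power[OF homg_Var[of "Inr i" xw], of N] by simp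
 have xN: "(xv j^N :: ('n + 'n, 'k) mpoly) : homg xw N" for j N using homg_power[OF x_homg_xw, of j N] by simp
 define y' where "y' = (%j. hcomp xw (N + q) (y j))"
 have fx: "xP f : homg xw m" by (rule xP_homg(2)[OF f(2)])
 have y': "tv r^N*(xv j^N*F) - xP f * y' j : Ll" for j proof -
  have "tv r^N*(xv j^N*F) : homg xw (0 + (N + e))" by (intro homg_mult T0 xN F(1))
  hence "hcomp xw (N + e) (tv r^N*(xv j^N*F)) = tv r^N*(xv j^N*F)" by (simp add: hcomp_of_homg)
  moreover have "hcomp xw (N + e) (xP f * y j) = xP f * y' j" unfolding hcomp_mult_homg[OF fx] y'_def e by simp
  moreover have "hcomp xw (N + e) (tv r^N*(xv j^N*F) - xP f * y j) : Ll" by (rule hcomp_Ll) (use y[of j] in "simp only: mult.commute")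
  ultimately show ?thesis unfolding hcomp_diff by (simp only:)
 qed
 have yh: "evT h (y' j) = c*h j^N" for j proof -
  have "ev Const h f * evT h (y' j) = Var r^N*(h j^N*evT h F)" using evT_h_Ll[OF y'[of j]] by (simp add: evT_simps evT_xP)
  also have "... = h j^N*(Var r^N*evT h F)" by (simp only: mult_ac)
  also have "... = ev Const h f*(c*h j^N)" unfolding c by (simp only: mult_ac)
  finally show ?thesis using mpoly_mult_cancel f_h by blast
 qed
 \<comment> \<open>G has the value c h_{j0}^q at h; if G lies in (l, u) locally, the quotient by u
   has the required value.\<close>
 define G where "G = xv j0^q * tP c"
 have Gx: "G : homg xw q" unfolding G_def using homg_mult[OF xN tP_homg(3), of j0 q c] by simp
 define C where "C = {K. K * G : Tloc r (Lu u)}"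
 have Ti: "isideal (Tloc r (Lu u))" by (intro Vloc_ideal isideal_igen)
 have Ci: "isideal C" unfolding C_def by (rule idl.subspaceI) (use Ti in "auto simp: distrib_right mult.assoc ideal_0 ideal_add ideal_mult_l")
 have uT: "u * K : Tloc r (Lu u)" for K by (intro Vloc_superset ideal_mult_r isideal_igen igen_base) simp
 \<comment> \<open>x_j^N G and u y'_j have the same value at h. So u and a power of each x_j carry G
   into (l, u), and a regular element w of (u, x) removes these multipliers.\<close>
 have xC: "xv j^N : C" for j proof -
  have "xv j^N*G - u*y' j : Tloc r Ll" proof (rule vanishing_at_h)
   have "u * y' j : homg xw (0 + (N + q))" unfolding y'_def by (intro homg_mult u hcomp_homg)
   hence "u * y' j : homg xw (N + q)" by (simp only: add_0)
   thus "xv j^N*G - u*y' j : homg xw (N + q)" by (rule homg_diff[OF homg_mult[OF xN Gx]])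
   show "evT h (xv j^N*G - u*y' j) = 0" by (simp add: G_def u_def evT_simps yh)
  qed
  hence "xv j^N*G - u*y' j : Tloc r (Lu u)" using Vloc_mono[OF Ll_Lu] by blast
  thus ?thesis unfolding C_def using ideal_mem_cong[OF Ti] uT by blast
 qed
 have "insert u (range (%i. xv i)) <= rad C" using xC uT[of G] by (auto simp: rad_def C_def intro: exI[of _ 1])
 hence Br: "igen (insert u (range (%i. xv i))) <= rad C" by (intro igen_subset rad_ideal Ci)
 have B: "hideal tot (igen (insert u (range (%i. xv i))))" proof (rule hideal_igen)
  fix x assume "x : insert u (range (%i. xv i))"
  thus "EX d. x : homg tot d" using u(1) by (elim insertE imageE) (blast, hypsubst, rule exI, rule homg_Var)
 qed
 obtain w where w: "w : igen (insert u (range (%i. xv i)))" "!!G k. w * G : Tloc k (Lu u) ==> G : Tloc k (Lu u)"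
  using regular_element[OF u(1,3) B dim_xq[OF hq(2), folded u_def]] by metis
 have "w : rad C" using w(1) Br by blast
 then obtain p where p: "w^p*G : Tloc r (Lu u)" unfolding rad_def C_def by blast
 have "K : Tloc r (Lu u)" if "w^p*K : Tloc r (Lu u)" for p K using that by (induction p) (auto simp: mult.assoc dest: w(2))
 from this[OF p] obtain N' where "tv r^N'*G : Lu u" unfolding Vloc_def by blast
 then obtain s where s: "tv r^N'*G - s*u : Ll" unfolding igen_insert by blast
 define s' where "s' = hcomp xw q s"
 have s': "tv r^N'*G - u * s' : Ll" proof -
  have "tv r^N'*G : homg xw (0 + q)" by (intro homg_mult T0 Gx)
  hence "hcomp xw q (tv r^N'*G) = tv r^N'*G" by (simp add: hcomp_of_homg)
  moreover have "hcomp xw q (u * s) = u * s'" unfolding hcomp_mult_homg[OF u(2)] s'_def by simp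
  moreover have "hcomp xw q (tv r^N'*G - u * s) : Ll" by (rule hcomp_Ll) (use s in "simp only: mult.commute")
  ultimately show ?thesis unfolding hcomp_diff by (simp only:)
 qed
 have "h j0^q*(Var r^N'*c) = h j0^q*evT h s'" using evT_h_Ll[OF s'] by (simp add: G_def u_def evT_simps mult_ac)
 hence sh: "Var r^N'*c = evT h s'" using mpoly_mult_cancel hq(2) by blast
 have "tv r^N'*(tv r^N*F) - s'*xP f : Tloc r Ll" proof (rule vanishing_at_h)
  have "tv r^N'*(tv r^N*F) : homg xw (0 + (0 + e))" by (intro homg_mult T0 F(1))
  moreover have "s' * xP f : homg xw e" unfolding e s'_def by (intro homg_mult hcomp_homg fx)
  ultimately show "tv r^N'*(tv r^N*F) - s'*xP f : homg xw e" by (intro homg_diff) simp_all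
  show "evT h (tv r^N'*(tv r^N*F) - s'*xP f) = 0" by (simp only: evT_simps evT_xP c sh[symmetric] mult.assoc diff_self)
 qed
 hence "tv r^N'*(tv r^N*F) - s'*xP f : Tloc r Lf" using Vloc_mono[OF Ll_Lu] by blast
 moreover have "s' * xP f : Tloc r Lf" by (intro Vloc_superset ideal_mult_l isideal_igen igen_base) simp
 ultimately have "(tv r^N'*(tv r^N*F) - s'*xP f) + s'*xP f : Tloc r Lf" by (rule ideal_add[OF Vloc_ideal[OF isideal_igen]])
 hence "tv r^N'*(tv r^N*F) : Tloc r Lf" by (simp only: diff_add_cancel)
 thus ?thesis by (simp only: Vloc_power[OF isideal_igen])
qed

text \<open>Two indices r and r' give T_r^N c_{r'} = T_{r'}^N c_r; as the variables are coprime,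
  T_r^N divides c_r.\<close>

lemma value_multiple_T_free: assumes sat: "!!j r. EX M. xv j^M*F : Tloc r Lf" shows "EX c. evT h F = c*ev Const h f" proof -
 have v: "EX N. EX c. Var r^N*evT h F = c*ev Const h f" for r using value_multiple[OF sat, of r] by blast
 have "EX N. ALL r:UNIV. EX c. Var r^N*evT h F = c*ev Const h f" proof (rule uniform_bound[OF _ v])
  fix r :: 'n and C D :: nat
  assume *: "EX c. Var r^C*evT h F = c*ev Const h f" "C <= D"
  then obtain c where "Var r^C*evT h F = c*ev Const h f" by blast
  hence "Var r^(D - C)*(Var r^C*evT h F) = Var r^(D - C)*(c*ev Const h f)" by (rule arg_cong)
  hence "Var r^D*evT h F = (Var r^(D - C)*c)*ev Const h f" using *(2) by (simp flip: mult.assoc power_add)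
  thus "EX c. Var r^D*evT h F = c*ev Const h f" by blast
 qed simp
 then obtain N where "!!r. EX c. Var r^N*evT h F = c*ev Const h f" by blast
 then obtain c where c: "!!r. Var r^N*evT h F = c r * ev Const h f" by metis
 obtain r r' :: 'n where r: "r ~= r'" using other_index by metis
 have "ev Const h f*(Var r^N*c r') = Var r^N*(c r' * ev Const h f)" by (simp only: mult_ac)
 also have "... = Var r'^N*(c r * ev Const h f)" unfolding c[symmetric] by (simp only: mult_ac)
 also have "... = ev Const h f*(Var r'^N*c r)" by (simp only: mult_ac)
 finally have "Var r^N*c r' = Var r'^N*c r" using mpoly_mult_cancel f_h by blast
 then obtain c0 where c0: "c r = Var r^N*c0" using Var_coprime[OF r] by blast
 have "Var r^N*(evT h F - c0*ev Const h f) = 0" using c[of r] by (simp add: c0 algebra_simps)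
 hence "evT h F - c0*ev Const h f = 0" by (rule Var_power_cancel)
 thus ?thesis by (intro exI[of _ c0]) simp
qed

lemma homg_value: assumes "!!r. D r : homg xw p" "!!r. D r : homg tw q"
 shows "(SUM r:UNIV. D r * tP (h r)) : homg xw p" "(SUM r:UNIV. D r * tP (h r)) : homg tw (q + (d - 1))" proof -
 have "D r * tP (h r) : homg xw (p + 0)" "D r * tP (h r) : homg tw (q + (d - 1))" for r by (intro homg_mult assms tP_homg h_homg)+
 thus "(SUM r:UNIV. D r * tP (h r)) : homg xw p" "(SUM r:UNIV. D r * tP (h r)) : homg tw (q + (d - 1))" by (auto intro!: homg_sum)
qed

end

text \<open>The gcd-iterations transported to k[x, T]: \<open>Dv i\<close> is the column
  \<partial>g_i, and \<open>c i\<close> is the unit by which a chosen gcd differs from the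
  sum.\<close>

locale gcd_chain = linear_alternating d m f \<pi> I \<phi> a \<psi>
 for d m and f :: "('n::finite, 'k::field) mpoly" and \<pi> :: "('n, 'k) mpoly => 'r::comm_ring_1" and I \<phi> a \<psi> +
 fixes g :: "nat => ('n + 'n, 'k) mpoly" and Dv :: "nat => 'n => ('n + 'n, 'k) mpoly" and c :: "nat => 'k"
 assumes g0: "g 0 = xP f" and c: "!!i. c i ~= 0"
  and Dv: "!!i r. i < m ==> Dv i r : homg xw (m - Suc i)" "!!i r. i < m ==> Dv i r : homg tw (i*(d - 1))"
   "!!i. i < m ==> (SUM r:UNIV. xv r * Dv i r) = g i" and gS: "!!i. i < m ==> g (Suc i) = Const (c i)*(SUM r:UNIV. Dv i r * tP (h r))"
begin

lemma g_homg: "i <= m ==> g i : homg xw (m - i)" "i <= m ==> g i : homg tw (i*(d - 1))" proof -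
 assume i: "i <= m"
 have "g i : homg xw (m - i) & g i : homg tw (i*(d - 1))" proof (cases i)
  case 0 thus ?thesis using xP_homg(2)[OF f(2)] xP_homg(3) by (simp add: g0)
 next
  case (Suc i')
  hence "i' < m" using i by simp
  from homg_value[OF Dv(1)[OF this] Dv(2)[OF this]] gS[OF this] show ?thesis unfolding Suc by (simp add: homg_Const_mult add.commute)
 qed
 thus "g i : homg xw (m - i)" "g i : homg tw (i*(d - 1))" by blast+
qed

lemma g_value: "i <= m ==> EX b. b ~= 0 & evT h (g i) = Const b * ev Const h f" proof (induction i)
 case 0
 thus ?case by (intro exI[of _ 1]) (simp add: g0 evT_xP Const_simps)
next
 case (Suc i)
 then obtain b where b: "b ~= 0" "evT h (g i) = Const b * ev Const h f" by auto
 have "evT h (g (Suc i)) = Const (c i)*(SUM r:UNIV. h r * evT h (Dv i r))"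
  using Suc.prems by (simp add: gS evT_simps ev_sum rhom_Const ev_Const mult.commute)
 also have "(SUM r:UNIV. h r * evT h (Dv i r)) = evT h (SUM r:UNIV. xv r * Dv i r)" by (simp add: evT_simps ev_sum rhom_Const)
 also have "... = Const b * ev Const h f" using Dv(3)[of i] Suc.prems b(2) by simp
 finally have "evT h (g (Suc i)) = Const (c i * b)*ev Const h f" by (simp add: Const_simps mult.assoc)
 thus ?case using b(1) c by (intro exI[of _ "c i * b"]) simp
qed

text \<open>Exchanging x_j with h_j changes the sum by a combination of the x_j h_r - x_r h_j, which
  are T-torsion modulo (l). The combination has positive T-degree because d >= 2, so it lies in
  (l).\<close>

lemma x_g: assumes i: "i < m" shows "xv j * g (Suc i) : igen (insert (g i) (range l))" proof -
 define R where "R = (SUM r:UNIV. Dv i r*(xv j * tP (h r) - xv r * tP (h j)))"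
 have "xv j*(SUM r:UNIV. Dv i r * tP (h r)) = R + tP (h j)*(SUM r:UNIV. xv r * Dv i r)"
  unfolding R_def by (simp add: sum_distrib_left algebra_simps flip: sum.distrib)
 hence eq: "xv j * g (Suc i) = Const (c i) * R + Const (c i) * tP (h j)*g i"
  using i by (simp add: gS Dv(3) distrib_left) (metis (no_types, lifting) distrib_left mult.assoc mult.left_commute)
 have "R : Ll" proof (rule T_torsion_l)
  have x0: "(xv j :: ('n + 'n, 'k) mpoly) : homg tw 0" for j using homg_Var[of "Inl j" tw] by simp
  have "Dv i r*(xv j * tP (h r) - xv r * tP (h j)) : homg tw (i*(d - 1) + (0 + (d - 1)))" for r by (intro homg_mult homg_diff Dv i x0 tP_homg h_homg)
  thus "R : homg tw (i*(d - 1) + (d - 1))" unfolding R_def by (intro homg_sum) simp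
  show "0 < i*(d - 1) + (d - 1)" using d_ge_2 by simp
  have "xv j * tP (h r) - xv r * tP (h j) : Tloc k Ll" for r k using x_h_relation[of k j r] unfolding Vloc_def by (auto intro!: exI[of _ 1])
  thus "R : Tloc k Ll" for k unfolding R_def by (intro ideal_sum ideal_mult_l Vloc_ideal isideal_igen)
 qed
 hence "Const (c i) * R : igen (insert (g i) (range l))" using Ll_Lu by (intro ideal_mult_l isideal_igen) auto
 thus ?thesis unfolding eq by (rule ideal_add[OF isideal_igen _ ideal_mult_l[OF isideal_igen igen_base]]) simp
qed

definition GG :: "('n + 'n, 'k) mpoly set" where
 "GG = igen (range l Un g ` {..m})"

lemma Lu_g_GG: "i <= m ==> igen (insert (g i) (range l)) <= GG" unfolding GG_def by (rule idl.span_mono) auto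

text \<open>In x-degree at least m nothing beyond (l, f) arises. In x-degree e < m the value F(h) is
  a multiple of f(h), so F agrees at h with g_{m-e} times a polynomial in T, and both have x-degree
  e.\<close>

lemma saturated_GG: assumes F: "F : homg xw e" "F : homg tw b" "b > 0" and sat: "!!j r. EX M. xv j^M*F : Tloc r Lf" shows "F : GG"
proof (cases "m <= e")
 case True
 have "F : Lf" by (rule T_torsion_lf[OF F(2,3) x_saturated_lf[OF F(1) True sat]])
 thus ?thesis using Lu_g_GG[of 0] by (auto simp: g0)
next
 case False
 define i where "i = m - e"
 have i: "i <= m" "m - i = e" using False by (auto simp: i_def)
 obtain q where q: "evT h F = q*ev Const h f" using value_multiple_T_free[OF sat] by blast
 obtain b' where b': "b' ~= 0" "evT h (g i) = Const b' * ev Const h f" using g_value[OF i(1)] by blast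
 define u where "u = tP (Const (inverse b')*q)"
 have "F - g i * u : Tloc r Ll" for r proof (rule vanishing_at_h)
  have "g i * u : homg xw (e + 0)" unfolding u_def using homg_mult[OF g_homg(1)[OF i(1)] tP_homg(3)] i(2) by simp
  thus "F - g i * u : homg xw e" using F(1) by (intro homg_diff) simp_all
  have "Const b'*(Const (inverse b')*q) = q" using Const_inverse[OF b'(1), of q] by (simp only: mult_ac)
  moreover have "Const b' * ev Const h f*(Const (inverse b')*q) = (Const b'*(Const (inverse b')*q))*ev Const h f" by (simp only: mult_ac)
  ultimately have "Const b' * ev Const h f*(Const (inverse b')*q) = q*ev Const h f" by (simp only:)
  thus "evT h (F - g i * u) = 0" by (simp only: evT_simps u_def evT_tP q b'(2) diff_self)
 qed
 hence "hcomp tw b (F - g i * u) : Tloc r Ll" for r by (rule Vloc_hcomp[OF hideal_l(3)])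
 hence "hcomp tw b (F - g i * u) : Ll" by (intro T_torsion_l[OF hcomp_homg F(3)])
 moreover have "EX v. hcomp tw b (g i * u) = g i * v" unfolding hcomp_mult_homg[OF g_homg(2)[OF i(1)]] by (auto intro: exI[of _ 0])
 moreover have "hcomp tw b F = F" using hcomp_of_homg[OF F(2), of b] by simp
 ultimately obtain v where "F - v * g i : Ll" unfolding hcomp_diff by (metis mult.commute)
 hence "F : igen (insert (g i) (range l))" unfolding igen_insert by blast
 thus ?thesis using Lu_g_GG[OF i(1)] by blast
qed

end

section \<open>The defining ideal of the Rees algebra\<close>

lemma ideal_diffD: "isideal a ==> x - y : a ==> y : a ==> x : a" using ideal_add[of a "x - y" y] by simp

lemma homg_tw_0: assumes F: "F : homg tw 0" shows "xP (evS v F) = F" proof -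
 have "xP (evS v F) = ev Const (%i. xP (case_sum Var v i)) F" by (simp add: ev_comp[OF rhom_xP rhom_Const] xP_simps)
 also have "... = ev Const Var F" proof (rule ev_cong)
  fix i n assume n: "n : kys F" "i : kys n"
  hence "wdeg tw n = 0" using F by (auto simp: homg_iff in_keys_iff)
  hence "ALL i:kys n. tw i * lk n i = 0" unfolding wdeg_def by (simp only: sum_eq_0_iff finite_keys)
  hence "tw i * lk n i = 0" using n(2) by (rule bspec)
  thus "xP (case_sum Var v i) = Var i" using n(2) by (cases i) (auto simp: xP_simps in_keys_iff)
 qed
 finally show ?thesis by simp
qed

lemma hideal_closed_generators: assumes Z: "!!z d. z : Z ==> hcomp wt d z : Z" shows "hideal wt (igen Z)" proof -
 let ?H = "{z : Z. EX d. z : homg wt d}"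
 have "igen Z = igen ?H" proof (rule antisym)
  have "z : igen ?H" if z: "z : Z" for z proof -
   obtain D where D: "z = (SUM d<=D. hcomp wt d z)" using hcomp_decomp[of z wt] by blast
   have "hcomp wt d z : ?H" for d using Z[OF z] hcomp_homg by blast
   hence "(SUM d<=D. hcomp wt d z) : igen ?H" by (intro ideal_sum isideal_igen igen_base)
   thus ?thesis by (subst D)
  qed
  thus "igen Z <= igen ?H" by (intro igen_subset isideal_igen) blast
 qed (rule idl.span_mono, blast)
 moreover have "hideal wt (igen ?H)" by (rule hideal_igen) blast
 ultimately show ?thesis by simp
qed

lemma hideal_Vloc: assumes a: "hideal wt a" shows "hideal wt (Vloc v a)" using a Vloc_ideal[of a v] Vloc_hcomp[OF a] by (auto simp: hideal_def)

context linear_alternating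
begin

lemma f_dvd: "F : igen {f} \<longleftrightarrow> (EX r. F = r*f)" by (auto simp: idl.span_singleton)

text \<open>If f divides x_p^M u and x_q^M u for distinct p and q, the first quotient is divisible
  by x_p^M.\<close>

lemma coprime_powers: assumes "!!j. Var j^M*u : igen {f}" shows "u : igen {f}" proof -
 have "ALL j. EX r. Var j^M*u = r*f" using assms unfolding f_dvd by blast
 then obtain r where r: "!!j. Var j^M*u = r j * f" by metis
 obtain p q :: 'n where pq: "p ~= q" using other_index by metis
 have "f*(Var p^M*r q) = Var p^M*(r q * f)" by (simp only: mult_ac)
 also have "... = Var q^M*(r p * f)" unfolding r[symmetric] by (simp only: mult_ac)
 also have "... = f*(Var q^M*r p)" by (simp only: mult_ac)
 finally have "Var p^M*r q = Var q^M*r p" using mpoly_mult_cancel f(1) by blast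
 then obtain H where H: "r p = Var p^M*H" using Var_coprime[OF pq] by blast
 have "Var p^M*(u - H*f) = 0" using r[of p] by (simp add: H algebra_simps)
 hence "u - H*f = 0" by (rule Var_power_cancel)
 thus ?thesis unfolding f_dvd by (intro exI[of _ H]) simp
qed

abbreviation lift :: "'r => ('n, 'k) mpoly" where "lift == inv_into UNIV \<pi>"

lemma lift: "\<pi> (lift y) = y" by (rule surj_f_inv_f[OF \<pi>(2)])

definition av :: "'n => ('n, 'k) mpoly" where "av i = lift (a $ i)"

lemma av: "\<pi> (av i) = a $ i" unfolding av_def by (rule lift)

lemma I_gen: "I = igen (range (%i. a $ i))" and relations: "(SUM i:UNIV. a $ i * v $ i) = 0 \<longleftrightarrow> (EX w. v = \<phi> *v w)"
 using pres by (auto simp: presents_def Idl_rng)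

lemma xP_f_Lf: "x : igen {f} ==> xP x : Lf" proof -
 assume "x : igen {f}"
 then obtain r where r: "x = r*f" unfolding f_dvd by blast
 show "xP x : Lf" unfolding r rhom_mult[OF rhom_xP] by (rule ideal_mult_l[OF isideal_igen igen_base]) simp
qed

lemma l_Lu: "l j : Lu u" and u_Lu: "u : Lu u" by (auto intro: igen_base)

text \<open>A form linear in T that vanishes at T = a is a syzygy of a, and syzygies come from the
  columns of \<phi>; so the T-linear part of the Rees ideal lifts to (l, f).\<close>

lemma relation_lift: assumes "(SUM s:UNIV. a $ s * \<pi> (v s)) = 0" shows "(SUM s:UNIV. tv s * xP (v s)) : Lf" proof -
 obtain w where "(\<chi> s. \<pi> (v s)) = \<phi> *v w" using relations[of "\<chi> s. \<pi> (v s)"] assms by auto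
 hence w: "\<pi> (v s) = (SUM t:UNIV. \<phi> $ s $ t * w $ t)" for s by (simp add: vec_eq_iff matrix_vector_mult_def)
 define w' where "w' = (%t. lift (w $ t))"
 have w': "\<pi> (w' t) = w $ t" for t unfolding w'_def by (rule lift)
 have "\<pi> (v s - (SUM t:UNIV. \<psi> $ s $ t * w' t)) = 0" for s by (simp add: rhom_simps[OF \<pi>(1)] w' \<phi> w)
 hence v: "xP (v s - (SUM t:UNIV. \<psi> $ s $ t * w' t)) : Lf" for s using ker xP_f_Lf by blast
 have "(SUM s:UNIV. tv s * xP (v s)) = (SUM s:UNIV. tv s * xP (v s - (SUM t:UNIV. \<psi> $ s $ t * w' t)))
   + (SUM s:UNIV. SUM t:UNIV. xP (w' t)*(tv s * xP (\<psi> $ s $ t)))"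
  by (simp add: rhom_simps[OF rhom_xP] right_diff_distrib sum_subtractf sum_distrib_left mult_ac)
 also have "(SUM s:UNIV. SUM t:UNIV. xP (w' t)*(tv s * xP (\<psi> $ s $ t))) = (SUM t:UNIV. xP (w' t)*l t)"
  by (subst sum.swap) (simp add: l_def sum_distrib_left)
 also have "(SUM s:UNIV. tv s * xP (v s - (SUM t:UNIV. \<psi> $ s $ t * w' t))) + (SUM t:UNIV. xP (w' t)*l t) : Lf"
  by (rule ideal_add[OF isideal_igen]; rule ideal_sum[OF isideal_igen];
    rule ideal_mult_l[OF isideal_igen]) (rule v l_Lu)+
 finally show ?thesis .
qed

lemma delta_sum: "(SUM s:UNIV. b s*(if s = (j :: 'n) then x else 0)) = b j*(x :: 'z::comm_ring_1)"
 by (simp add: if_distrib[of "%x. _ * x"] cong: if_cong)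

lemma av_T_relation: "tv j * xP (av i) - tv i * xP (av j) : Lf" proof -
 let ?v = "%s. (if s = j then av i else 0) - (if s = i then av j else 0)"
 have p: "\<pi> (?v s) = (if s = j then a $ i else 0) - (if s = i then a $ j else 0)" for s by (simp add: rhom_simps[OF \<pi>(1)] av)
 have x: "xP (?v s) = (if s = j then xP (av i) else 0) - (if s = i then xP (av j) else 0)" for s by (simp add: rhom_simps[OF rhom_xP])
 have "(SUM s:UNIV. a $ s * \<pi> (?v s)) = 0" unfolding p right_diff_distrib sum_subtractf delta_sum by (simp add: mult.commute)
 from relation_lift[OF this] show ?thesis unfolding x right_diff_distrib sum_subtractf delta_sum .
qed

text \<open>The Koszul syzygies give T_s a_i = T_i a_s modulo (l, f), so a_i^b F(x, T) equals T_i^b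
  F(x, a), which is zero modulo f.\<close>

lemma rad_colon_av: assumes F: "F : homg tw b" "evS av F : igen {f}" shows "xP (av i)^b*F : Lf" proof -
 let ?u = "%v. Var v * xP (av i)^tw v" and ?v = "%v. xP (case_sum Var av v) * tv i^tw v"
 have "ev Const ?u F - ev Const ?v F : Lf" proof (rule ev_ideal_cong[OF isideal_igen, of UNIV])
  fix v :: "'n + 'n"
  show "?u v - ?v v : Lf" proof (cases v)
   case (Inl s) thus ?thesis by (simp add: xP_simps ideal_0[OF isideal_igen])
  next
   case (Inr s) thus ?thesis using av_T_relation[of s i] by (simp add: mult.commute)
  qed
 qed (simp add: vin_def)
 moreover have "ev Const ?u F = F*xP (av i)^b" using ev_weight_scale[OF rhom_Const F(1), of Var "xP (av i)"] by simp
 moreover have "ev Const ?v F = xP (evS av F) * tv i^b" using ev_weight_scale[OF rhom_Const F(1), of "%v. xP (case_sum Var av v)" "tv i"]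
  by (simp add: ev_comp[OF rhom_xP rhom_Const] xP_simps)
 moreover have "xP (evS av F) * tv i^b : Lf" by (intro ideal_mult_r isideal_igen xP_f_Lf F(2))
 ultimately have "F * xP (av i)^b - xP (evS av F) * tv i^b : Lf" "xP (evS av F) * tv i^b : Lf" by (simp_all only:)
 hence "F * xP (av i)^b : Lf" by (rule ideal_diffD[OF isideal_igen])
 thus ?thesis by (simp only: mult.commute)
qed

lemma Lf_dim: "dimle Lf (d + 1)" and Lf_f: "xP f : homg tot m" using dim_lf xP_homg(1)[OF f(2)] by auto

text \<open>The annihilator of a member of the Rees ideal modulo \<open>(l, f)\<close> contains a power of the ideal \<open>I\<close>;
  away from the origin of the \<open>x\<close>-space \<open>(l, f, I)\<close> has smaller dimension than \<open>(l, f)\<close>.\<close>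

lemma rees_saturated: assumes hJ: "hideal tot {x. \<pi> x : I}" and F: "F : homg tw b" "evS av F : igen {f}" shows "EX M. xv j^M*F : Tloc r Lf"
proof -
 let ?J = "{x. \<pi> x : I}"
 define E where "E = igen (range l Un xP ` ?J)"
 define C where "C = {K. K * F : Tloc r Lf}"
 have Ti: "isideal (Tloc r Lf)" by (intro Vloc_ideal isideal_igen)
 have Ci: "isideal C" unfolding C_def by (rule idl.subspaceI) (use Ti in "auto simp: distrib_right mult.assoc ideal_0 ideal_add ideal_mult_l")
 have LC: "K : C" if "K : Lf" for K unfolding C_def using that by (auto intro!: Vloc_superset ideal_mult_r isideal_igen)
 have avC: "xP (av i) : rad C" for i unfolding rad_def C_def using rad_colon_av[OF F, of i] by (auto intro!: Vloc_superset exI[of _ b])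
 have JC: "xP x : rad C" if x: "\<pi> x : I" for x proof -
  obtain r where r: "\<pi> x = (SUM i:UNIV. r i * a $ i)" using x igen_image[of UNIV "\<pi> x" "%i. a $ i"] unfolding I_gen by auto
  define r' where "r' = (%i. lift (r i))"
  have r': "\<pi> (r' i) = r i" for i unfolding r'_def by (rule lift)
  have "\<pi> (x - (SUM i:UNIV. r' i * av i)) = 0" by (simp add: rhom_simps[OF \<pi>(1)] r' av r)
  hence "xP (x - (SUM i:UNIV. r' i * av i)) : rad C" using ker xP_f_Lf LC rad_superset by blast
  moreover have "xP (SUM i:UNIV. r' i * av i) : rad C" unfolding rhom_simps[OF rhom_xP] by (intro ideal_sum ideal_mult_l rad_ideal Ci avC)
  ultimately have "xP (x - (SUM i:UNIV. r' i * av i)) + xP (SUM i:UNIV. r' i * av i) : rad C" by (rule ideal_add[OF rad_ideal[OF Ci]])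
  thus ?thesis unfolding rhom_add[OF rhom_xP, symmetric] by simp
 qed
 have "l i : rad C" for i using LC[OF l_Lu] rad_superset by blast
 hence EC: "E <= rad C" unfolding E_def using JC by (intro igen_subset rad_ideal Ci) auto
 have "hcomp tot e z : range l Un xP ` ?J" if z: "z : range l Un xP ` ?J" for z e proof (cases "z : range l")
  case True
  hence "z : homg tot 2" using l_homg by auto
  hence "hcomp tot e z = (if e = 2 then z else 0)" by (rule hcomp_of_homg)
  moreover have "0 : xP ` ?J" using rhom_0[OF rhom_xP] rhom_0[OF \<pi>(1)] idl.span_zero unfolding I_gen by (intro image_eqI[of _ _ 0]) auto
  ultimately show ?thesis using True by auto
 next
  case False
  then obtain x where x: "z = xP x" "x : ?J" using z by blast
  have "hcomp tot e z = xP (hcomp tot e x)" unfolding x(1) xP_def by (rule ev_hcomp) (rule homg_Var[of _ tot])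
  moreover have "hcomp tot e x : ?J" using hJ x(2) unfolding hideal_def by blast
  ultimately show ?thesis by blast
 qed
 hence hE: "hideal tot E" unfolding E_def by (rule hideal_closed_generators)
 \<comment> \<open>Elements independent modulo this localization stay independent modulo some prime
   over E that misses x_j, to which \<open>dim_prime_lfI\<close> applies.\<close>
 have "dimle (Vloc (Inl j) E) d" unfolding dimle_def proof (intro allI impI)
  fix q t assume t: "indep (Vloc (Inl j) E) q t"
  have "EX Q. isprime Q & E <= Q & xv j ~: Q & indep Q q t" proof (rule indep_prime_over)
   show "isideal E" unfolding E_def by (rule isideal_igen)
   show "xv j^N*ev Const t K ~: E" if "vin {..<q} K" "K ~= 0" for N K using t that unfolding indep_def Vloc_def by blast
  qed
  then obtain Q where Q: "isprime Q" "E <= Q" "xv j ~: Q" "indep Q q t" by blast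
  have gE: "z : Q" if "z : range l Un xP ` ?J" for z using Q(2) igen_base[OF that] unfolding E_def by blast
  have "dimle Q d" proof (rule dim_prime_lfI[OF Q(1) _ _ _ Q(3)])
   show "l i : Q" for i using gE by blast
   have "\<pi> f = 0" unfolding ker by (rule igen_base) simp
   hence "f : ?J" unfolding I_gen by (simp add: idl.span_zero)
   thus "xP f : Q" using gE by blast
   show "I <= \<pi> ` {F. xP F : Q}" proof
    fix y assume y: "y : I"
    have x: "\<pi> (lift y) = y" by (rule lift)
    have "xP (lift y) : Q" by (rule gE, rule UnI2, rule imageI) (simp add: x y)
    hence "lift y : {F. xP F : Q}" by (rule CollectI)
    thus "y : \<pi> ` {F. xP F : Q}" using x[symmetric] by (rule rev_image_eqI)
   qed
  qed
  with Q(4) show "q <= d" unfolding dimle_def by blast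
 qed
 \<comment> \<open>Some power of x_j^N w carries F into (l, f) locally in T, and w cancels because
   it is regular there.\<close>
 from regular_element[OF Lf_f Lf_dim hideal_Vloc[OF hE] this] obtain w
  where w: "w : Vloc (Inl j) E" "!!G k. w * G : Tloc k Lf ==> G : Tloc k Lf" by blast
 obtain N where "xv j^N*w : E" using w(1) unfolding Vloc_def by blast
 hence "xv j^N*w : rad C" using EC by blast
 then obtain p where "(xv j^N*w)^p*F : Tloc r Lf" unfolding rad_def C_def by blast
 hence "w^p*(xv j^(N*p)*F) : Tloc r Lf" by (simp only: power_mult_distrib power_mult mult_ac)
 moreover have "K : Tloc r Lf" if "w^p*K : Tloc r Lf" for p K using that by (induction p) (auto simp: mult.assoc dest: w(2))
 ultimately show ?thesis by blast
qed

text \<open>The preimage in k[x, T] of the Rees ideal, see \<open>rees_JJ\<close>. Putting T_i = a_i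
  forgets the variable t; \<open>star\<close> in the T-grading restores it.\<close>

definition JJ :: "('n + 'n, 'k) mpoly set" where
 "JJ = star tw {F. evS av F : igen {f}}"

lemma JJ_ideal: "isideal JJ" unfolding JJ_def by (intro star_ideal ideal_vimage rhom_ev rhom_Const isideal_igen)

lemma JJ_homg: "F : homg tw b ==> F : JJ \<longleftrightarrow> evS av F : igen {f}"
 using ideal_0[OF isideal_igen, of "{f}"] by (auto simp: JJ_def star_def hcomp_of_homg ev_0)

lemma l_JJ: "l j : JJ" unfolding JJ_homg[OF l_homg(3)] proof -
 have "(SUM i:UNIV. a $ i*(\<phi> *v axis j 1) $ i) = 0" using relations by blast
 moreover have "(\<phi> *v axis j 1) $ i = \<phi> $ i $ j" for i
  by (simp add: matrix_vector_mult_def axis_def if_distrib[of "%x. _ * x"] cong: if_cong)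
 ultimately have "\<pi> (evS av (l j)) = 0" unfolding evS_l by (simp add: rhom_simps[OF \<pi>(1)] av transpose_def \<phi> mult.commute)
 thus "evS av (l j) : igen {f}" unfolding ker .
qed

lemma f_JJ: "xP f : JJ" unfolding JJ_homg[OF xP_homg(3)] by (simp add: igen_base)

end

text \<open>\<open>hJ\<close> is homogeneity of I, stated for its preimage in S.\<close>

locale gorenstein_chain = gcd_chain d m f \<pi> I \<phi> a \<psi> g Dv c
 for d m and f :: "('n::finite, 'k::field) mpoly" and \<pi> :: "('n, 'k) mpoly => 'r::comm_ring_1" and I \<phi> a \<psi> g Dv c +
 assumes hJ: "hideal tot {x. \<pi> x : I}"
begin

lemma saturated_component: assumes F: "F : homg tw b" and z: "b = 0 ==> evS v F : igen {f}" and sat: "!!j r. EX M. xv j^M*F : Tloc r Lf"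
 shows "F : GG" proof (cases "b = 0")
 case True
 hence "xP (evS v F) : Lf" using xP_f_Lf z by blast
 thus ?thesis using homg_tw_0[of F v] F True Lu_g_GG[of 0] by (auto simp: g0)
next
 case False
 obtain D where D: "F = (SUM e<=D. hcomp xw e F)" using hcomp_decomp[of F xw] by blast
 have "hcomp xw e F : GG" for e proof (rule saturated_GG[OF hcomp_homg hcomp_homg'[OF F]])
  fix j r
  obtain M where "xv j^M*F : Tloc r Lf" using sat by blast
  hence "hcomp xw (xw (Inl j)*M + e) (xv j^M*F) : Tloc r Lf" by (rule Vloc_hcomp[OF hideal_Lu(2)[OF xP_homg(2)[OF f(2)]]])
  thus "EX M. xv j^M*hcomp xw e F : Tloc r Lf" unfolding hcomp_of_Var_power_mult by blast
 qed (use False in simp)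
 hence "(SUM e<=D. hcomp xw e F) : GG" unfolding GG_def by (intro ideal_sum isideal_igen)
 thus ?thesis by (subst D)
qed

lemma JJ_GG: "JJ = GG" proof (rule antisym)
 show "JJ <= GG" proof
  fix F assume F: "F : JJ"
  obtain D where D: "F = (SUM b<=D. hcomp tw b F)" using hcomp_decomp[of F tw] by blast
  have "hcomp tw b F : GG" for b proof -
   have e: "evS av (hcomp tw b F) : igen {f}" using F by (simp add: JJ_def star_def)
   show ?thesis by (rule saturated_component[OF hcomp_homg e rees_saturated[OF hJ hcomp_homg e]])
  qed
  hence "(SUM b<=D. hcomp tw b F) : GG" unfolding GG_def by (intro ideal_sum isideal_igen)
  thus "F : GG" by (subst D)
 qed
 have "evS av (g i) : igen {f}" if "i <= m" for i using that proof (induction i)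
  case 0 show ?case by (simp add: g0 igen_base)
 next
  case (Suc i)
  \<comment> \<open>x_j g_{i+1} lies in (l, g_i), hence vanishes at T = a modulo f; this holds for
    all j, so the variables can be cancelled.\<close>
  have "Var j^1*evS av (g (Suc i)) : igen {f}" for j proof -
   have "g i : JJ" using Suc JJ_homg[OF g_homg(2)] by simp
   hence "igen (insert (g i) (range l)) <= JJ" using l_JJ by (intro igen_subset JJ_ideal) auto
   hence "xv j * g (Suc i) : JJ" using x_g[of i j] Suc.prems by auto
   moreover have "xv j * g (Suc i) : homg tw (0 + Suc i*(d - 1))" using homg_Var[of "Inl j" tw] Suc.prems by (intro homg_mult g_homg) auto
   ultimately have "evS av (xv j * g (Suc i)) : igen {f}" using JJ_homg by blast
   thus ?thesis by (simp add: ev_mult rhom_Const ev_Var)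
  qed
  thus ?case by (rule coprime_powers)
 qed
 hence "g i : JJ" if "i <= m" for i using that JJ_homg[OF g_homg(2)] by blast
 thus "GG <= JJ" unfolding GG_def using l_JJ by (intro igen_subset JJ_ideal) auto
qed

lemma saturation_GG: assumes F: "!!j. xv j^M*F : Lf" shows "F : GG" proof -
 obtain D where D: "F = (SUM b<=D. hcomp tw b F)" using hcomp_decomp[of F tw] by blast
 have "hcomp tw b F : GG" for b proof (rule saturated_component[OF hcomp_homg, where v = "%_. 0"])
  have c: "xv j^M*hcomp tw b F : Lf" for j proof -
   have "hcomp tw (tw (Inl j)*M + b) (xv j^M*F) : Lf" using F[of j] hideal_Lu(3)[OF xP_homg(3)] unfolding hideal_def by blast
   thus ?thesis unfolding hcomp_of_Var_power_mult .
  qed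
  show "EX M. xv j^M*hcomp tw b F : Tloc r Lf" for j r by (rule exI, rule Vloc_superset[OF c])
  have "insert (xP f) (range l) <= {F. evS (%_. 0) F : igen {f}}" using ideal_0[OF isideal_igen, of "{f}"] by (auto simp: evS_l intro: igen_base)
  hence "Lf <= {F. evS (%_. 0) F : igen {f}}" by (intro igen_subset ideal_vimage rhom_ev rhom_Const isideal_igen)
  hence "evS (%_. 0) (xv j^M*hcomp tw b F) : igen {f}" for j using c by blast
  hence "Var j^M*evS (%_. 0) (hcomp tw b F) : igen {f}" for j by (simp add: ev_mult rhom_Const ev_Var rhom_power[OF rhom_ev])
  thus "evS (%_. 0) (hcomp tw b F) : igen {f}" by (rule coprime_powers)
 qed
 hence "(SUM b<=D. hcomp tw b F) : GG" unfolding GG_def by (intro ideal_sum isideal_igen)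
 thus ?thesis by (subst D)
qed

text \<open>For d = 2 the column h is linear, so g_1 is linear in T and lies in (l, f). Its x-degree
  m - 1 is too small for f, so it lies in (l) and vanishes at h, against \<open>g_value\<close>. The
  bound d >= 3 puts the T-degrees of g_1, ..., g_m above that of the l_j.\<close>

lemma d_ge_3: "d >= 3" proof (rule ccontr)
 assume "~ ?thesis"
 hence d: "d = 2" using d_ge_2 by simp
 have m0: "0 < m" using m by simp
 define v where "v = (%s. SUM r:UNIV. Const (c 0)*(Const (lk (h r) (sgl s 1))*evS av (Dv 0 r)))"
 have "tP (h r) = (SUM s:UNIV. Const (lk (h r) (sgl s 1)) * tv s)" for r
  using h_homg[of r] by (subst linear_expand) (simp_all add: d rhom_simps[OF rhom_tP] xP_simps)
 moreover have "Dv 0 r = xP (evS av (Dv 0 r))" for r using homg_tw_0[of "Dv 0 r"] Dv(2)[of 0 r] m0 by simp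
 ultimately have "g 1 = Const (c 0)*(SUM r:UNIV. xP (evS av (Dv 0 r))*(SUM s:UNIV. Const (lk (h r) (sgl s 1)) * tv s))" using gS[of 0] m0 by simp
 also have "... = (SUM r:UNIV. SUM s:UNIV. tv s * xP (Const (c 0)*(Const (lk (h r) (sgl s 1))*evS av (Dv 0 r))))"
  by (simp add: sum_distrib_left rhom_simps[OF rhom_xP] xP_simps mult_ac)
 also have "... = (SUM s:UNIV. tv s * xP (v s))" by (subst sum.swap) (simp add: v_def rhom_sum[OF rhom_xP] sum_distrib_left)
 finally have g1: "g 1 = (SUM s:UNIV. tv s * xP (v s))" .
 have gm: "1 <= m" using m by simp
 have "g 1 : GG" unfolding GG_def by (rule igen_base) (use gm in auto)
 hence "evS av (g 1) : igen {f}" unfolding JJ_GG[symmetric] using JJ_homg[OF g_homg(2)[OF gm]] by blast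
 hence "\<pi> (evS av (g 1)) = 0" unfolding ker .
 hence "(SUM s:UNIV. a $ s * \<pi> (v s)) = 0" unfolding g1 by (simp add: ev_sum rhom_Const ev_mult ev_Var rhom_simps[OF \<pi>(1)] av)
 from relation_lift[OF this] have "g 1 : Lf" unfolding g1 .
 then obtain y where "g 1 - y*xP f : Ll" unfolding igen_insert by blast
 hence "hcomp xw (m - 1) (g 1 - xP f * y) : Ll" by (intro hcomp_Ll) (simp only: mult.commute)
 moreover have "hcomp xw (m - 1) (xP f * y) = 0" using hcomp_mult_homg[OF xP_homg(2)[OF f(2)], of "m - 1" y] m0 by simp
 moreover have "hcomp xw (m - 1) (g 1) = g 1" using hcomp_of_homg[OF g_homg(1)[OF gm], of "m - 1"] by simp
 ultimately have "g 1 : Ll" unfolding hcomp_diff by simp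
 hence "evT h (g 1) = 0" by (rule evT_h_Ll)
 moreover obtain b where "b ~= 0" "evT h (g 1) = Const b * ev Const h f" using g_value[OF gm] by blast
 ultimately show False using mpoly_mult_eq_0 f_h Const_eq_0 by metis
qed

end

section \<open>Minimality of the generators\<close>

text \<open>The rows of A are read as linear forms in variables indexed by U; they span all these
  variables.\<close>

lemma matrix_bound: fixes A :: "'z => 'u => 'k::field"
 assumes U: "finite U" and Z: "finite Z" and eq: "!!j k. j : U ==> k : U ==> (SUM z:Z. B j z * A z k) = (if j = k then 1 else 0)"
 shows "card U <= card Z" proof -
 let ?t = "%z. SUM k:U. Const (A z k)*Var k :: ('u, 'k) mpoly"
 have "card U <= card (?t ` Z)" proof (rule independent_mod_bound[OF U finite_imageI[OF Z] idl.subspace_single_0, where f = Var])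
  fix j assume j: "j : U"
  have "(SUM z:Z. Const (B j z) * ?t z) = (SUM k:U. Const (SUM z:Z. B j z * A z k)*Var k)"
   by (simp add: sum_distrib_left sum_distrib_right Const_simps mult.assoc) (rule sum.swap)
  also have "... = (SUM k:U. if k = j then Var k else 0)" by (intro sum.cong refl) (simp add: eq[OF j] Const_simps)
  also have "... = Var j" using U j by simp
  finally have "Var j - (SUM z:Z. Const (B j z) * ?t z) : {0}" by simp
  moreover have "(SUM z:Z. Const (B j z) * ?t z) : ksp.span (?t ` Z)" by (intro ksp.span_sum ksp.span_scale ksp.span_base imageI)
  ultimately show "EX g:ksp.span (?t ` Z). Var j - g : {0}" by blast
 next
  fix b assume "(SUM j:U. Const (b j)*Var j) : {0 :: ('u, 'k) mpoly}"
  hence z: "lk (SUM j:U. Const (b j)*Var j) n = 0" for n by simp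
  show "ALL j:U. b j = 0" proof
   fix j assume j: "j : U"
   have inj: "sgl s (1::nat) = sgl j 1 \<longleftrightarrow> s = j" for s by (metis lookup_single_eq lookup_single_not_eq zero_neq_one)
   have "lk (SUM j:U. Const (b j)*Var j) (sgl j 1) = (SUM s:U. if s = j then b s else 0)"
    unfolding lookup_sum lookup_Const_mult Var_def lookup_single inj by (intro sum.cong refl) (simp add: when_def)
   thus "b j = 0" using z U j by simp
  qed
 qed
 thus ?thesis using card_image_le[OF Z, of ?t] by linarith
qed

abbreviation cst :: "('v, 'k::comm_ring_1) mpoly => 'k" where "cst == ev (%x. x) (%_. 0)"

lemma cst_lookup: fixes F :: "('v, 'k::comm_ring_1) mpoly" shows "cst F = lk F 0" proof -
 have z: "mev (%_. 0 :: 'k) n = (if n = 0 then 1 else 0)" for n :: "'v \<Rightarrow>\<^sub>0 nat" proof (cases "n = 0")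
  case False
  hence "kys n ~= {}" by simp
  then obtain i where i: "i : kys n" by blast
  hence "(0 :: 'k)^lk n i = 0" by (intro zero_power) (simp add: in_keys_iff)
  hence "mev (%_. 0 :: 'k) n = 0" unfolding mev_def using i by (intro prod_zero) auto
  with False show ?thesis by simp
 qed simp
 have "ev (%x. x) (%_. 0) F = (SUM n:insert 0 (kys F). lk F n * mev (%_. 0) n)" by (rule ev_superset) auto
 also have "... = lk F 0" unfolding z by (simp add: if_distrib[of "%x. _ * x"] sum.delta cong: if_cong)
 finally show ?thesis .
qed

lemma cst_homg: "F : homg tot e ==> e > 0 ==> cst F = 0" by (simp add: cst_lookup homg_iff)

lemma hcomp_0_0: fixes F :: "('n + 'n, 'k::comm_ring_1) mpoly" shows "hcomp xw 0 (hcomp tw 0 F) = Const (cst F)" proof (rule pm_eqI)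
 fix n :: "'n + 'n \<Rightarrow>\<^sub>0 nat"
 have "n = 0" if "wdeg xw n = 0" "wdeg tw n = 0" proof (rule pm_eqI)
  fix i
  have "ALL i:kys n. xw i * lk n i = 0" "ALL i:kys n. tw i * lk n i = 0" using that unfolding wdeg_def by (simp_all only: sum_eq_0_iff finite_keys)
  hence "xw i * lk n i = 0" "tw i * lk n i = 0" by (cases "i : kys n", simp, simp add: in_keys_iff)+
  thus "lk n i = lk 0 i" by (cases i) simp_all
 qed
 thus "lk (hcomp xw 0 (hcomp tw 0 F)) n = lk (Const (cst F)) n" by (auto simp: lookup_hcomp cst_lookup Const_def lookup_single when_def)
qed

text \<open>Under a Kronecker substitution a unit becomes a constant, which is found by evaluating
  at 1; the substitution is chosen so as not to kill F minus this constant unless that difference is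
  zero.\<close>

lemma unit_const: fixes F :: "('v, 'k::field) mpoly" assumes "F * G = 1" obtains c where "c ~= 0" "F = Const c" proof -
 define c where "c = ev (%x. x) (%_. 1) F"
 obtain w where w: "F - Const c ~= 0 --> ev (%c. [:c:]) (%i. Polynomial.monom 1 (w i)) (F - Const c) ~= (0 :: 'k poly)"
  using kronecker[of "{F - Const c}"] by auto
 let ?e = "ev (%c. [:c:]) (%i. Polynomial.monom 1 (w i)) :: ('v, 'k) mpoly => 'k poly"
 have h0: "rhom (%c :: 'k. [:c:])" by (auto simp: rhom_def one_pCons)
 note h = rhom_ev[OF h0]
 have "?e F * ?e G = 1" using arg_cong[OF assms, of ?e] by (simp add: rhom_simps[OF h])
 hence "?e F dvd 1" by (metis dvdI)
 then obtain a where a: "?e F = [:a:]" by (auto simp: is_unit_poly_iff)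
 have "poly (?e F) 1 = ev (%c. poly [:c:] 1) (%i. poly (Polynomial.monom 1 (w i)) 1) F" by (rule ev_comp[OF _ h0]) (simp add: rhom_def)
 hence "a = c" by (simp add: a c_def poly_monom)
 hence "?e (F - Const c) = 0" by (simp add: rhom_simps[OF h] a ev_Const[OF h0])
 hence "F = Const c" using w by auto
 moreover have "F ~= 0" using assms by auto
 ultimately show ?thesis using that by (metis Const_eq_0)
qed

lemma inj_permutes: "inj (p :: 'n::finite => 'n) ==> p permutes UNIV" by (rule bij_imp_permutes) (simp_all add: bij_betw_def finite_UNIV_inj_surj)

section \<open>Constant column relations and maximal minors\<close>

context linear_alternating
begin

text \<open>By alternation a constant relation among the columns pairs to zero with the image of
  \<phi>, that is, with all syzygies of a. The Koszul syzygies then make a_j a scalar multiple of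
  a_p. This is a syzygy with an entry 1, although the entries of \<phi> come from forms of degree
  1.\<close>

lemma columns_independent_mod_f: assumes c: "!!i. (SUM j:UNIV. Const (c j)*\<psi> $ i $ j) : igen {f}" shows "c p = 0" proof (rule ccontr)
 assume cp: "c p ~= 0"
 define c' where "c' = (%j. \<pi> (Const (c j)))"
 have 0: "(SUM j:UNIV. c' j * \<phi> $ i $ j) = 0" for i using c[of i] unfolding ker[symmetric] by (simp add: rhom_simps[OF \<pi>(1)] \<phi> c'_def)
 have alt\<phi>: "\<phi> $ i $ j = - (\<phi> $ j $ i)" for i j
  using arg_cong[OF alt(1)[of i j], of \<pi>] by (simp add: rhom_simps[OF \<pi>(1)] \<phi>)
 have im: "(SUM i:UNIV. c' i*(\<phi> *v w) $ i) = 0" for w proof -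
  have "(SUM i:UNIV. c' i*(\<phi> *v w) $ i) = (SUM t:UNIV. w $ t*(SUM i:UNIV. c' i * \<phi> $ i $ t))"
   by (simp add: matrix_vector_mult_def sum_distrib_left mult_ac) (rule sum.swap)
  moreover have "(SUM i:UNIV. c' i * \<phi> $ i $ t) = - (SUM i:UNIV. c' i * \<phi> $ t $ i)" for t
   unfolding sum_negf[symmetric] by (intro sum.cong refl) (subst alt\<phi>, simp)
  ultimately show ?thesis by (simp add: 0)
 qed
 have par: "c' j * a $ i = c' i * a $ j" for i j proof -
  let ?v = "\<chi> s. (if s = j then a $ i else 0) - (if s = i then a $ j else 0)"
  have "(SUM s:UNIV. a $ s * ?v $ s) = 0" by (simp only: vec_lambda_beta right_diff_distrib sum_subtractf delta_sum) (simp add: mult.commute)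
  then obtain w where w: "?v = \<phi> *v w" unfolding relations by blast
  have "(SUM s:UNIV. c' s * ?v $ s) = 0" unfolding w by (rule im)
  thus ?thesis by (simp only: vec_lambda_beta right_diff_distrib sum_subtractf delta_sum) simp
 qed
 obtain j where j: "j ~= p" using other_index ..
 define b where "b = \<pi> (Const (inverse (c p)))"
 have "b * c' p = \<pi> (Const (inverse (c p)*c p))" by (simp add: b_def c'_def Const_simps rhom_mult[OF \<pi>(1)])
 hence bc: "b * c' p = 1" using cp by (simp add: Const_simps rhom_1[OF \<pi>(1)])
 let ?v = "\<chi> s. (if s = j then 1 else 0) - (if s = p then b * c' j else 0)"
 have "(SUM s:UNIV. a $ s * ?v $ s) = a $ j - b*(c' j * a $ p)"
  by (simp only: vec_lambda_beta right_diff_distrib sum_subtractf delta_sum) (simp add: mult_ac)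
 also have "... = a $ j - (b*c' p)*a $ j" unfolding par[of j p] by (simp only: mult.assoc)
 also have "... = 0" by (simp add: bc)
 finally obtain w where w: "?v = \<phi> *v w" unfolding relations by blast
 have "1 = (\<phi> *v w) $ j" unfolding w[symmetric] using j by simp
 also have "... = \<pi> (SUM t:UNIV. \<psi> $ j $ t * lift (w $ t))" by (simp add: matrix_vector_mult_def rhom_simps[OF \<pi>(1)] \<phi> lift)
 finally have "\<pi> (1 - (SUM t:UNIV. \<psi> $ j $ t * lift (w $ t))) = 0" by (simp add: rhom_simps[OF \<pi>(1)])
 then obtain r where r: "1 - (SUM t:UNIV. \<psi> $ j $ t * lift (w $ t)) = r*f" unfolding ker f_dvd by blast
 have "cst f = 0" using cst_homg[OF f(2)] m by simp
 moreover have "cst (\<psi> $ j $ t) = 0" for t using cst_homg[OF lin] by simp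
 ultimately have "(1 :: 'k) = 0" using arg_cong[OF r, of cst] by (simp add: rhom_simps[OF rhom_ev[OF rhom_id]])
 thus False by simp
qed

lemma det_W_rows: assumes p: "p permutes (UNIV :: 'n set)" shows "det (\<chi> j. W $ p j) = 0" proof -
 fix r :: 'n
 have "Var (p r)*det (\<chi> j. W $ p j) = (SUM k:UNIV. (SUM j:UNIV. Var (p j)*W $ p j $ k)*det (rowrep (\<chi> j. W $ p j) r (axis k 1)))"
  using cramer_row[of "%j. Var (p j)" r "\<chi> j. W $ p j"] by simp
 moreover have "(SUM j:UNIV. Var (p j)*W $ p j $ k) = (SUM j:UNIV. Var j * W $ j $ k)" for k
  using sum.permute[OF p, of "%j. Var j * W $ j $ k"] by (simp add: o_def)
 ultimately have "Var (p r)^1*det (\<chi> j. W $ p j) = 0" by (simp add: T_W)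
 thus ?thesis by (rule Var_power_cancel)
qed

definition Wt :: "('n + 'n, 'k) mpoly ^ 'n ^ 'n" where
 "Wt = (\<chi> s j. tP (W $ j $ s))"

text \<open>Without the column D the minor is det W up to sign, which is zero. Otherwise one column
  j0 of W is omitted, and expansion along D produces the cofactors T_{j0} h_s.\<close>

lemma minor_value: fixes D :: "('n + 'n, 'k) mpoly ^ 'n" and b :: "'n => 'n option" assumes b: "inj b"
 shows "EX u j. (u = 0 \<or> u = 1 \<or> u = - 1) & det (\<chi> s i. augment Wt D $ s $ b i) = u*(tv j*(SUM s:UNIV. D $ s * tP (h s)))" proof -
 let ?A = "\<chi> s i. augment Wt D $ s $ b i"
 have tr: "det ?A = det (\<chi> i s. augment Wt D $ s $ b i)" using det_transpose[of ?A] by (simp add: transpose_def)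
 show ?thesis proof (cases "None : range b")
  case False
  define p where "p = (%i. the (b i))"
  have bp: "b i = Some (p i)" for i unfolding p_def using False by (metis option.exhaust_sel rangeI)
  have "inj p" using b unfolding inj_def bp by simp
  hence p: "p permutes UNIV" by (rule inj_permutes)
  have "(\<chi> i s. augment Wt D $ s $ b i) = (\<chi> i j. tP ((\<chi> j. W $ p j) $ i $ j))" by (simp add: vec_eq_iff augment_def bp Wt_def)
  hence "det ?A = 0" unfolding tr by (simp only: rhom_det[OF rhom_tP, symmetric] det_W_rows[OF p] rhom_0[OF rhom_tP])
  thus ?thesis by (intro exI[of _ 0]) simp
 next
  case True
  then obtain i1 where i1: "b i1 = None" by (metis imageE)
  have "~ surj b" proof
   assume "surj b"
   hence "CARD('n option) <= CARD('n)" by (metis card_image_le finite)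
   thus False by simp
  qed
  then obtain y where y: "y ~: range b" by blast
  with True obtain j0 where j0: "Some j0 ~: range b" by (cases y) auto
  \<comment> \<open>p puts the omitted index j0 in the place of the column D and thus becomes a
    permutation.\<close>
  define p where "p = (%i. case b i of None => j0 | Some x => x)"
  have "inj p" proof (rule injI)
   fix x y assume "p x = p y"
   hence "b x = b y" unfolding p_def using j0 by (auto split: option.splits) (metis rangeI)+
   thus "x = y" using b by (rule injD[rotated])
  qed
  hence p: "p permutes UNIV" by (rule inj_permutes)
  have p1: "p i = j0 \<longleftrightarrow> i = i1" for i using i1 `inj p` by (auto simp: p_def inj_def)
  have bp: "b i = (if i = i1 then None else Some (p i))" for i using i1 b by (cases "b i") (auto simp: p_def inj_def)
  let ?W = "\<chi> i j. tP (W $ i $ j)"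
  have "(\<chi> i s. augment Wt D $ s $ b i) = (\<chi> i. rowrep ?W j0 D $ p i)" by (auto simp: vec_eq_iff augment_def bp Wt_def p1)
  hence "det ?A = of_int (sign p)*det (rowrep ?W j0 D)" unfolding tr using det_permute_rows[OF p, of "rowrep ?W j0 D"] by simp
  also have "det (rowrep ?W j0 D) = (SUM s:UNIV. D $ s * det (rowrep ?W j0 (axis s 1)))" by (rule det_row_expand)
  also have "... = (SUM s:UNIV. D $ s*(tv j0 * tP (h s)))" proof (intro sum.cong refl arg_cong2[of _ _ _ _ "(*)"])
   fix s
   have "rowrep ?W j0 (axis s 1) = (\<chi> i j. tP (rowrep W j0 (axis s 1) $ i $ j))"
    by (auto simp: vec_eq_iff axis_def rhom_0[OF rhom_tP] rhom_1[OF rhom_tP])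
   thus "det (rowrep ?W j0 (axis s 1)) = tv j0 * tP (h s)" by (simp only: rhom_det[OF rhom_tP, symmetric] cofactor_h rhom_mult[OF rhom_tP] xP_simps)
  qed
  also have "... = tv j0*(SUM s:UNIV. D $ s * tP (h s))" by (simp add: sum_distrib_left mult_ac)
  finally show ?thesis by (intro exI[of _ "of_int (sign p)"] exI[of _ j0]) (auto simp: sign_def)
 qed
qed

text \<open>That every T_j occurs is what determines the gcd in \<open>gcd_minors\<close>.\<close>

lemma minor_attained: fixes D :: "('n + 'n, 'k) mpoly ^ 'n" shows "tv j*(SUM s:UNIV. D $ s * tP (h s)) : max_minors (augment Wt D)" proof -
 let ?b = "%i. if i = j then None else Some i"
 let ?A = "\<chi> s i. augment Wt D $ s $ ?b i"
 let ?W = "\<chi> i j. tP (W $ i $ j)"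
 have "det ?A = det (transpose ?A)" by simp
 also have "transpose ?A = rowrep ?W j D" by (auto simp: vec_eq_iff augment_def Wt_def transpose_def)
 also have "det (rowrep ?W j D) = (SUM s:UNIV. D $ s * det (rowrep ?W j (axis s 1)))" by (rule det_row_expand)
 also have "... = (SUM s:UNIV. D $ s*(tv j * tP (h s)))" proof (intro sum.cong refl arg_cong2[of _ _ _ _ "(*)"])
  fix s
  have "rowrep ?W j (axis s 1) = (\<chi> i k. tP (rowrep W j (axis s 1) $ i $ k))"
   by (auto simp: vec_eq_iff axis_def rhom_0[OF rhom_tP] rhom_1[OF rhom_tP])
  thus "det (rowrep ?W j (axis s 1)) = tv j * tP (h s)" by (simp only: rhom_det[OF rhom_tP, symmetric] cofactor_h rhom_mult[OF rhom_tP] xP_simps)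
 qed
 also have "... = tv j*(SUM s:UNIV. D $ s * tP (h s))" by (simp add: sum_distrib_left mult_ac)
 finally have "tv j*(SUM s:UNIV. D $ s * tP (h s)) = det ?A" by simp
 moreover have "inj ?b" by (auto simp: inj_def split: if_splits)
 ultimately show ?thesis unfolding max_minors_def by (intro CollectI exI[of _ ?b] conjI)
qed

text \<open>The sum G divides all minors, hence g = G w; since g divides every T_j G, the factor w
  divides two distinct variables and is a unit.\<close>

lemma gcd_minors: fixes D :: "('n + 'n, 'k) mpoly ^ 'n" assumes g: "is_gcd (max_minors (augment Wt D)) g" and nz: "(SUM s:UNIV. D $ s * tP (h s)) ~= 0"
 shows "EX c. c ~= 0 & g = Const c*(SUM s:UNIV. D $ s * tP (h s))" proof -
 define G where "G = (SUM s:UNIV. D $ s * tP (h s))"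
 have "G dvd z" if z: "z : max_minors (augment Wt D)" for z proof -
  obtain b :: "'n => 'n option" where "inj b" "z = det (\<chi> s i. augment Wt D $ s $ b i)" using z unfolding max_minors_def by blast
  thus ?thesis using minor_value[of b D] unfolding G_def[symmetric] by auto
 qed
 hence "G dvd g" using g unfolding is_gcd_def by blast
 then obtain w where w: "g = G*w" by (auto simp: dvd_def)
 have "w dvd tv j" for j proof -
  have "g dvd tv j * G" using g minor_attained[of j D] unfolding is_gcd_def G_def by blast
  then obtain v where "tv j * G = G*w * v" unfolding w by (auto simp: dvd_def)
  hence "G * tv j = G*(w * v)" by (simp only: mult_ac)
  hence "tv j = w * v" using mpoly_mult_cancel nz unfolding G_def by blast
  thus ?thesis by simp
 qed
 hence "ALL j. EX v. tv j = w * v" by (auto simp: dvd_def)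
 then obtain v where v: "!!j. tv j = w * v j" by metis
 obtain p q :: 'n where pq: "p ~= q" using other_index by metis
 have w0: "w ~= 0" using v[of p] Var_power_cancel[of "Inr p" 1 "1 :: ('n + 'n, 'k) mpoly"] by auto
 have "w*(tv p * v q) = tv p*(w * v q)" "w*(tv q * v p) = tv q*(w * v p)" by (simp_all only: mult_ac)
 hence "w*(tv p * v q) = w*(tv q * v p)" unfolding v[symmetric] by (simp only: mult.commute)
 hence "tv p^1 * v q = tv q^1 * v p" using mpoly_mult_cancel w0 by simp blast
 then obtain H where "v p = tv p * H" using Var_coprime[of "Inr p" "Inr q" 1] pq by auto
 hence "tv p^1*(1 - w*H) = 0" using v[of p] by (simp add: algebra_simps)
 hence "1 - w*H = 0" by (rule Var_power_cancel)
 hence "w * H = 1" by simp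
 then obtain c where "c ~= 0" "w = Const c" by (rule unit_const)
 thus ?thesis unfolding w G_def by (intro exI[of _ c]) (simp add: mult.commute)
qed

end

section \<open>Syzygies of the generators\<close>

context gorenstein_chain
begin

definition gen :: "'n + nat => ('n + 'n, 'k) mpoly" where "gen = case_sum l g"
definition IX :: "('n + nat) set" where "IX = range Inl Un Inr ` {..m}"

lemma finite_IX: "finite IX" and card_IX: "card IX = d + m + 2" proof -
 show "finite IX" by (simp add: IX_def)
 have "card IX = card (range Inl :: ('n + nat) set) + card (Inr ` {..m} :: ('n + nat) set)" unfolding IX_def by (intro card_Un_disjoint) auto
 thus "card IX = d + m + 2" by (simp add: card_image card)
qed

lemma gen_GG: "igen (gen ` IX) = GG" proof -
 have "gen ` IX = range l Un g ` {..m}" by (simp add: gen_def IX_def image_Un image_image)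
 thus ?thesis by (simp add: GG_def)
qed

lemma sum_IX: "(SUM k:IX. q k * gen k) = (SUM j:UNIV. q (Inl j)*l j) + (SUM i<=m. q (Inr i)*g i)" unfolding IX_def
 by (subst sum.union_disjoint) (auto simp: sum.reindex gen_def)

lemma hcomp2_mult: assumes "u : homg xw i" "u : homg tw j"
 shows "hcomp xw e (hcomp tw b (u*F)) = (if i <= e & j <= b then u * hcomp xw (e - i) (hcomp tw (b - j) F) else 0)"
 by (cases "j <= b") (simp_all only: hcomp_mult_homg[OF assms(1)] hcomp_mult_homg[OF assms(2)] if_True if_False hcomp_0 simp_thms)

text \<open>In the bidegree of g_i no other g contributes, and substituting h kills the l_j but not
  g_i. In bidegree (1, 1) the g_i with i > 0 are absent because their T-degree exceeds 1, and a
  relation among the l_j modulo f remains, to which \<open>columns_independent_mod_f\<close>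
  applies.\<close>

lemma syzygy_constants: assumes q: "(SUM k:IX. q k * gen k) = 0" and k: "k : IX" shows "cst (q k) = 0" proof -
 let ?b = "%e b F. hcomp xw e (hcomp tw b F)"
 have rel: "(SUM j:UNIV. ?b e b (l j * q (Inl j))) + (SUM i<=m. ?b e b (g i * q (Inr i))) = 0" for e b
  using arg_cong[OF q[unfolded sum_IX], of "?b e b"] by (simp add: hcomp_add hcomp_sum mult.commute)
 have gm: "?b e b (g i * F) = (if m - i <= e & i*(d - 1) <= b then g i * ?b (e - (m - i)) (b - i*(d - 1)) F else 0)"
  if "i <= m" for i e b F by (rule hcomp2_mult[OF g_homg[OF that]])
 have lm: "?b e b (l j * F) = (if 1 <= e & 1 <= b then l j * ?b (e - 1) (b - 1) F else 0)" for e b j F by (rule hcomp2_mult[OF l_homg(2,3)])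
 have g: "cst (q (Inr i)) = 0" if i: "i <= m" for i proof -
  have "(SUM i'<=m. ?b (m - i) (i*(d - 1)) (g i' * q (Inr i'))) = (SUM i'<=m. if i' = i then g i * Const (cst (q (Inr i))) else 0)"
  proof (intro sum.cong refl)
   fix i' assume "i' : {..m}"
   hence "i' <= m" by simp
   have eq: "m - i' <= m - i & i'*(d - 1) <= i*(d - 1) \<longleftrightarrow> i' = i" using i `i' <= m` d_ge_2 by auto
   thus "?b (m - i) (i*(d - 1)) (g i' * q (Inr i')) = (if i' = i then g i * Const (cst (q (Inr i))) else 0)"
    unfolding gm[OF `i' <= m`] eq by (auto simp only: hcomp_0_0 diff_self_eq_0 split: if_split)
  qed
  also have "... = g i * Const (cst (q (Inr i)))" using i by simp
  finally have e: "(SUM i'<=m. ?b (m - i) (i*(d - 1)) (g i' * q (Inr i'))) = g i * Const (cst (q (Inr i)))" .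
  have A: "(SUM j:UNIV. ?b (m - i) (i*(d - 1)) (l j * q (Inl j))) + g i * Const (cst (q (Inr i))) = 0" using rel[of "m - i" "i*(d - 1)"] unfolding e .
  have B: "(SUM j:UNIV. ?b (m - i) (i*(d - 1)) (l j * q (Inl j))) : Ll" proof (rule ideal_sum[OF isideal_igen])
   fix j
   have "l j * F : Ll" for F by (rule ideal_mult_r[OF isideal_igen igen_base]) simp
   thus "?b (m - i) (i*(d - 1)) (l j * q (Inl j)) : Ll" unfolding lm using ideal_0[OF isideal_igen, of "range l"] by (simp split: if_split)
  qed
  from evT_h_Ll[OF B] arg_cong[OF A, of "evT h"] have "evT h (g i * Const (cst (q (Inr i)))) = 0" by (simp only: evT_simps(1) ev_0 add_0)
  moreover obtain b where "b ~= 0" "evT h (g i) = Const b * ev Const h f" using g_value[OF i] by blast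
  ultimately have "Const b * ev Const h f * Const (cst (q (Inr i))) = 0" by (simp add: evT_simps ev_Const rhom_Const)
  thus ?thesis using mpoly_mult_eq_0 f_h `b ~= 0` Const_eq_0 by metis
 qed
 have l: "cst (q (Inl p)) = 0" for p proof (rule columns_independent_mod_f)
  fix i
  have "?b 1 1 (g i' * q (Inr i')) : igen {xP f}" if i': "i' <= m" for i' proof (cases "i' = 0")
   case True
   hence "?b 1 1 (g i' * q (Inr i')) = (if m - i' <= 1 & i'*(d - 1) <= 1 then xP f * ?b (1 - (m - i')) (1 - i'*(d - 1)) (q (Inr i')) else 0)"
    unfolding gm[OF i'] g0[symmetric] by simp
   moreover have "xP f * F : igen {xP f}" for F by (rule ideal_mult_r[OF isideal_igen igen_base]) simp
   ultimately show ?thesis using ideal_0[OF isideal_igen, of "{xP f}"] by (simp split: if_split)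
  next
   case False
   hence "1 < i'*(d - 1)" using d_ge_3 by (cases i') auto
   thus ?thesis unfolding gm[OF i'] by (simp add: ideal_0[OF isideal_igen])
  qed
  hence "(SUM i<=m. ?b 1 1 (g i * q (Inr i))) : igen {xP f}" by (intro ideal_sum isideal_igen) simp
  then obtain P where P: "(SUM i<=m. ?b 1 1 (g i * q (Inr i))) = P*xP f" by (auto simp: idl.span_singleton)
  have "(SUM j:UNIV. l j * Const (cst (q (Inl j)))) + P*xP f = 0"
   using rel[of 1 1] unfolding P lm by (simp only: le_refl simp_thms if_True diff_self_eq_0 hcomp_0_0)
  from arg_cong[OF this, of "evS (%s. if s = i then 1 else 0)"]
  have "(SUM j:UNIV. Const (cst (q (Inl j)))*\<psi> $ i $ j) + evS (%s. if s = i then 1 else 0) P * f = 0"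
   by (simp add: ev_add ev_sum ev_mult rhom_Const ev_Const ev_0 evS_l delta_sum transpose_def mult.commute)
  hence "(SUM j:UNIV. Const (cst (q (Inl j)))*\<psi> $ i $ j) = (- evS (%s. if s = i then 1 else 0) P)*f" by (simp add: eq_neg_iff_add_eq_0)
  thus "(SUM j:UNIV. Const (cst (q (Inl j)))*\<psi> $ i $ j) : igen {f}" unfolding f_dvd by blast
 qed
 show ?thesis using k g l unfolding IX_def by auto
qed

text \<open>Express Z by the generators and the generators by Z: the composite differs from the
  identity by syzygies, so the constant coefficients satisfy the hypothesis of
  \<open>matrix_bound\<close>. The bound covers all finite generating sets, homogeneous or
  not.\<close>

lemma generators_bound: assumes Z: "finite Z" "igen Z = GG" shows "d + m + 2 <= card Z" proof -
 have "ALL z:Z. EX A. z = (SUM k:IX. A k * gen k)" using igen_base[of _ Z] unfolding Z(2) gen_GG[symmetric] igen_image[OF finite_IX] by blast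
 from bchoice[OF this] obtain A where A: "!!z. z : Z ==> z = (SUM k:IX. A z k * gen k)" by blast
 have "gen k : igen ((%z. z) ` Z)" if "k : IX" for k using that igen_base[of "gen k" "gen ` IX"] unfolding gen_GG by (simp add: Z(2))
 hence "ALL k:IX. EX B. gen k = (SUM z:Z. B z * z)" unfolding igen_image[OF Z(1)] by blast
 from bchoice[OF this] obtain B where B: "!!k. k : IX ==> gen k = (SUM z:Z. B k z * z)" by blast
 have "(SUM z:Z. cst (B j z)*cst (A z k)) = (if j = k then 1 else 0)" if jk: "j : IX" "k : IX" for j k proof -
  define q where "q = (%k. (SUM z:Z. B j z * A z k) - (if j = k then 1 else 0))"
  have "gen j = (SUM z:Z. B j z * z)" by (rule B[OF jk(1)])
  also have "... = (SUM z:Z. B j z*(SUM k:IX. A z k * gen k))" proof (rule sum.cong[OF refl])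
   fix z assume "z : Z"
   from arg_cong[OF A[OF this], of "(*) (B j z)"] show "B j z * z = B j z*(SUM k:IX. A z k * gen k)" .
  qed
  also have "... = (SUM k:IX. (SUM z:Z. B j z * A z k)*gen k)" by (simp add: sum_distrib_left sum_distrib_right mult.assoc) (rule sum.swap)
  finally have e: "(SUM k:IX. (SUM z:Z. B j z * A z k)*gen k) = gen j" ..
  have "(SUM k:IX. (if j = k then 1 else 0)*gen k) = gen j" using jk(1) finite_IX by (simp add: if_distrib[of "%x. x * _"] cong: if_cong)
  hence "(SUM k:IX. q k * gen k) = 0" unfolding q_def left_diff_distrib sum_subtractf e by simp
  from syzygy_constants[OF this jk(2)] show ?thesis by (simp add: q_def rhom_simps[OF rhom_ev[OF rhom_id]] split: if_splits)
 qed
 from matrix_bound[OF finite_IX Z(1) this] show ?thesis unfolding card_IX .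
qed

end

section \<open>Nested polynomial rings and ideals as sets\<close>

lemma forms_homg: "forms b = homg tot b" proof -
 have "mon_degree n = wdeg tot n" for n :: "'a \<Rightarrow>\<^sub>0 nat" unfolding mon_degree_def by (subst wdeg_superset[of UNIV]) auto
 thus ?thesis by (auto simp: forms_over_def homg_def)
qed

lemma forms_over_iff: "F : forms_over C b \<longleftrightarrow> F : homg tot b & (ALL n. lk F n ~= 0 --> lk F n : C)"
 unfolding forms_homg[symmetric] by (auto simp: forms_over_def in_keys_iff)

lemma set_add_igen: "igen A <+>\<^bsub>rng\<^esub> PIdl\<^bsub>rng\<^esub> x = igen (insert x A)" proof -
 interpret cring "rng :: 'a ring" by (rule cring_rng)
 have "igen A <+>\<^bsub>rng\<^esub> PIdl\<^bsub>rng\<^esub> x = Idl\<^bsub>rng\<^esub> (igen A Un igen {x})"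
  using union_genideal[of "igen A" "igen {x}"] cgenideal_eq_genideal[of x] by (simp add: ideal_rng_iff Idl_rng)
 also have "... = igen (insert x A)" unfolding Idl_rng proof (rule antisym)
  show "igen (igen A Un igen {x}) <= igen (insert x A)"
   using igen_mono[of A "insert x A"] igen_mono[of "{x}" "insert x A"] by (intro igen_subset isideal_igen) auto
  show "igen (insert x A) <= igen (igen A Un igen {x})" by (rule igen_mono) (auto intro: igen_base)
 qed
 finally show ?thesis .
qed

lemma igen_rhom_image: assumes h: "rhom h" "surj h" shows "h ` igen Z = igen (h ` Z)" proof (rule antisym)
 have "Z <= {x. h x : igen (h ` Z)}" by (auto intro: igen_base)
 hence "igen Z <= {x. h x : igen (h ` Z)}" by (intro igen_subset ideal_vimage h(1) isideal_igen)
 thus "h ` igen Z <= igen (h ` Z)" by blast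
 have "isideal (h ` igen Z)" proof (rule idl.subspaceI)
  show "0 : h ` igen Z" using rhom_0[OF h(1)] idl.span_zero by (metis image_eqI)
  fix x y assume "x : h ` igen Z" "y : h ` igen Z"
  then obtain x' y' where "x = h x'" "y = h y'" "x' : igen Z" "y' : igen Z" by blast
  thus "x + y : h ` igen Z" using rhom_add[OF h(1), of x' y'] idl.span_add by (metis image_eqI)
 next
  fix c x assume "x : h ` igen Z"
  then obtain x' where x: "x = h x'" "x' : igen Z" by blast
  obtain c' where "c = h c'" using h(2) by (metis surjD)
  with x show "c * x : h ` igen Z" using rhom_mult[OF h(1), of c' x'] ideal_mult_l[OF isideal_igen] by (metis image_eqI)
 qed
 thus "igen (h ` Z) <= h ` igen Z" by (intro igen_subset image_mono) (auto intro: igen_base)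
qed

lemma num_gensI: assumes "!!Z. finite Z ==> igen Z = I ==> N <= card Z" and "finite Z" "Z <= H" "igen Z = I" "card Z <= N"
 shows "num_gens rng H I = enat N" proof -
 have "card Z = N" using assms by (simp add: le_antisym)
 show ?thesis unfolding num_gens_def Idl_rng proof (rule antisym)
  show "Inf {enat (card G) |G. finite G & G <= carrier rng Int H & igen G = I} <= enat N" by (rule Inf_lower) (use assms `card Z = N` in auto)
  show "enat N <= Inf {enat (card G) |G. finite G & G <= carrier rng Int H & igen G = I}" by (rule Inf_greatest) (use assms(1) in auto)
 qed
qed

lemma minimal_generatorsI: assumes "!!Z. finite Z ==> igen Z = I ==> N <= card Z" and Z: "finite Z" "igen Z = I" "card Z <= N"
 shows "minimal_generating_set rng I Z" unfolding minimal_generating_set_def Idl_rng proof (intro conjI allI impI Z(2))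
 fix Y assume Y: "Y \<subset> Z"
 hence "card Y < N" using psubset_card_mono[OF Z(1) Y] Z(3) by simp
 moreover have "finite Y" using Y Z(1) finite_subset by blast
 ultimately show "igen Y ~= I" using assms(1)[of Y] by auto
qed simp

text \<open>\<open>nest\<close> and \<open>flat\<close> are mutually inverse isomorphisms between
  k[x, T] and S[T].\<close>

definition nest :: "('n + 'n, 'k::comm_ring_1) mpoly => ('n, ('n, 'k) mpoly) mpoly" where
 "nest = ev (%c. Const (Const c)) (case_sum (%i. Const (Var i)) Var)"

definition flat :: "('n, ('n, 'k::comm_ring_1) mpoly) mpoly => ('n + 'n, 'k) mpoly" where
 "flat = ev xP (%i. tv i)"

lemma rhom_nest: "rhom nest" and rhom_flat: "rhom flat" unfolding nest_def flat_def by (intro rhom_ev rhom_comp[OF rhom_Const rhom_Const] rhom_xP)+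

lemma nest_simps: "nest (Const c) = Const (Const c)" "nest (xv i) = Const (Var i)" "nest (tv i) = Var i"
 and flat_simps: "flat (Const F) = xP F" "flat (Var i) = tv i"
 by (simp_all add: nest_def flat_def ev_Const ev_Var rhom_comp[OF rhom_Const rhom_Const] rhom_xP)

lemma nest_xP: "nest (xP F) = Const F" by (rule rhom_ext[of "%F. nest (xP F)" Const])
  (simp_all add: rhom_comp[OF rhom_nest rhom_xP] rhom_Const xP_simps nest_simps)

lemma flat_nest [simp]: "flat (nest F) = F" proof (rule rhom_ext[of "%F. flat (nest F)" "%F. F"])
 show "flat (nest (Var i)) = Var i" for i :: "'a + 'a" by (cases i) (simp_all add: nest_simps flat_simps xP_simps)
qed (simp_all add: rhom_comp[OF rhom_flat rhom_nest] rhom_id nest_simps flat_simps xP_simps)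

lemma nest_flat [simp]: "nest (flat F) = F" by (rule rhom_ext[of "%F. nest (flat F)" "%F. F"])
  (simp_all add: rhom_comp[OF rhom_nest rhom_flat] rhom_id nest_simps flat_simps nest_xP)

lemma surj_flat: "surj flat" by (rule surjI[of flat nest]) (rule flat_nest)

lemma inj_flat: "inj flat" by (rule inj_on_inverseI[of _ nest]) simp

lemma mem_igen_flat: "x : igen Z \<longleftrightarrow> flat x : igen (flat ` Z)"
 unfolding igen_rhom_image[OF rhom_flat surj_flat, symmetric] by (rule inj_image_mem_iff[OF inj_flat, symmetric])

lemma flat_biforms: assumes "F : biforms i b" shows "flat F : homg xw i" "flat F : homg tw b" proof -
 have F: "F : homg tot b" "!!n. lk F n : homg tot i" using assms unfolding forms_over_iff[of F] forms_homg by (auto, metis homg_0)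
 have m: "mev (%i. tv i) n = tP (mev Var n)" for n :: "'a \<Rightarrow>\<^sub>0 nat" by (simp add: mev_def rhom_prod[OF rhom_tP] rhom_power[OF rhom_tP] xP_simps)
 have v: "mev Var n : homg tot b" if "n : kys F" for n :: "'a \<Rightarrow>\<^sub>0 nat" proof -
  have w: "wdeg tot n = b" using F(1) that unfolding homg_def by blast
  from homg_single[of n 1 tot] show ?thesis unfolding single_eq_prod w by (simp add: Const_simps)
 qed
 have "xP (lk F n)*mev (%i. tv i) n : homg xw (i + 0)" for n unfolding m by (intro homg_mult xP_homg tP_homg F)
 thus "flat F : homg xw i" unfolding flat_def ev_def by (intro homg_sum) simp
 have "xP (lk F n)*mev (%i. tv i) n : homg tw (0 + b)" if "n : kys F" for n unfolding m by (intro homg_mult xP_homg tP_homg v that)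
 thus "flat F : homg tw b" unfolding flat_def ev_def by (intro homg_sum) simp
qed

lemma forms_over_closed: assumes C: "0 : C" "!!x y. x : C ==> y : C ==> x + y : C"
 shows "(!!j. j : J ==> F j : forms_over C b) ==> sum F J : forms_over C b" proof (induction J rule: infinite_finite_induct)
 case (insert j J)
 have s: "lk F n : C" if "F : forms_over C b" for F n using that C(1) unfolding forms_over_iff by (cases "lk F n = 0") auto
 have 1: "F j : forms_over C b" "sum F J : forms_over C b" using insert by auto
 have "F j + sum F J : homg tot b" using 1 unfolding forms_over_iff by (blast intro: homg_add)
 moreover have "lk (F j + sum F J) n : C" for n unfolding lookup_add by (rule C(2)[OF s[OF 1(1)] s[OF 1(2)]])
 ultimately show ?case using insert(1,2) unfolding forms_over_iff by simp
qed (simp_all add: forms_over_iff)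

lemma nest_biforms: fixes F :: "('n::finite + 'n, 'k::comm_ring_1) mpoly" assumes F: "F : homg xw i" "F : homg tw b" shows "nest F : biforms i b" proof -
 have "Const (Const (lk F n))*mev (case_sum (%i. Const (Var i)) Var) n : biforms i b" if n: "n : kys F" for n proof -
  let ?u = "Const (lk F n)*mev (case_sum Var (%_. 1)) n" and ?t = "mev (case_sum (%_. 1) Var) n :: ('n, ('n, 'k) mpoly) mpoly"
  have "(mev (case_sum (%i. Const (Var i)) Var) n :: ('n, ('n, 'k) mpoly) mpoly) = Const (mev (case_sum Var (%_. 1)) n)*mev (case_sum (%_. 1) Var) n"
   unfolding mev_def rhom_prod[OF rhom_Const] prod.distrib[symmetric]
   by (intro prod.cong refl) (auto simp: Const_simps power_mult_distrib split: sum.split)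
  hence e: "Const (Const (lk F n))*mev (case_sum (%i. Const (Var i)) Var) n = Const ?u * ?t" by (simp only: rhom_mult[OF rhom_Const] mult.assoc)
  have w: "wdeg xw n = i" "wdeg tw n = b" using F n by (auto simp: homg_def)
  hence w': "(SUM v:kys n. lk n v * xw v) = i" "(SUM v:kys n. lk n v * tw v) = b" unfolding wdeg_def by (simp_all only: mult.commute)
  have "mev (case_sum Var (%_. 1)) n : homg tot (SUM v:kys n. lk n v * xw v)"
   unfolding mev_def by (intro homg_prod finite_keys homg_power) (auto split: sum.split intro: homg_Var[of _ tot, simplified] homg_1)
  hence u: "?u : homg tot i" unfolding w' by (rule homg_Const_mult)
  have t: "?t : homg tot (SUM v:kys n. lk n v * tw v)"
   unfolding mev_def by (intro homg_prod finite_keys homg_power) (auto split: sum.split intro: homg_Var[of _ tot, simplified] homg_1)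
  hence t: "?t : homg tot b" unfolding w' .
  \<comment> \<open>The T-part of a monomial is a monomial with coefficient 1, so the product has
    the single coefficient ?u.\<close>
  have c: "EX n'. lk ?t n'' = (if n'' = n' then 1 else 0)" for n'' proof -
   have "EX n'. (PROD v:K. case_sum (%_. 1) Var v^lk n v) = sgl n' (1 :: ('n, 'k) mpoly)" if "finite K" for K using that
   proof (induction K rule: finite_induct)
    case (insert v K)
    then obtain n' where n': "(PROD v:K. case_sum (%_. 1) Var v^lk n v) = sgl n' (1 :: ('n, 'k) mpoly)" by blast
    show ?case proof (cases v)
     case (Inl i) thus ?thesis using insert(1,2) n' by auto
    next
     case (Inr i)
     hence "(PROD v:insert v K. case_sum (%_. 1) Var v^lk n v) = sgl (sgl i (lk n v) + n') (1 :: ('n, 'k) mpoly)"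
      using insert(1,2) n' by (simp add: power_Var mult_single)
     thus ?thesis by blast
    qed
   qed (auto intro!: exI[of _ 0])
   from this[of "kys n"] obtain n' where "?t = sgl n' 1" unfolding mev_def by auto
   hence "lk ?t n'' = (if n'' = n' then 1 else 0)" by (simp add: lookup_single when_def)
   thus ?thesis by (rule exI)
  qed
  have "Const ?u * ?t : homg tot b" using t by (rule homg_Const_mult)
  moreover have "lk (Const ?u * ?t) n'' : homg tot i" for n'' using c[of n''] u unfolding lookup_Const_mult by auto
  ultimately show ?thesis unfolding e forms_over_iff[of "Const ?u * ?t"] forms_homg by blast
 qed
 thus ?thesis unfolding nest_def ev_def by (intro forms_over_closed) (simp_all add: forms_homg homg_add)
qed

lemma flat_det: "flat (det A) = det (\<chi> i j. flat (A $ i $ j))" by (rule rhom_det[OF rhom_flat])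

lemma flat_max_minors: "flat ` max_minors A = max_minors (\<chi> i j. flat (A $ i $ j))"
 unfolding max_minors_def by (auto simp: flat_det intro!: image_eqI)

lemma flat_dvd: "flat x dvd flat y \<longleftrightarrow> x dvd y" proof
 assume "flat x dvd flat y"
 then obtain z where "flat y = flat x * z" by (auto simp: dvd_def)
 hence "nest (flat y) = nest (flat x * z)" by simp
 thus "x dvd y" by (simp add: rhom_mult[OF rhom_nest])
qed (auto simp: dvd_def rhom_mult[OF rhom_flat])

lemma flat_is_gcd: assumes "is_gcd A x" shows "is_gcd (flat ` A) (flat x)" unfolding is_gcd_def proof (intro conjI allI impI ballI)
 show "flat x dvd z" if "z : flat ` A" for z using that assms by (auto simp: flat_dvd is_gcd_def)
 fix z assume "ALL y:flat ` A. z dvd y"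
 hence "ALL y:A. flat (nest z) dvd flat y" by simp
 hence "nest z dvd x" using assms unfolding flat_dvd is_gcd_def by blast
 thus "z dvd flat x" unfolding flat_dvd[symmetric] by simp
qed

text \<open>A nonzero element has only one bidegree, so the bidegree hidden in
  \<open>is_partial\<close> is the known one.\<close>

lemma flat_partial: assumes p: "is_partial F D" and nz: "F ~= 0" and F: "flat F : homg xw i" "flat F : homg tw b"
 shows "i > 0 & (ALL r. flat (D $ r) : homg xw (i - 1) & flat (D $ r) : homg tw b) & (SUM r:UNIV. xv r * flat (D $ r)) = flat F" proof -
 obtain a' b' where ab: "F : biforms (Suc a') b'" "!!r. D $ r : biforms a' b'" "(SUM r:UNIV. X_vec $ r * D $ r) = F"
  using p nz unfolding is_partial_def by auto
 have "flat F ~= 0" using nz nest_flat rhom_0[OF rhom_nest] by metis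
 hence "i = Suc a'" "b = b'" using homg_inter_0[OF F(1) flat_biforms(1)[OF ab(1)]] homg_inter_0[OF F(2) flat_biforms(2)[OF ab(1)]] by blast+
 moreover have "(SUM r:UNIV. xv r * flat (D $ r)) = flat F"
  unfolding ab(3)[symmetric] by (simp add: rhom_simps[OF rhom_flat] X_vec_def flat_simps xP_simps)
 ultimately show ?thesis using flat_biforms[OF ab(2)] by simp
qed

text \<open>Substituting unit vectors for x recovers each coefficient; this is the uniqueness of
  B(\<psi>).\<close>

lemma linear_x_unique: assumes u: "!!s. u s : homg xw 0" and z: "(SUM s:UNIV. xv s * u s) = (0 :: ('n::finite + 'n, 'k::field) mpoly)" shows "u s = 0"
proof -
 have e: "tP (evT v (u s)) = u s" for v s proof -
  have "tP (evT v (u s)) = ev Const (%i. tP (case_sum v Var i)) (u s)" by (simp add: ev_comp[OF rhom_tP rhom_Const] xP_simps)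
  also have "... = ev Const Var (u s)" proof (rule ev_cong)
   fix i n assume n: "n : kys (u s)" "i : kys n"
   hence "wdeg xw n = 0" using u[of s] by (auto simp: homg_def)
   hence "ALL i:kys n. xw i * lk n i = 0" unfolding wdeg_def by (simp only: sum_eq_0_iff finite_keys)
   hence "xw i * lk n i = 0" using n(2) by (rule bspec)
   thus "tP (case_sum v Var i) = Var i" using n(2) by (cases i) (auto simp: xP_simps in_keys_iff)
  qed
  finally show ?thesis by simp
 qed
 let ?v = "%i. if i = s then 1 else 0"
 have "evT ?v (SUM s:UNIV. xv s * u s) = (SUM s':UNIV. if s' = s then evT ?v (u s) else 0)"
  unfolding ev_sum[OF rhom_Const] by (intro sum.cong refl) (simp add: ev_mult ev_Var rhom_Const)
 hence "evT ?v (u s) = 0" by (simp add: z ev_0)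
 thus ?thesis using e[of ?v s] rhom_0[OF rhom_tP] by metis
qed

context linear_alternating
begin

lemma flat_l: "flat ((T_vec v* const_mat \<psi>) $ j) = l j"
 by (simp add: vector_matrix_mult_def T_vec_def const_mat_def rhom_simps[OF rhom_flat] flat_simps l_def mult.commute)

lemma flat_jacobian_dual: assumes "is_jacobian_dual \<psi> B" shows "(\<chi> s j. flat (B $ s $ j)) = Wt" proof -
 have B: "B $ s $ j : biforms 0 1" for s j using assms unfolding is_jacobian_dual_def entries_def by blast
 have "(T_vec v* const_mat \<psi>) $ j = (X_vec v* B) $ j" for j using assms unfolding is_jacobian_dual_def by simp
 hence "l j = (SUM s:UNIV. xv s * flat (B $ s $ j))" for j
  unfolding flat_l[symmetric] by (simp add: vector_matrix_mult_def X_vec_def rhom_simps[OF rhom_flat] flat_simps xP_simps mult.commute)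
 hence z: "(SUM s:UNIV. xv s*(flat (B $ s $ j) - tP (W $ j $ s))) = 0" for j using l_W[of j] by (simp add: right_diff_distrib sum_subtractf)
 have "flat (B $ s $ j) - tP (W $ j $ s) = 0" for s j by (rule linear_x_unique[OF _ z]) (intro homg_diff flat_biforms(1)[OF B] tP_homg(3))
 thus ?thesis by (simp add: Wt_def vec_eq_iff)
qed

lemma flat_gcd_step: assumes B: "is_jacobian_dual \<psi> B" and g: "is_gcd (max_minors (augment B D)) x" and nz: "(SUM s:UNIV. flat (D $ s) * tP (h s)) ~= 0"
 shows "EX c. c ~= 0 & flat x = Const c*(SUM s:UNIV. flat (D $ s) * tP (h s))" proof -
 have "(\<chi> i j. flat (augment B D $ i $ j)) = augment Wt (\<chi> i. flat (D $ i))"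
  unfolding flat_jacobian_dual[OF B, symmetric] by (auto simp: augment_def vec_eq_iff split: option.split)
 hence "is_gcd (max_minors (augment Wt (\<chi> i. flat (D $ i)))) (flat x)" using flat_is_gcd[OF g] unfolding flat_max_minors by simp
 from gcd_minors[OF this] nz show ?thesis by simp
qed

end

section \<open>Passage from S[T] to R[T]\<close>

context linear_alternating
begin

definition mp :: "('n, ('n, 'k) mpoly) mpoly => ('n, 'r) mpoly" where
 "mp = ev (%c. Const (\<pi> c)) Var"

definition rho :: "('n + 'n, 'k) mpoly => ('n, 'r) mpoly" where
 "rho F = mp (nest F)"

lemma rhom_mp: "rhom mp" and rhom_rho: "rhom rho" proof -
 show "rhom mp" unfolding mp_def by (intro rhom_ev rhom_comp[OF rhom_Const \<pi>(1)])
 from rhom_comp[OF this rhom_nest] show "rhom rho" by (simp add: rho_def[abs_def])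
qed

lemma mp_simps: "mp (Const c) = Const (\<pi> c)" "mp (Var i) = Var i" by (simp_all add: mp_def ev_Const ev_Var rhom_comp[OF rhom_Const \<pi>(1)])

lemma lookup_mp: "lk (mp F) n = \<pi> (lk F n)" proof -
 have "Const (\<pi> (lk F n'))*mev Var n' = sgl n' (\<pi> (lk F n'))" for n' by (rule single_eq_prod[symmetric])
 hence "lk (mp F) n = (SUM n':kys F. \<pi> (lk F n') when n' = n)" by (simp add: mp_def ev_def lookup_sum lookup_single)
 also have "... = (SUM n':kys F. if n' = n then \<pi> (lk F n) else 0)" by (intro sum.cong refl) (simp add: when_def)
 also have "... = \<pi> (lk F n)" by (simp add: in_keys_iff rhom_0[OF \<pi>(1)])
 finally show ?thesis .
qed

lemma mpoly_expand_Const: "F = (SUM n:kys F. Const (lk F n)*mev Var n)" by (subst (1) mpoly_expand) (simp add: single_eq_prod)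

lemma surj_rho: "surj rho" proof (rule surjI)
 fix y
 have "mp (SUM n:kys y. Const (lift (lk y n))*mev Var n) = (SUM n:kys y. Const (lk y n)*mev Var n)"
  by (simp add: rhom_simps[OF rhom_mp] mp_simps lift mev_def)
 also have "... = y" by (rule mpoly_expand_Const[symmetric])
 finally show "rho (flat (SUM n:kys y. Const (lift (lk y n))*mev Var n)) = y" by (simp add: rho_def)
qed

lemma rho_f: "rho (xP f) = 0" using ker[of f] by (simp add: rho_def nest_xP mp_simps igen_base)

lemma rho_kernel: assumes "rho F = 0" shows "F : igen {xP f}" proof -
 have "\<pi> (lk (nest F) n) = 0" for n using assms unfolding rho_def lookup_mp[symmetric] by simp
 hence "EX r. lk (nest F) n = r*f" for n unfolding ker f_dvd by blast
 hence x: "xP (lk (nest F) n)*z : igen {xP f}" for n z by (metis igen_base isideal_igen ideal_mult_l ideal_mult_r insertI1 rhom_mult[OF rhom_xP])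
 have "F = flat (nest F)" by simp
 also have "... = (SUM n:kys (nest F). xP (lk (nest F) n)*mev (%i. tv i) n)" by (simp only: flat_def ev_def)
 also have "... : igen {xP f}" by (intro ideal_sum isideal_igen x)
 finally show ?thesis .
qed

text \<open>The coefficient of t^b in the image of F is the component of T-degree b evaluated at T =
  a.\<close>

lemma rees_JJ: "rho F : rees_ideal a \<longleftrightarrow> F : JJ" proof -
 define \<eta> where "\<eta> = (%F. ev (%c. [:c:]) (%i. Polynomial.monom (a $ i) 1) (rho F))"
 have \<eta>: "rhom \<eta>" unfolding \<eta>_def by (intro rhom_comp[OF rhom_ev rhom_rho] rhom_pCons)
 have \<eta>_simps: "\<eta> (Const c) = [:\<pi> (Const c):]" "\<eta> (xv i) = [:\<pi> (Var i):]" "\<eta> (tv i) = Polynomial.monom (a $ i) 1" for c i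
  by (simp_all add: \<eta>_def rho_def nest_simps mp_simps ev_Const ev_Var rhom_pCons)
 have r: "rhom (%x. [:\<pi> x:])" by (rule rhom_comp[OF rhom_pCons \<pi>(1)])
 have homg: "\<eta> K = Polynomial.monom (\<pi> (evS av K)) b" if K: "K : homg tw b" for K b proof -
  let ?u = "%v. [:\<pi> (case_sum Var av v):]"
  have v: "\<eta> (Var v) = ?u v * Polynomial.monom 1 1^tw v" for v by (cases v) (simp_all add: \<eta>_simps av smult_monom)
  have "\<eta> K = ev (%c. [:\<pi> (Const c):]) (%v. ?u v * Polynomial.monom 1 1^tw v) K"
   using ev_comp[OF \<eta> rhom_Const, of Var K] by (simp add: \<eta>_simps v)
  also have "... = ev (%c. [:\<pi> (Const c):]) ?u K * Polynomial.monom 1 1^b" by (rule ev_weight_scale[OF rhom_comp[OF r rhom_Const] K])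
  also have "ev (%c. [:\<pi> (Const c):]) ?u K = [:\<pi> (evS av K):]" by (rule ev_comp[OF r rhom_Const, symmetric])
  finally show ?thesis by (simp add: monom_power smult_monom)
 qed
 have "coeff (\<eta> F) b = \<pi> (evS av (hcomp tw b F))" for b proof -
  obtain D where D: "F = (SUM e<=max b D. hcomp tw e F)" using hcomp_decomp[of F tw] by (metis max.cobounded2)
  have "\<eta> F = (SUM e<=max b D. \<eta> (hcomp tw e F))" by (subst D) (rule rhom_sum[OF \<eta>])
  also have "... = (SUM e<=max b D. Polynomial.monom (\<pi> (evS av (hcomp tw e F))) e)" by (intro sum.cong refl homg hcomp_homg)
  finally show ?thesis by (simp add: coeff_sum)
 qed
 hence "\<eta> F = 0 \<longleftrightarrow> (ALL b. \<pi> (evS av (hcomp tw b F)) = 0)" by (simp add: poly_eq_iff)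
 thus ?thesis by (simp add: rees_ideal_def eval_mpoly_ev \<eta>_def JJ_def star_def ker)
qed

lemma rho_forms: assumes F: "F : homg xw i" "F : homg tw b" shows "rho F : forms_over (\<pi> ` forms i) b" proof -
 have n: "nest F : homg tot b" "!!n. lk (nest F) n ~= 0 ==> lk (nest F) n : forms i"
  using nest_biforms[OF F] unfolding forms_over_iff[of "nest F" "forms i"] by blast+
 have nz: "lk (nest F) n ~= 0" if "\<pi> (lk (nest F) n) ~= 0" for n using that rhom_0[OF \<pi>(1)] by metis
 show ?thesis unfolding forms_over_iff proof (intro conjI allI impI)
  show "rho F : homg tot b" using n(1) nz unfolding homg_iff rho_def lookup_mp by metis
  fix n' assume "lk (rho F) n' ~= 0"
  hence "\<pi> (lk (nest F) n') ~= 0" unfolding rho_def lookup_mp .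
  hence "lk (nest F) n' : forms i" by (rule n(2)[OF nz])
  thus "lk (rho F) n' : \<pi> ` forms i" unfolding rho_def lookup_mp by (rule imageI)
 qed
qed

end

section \<open>Generators and relation type of the Rees ideal\<close>

context gorenstein_chain
begin

abbreviation GJ :: "('n, 'r) mpoly set" where "GJ == rho ` range l Un (%i. rho (g i)) ` {1..m}"

lemma rees_gen: "rees_ideal a = igen GJ" proof -
 have "rees_ideal a = rho ` GG" unfolding JJ_GG[symmetric] using rees_JJ surj_rho by (auto simp: image_iff) (metis surjD)
 also have "... = igen (rho ` (range l Un g ` {..m}))" unfolding GG_def by (rule igen_rhom_image[OF rhom_rho surj_rho])
 also have "rho ` (range l Un g ` {..m}) = insert 0 GJ" proof -
  have "{..m} = insert 0 {1..m}" by auto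
  thus ?thesis using rho_f by (simp add: g0 image_Un image_image)
 qed
 also have "igen (insert 0 GJ) = igen GJ" by (simp add: Set.set_eq_iff igen_insert)
 finally show ?thesis .
qed

lemma finite_GJ: "finite GJ" and card_GJ: "card GJ <= d + m + 1" proof -
 show "finite GJ" by simp
 have "card (rho ` range l) <= CARD('n)" unfolding image_image by (rule card_image_le) simp
 moreover have "card ((%i. rho (g i)) ` {1..m}) <= m" using card_image_le[of "{1..m}" "%i. rho (g i)"] by simp
 ultimately show "card GJ <= d + m + 1" using card_Un_le[of "rho ` range l" "(%i. rho (g i)) ` {1..m}"] card by linarith
qed

text \<open>Lifts of generators of the Rees ideal generate \<open>JJ\<close> together with f, so the
  bound for \<open>JJ\<close> drops by one.\<close>

lemma rees_generators_bound: assumes Z: "finite Z" "igen Z = rees_ideal a" shows "d + m + 1 <= card Z" proof -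
 define Z' where "Z' = inv_into UNIV rho ` Z"
 have rZ: "rho ` Z' = Z" unfolding Z'_def using surj_f_inv_f[OF surj_rho] by (force simp: image_image)
 have "igen (insert (xP f) Z') = GG" unfolding JJ_GG[symmetric] proof (rule antisym)
  have "rho z : rees_ideal a" if "z : Z'" for z unfolding Z(2)[symmetric] by (rule igen_base) (use that rZ in blast)
  thus "igen (insert (xP f) Z') <= JJ" using f_JJ rees_JJ by (intro igen_subset JJ_ideal) blast
  show "JJ <= igen (insert (xP f) Z')" proof
   fix F assume "F : JJ"
   hence "rho F : rho ` igen Z'" unfolding igen_rhom_image[OF rhom_rho surj_rho] rZ Z(2) by (simp add: rees_JJ)
   then obtain F' where F': "F' : igen Z'" "rho F = rho F'" by blast
   hence "rho (F - F') = 0" by (simp add: rhom_simps[OF rhom_rho])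
   then obtain r where "F - F' = r*xP f" using rho_kernel by (auto simp: idl.span_singleton)
   hence "F - r*xP f = F'" by (simp add: algebra_simps)
   thus "F : igen (insert (xP f) Z')" unfolding igen_insert using F'(1) by metis
  qed
 qed
 from generators_bound[OF _ this] have "d + m + 2 <= card (insert (xP f) Z')" using Z(1) by (simp add: Z'_def)
 also have "... <= Suc (card Z')" by (rule card_insert_le_m1[THEN order_trans]) (auto simp: Z'_def Z(1) card_insert_if)
 also have "... <= Suc (card Z)" unfolding Z'_def using card_image_le[OF Z(1)] by simp
 finally show ?thesis by simp
qed

lemma GJ_forms: "y : GJ ==> y : bihomogs_quot \<pi> & (EX t<=m*(d - 1). y : homg tot t)" proof -
 assume y: "y : GJ"
 have "1 <= m*(d - 1)" using m d_ge_2 by (cases m) auto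
 moreover have "i*(d - 1) <= m*(d - 1)" if "i <= m" for i using that by (rule mult_le_mono1)
 moreover obtain i b where ib: "y : forms_over (\<pi> ` forms i) b" "b = 1 \<or> (EX j<=m. b = j*(d - 1))"
  using y rho_forms[OF l_homg(2,3)] rho_forms[OF g_homg] by (elim UnE imageE) force+
 ultimately have "b <= m*(d - 1)" by auto
 moreover have "y : homg tot b" using ib(1) unfolding forms_over_iff by blast
 moreover have "y : bihomogs_quot \<pi>" using ib(1) unfolding bihomogs_quot_def by blast
 ultimately show ?thesis by blast
qed

lemma num_gens_rees: "num_gens rng (bihomogs_quot \<pi>) (rees_ideal a) = enat (d + m + 1)"
 by (rule num_gensI[OF rees_generators_bound finite_GJ _ rees_gen[symmetric] card_GJ]) (use GJ_forms in blast)+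

lemma relation_type_rees: "relation_type \<pi> a = enat (m*(d - 1))" unfolding relation_type_def proof (rule antisym)
 let ?S = "{enat b |b. EX G F. minimal_generating_set rng (rees_ideal a) G & G <= bihomogs_quot \<pi> & F : G & F : forms b}"
 show "Sup ?S <= enat (m*(d - 1))" proof (rule Sup_least)
  fix x assume "x : ?S"
  then obtain b G F where b: "x = enat b" "minimal_generating_set rng (rees_ideal a) G" "G <= bihomogs_quot \<pi>" "F : G" "F : forms b" by blast
  have "b <= m*(d - 1)" proof (rule ccontr)
   assume "~ ?thesis"
   hence big: "m*(d - 1) < b" by simp
   define Y where "Y = igen (G - {F})"
   have Yi: "isideal Y" unfolding Y_def by (rule isideal_igen)
   \<comment> \<open>S is the ideal of elements whose components of T-degree below b are generated
     without F. It contains G, hence also the generators \<open>GJ\<close>, whose degrees are below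
     b; so F would be redundant.\<close>
   define S where "S = {y. ALL t<b. hcomp tot t y : Y}"
   have "isideal S" proof (rule idl.subspaceI)
    show "0 : S" by (simp add: S_def ideal_0[OF Yi])
    show "x + y : S" if "x : S" "y : S" for x y using that by (simp add: S_def hcomp_add ideal_add[OF Yi])
    show "c * x : S" if "x : S" for c x using that by (auto simp: S_def hcomp_product intro!: ideal_sum[OF Yi] ideal_mult_l[OF Yi])
   qed
   moreover have "z : S" if z: "z : G" for z unfolding S_def proof (intro CollectI allI impI)
    fix t assume t: "t < b"
    show "hcomp tot t z : Y" proof (cases "z = F")
     case True
     have "F : homg tot b" using b(5) unfolding forms_homg .
     from hcomp_of_homg[OF this, of t] show ?thesis using t True ideal_0[OF Yi] by simp
    next
     case False
     obtain i s where "z : forms_over (\<pi> ` forms i) s" using b(3) z unfolding bihomogs_quot_def by blast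
     hence "z : homg tot s" unfolding forms_over_iff by blast
     from hcomp_of_homg[OF this, of t] have "hcomp tot t z = z \<or> hcomp tot t z = 0" by simp
     moreover have "z : Y" unfolding Y_def by (rule igen_base) (use z False in blast)
     ultimately show ?thesis using ideal_0[OF Yi] by metis
    qed
   qed
   ultimately have "igen G <= S" by (intro igen_subset) auto
   hence GS: "igen GJ <= S" using b(2) rees_gen unfolding minimal_generating_set_def Idl_rng by simp
   have "y : Y" if y: "y : GJ" for y proof -
    obtain t where t: "t <= m*(d - 1)" "y : homg tot t" using GJ_forms[OF y] by blast
    have "y : S" using GS igen_base[OF y] by blast
    hence "hcomp tot t y : Y" using t(1) big by (simp add: S_def)
    thus ?thesis using hcomp_of_homg[OF t(2), of t] by simp
   qed
   hence "igen GJ <= Y" by (intro igen_subset Yi) blast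
   moreover have "Y <= igen G" unfolding Y_def by (rule idl.span_mono) blast
   ultimately have "Idl\<^bsub>rng\<^esub> (G - {F}) = rees_ideal a" using b(2) rees_gen unfolding minimal_generating_set_def Idl_rng Y_def by blast
   moreover have "G - {F} \<subset> G" using b(4) by blast
   ultimately show False using b(2) unfolding minimal_generating_set_def by blast
  qed
  thus "x <= enat (m*(d - 1))" using b(1) by simp
 qed
 have "minimal_generating_set rng (rees_ideal a) GJ" by (rule minimal_generatorsI[OF rees_generators_bound finite_GJ rees_gen[symmetric] card_GJ])
 moreover have "rho (g m) : GJ" using m by auto
 moreover have "rho (g m) : forms (m*(d - 1))" using rho_forms[OF g_homg[of m]] unfolding forms_homg forms_over_iff by simp
 ultimately show "enat (m*(d - 1)) <= Sup ?S" using GJ_forms by (intro Sup_upper) blast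
qed

end

lemma ideals_pow_Suc: "x [^]\<^bsub>ideals_set rng\<^esub> (Suc i) = ideal_prod rng (x [^]\<^bsub>ideals_set rng\<^esub> i) x"
 by (simp add: ideals_set_def)

lemma ideals_pow_mem: fixes x :: "'a::comm_ring_1" assumes "x : Y" shows "x^i : Y [^]\<^bsub>ideals_set rng\<^esub> i" proof (induction i)
 case 0 show ?case by (simp add: ideals_set_def)
next
 case (Suc i)
 thus ?case unfolding ideals_pow_Suc using ideal_prod.prod[of "x^i" _ x Y rng] assms by (simp add: mult.commute)
qed

section \<open>The colon ideal\<close>

context gorenstein_chain
begin

text \<open>Each factor from (x) exchanges g_{j+1} for g_j modulo (l), until g_0 = f is
  reached.\<close>

lemma power_colon: assumes Y: "!!y. y : Y ==> flat y : igen (range (%i. xv i))"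
 shows "j <= m ==> j <= i ==> b : Y [^]\<^bsub>ideals_set rng\<^esub> i ==> flat b * g j : Lf" proof (induction j arbitrary: i b)
 case 0
 show ?case unfolding g0 by (rule ideal_mult_l[OF isideal_igen u_Lu])
next
 case (Suc j)
 then obtain i' where i: "i = Suc i'" "j <= i'" by (metis Suc_le_D Suc_le_mono)
 have x: "F * g (Suc j) : igen (insert (g j) (range l))" if "F : igen (range (%i. xv i))" for F proof -
  have "isideal {F. F * g (Suc j) : igen (insert (g j) (range l))}"
   by (rule idl.subspaceI) (auto simp: distrib_right mult.assoc idl.span_zero intro: idl.span_add ideal_mult_l isideal_igen)
  moreover have "range (%i. xv i) <= {F. F * g (Suc j) : igen (insert (g j) (range l))}" using x_g[of j] Suc.prems(1) by auto
  ultimately show ?thesis using that igen_subset by blast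
 qed
 from Suc.prems(3) have "b : ideal_prod rng (Y [^]\<^bsub>ideals_set rng\<^esub> i') Y" unfolding i(1) ideals_pow_Suc .
 thus ?case proof (induction b rule: ideal_prod.induct)
  case (prod p y)
  have "flat y * g (Suc j) : igen (insert (g j) (range l))" by (rule x[OF Y[OF prod(2)]])
  then obtain r where r: "flat y * g (Suc j) - r*g j : Ll" unfolding igen_insert by blast
  have "flat p * g j : Lf" by (rule Suc.IH[OF _ i(2) prod(1)]) (use Suc.prems(1) in simp)
  hence "r*(flat p * g j) : Lf" by (rule ideal_mult_l[OF isideal_igen])
  moreover have "flat p*(flat y * g (Suc j) - r*g j) : Lf" using r Ll_Lu by (intro ideal_mult_l isideal_igen) auto
  ultimately have "flat p*(flat y * g (Suc j) - r*g j) + r*(flat p * g j) : Lf" by (intro ideal_add isideal_igen)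
  moreover have "flat p*(flat y * g (Suc j) - r*g j) + r*(flat p * g j) = flat (p*y)*g (Suc j)" by (simp add: rhom_mult[OF rhom_flat] algebra_simps)
  ultimately show ?case by simp
 next
  case (sum p q)
  hence "flat p * g (Suc j) + flat q * g (Suc j) : Lf" by (intro ideal_add isideal_igen)
  thus ?case by (simp add: rhom_add[OF rhom_flat] distrib_right)
 qed
qed

text \<open>One inclusion is \<open>power_colon\<close> for i = m; for the other, the pure powers
  x_j^m suffice.\<close>

lemma colon_GG:
 defines "Y == igen (range (%i. X_vec $ i)) :: ('n, ('n, 'k) mpoly) mpoly set"
 shows "x : ideal_colon rng (igen (range (%i. (T_vec v* const_mat \<psi>) $ i) Un {Const f})) (Y [^]\<^bsub>ideals_set rng\<^esub> m)
  \<longleftrightarrow> flat x : GG" proof -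
 have fl: "flat ` (range (%i. (T_vec v* const_mat \<psi>) $ i) Un {Const f}) = insert (xP f) (range l)"
  by (auto simp: image_Un image_image flat_l flat_simps)
 have L: "y : igen (range (%i. (T_vec v* const_mat \<psi>) $ i) Un {Const f}) \<longleftrightarrow> flat y : Lf" for y
  unfolding mem_igen_flat[of y] fl ..
 have "flat ` range (%i. X_vec $ i :: ('n, ('n, 'k) mpoly) mpoly) = range (%i. xv i)" by (simp add: image_image X_vec_def flat_simps xP_simps)
 hence Y: "flat y : igen (range (%i. xv i))" if "y : Y" for y using that unfolding Y_def mem_igen_flat[of y] by simp
 show ?thesis proof
  assume "x : ideal_colon rng (igen (range (%i. (T_vec v* const_mat \<psi>) $ i) Un {Const f})) (Y [^]\<^bsub>ideals_set rng\<^esub> m)"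
  hence x: "flat (x*b) : Lf" if "b : Y [^]\<^bsub>ideals_set rng\<^esub> m" for b using that unfolding ideal_colon_def L[symmetric] by simp
  show "flat x : GG" proof (rule saturation_GG)
   fix j
   have "X_vec $ j^m : Y [^]\<^bsub>ideals_set rng\<^esub> m" by (rule ideals_pow_mem) (simp add: Y_def igen_base)
   from x[OF this] show "xv j^m*flat x : Lf"
    by (simp add: rhom_mult[OF rhom_flat] rhom_power[OF rhom_flat] X_vec_def flat_simps xP_simps mult.commute)
  qed
 next
  assume x: "flat x : GG"
  have "flat (x*b) : Lf" if b: "b : Y [^]\<^bsub>ideals_set rng\<^esub> m" for b proof -
   have "isideal {F. flat b * F : Lf}"
    by (rule idl.subspaceI) (auto simp: distrib_left mult.left_commute[of "flat b"] idl.span_zero intro: idl.span_add ideal_mult_l isideal_igen)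
   moreover have "range l Un g ` {..m} <= {F. flat b * F : Lf}" using power_colon[OF Y _ _ b] l_Lu by (auto intro: ideal_mult_l isideal_igen)
   ultimately have "GG <= {F. flat b * F : Lf}" unfolding GG_def by (intro igen_subset)
   thus ?thesis using x by (auto simp: rhom_mult[OF rhom_flat] mult.commute)
  qed
  thus "x : ideal_colon rng (igen (range (%i. (T_vec v* const_mat \<psi>) $ i) Un {Const f})) (Y [^]\<^bsub>ideals_set rng\<^esub> m)"
   unfolding ideal_colon_def L[symmetric] by simp
 qed
qed

end

section \<open>The gcd-iterations in S[T]\<close>

context linear_alternating
begin

theorem gcd_iterations_minimal:
 fixes B :: "nat => ('n, ('n, 'k) mpoly) mpoly^('n option) ^ 'n" and G :: "nat => ('n, ('n, 'k) mpoly) mpoly"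
 defines "\<L> == igen (range (%i. (T_vec v* const_mat \<psi>) $ i) Un {Const f})"
  and "\<A> == ideal_colon rng (igen (range (%i. (T_vec v* const_mat \<psi>) $ i) Un {Const f}))
   (igen (range (%i. X_vec $ i)) [^]\<^bsub>ideals_set rng\<^esub> m)"
  and "\<G> == range (%i. (T_vec v* const_mat \<psi>) $ i) Un {Const f} Un G ` {1..m}"
 assumes hJ: "hideal tot {x. \<pi> x : I}" and jd: "is_jacobian_dual \<psi> B\<psi>" and D: "is_partial (Const f) D"
  and B1: "B 1 = augment B\<psi> D" and L1: "L 1 = \<L>" and it: "gcd_iterations m B\<psi> B L G"
 shows "\<A> = L m <+>\<^bsub>rng\<^esub> PIdl\<^bsub>rng\<^esub> (G m) & minimal_generating_set rng \<A> \<G>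
  & num_gens rng bihomogs \<A> = enat (d + m + 2)
  & num_gens rng (bihomogs_quot \<pi>) (rees_ideal a) = enat (d + m + 1)
  & relation_type \<pi> a = enat (m*(d - 1))" proof -
 \<comment> \<open>With f at index 0 the first matrix follows the same pattern as the later
   ones.\<close>
 define G' where "G' = (%i. if i = 0 then Const f else G i)"
 have "EX D. is_partial (G' i) D & B (Suc i) = augment B\<psi> D" if "i < m" for i proof (cases "i = 0")
  case True thus ?thesis using D B1 by (auto simp: G'_def)
 next
  case False
  hence "Suc i : {2..m}" using that by auto
  thus ?thesis using it False unfolding gcd_iterations_def G'_def by fastforce
 qed
 then obtain Dn where Dn: "!!i. i < m ==> is_partial (G' i) (Dn i)" "!!i. i < m ==> B (Suc i) = augment B\<psi> (Dn i)" by metis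
 have gcd: "is_gcd (max_minors (augment B\<psi> (Dn i))) (G' (Suc i))" if "i < m" for i proof -
  have "is_gcd (max_minors (B (Suc i))) (G (Suc i))" using it that unfolding gcd_iterations_def by simp
  thus ?thesis unfolding Dn(2)[OF that] G'_def by simp
 qed
 let ?E = "%i. SUM s:UNIV. flat (Dn i $ s) * tP (h s)"
 let ?S = "%i. (ALL r. flat (Dn i $ r) : homg xw (m - Suc i) & flat (Dn i $ r) : homg tw (i*(d - 1))) &
   (SUM r:UNIV. xv r * flat (Dn i $ r)) = flat (G' i) & (EX c. c ~= 0 & flat (G' (Suc i)) = Const c * ?E i)"
 have step: "?S i"
  if i: "i < m" and G: "flat (G' i) : homg xw (m - i)" "flat (G' i) : homg tw (i*(d - 1))" "evT h (flat (G' i)) ~= 0" for i proof -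
  have "G' i ~= 0" using G(3) rhom_0[OF rhom_flat] ev_0 by metis
  from flat_partial[OF Dn(1)[OF i] this G(1,2)]
  have p: "!!r. flat (Dn i $ r) : homg xw (m - i - 1)" "!!r. flat (Dn i $ r) : homg tw (i*(d - 1))"
   "(SUM r:UNIV. xv r * flat (Dn i $ r)) = flat (G' i)" by blast+
  have "evT h (?E i) = evT h (SUM r:UNIV. xv r * flat (Dn i $ r))" by (simp add: evT_simps ev_sum rhom_Const mult.commute)
  hence "?E i ~= 0" using G(3) p(3) ev_0 by metis
  from flat_gcd_step[OF jd gcd[OF i] this] p show ?thesis by simp
 qed
 \<comment> \<open>Nonvanishing at h is carried along: it excludes g_i = 0, for which \<partial>g_i
   and the next gcd degenerate.\<close>
 have P: "flat (G' i) : homg xw (m - i) & flat (G' i) : homg tw (i*(d - 1)) & evT h (flat (G' i)) ~= 0" if "i <= m" for i using that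
 proof (induction i)
  case 0
  thus ?case using xP_homg(2)[OF f(2)] xP_homg(3)[of f] f_h by (simp add: G'_def flat_simps evT_xP)
 next
  case (Suc i)
  hence P: "flat (G' i) : homg xw (m - i)" "flat (G' i) : homg tw (i*(d - 1))" "evT h (flat (G' i)) ~= 0" "i < m" by auto
  from step[OF P(4,1-3)] obtain c where s: "!!r. flat (Dn i $ r) : homg xw (m - Suc i)" "!!r. flat (Dn i $ r) : homg tw (i*(d - 1))"
   "(SUM r:UNIV. xv r * flat (Dn i $ r)) = flat (G' i)" "c ~= 0" "flat (G' (Suc i)) = Const c * ?E i" by blast
  have "?E i : homg xw (m - Suc i)" "?E i : homg tw (Suc i*(d - 1))" using homg_value[OF s(1,2)] by (simp_all add: add.commute)
  moreover have "evT h (?E i) = evT h (flat (G' i))" unfolding s(3)[symmetric] by (simp add: evT_simps ev_sum rhom_Const mult.commute)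
  ultimately show ?case unfolding s(5) using s(4) P(3) mpoly_mult_eq_0[of "Const c" "evT h (flat (G' i))"]
   by (auto intro: homg_Const_mult simp: evT_simps ev_Const rhom_Const)
 qed
 have st: "?S i" if i: "i < m" for i using step[OF i] P[of i] i by simp
 have "ALL i. EX c. c ~= 0 & (i < m --> flat (G' (Suc i)) = Const c * ?E i)" proof
  fix i show "EX c. c ~= 0 & (i < m --> flat (G' (Suc i)) = Const c * ?E i)"
   using st[of i] by (cases "i < m") (blast, auto intro: exI[of _ 1])
 qed
 from choice[OF this] obtain c where c: "!!i. c i ~= 0" "!!i. i < m ==> flat (G' (Suc i)) = Const (c i) * ?E i" by blast
 interpret C: gorenstein_chain d m f \<pi> I \<phi> a \<psi> "%i. flat (G' i)" "%i r. flat (Dn i $ r)" c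
  by unfold_locales (use st c hJ in "auto simp: G'_def flat_simps")
 have fG: "flat ` \<G> = range l Un (%i. flat (G' i)) ` {..m}" proof -
  have "{..m} = insert 0 {1..m}" by auto
  moreover have "(%i. flat (G' i)) ` {1..m} = (%i. flat (G i)) ` {1..m}" by (intro image_cong) (auto simp: G'_def)
  ultimately show ?thesis unfolding \<G>_def by (simp add: image_Un image_image flat_l G'_def flat_simps)
 qed
 have AG: "\<A> = igen \<G>" unfolding \<A>_def Set.set_eq_iff C.colon_GG mem_igen_flat[of _ \<G>] fG C.GG_def by blast
 have bound: "d + m + 2 <= card Z" if Z: "finite Z" "igen Z = \<A>" for Z proof -
  have "igen (flat ` Z) = igen (flat ` \<G>)" using Z(2) igen_rhom_image[OF rhom_flat surj_flat] unfolding AG by metis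
  hence "d + m + 2 <= card (flat ` Z)" using C.generators_bound[of "flat ` Z"] Z(1) unfolding fG C.GG_def by simp
  thus ?thesis using card_image_le[OF Z(1), of flat] by linarith
 qed
 have fin: "finite \<G>" by (simp add: \<G>_def)
 have cardG: "card \<G> <= d + m + 2" proof -
  have "card (range (%i. (T_vec v* const_mat \<psi>) $ i)) <= CARD('n)" by (rule card_image_le) simp
  moreover have "card (G ` {1..m}) <= m" using card_image_le[of "{1..m}" G] by simp
  moreover have "card \<G> <= card (range (%i. (T_vec v* const_mat \<psi>) $ i)) + card {Const f :: ('n, ('n, 'k) mpoly) mpoly} + card (G ` {1..m})"
   unfolding \<G>_def by (meson add_le_mono1 card_Un_le le_trans)
  ultimately show ?thesis using card by simp
 qed
 have bh: "\<G> <= bihomogs" proof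
  fix x assume "x : \<G>"
  hence "flat x : range l Un (%i. flat (G' i)) ` {..m}" unfolding fG[symmetric] by (rule imageI)
  hence "EX i b. flat x : homg xw i & flat x : homg tw b" proof (elim UnE imageE)
   fix j assume "flat x = l j"
   with l_homg(2,3)[of j] show ?thesis by metis
  next
   fix i assume "flat x = flat (G' i)" "i : {..m}"
   with P[of i] show ?thesis by (metis atMost_iff)
  qed
  then obtain i b where "nest (flat x) : biforms i b" using nest_biforms by blast
  thus "x : bihomogs" unfolding bihomogs_def by auto
 qed
 have L: "1 <= i ==> i <= m ==> L i = igen (range (%i. (T_vec v* const_mat \<psi>) $ i) Un {Const f} Un G ` {1..<i})" for i
 proof (induction i rule: nat_induct_at_least)
  case base show ?case using L1 by (simp add: \<L>_def)
 next
  case (Suc i)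
  hence "L (Suc i) = L i <+>\<^bsub>rng\<^esub> PIdl\<^bsub>rng\<^esub> (G i)" using it unfolding gcd_iterations_def by auto
  moreover have "{1..<Suc i} = insert i {1..<i}" using Suc by auto
  ultimately show ?case using Suc by (simp add: set_add_igen)
 qed
 have "{1..m} = insert m {1..<m}" using m by auto
 hence "\<A> = L m <+>\<^bsub>rng\<^esub> PIdl\<^bsub>rng\<^esub> (G m)" using m by (simp add: L set_add_igen AG \<G>_def)
 moreover have "minimal_generating_set rng \<A> \<G>" by (rule minimal_generatorsI[OF bound fin AG[symmetric] cardG])
 moreover have "num_gens rng bihomogs \<A> = enat (d + m + 2)" by (rule num_gensI[OF bound fin bh AG[symmetric] cardG])
 ultimately show ?thesis using C.num_gens_rees C.relation_type_rees by blast
qed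

end

text \<open>Since \<open>num_gens\<close> is finite, a finite homogeneous generating set exists: an
  infimum over the empty set would be infinite. Homogeneous lifts of it together with f generate the
  preimage.\<close>

lemma homogeneous_preimage: fixes \<pi> :: "('n::finite, 'k::field) mpoly => 'r::comm_ring_1"
 assumes \<pi>: "rhom \<pi>" "surj \<pi>" and ker: "!!x. \<pi> x = 0 \<longleftrightarrow> x : igen {f}" and f: "f : homg tot m"
  and I: "num_gens rng (homogs_quot \<pi>) I = enat N" shows "hideal tot {x. \<pi> x : I}" proof -
 have "EX Z. finite Z & Z <= homogs_quot \<pi> & igen Z = I" proof (rule ccontr)
  assume "~ ?thesis"
  hence "num_gens rng (homogs_quot \<pi>) I = Inf {}" unfolding num_gens_def Idl_rng by (intro arg_cong[of _ _ Inf]) auto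
  thus False using I by (simp add: top_enat_def)
 qed
 then obtain Z where Z: "Z <= homogs_quot \<pi>" "igen Z = I" by blast
 let ?Z = "insert f {x. \<pi> x : Z & (EX e. x : homg tot e)}"
 have zi: "\<pi> ` ?Z = insert 0 Z" proof -
  have "\<pi> f = 0" unfolding ker by (simp add: igen_base)
  moreover have "z : \<pi> ` {x. \<pi> x : Z & (EX e. x : homg tot e)}" if z: "z : Z" for z proof -
   obtain e x where "z = \<pi> x" "x : homg tot e" using Z(1) z unfolding homogs_quot_def forms_homg by blast
   thus ?thesis using z by blast
  qed
  ultimately show ?thesis by auto
 qed
 hence im: "\<pi> ` igen ?Z = I" unfolding igen_rhom_image[OF \<pi>] zi Z(2)[symmetric] by (simp add: Set.set_eq_iff igen_insert)
 have "{x. \<pi> x : I} = igen ?Z" proof (intro antisym subsetI CollectI)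
  fix x assume "x : {x. \<pi> x : I}"
  then obtain y where y: "y : igen ?Z" "\<pi> x = \<pi> y" using im by blast
  hence "x - y : igen {f}" unfolding ker[symmetric] by (simp add: rhom_diff[OF \<pi>(1)])
  hence "x - y : igen ?Z" using idl.span_mono[of "{f}" ?Z] by blast
  thus "x : igen ?Z" using ideal_diffD[OF isideal_igen _ y(1)] by blast
 qed (use im in blast)
 moreover have "hideal tot (igen ?Z)" by (rule hideal_igen) (use f in blast)
 ultimately show ?thesis by simp
qed

theorem proposition5p4:
  fixes d m :: nat
    and f :: "('n::finite, 'k::field) mpoly"
    and \<pi> :: "('n, 'k) mpoly \<Rightarrow> 'r::comm_ring_1"
    and I :: "'r set"
    and \<phi> :: "'r ^ 'n ^ 'n"
    and a :: "'r ^ 'n"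
    and \<psi> :: "('n, 'k) mpoly ^ 'n ^ 'n"
    and B\<psi> :: "('n, ('n, 'k) mpoly) mpoly ^ 'n ^ 'n"
    and D :: "('n, ('n, 'k) mpoly) mpoly ^ 'n"
    and l :: "('n, ('n, 'k) mpoly) mpoly ^ 'n"
    and \<L> \<A> :: "('n, ('n, 'k) mpoly) mpoly set"
    and B :: "nat \<Rightarrow> ('n, ('n, 'k) mpoly) mpoly ^ ('n option) ^ 'n"
    and L :: "nat \<Rightarrow> ('n, ('n, 'k) mpoly) mpoly set"
    and g :: "nat \<Rightarrow> ('n, ('n, 'k) mpoly) mpoly"
    and \<J> :: "('n, 'r) mpoly set"
  assumes "infinite (UNIV :: 'k set)"
    and "CARD('n) = d + 1"
    and "m \<ge> 1" and "f \<noteq> 0" and "f \<in> forms m"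
    \<comment> \<open>\<open>R = S/(f)\<close> is the type \<open>'r\<close>, with projection \<open>\<pi>\<close>\<close>
    and "\<pi> \<in> ring_hom rng rng" and "surj \<pi>" and "a_kernel rng rng \<pi> = PIdl\<^bsub>rng\<^esub> f"
    and "perfect_ideal (rng :: 'r ring) I" and "gorenstein_ideal (rng :: 'r ring) I"
    and "grade (rng :: 'r ring) I = 3"
    and "presents \<phi> a I" and "alternating \<phi>" and "entries \<phi> \<subseteq> \<pi> ` forms 1"
    and "satisfies_G (rng :: 'r ring) d I"
    and "num_gens rng (homogs_quot \<pi>) I = enat (d + 1)"
    and "Idl\<^bsub>rng\<^esub> (entries \<phi>) = \<pi> ` (Idl\<^bsub>rng\<^esub> (range Var))"
    and "alternating \<psi>" and "entries \<psi> \<subseteq> forms 1"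
    and "Idl\<^bsub>rng\<^esub> (entries \<psi>) = Idl\<^bsub>rng\<^esub> (range Var)"
    and "\<forall>i j. \<pi> (\<psi> $ i $ j) = \<phi> $ i $ j"
    and "l = T_vec v* const_mat \<psi>"
    and "\<L> = Idl\<^bsub>rng\<^esub> (range (\<lambda>i. l $ i) \<union> {Const f})"
    and "\<A> = ideal_colon rng \<L>
               ((Idl\<^bsub>rng\<^esub> (range (\<lambda>i. X_vec $ i))) [^]\<^bsub>ideals_set rng\<^esub> m)"
    and "is_jacobian_dual \<psi> B\<psi>" and "is_partial (Const f) D"
    and "B 1 = augment B\<psi> D" and "L 1 = \<L>"
    and "gcd_iterations m B\<psi> B L g"
    and "\<J> = rees_ideal a"
  shows "\<A> = L m <+>\<^bsub>rng\<^esub> PIdl\<^bsub>rng\<^esub> (g m)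
    \<and> minimal_generating_set rng \<A> (range (\<lambda>i. l $ i) \<union> {Const f} \<union> g ` {1..m})
    \<and> num_gens rng bihomogs \<A> = enat (d + m + 2)
    \<and> num_gens rng (bihomogs_quot \<pi>) \<J> = enat (d + m + 1)
    \<and> relation_type \<pi> a = enat (m * (d - 1))"
proof -
 note hyps = assms
 have \<pi>: "rhom \<pi>" using hyps(6) by (simp add: ring_hom_def rhom_def)
 interpret cring "rng :: ('n, 'k) mpoly ring" by (rule cring_rng)
 have "a_kernel rng rng \<pi> = igen {f}" using hyps(8) cgenideal_eq_genideal[of f] by (simp add: Idl_rng)
 hence ker: "\<pi> x = 0 \<longleftrightarrow> x : igen {f}" for x unfolding a_kernel_def kernel_def by auto
 have f: "f : homg tot m" using hyps(5) unfolding forms_homg .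
 interpret linear_alternating d m f \<pi> I \<phi> a \<psi> proof
  show "\<pi> x = 0 \<longleftrightarrow> x : igen {f}" for x by (rule ker)
  show "\<psi> $ i $ j : homg tot 1" for i j using hyps(19) unfolding forms_homg entries_def by blast
  show "Var i : q" if q: "isideal q" "!!i j. \<psi> $ i $ j : q" for q i proof -
   have "igen (entries \<psi>) <= q" by (rule igen_subset[OF _ q(1)]) (use q(2) in "auto simp: entries_def")
   moreover have "Var i : igen (range Var)" by (rule igen_base) simp
   ultimately show ?thesis using hyps(20) unfolding Idl_rng by blast
  qed
  show "\<psi> $ i $ j = - (\<psi> $ j $ i)" "\<psi> $ i $ i = 0" for i j using hyps(18) unfolding alternating_def by blast+
  show "\<pi> (\<psi> $ i $ j) = \<phi> $ i $ j" for i j using hyps(21) by blast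
 qed (rule hyps(1-4) f \<pi> hyps(7) hyps(12) hyps(15))+
 have "hideal tot {x. \<pi> x : I}" by (rule homogeneous_preimage[OF \<pi> ker f(2) hyps(16)])
 moreover have "L 1 = igen (range (%i. (T_vec v* const_mat \<psi>) $ i) Un {Const f})" using hyps(28) unfolding hyps(23) hyps(22) Idl_rng .
 ultimately show ?thesis unfolding hyps(30) hyps(24) hyps(23) hyps(22) Idl_rng by (rule gcd_iterations_minimal[OF _ hyps(25,26,27) _ hyps(29)])
qed

end
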